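(* Let $\rho>0$, $\underline a\le0$, $(w,\tau)\in(0,\infty)\times(-\infty,1)$, and let $u$ be of CRRA type with coefficient $\gamma>0$. For $r\in R(w,\tau)$ set $$\Theta(r):=\max_{z\in\mathcal Z}\ \sum_{y\ne z}\lambda(z,y)\left(\frac{u'(r\underline a+w(1-\tau)y)}{u'(r\underline a+w(1-\tau)z)}-1\right).$$ Let $\underline r$ be the unique solution to $\underline r=\rho-\Theta(\underline r)$. Then, for $r\in R(w,\tau)$, the stationary measure $G^*(\mathrm da,\mathrm dz;r,w,\tau)$ is supported at the borrowing constraint $\{\underline a\}\times\mathcal Z$ if and only if $r\le\underline r$.
   Context: Income: $(z_t)_{t\ge0}$ is an irreducible stationary continuous-time Markov chain on $\mathcal Z=\{z_1,\dots,z_d\}$, $0<z_1<\dots<z_d$, $d\ge2$, with transition rates $\lambda(z,y)\ge0$ ($y\ne z$), mean normalized to $\mathbb E[z_t]=1$, on a complete filtered probability space whose filtration satisfies the usual conditions. $\underline z:=\min\mathcal Z$. $\rho$ is the discount rate, $w$ the wage, $\tau$ the (linear) tax rate, $r$ the interest rate, $\underline a$ the borrowing limit. $R(w,\tau):=\{r<\rho: r\underline a+w(1-\tau)\underline z>0\}$. $\mathscr X:=[\underline a,\infty)\times\mathcal Z$. CRRA type with coefficient $\gamma>0$: $u(c)=c^{1-\gamma}/(1-\gamma)$ if $\gamma\ne1$, $u(c)=\log c$ if $\gamma=1$. Household problem for $r\in R(w,\tau)$: for $(a,z)\in\mathscr X$, an admissible control is a progressively measurable process $(c_t)$ with values in $(0,\infty)$,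 a.s. locally integrable in time, such that $\mathrm da_t=[ra_t+w(1-\tau)z_t-c_t]\,\mathrm dt$, $(a_0,z_0)=(a,z)$, satisfies $a_t\ge\underline a$ for all $t\ge0$ a.s. The value function is $v^*(a,z):=\sup\mathbb E_{a,z}[\int_0^\infty e^{-\rho t}u(c_t)\,\mathrm dt]$ over admissible controls; it is $C^1$ in $a$ on $[\underline a,\infty)$ and $c^*(a,z):=(u')^{-1}(v_a^*(a,z))$ is the unique optimal feedback consumption rule. $G^*(\mathrm da,\mathrm dz;r,w,\tau)$ denotes the unique invariant probability measure of the optimal state process $(a^*_t,z_t)$, $\mathrm da^*_t=[ra^*_t+w(1-\tau)z_t-c^*(a^*_t,z_t)]\,\mathrm dt$. *)

theory Defs
  imports "HOL-Probability.Probability"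
begin

section \<open>Finite-state continuous-time Markov chains\<close>

definition generator :: "'s set \<Rightarrow> ('s \<Rightarrow> 's \<Rightarrow> real) \<Rightarrow> 's \<Rightarrow> 's \<Rightarrow> real" where
  "generator S rate x y = (if y = x then - (\<Sum>v\<in>S - {x}. rate x v) else rate x y)"

primrec generator_pow :: "'s set \<Rightarrow> ('s \<Rightarrow> 's \<Rightarrow> real) \<Rightarrow> nat \<Rightarrow> 's \<Rightarrow> 's \<Rightarrow> real" where
  "generator_pow S rate 0 x y = (if y = x then 1 else 0)"
| "generator_pow S rate (Suc n) x y =
     (\<Sum>v\<in>S. generator S rate x v * generator_pow S rate n v y)"

text \<open>The entries of the matrix exponential \<open>exp (t Q)\<close>, \<open>Q\<close> being the generator.\<close>

definition transition_prob ::
    "'s set \<Rightarrow> ('s \<Rightarrow> 's \<Rightarrow> real) \<Rightarrow> real \<Rightarrow> 's \<Rightarrow> 's \<Rightarrow> real" where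
  "transition_prob S rate t x y = (\<Sum>n. t ^ n / fact n * generator_pow S rate n x y)"

definition irreducible_rates :: "'s set \<Rightarrow> ('s \<Rightarrow> 's \<Rightarrow> real) \<Rightarrow> bool" where
  "irreducible_rates S rate \<longleftrightarrow>
     (\<forall>x\<in>S. \<forall>y\<in>S. (x, y) \<in> {(u, v). u \<in> S \<and> v \<in> S \<and> u \<noteq> v \<and> rate u v > 0}\<^sup>*)"

text \<open>
  Only the values of \<open>rate\<close> at pairs of distinct states matter.  Time is \<open>{0..}\<close>; the library's
  filtrations are indexed by a whole type, and the members of \<open>F\<close> at negative times
  play no role (one may take them equal to \<open>F 0\<close>).
\<close>

locale income_chain = prob_space M + complete_measure M + filtration "space M" F
  for M :: "'w measure" and F :: "real \<Rightarrow> 'w measure" +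
  fixes S :: "real set" and rate :: "real \<Rightarrow> real \<Rightarrow> real" and inc :: "real \<Rightarrow> 'w \<Rightarrow> real"
  assumes sub_F: "\<And>t. t \<ge> 0 \<Longrightarrow> subalgebra M (F t)"
    and complete_F: "null_sets M \<subseteq> sets (F 0)"
    and right_continuous_F: "\<And>t. t \<ge> 0 \<Longrightarrow> sets (F t) = (\<Inter>s\<in>{t<..}. sets (F s))"
    and finite_S: "finite S" and card_S: "card S \<ge> 2" and pos_S: "\<And>x. x \<in> S \<Longrightarrow> x > 0"
    and rate_nonneg: "\<And>x y. x \<in> S \<Longrightarrow> y \<in> S \<Longrightarrow> y \<noteq> x \<Longrightarrow> rate x y \<ge> 0"
    and irreducible: "irreducible_rates S rate"
    and inc_in_S: "\<And>t \<omega>. t \<ge> 0 \<Longrightarrow> \<omega> \<in> space M \<Longrightarrow> inc t \<omega> \<in> S"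
    and adapted: "\<And>t. t \<ge> 0 \<Longrightarrow> inc t \<in> borel_measurable (F t)"
    and cadlag: "AE \<omega> in M. (\<forall>t\<ge>0. continuous (at_right t) (\<lambda>s. inc s \<omega>)) \<and>
                   (\<forall>t>0. \<exists>l. ((\<lambda>s. inc s \<omega>) \<longlongrightarrow> l) (at_left t))"
    and markov: "\<And>s t y. s \<ge> 0 \<Longrightarrow> t \<ge> 0 \<Longrightarrow> y \<in> S \<Longrightarrow>
                   AE \<omega> in M. real_cond_exp M (F s) (indicator {\<omega> \<in> space M. inc (s + t) \<omega> = y}) \<omega>
                     = transition_prob S rate t (inc s \<omega>) y"
    and stationary: "\<And>h. h \<ge> 0 \<Longrightarrow>
                   distr M (\<Pi>\<^sub>M t\<in>{0..}. borel) (\<lambda>\<omega>. \<lambda>t\<in>{0..}. inc (h + t) \<omega>) =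
                   distr M (\<Pi>\<^sub>M t\<in>{0..}. borel) (\<lambda>\<omega>. \<lambda>t\<in>{0..}. inc t \<omega>)"
    and mean_one: "\<And>t. t \<ge> 0 \<Longrightarrow> (\<integral>\<omega>. inc t \<omega> \<partial>M) = 1"

section \<open>The household problem\<close>

definition crra :: "real \<Rightarrow> real \<Rightarrow> real" where
  "crra \<gamma> c = (if \<gamma> = 1 then ln c else c powr (1 - \<gamma>) / (1 - \<gamma>))"

definition feasible_rates :: "real set \<Rightarrow> real \<Rightarrow> real \<Rightarrow> real \<Rightarrow> real \<Rightarrow> real set" where
  "feasible_rates S \<rho> abar w \<tau> = {r. r < \<rho> \<and> r * abar + w * (1 - \<tau>) * Min S > 0}"

definition Theta ::
    "real set \<Rightarrow> (real \<Rightarrow> real \<Rightarrow> real) \<Rightarrow> real \<Rightarrow> real \<Rightarrow> real \<Rightarrow> real \<Rightarrow> real \<Rightarrow> real" where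
  "Theta S rate abar \<gamma> w \<tau> r =
     Max ((\<lambda>x. \<Sum>y\<in>S - {x}. rate x y *
             (deriv (crra \<gamma>) (r * abar + w * (1 - \<tau>) * y) /
              deriv (crra \<gamma>) (r * abar + w * (1 - \<tau>) * x) - 1)) ` S)"

definition progressively_measurable ::
    "(real \<Rightarrow> 'w measure) \<Rightarrow> (real \<Rightarrow> 'w \<Rightarrow> real) \<Rightarrow> bool" where
  "progressively_measurable F c \<longleftrightarrow>
     (\<forall>t\<ge>0. (\<lambda>(s, \<omega>). c s \<omega>) \<in> borel_measurable (restrict_space borel {0..t} \<Otimes>\<^sub>M F t))"

text \<open>\<open>da\<^sub>t = b\<^sub>t dt\<close>, \<open>a\<^sub>0 = a0\<close>, on \<open>{0..}\<close>, in integrated form.\<close>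

definition has_drift :: "real \<Rightarrow> (real \<Rightarrow> real) \<Rightarrow> (real \<Rightarrow> real) \<Rightarrow> bool" where
  "has_drift a0 b a \<longleftrightarrow>
     (\<forall>t\<ge>0. set_integrable lborel {0..t} b \<and> a t = a0 + (LINT s:{0..t}|lborel. b s))"

context
  fixes M :: "'w measure" and F :: "real \<Rightarrow> 'w measure"
    and S :: "real set" and inc :: "real \<Rightarrow> 'w \<Rightarrow> real"
    and \<rho> abar \<gamma> w \<tau> r :: real
begin

text \<open>The law given initial income \<open>x\<close>; initial wealth enters through the state equation.\<close>

definition law_from :: "real \<Rightarrow> 'w measure" where
  "law_from x = uniform_measure M {\<omega> \<in> space M. inc 0 \<omega> = x}"

definition admissible :: "real \<Rightarrow> real \<Rightarrow> (real \<Rightarrow> 'w \<Rightarrow> real) \<Rightarrow> bool" where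
  "admissible a x c \<longleftrightarrow>
     progressively_measurable F c \<and>
     (\<forall>t\<ge>0. \<forall>\<omega>\<in>space M. c t \<omega> > 0) \<and>
     (AE \<omega> in law_from x. \<forall>t\<ge>0. set_integrable lborel {0..t} (\<lambda>s. c s \<omega>)) \<and>
     (\<exists>A. AE \<omega> in law_from x.
        has_drift a (\<lambda>t. r * A t \<omega> + w * (1 - \<tau>) * inc t \<omega> - c t \<omega>) (\<lambda>t. A t \<omega>) \<and>
        (\<forall>t\<ge>0. A t \<omega> \<ge> abar))"

text \<open>
  \<open>ennreal\<close> maps negative reals to \<open>0\<close>, so this is the expectation of the positive part minus
  that of the negative part.  For \<open>r < \<rho>\<close> the budget constraint bounds the
  expectation of the discounted integral of \<open>c\<close>, and \<open>crra \<gamma> c\<close> is bounded above by an affine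
  function of \<open>c\<close>; so the first term is finite for admissible \<open>c\<close>.
\<close>

definition payoff :: "real \<Rightarrow> (real \<Rightarrow> 'w \<Rightarrow> real) \<Rightarrow> ereal" where
  "payoff x c =
     enn2ereal (\<integral>\<^sup>+\<omega>. (\<integral>\<^sup>+t\<in>{0..}. ennreal (exp (- \<rho> * t) * crra \<gamma> (c t \<omega>)) \<partial>lborel) \<partial>law_from x) -
     enn2ereal (\<integral>\<^sup>+\<omega>. (\<integral>\<^sup>+t\<in>{0..}. ennreal (- (exp (- \<rho> * t) * crra \<gamma> (c t \<omega>))) \<partial>lborel) \<partial>law_from x)"

definition value_fun :: "real \<Rightarrow> real \<Rightarrow> real" where
  "value_fun a x = real_of_ereal (SUP c\<in>{c. admissible a x c}. payoff x c)"

text \<open>The derivative of the value function is one-sided at the borrowing limit.\<close>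

definition opt_consumption :: "real \<Rightarrow> real \<Rightarrow> real" where
  "opt_consumption a x =
     the_inv_into {0<..} (deriv (crra \<gamma>))
       (vector_derivative (\<lambda>b. value_fun b x) (at a within {abar..}))"

text \<open>
  The optimal wealth path from wealth \<open>a\<close> along the income path of \<open>\<omega>\<close>.  As \<open>opt_consumption\<close> is
  nondecreasing in wealth, there is at most one such path on \<open>{0..}\<close>.
\<close>

definition opt_wealth :: "real \<Rightarrow> 'w \<Rightarrow> real \<Rightarrow> real" where
  "opt_wealth a \<omega> =
     (SOME \<alpha>. (\<forall>t\<ge>0. \<alpha> t \<ge> abar) \<and>
        has_drift a (\<lambda>t. r * \<alpha> t + w * (1 - \<tau>) * inc t \<omega> - opt_consumption (\<alpha> t) (inc t \<omega>)) \<alpha>)"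

definition opt_kernel :: "real \<Rightarrow> real \<times> real \<Rightarrow> (real \<times> real) set \<Rightarrow> ennreal" where
  "opt_kernel t = (\<lambda>(a, x) B.
     emeasure (law_from x) {\<omega> \<in> space M. (opt_wealth a \<omega> t, inc t \<omega>) \<in> B})"

definition invariant_prob :: "(real \<times> real) measure \<Rightarrow> bool" where
  "invariant_prob G \<longleftrightarrow>
     prob_space G \<and> sets G = sets borel \<and> emeasure G ({abar..} \<times> S) = 1 \<and>
     (\<forall>t\<ge>0. \<forall>B\<in>sets borel. (\<integral>\<^sup>+ s. opt_kernel t s B \<partial>G) = emeasure G B)"

end

end

theory Submission
  imports Defs "HOL-Complex_Analysis.Great_Picard" "HOL-Real_Asymp.Real_Asymp"
begin

text \<open>
  Let \<open>x = a - abar\<close> be wealth above the limit, \<open>y(z)\<close> income at the limit and \<open>q(z) = u'(y(z))\<close>.  The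
  condition \<open>r \<le> rbar\<close> says that \<open>(\<rho> - r) q - Q q \<ge> 0\<close> for the generator \<open>Q\<close>, because
  \<open>r + Theta r\<close> is strictly increasing.  The slopes of the value function are estimated by comparing explicit
  controls, without the Hamilton-Jacobi-Bellman equation.

  If \<open>(\<rho> - r) q - Q q \<ge> 0\<close>, take any control from wealth \<open>x + \<eta>\<close> and cut consumption down to
  \<open>y + r x\<close> until \<open>\<eta>\<close> has been saved; the result is feasible from \<open>x\<close>, and its loss is at most
  \<open>\<eta> u'(y + r x)\<close>, strictly less in the lowest income state.  So optimal consumption is at least current
  income: optimal wealth never increases, and it decreases in the lowest income state.  An invariant measure
  lives on states from which wealth stays constant, hence on \<open>x = 0\<close>.

  In the other direction, from \<open>x = 0\<close> the control that spends an additional \<open>\<epsilon>\<close> very quickly shows that the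
  slope of the value function at the limit is at least \<open>q\<close>, with strict inequality in each state where
  \<open>(\<rho> - r) q - Q q < 0\<close>.  There the household saves at the limit, so wealth leaves it.
\<close>

section \<open>CRRA utility\<close>

text \<open>With \<open>h = \<alpha> f - gen f\<close>, the process
  \<open>exp (- \<alpha> t) f (Z t)\<close> is a conditional expectation of future values of h.
  Pricing a spending flow at f and exchanging the order of integration therefore replaces the flow
  by its cumulative discounted amount, weighted by h. This is what makes controls comparable: the
  budget bounds only cumulative amounts, and for f = q the weight is the expression whose sign
  defines the threshold. Income times \<open>excess\<close> is antitone in nonlabour income; this is
  why \<open>r + Theta r\<close> increases and why the sign at the limit extends to wealth with r x
  \<ge> 0.

  The strict loss must survive the passage from increments to derivatives. A perturbation of size m
  costs an error of order m^2; discounting it at an extra rate \<theta> of order 1/m brings the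
  error to order m^3, below the gain from an increment of order m^2. The value function is known to
  be concave with second differences bounded below. This gives a continuous derivative but no
  Lipschitz drift, so optimal wealth comes from an existence theorem of Caratheodory type.\<close>

lemma crra_has_real_derivative:
  assumes "c > 0" shows "(crra \<gamma> has_real_derivative c powr (- \<gamma>)) (at c)"
proof (cases "\<gamma> = 1")
  case True
  have "crra \<gamma> = ln" using True by (simp add: crra_def fun_eq_iff)
  moreover have "c powr (- \<gamma>) = 1 / c" using True assms by (simp add: powr_minus divide_simps)
  ultimately show ?thesis using DERIV_ln_divide[OF assms] by simp
next
  case False
  have "crra \<gamma> = (\<lambda>c. c powr (1 - \<gamma>) / (1 - \<gamma>))" using False by (simp add: crra_def fun_eq_iff)
  moreover have "((\<lambda>c. c powr (1 - \<gamma>) / (1 - \<gamma>)) has_real_derivative ((1 - \<gamma>) * c powr (1 - \<gamma> - 1)) / (1 - \<gamma>)) (at c)"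
    by (intro DERIV_cdivide has_real_derivative_powr assms)
  ultimately show ?thesis using False by simp
qed

lemma deriv_crra: "c > 0 \<Longrightarrow> deriv (crra \<gamma>) c = c powr (- \<gamma>)"
  by (intro DERIV_imp_deriv crra_has_real_derivative)

lemma crra_mono: "0 < a \<Longrightarrow> a \<le> b \<Longrightarrow> crra \<gamma> a \<le> crra \<gamma> b"
  by (rule DERIV_nonneg_imp_nondecreasing, assumption)
    (metis crra_has_real_derivative less_le_trans powr_ge_zero)

lemma crra_measurable [measurable]: "crra \<gamma> \<in> borel_measurable borel"
  unfolding crra_def by measurable

lemma powr_minus_antimono: "0 < (a::real) \<Longrightarrow> a \<le> b \<Longrightarrow> \<gamma> \<ge> 0 \<Longrightarrow> b powr (- \<gamma>) \<le> a powr (- \<gamma>)"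
  by (simp add: powr_minus le_imp_inverse_le powr_mono2)

lemma powr_minus_strict_antimono: "0 < (a::real) \<Longrightarrow> a < b \<Longrightarrow> \<gamma> > 0 \<Longrightarrow> b powr (- \<gamma>) < a powr (- \<gamma>)"
  by (simp add: powr_minus less_imp_inverse_less powr_less_mono2)

text \<open>Marginal utility decreases, so the mean value theorem compares each chord slope with the
  tangent slope at b. Concavity of utility enters the later estimates through this bound.\<close>

lemma crra_tangent:
  assumes "\<gamma> > 0" "0 < b" "0 < c"
  shows "crra \<gamma> c \<le> crra \<gamma> b + b powr (- \<gamma>) * (c - b)"
proof -
  consider "c = b" | "b < c" | "c < b" by linarith
  then show ?thesis
  proof cases
    case 2
    obtain z where z: "b < z" "z < c" "crra \<gamma> c - crra \<gamma> b = (c - b) * z powr (- \<gamma>)"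
      using MVT2[OF 2, of "crra \<gamma>" "\<lambda>z. z powr (- \<gamma>)"] crra_has_real_derivative assms by force
    have "(c - b) * z powr (- \<gamma>) \<le> (c - b) * b powr (- \<gamma>)"
      using z 2 assms by (intro mult_left_mono powr_minus_antimono) auto
    then show ?thesis using z(3) unfolding mult.commute[of "b powr (- \<gamma>)"] by linarith
  next
    case 3
    obtain z where z: "c < z" "z < b" "crra \<gamma> b - crra \<gamma> c = (b - c) * z powr (- \<gamma>)"
      using MVT2[OF 3, of "crra \<gamma>" "\<lambda>z. z powr (- \<gamma>)"] crra_has_real_derivative assms by force
    have "(b - c) * b powr (- \<gamma>) \<le> (b - c) * z powr (- \<gamma>)"
      using z 3 assms by (intro mult_left_mono powr_minus_antimono) auto
    then show ?thesis using z by (simp add: algebra_simps)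
  qed simp
qed

lemma powr_minus_has_real_derivative:
  "c > 0 \<Longrightarrow> ((\<lambda>c. c powr (- \<gamma>)) has_real_derivative - \<gamma> * c powr (- \<gamma> - 1)) (at c)"
  by (rule has_real_derivative_powr)

text \<open>Marginal utility is convex because its derivative increases. The tangent bound limits
  how fast marginal utility can fall, which the second-order estimates below rely on.\<close>

lemma powr_minus_tangent:
  fixes b c \<gamma> :: real
  assumes "\<gamma> > 0" "0 < b" "0 < c"
  shows "c powr (- \<gamma>) \<ge> b powr (- \<gamma>) - \<gamma> * b powr (- \<gamma> - 1) * (c - b)"
proof -
  have eq: "z powr (- \<gamma> - 1) = z powr (- (\<gamma> + 1))" for z :: real
    by (rule arg_cong[of _ _ "(powr) z"]) simp
  consider "c = b" | "b < c" | "c < b" by linarith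
  then show ?thesis
  proof cases
    case 2
    obtain z where z: "b < z" "z < c" "c powr (- \<gamma>) - b powr (- \<gamma>) = (c - b) * (- \<gamma> * z powr (- \<gamma> - 1))"
      using MVT2[OF 2, of "\<lambda>c. c powr (- \<gamma>)" "\<lambda>z. - \<gamma> * z powr (- \<gamma> - 1)"]
        powr_minus_has_real_derivative assms by force
    have "(c - b) * (\<gamma> * z powr (- \<gamma> - 1)) \<le> (c - b) * (\<gamma> * b powr (- \<gamma> - 1))"
      using z 2 assms unfolding eq by (intro mult_left_mono powr_minus_antimono) auto
    then show ?thesis using z by (simp add: algebra_simps)
  next
    case 3
    obtain z where z: "c < z" "z < b" "b powr (- \<gamma>) - c powr (- \<gamma>) = (b - c) * (- \<gamma> * z powr (- \<gamma> - 1))"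
      using MVT2[OF 3, of "\<lambda>c. c powr (- \<gamma>)" "\<lambda>z. - \<gamma> * z powr (- \<gamma> - 1)"]
        powr_minus_has_real_derivative assms by force
    have "(b - c) * (\<gamma> * b powr (- \<gamma> - 1)) \<le> (b - c) * (\<gamma> * z powr (- \<gamma> - 1))"
      using z 3 assms unfolding eq by (intro mult_left_mono powr_minus_antimono) auto
    then show ?thesis using z by (simp add: algebra_simps)
  qed simp
qed

text \<open>Concavity bounds the gain from below by e times the marginal utility at
  \<open>c + e\<close>, and convexity bounds the latter by its tangent at b. The result is affine in
  c for fixed e, which matters because only integrals of c are known for an arbitrary
  control.\<close>

lemma crra_incr_ge:
  assumes "\<gamma> > 0" "0 < b" "0 < c" "0 \<le> e"
  shows "crra \<gamma> (c + e) - crra \<gamma> c \<ge> (b powr (- \<gamma>) - \<gamma> * b powr (- \<gamma> - 1) * (c + e - b)) * e"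
proof -
  have "crra \<gamma> c \<le> crra \<gamma> (c + e) + (c + e) powr (- \<gamma>) * (c - (c + e))"
    using assms by (intro crra_tangent) auto
  moreover have "(b powr (- \<gamma>) - \<gamma> * b powr (- \<gamma> - 1) * (c + e - b)) * e \<le> (c + e) powr (- \<gamma>) * e"
    using assms by (intro mult_right_mono powr_minus_tangent) auto
  ultimately show ?thesis by (simp add: algebra_simps)
qed

text \<open>Both tangents are taken at the perturbed points, which leaves \<theta> times the
  difference of marginal utilities at \<open>1 + \<theta>\<close> and \<open>1 - \<theta>\<close>;
  convexity makes that difference of order \<theta>. By homogeneity the error is a multiple of
  \<open>c powr (1 - \<gamma>)\<close>, that is, of utility itself unless \<gamma> = 1.\<close>

lemma crra_second_difference:
  assumes \<gamma>: "\<gamma> > 0" and c: "c > 0" and \<theta>: "0 \<le> \<theta>" "\<theta> \<le> 1 / 2"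
  shows "crra \<gamma> ((1 + \<theta>) * c) + crra \<gamma> ((1 - \<theta>) * c) - 2 * crra \<gamma> c
           \<ge> - ((2 * \<gamma> * (1 / 2) powr (- \<gamma> - 1)) * \<theta>\<^sup>2 * c powr (1 - \<gamma>))"
proof -
  have t1: "crra \<gamma> c \<le> crra \<gamma> ((1 + \<theta>) * c) + ((1 + \<theta>) * c) powr (- \<gamma>) * (c - (1 + \<theta>) * c)"
    using assms by (intro crra_tangent) auto
  have t2: "crra \<gamma> c \<le> crra \<gamma> ((1 - \<theta>) * c) + ((1 - \<theta>) * c) powr (- \<gamma>) * (c - (1 - \<theta>) * c)"
    using assms by (intro crra_tangent) auto
  have p: "c powr (- \<gamma>) * c = c powr (1 - \<gamma>)"
    using c by (metis add.commute powr_mult_base uminus_add_conv_diff diff_conv_add_uminus mult.commute less_imp_le)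
  have e1: "((1 + \<theta>) * c) powr (- \<gamma>) * (c - (1 + \<theta>) * c) = - ((1 + \<theta>) powr (- \<gamma>) * \<theta> * c powr (1 - \<gamma>))"
    using c \<theta> by (subst powr_mult) (auto simp: p[symmetric] algebra_simps)
  have e2: "((1 - \<theta>) * c) powr (- \<gamma>) * (c - (1 - \<theta>) * c) = (1 - \<theta>) powr (- \<gamma>) * \<theta> * c powr (1 - \<gamma>)"
    using c \<theta> by (subst powr_mult) (auto simp: p[symmetric] algebra_simps)
  have "(1 + \<theta>) powr (- \<gamma>) \<ge> (1 - \<theta>) powr (- \<gamma>) - \<gamma> * (1 - \<theta>) powr (- \<gamma> - 1) * ((1 + \<theta>) - (1 - \<theta>))"
    using assms by (intro powr_minus_tangent) auto
  moreover have g1: "- \<gamma> - 1 = - (\<gamma> + 1)" by simp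
  have "(1 - \<theta>) powr (- (\<gamma> + 1)) \<le> (1 / 2) powr (- (\<gamma> + 1))"
    using assms by (intro powr_minus_antimono) auto
  then have "\<gamma> * (1 - \<theta>) powr (- \<gamma> - 1) * (2 * \<theta>) \<le> \<gamma> * (1 / 2) powr (- \<gamma> - 1) * (2 * \<theta>)"
    using assms unfolding g1 by (intro mult_right_mono mult_left_mono) auto
  ultimately have "(1 + \<theta>) powr (- \<gamma>) - (1 - \<theta>) powr (- \<gamma>) \<ge> - (\<gamma> * (1 / 2) powr (- \<gamma> - 1) * (2 * \<theta>))"
    by (simp add: algebra_simps)
  then have "((1 + \<theta>) powr (- \<gamma>) - (1 - \<theta>) powr (- \<gamma>)) * (\<theta> * c powr (1 - \<gamma>))
      \<ge> - (\<gamma> * (1 / 2) powr (- \<gamma> - 1) * (2 * \<theta>)) * (\<theta> * c powr (1 - \<gamma>))"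
    using assms by (intro mult_right_mono) auto
  then show ?thesis using t1 t2 unfolding e1 e2 by (simp add: algebra_simps power2_eq_square)
qed

section \<open>The threshold interest rate\<close>

text \<open>The bracket alone can move either way with k, depending on which of y and z is larger;
  the weight \<open>k + z\<close> repairs this. With \<xi> the quotient, the derivative of the
  weighted bracket is \<open>\<xi> powr \<gamma> * (1 + \<gamma> * (1 - \<xi>)) - 1\<close>, and
  this is at most 0 by the tangent bound for \<open>\<xi> powr (- \<gamma>)\<close> at 1.\<close>

lemma excess_ratio_antimono:
  fixes y z k l \<gamma> :: real
  assumes "\<gamma> > 0" "k + y > 0" "k + z > 0" "k \<le> l"
  shows "(l + z) * (((l + z) / (l + y)) powr \<gamma> - 1) \<le> (k + z) * (((k + z) / (k + y)) powr \<gamma> - 1)"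
proof (rule DERIV_nonpos_imp_nonincreasing[OF assms(4)])
  fix x assume x: "k \<le> x" "x \<le> l"
  then have pos: "x + y > 0" "x + z > 0" using assms by auto
  define \<xi> where "\<xi> = (x + z) / (x + y)"
  have xi: "\<xi> > 0" using pos by (simp add: \<xi>_def)
  have "((\<lambda>x. (x + z) / (x + y)) has_real_derivative (y - z) / (x + y)\<^sup>2) (at x)"
    using pos by (auto intro!: derivative_eq_intros simp: power2_eq_square field_simps)
  then have d1: "((\<lambda>x. ((x + z) / (x + y)) powr \<gamma>) has_real_derivative
      \<gamma> * ((x + z) / (x + y)) powr (\<gamma> - 1) * ((y - z) / (x + y)\<^sup>2)) (at x)"
    using DERIV_fun_powr[of "\<lambda>x. (x + z) / (x + y)" "(y - z) / (x + y)\<^sup>2" x \<gamma>] xi by (simp add: \<xi>_def)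
  let ?D = "(\<xi> powr \<gamma> - 1) + (x + z) * (\<gamma> * \<xi> powr (\<gamma> - 1) * ((y - z) / (x + y)\<^sup>2))"
  have "((\<lambda>x. (x + z) * (((x + z) / (x + y)) powr \<gamma> - 1)) has_real_derivative ?D) (at x)"
    using DERIV_mult[OF DERIV_add[OF DERIV_ident DERIV_const[of z]] DERIV_diff[OF d1 DERIV_const[of 1]]]
    unfolding \<xi>_def by (simp add: algebra_simps)
  moreover have "?D \<le> 0"
  proof -
    have "(x + z) * ((y - z) / (x + y)\<^sup>2) = \<xi> * (1 - \<xi>)"
      using pos by (simp add: \<xi>_def power2_eq_square field_simps)
    then have "?D = \<xi> powr \<gamma> - 1 + \<gamma> * (\<xi> powr (\<gamma> - 1) * \<xi>) * (1 - \<xi>)"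
      by (metis (no_types, opaque_lifting) mult.assoc mult.left_commute)
    also have "\<xi> powr (\<gamma> - 1) * \<xi> = \<xi> powr \<gamma>" using xi by (simp add: powr_diff)
    finally have D: "?D = \<xi> powr \<gamma> * (1 + \<gamma> * (1 - \<xi>)) - 1" by (simp add: algebra_simps)
    have "\<xi> powr (- \<gamma>) \<ge> 1 - \<gamma> * (\<xi> - 1)" using powr_minus_tangent[OF assms(1), of 1 \<xi>] xi by simp
    then have "\<xi> powr \<gamma> * (1 + \<gamma> * (1 - \<xi>)) \<le> \<xi> powr \<gamma> * \<xi> powr (- \<gamma>)"
      by (intro mult_left_mono) (auto simp: algebra_simps)
    also have "\<dots> = 1" using xi by (simp add: powr_minus)
    finally show ?thesis unfolding D by simp
  qed
  ultimately show "\<exists>D. DERIV (\<lambda>x. (x + z) * (((x + z) / (x + y)) powr \<gamma> - 1)) x :> D \<and> D \<le> 0" by blast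
qed

lemma continuous_on_Max_image:
  fixes f :: "'i \<Rightarrow> real \<Rightarrow> real"
  assumes "finite A" "A \<noteq> {}" "\<And>i. i \<in> A \<Longrightarrow> continuous_on U (f i)"
  shows "continuous_on U (\<lambda>x. Max ((\<lambda>i. f i x) ` A))"
  using assms
proof (induction A rule: finite_ne_induct)
  case (insert i A)
  have "(\<lambda>x. Max ((\<lambda>i. f i x) ` insert i A)) = (\<lambda>x. max (f i x) (Max ((\<lambda>i. f i x) ` A)))"
    using insert by (auto simp: fun_eq_iff)
  then show ?case using insert by (auto intro!: continuous_on_max)
qed simp

section \<open>Monotonicity of the threshold function\<close>

context income_chain
begin

text \<open>The generator applied to marginal utility, divided by marginal utility at x (see
  \<open>gen_marginal\<close>). The interest rate enters only through nonlabour income k, at the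
  limit \<open>r * abar\<close>; \<omega> is the after-tax wage.\<close>

definition excess :: "real \<Rightarrow> real \<Rightarrow> real \<Rightarrow> real \<Rightarrow> real" where
  "excess \<gamma> \<omega> k x = (\<Sum>y\<in>S - {x}. rate x y * (((k + \<omega> * x) / (k + \<omega> * y)) powr \<gamma> - 1))"

lemma S_ne: "S \<noteq> {}" using card_S by auto

lemma Min_S: "Min S \<in> S" and Max_S: "Max S \<in> S" using finite_S S_ne by auto

lemma Min_less_Max: "Min S < Max S"
proof -
  have "Min S \<noteq> Max S"
  proof
    assume "Min S = Max S"
    then have "x = Min S" if "x \<in> S" for x using that finite_S Min_le Max_ge by (metis order_antisym)
    then have "S \<subseteq> {Min S}" by auto
    then have "card S \<le> 1" by (metis card_mono card.empty card_insert_disjoint empty_iff finite.emptyI finite.insertI One_nat_def)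
    then show False using card_S by simp
  qed
  then show ?thesis using Min_le[OF finite_S Max_S] by simp
qed

lemma rate_out: obtains y where "y \<in> S" "y \<noteq> Max S" "rate (Max S) y > 0"
proof -
  have "(Max S, Min S) \<in> {(u, v). u \<in> S \<and> v \<in> S \<and> u \<noteq> v \<and> rate u v > 0}\<^sup>*"
    using irreducible Min_S Max_S unfolding irreducible_rates_def by blast
  then show ?thesis using that Min_less_Max by (cases rule: converse_rtranclE) auto
qed

lemma rate_in: obtains y where "y \<in> S" "y \<noteq> Min S" "rate y (Min S) > 0"
proof -
  have "(Max S, Min S) \<in> {(u, v). u \<in> S \<and> v \<in> S \<and> u \<noteq> v \<and> rate u v > 0}\<^sup>*"
    using irreducible Min_S Max_S unfolding irreducible_rates_def by blast
  then show ?thesis using that Min_less_Max by (cases rule: rtranclE) auto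
qed

lemma income_pos: "\<omega> > 0 \<Longrightarrow> k + \<omega> * Min S > 0 \<Longrightarrow> x \<in> S \<Longrightarrow> k + \<omega> * x > 0"
  using Min_le[OF finite_S, of x] mult_left_mono[of "Min S" x \<omega>] by linarith

lemma Theta_eq_excess:
  assumes "w > 0" "\<tau> < 1" "r * abar + w * (1 - \<tau>) * Min S > 0"
  shows "Theta S rate abar \<gamma> w \<tau> r = Max (excess \<gamma> (w * (1 - \<tau>)) (r * abar) ` S)"
proof -
  have "(\<Sum>y\<in>S - {x}. rate x y * (deriv (crra \<gamma>) (r * abar + w * (1 - \<tau>) * y) /
              deriv (crra \<gamma>) (r * abar + w * (1 - \<tau>) * x) - 1)) = excess \<gamma> (w * (1 - \<tau>)) (r * abar) x"
    if x: "x \<in> S" for x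
    unfolding excess_def
  proof (intro sum.cong refl)
    fix y assume y: "y \<in> S - {x}"
    have p: "r * abar + w * (1 - \<tau>) * y > 0" "r * abar + w * (1 - \<tau>) * x > 0"
      using income_pos[of "w * (1 - \<tau>)" "r * abar"] assms x y by auto
    show "rate x y * (deriv (crra \<gamma>) (r * abar + w * (1 - \<tau>) * y) /
              deriv (crra \<gamma>) (r * abar + w * (1 - \<tau>) * x) - 1)
       = rate x y * (((r * abar + w * (1 - \<tau>) * x) / (r * abar + w * (1 - \<tau>) * y)) powr \<gamma> - 1)"
      using p by (simp add: deriv_crra powr_minus powr_divide divide_simps)
  qed
  then show ?thesis unfolding Theta_def by (metis (no_types, lifting) image_cong)
qed

lemma excess_antimono:
  assumes "\<gamma> > 0" "\<omega> > 0" "k + \<omega> * Min S > 0" "k \<le> l" "x \<in> S"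
  shows "(l + \<omega> * x) * excess \<gamma> \<omega> l x \<le> (k + \<omega> * x) * excess \<gamma> \<omega> k x"
  unfolding excess_def sum_distrib_left
proof (intro sum_mono)
  fix y assume y: "y \<in> S - {x}"
  have "rate x y * ((l + \<omega> * x) * (((l + \<omega> * x) / (l + \<omega> * y)) powr \<gamma> - 1))
     \<le> rate x y * ((k + \<omega> * x) * (((k + \<omega> * x) / (k + \<omega> * y)) powr \<gamma> - 1))"
    using assms y rate_nonneg income_pos[of \<omega> k]
    by (intro mult_left_mono excess_ratio_antimono) auto
  then show "(l + \<omega> * x) * (rate x y * (((l + \<omega> * x) / (l + \<omega> * y)) powr \<gamma> - 1))
    \<le> (k + \<omega> * x) * (rate x y * (((k + \<omega> * x) / (k + \<omega> * y)) powr \<gamma> - 1))"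
    by (simp add: mult.left_commute)
qed

text \<open>Every jump out of the highest income state lowers income and so raises marginal utility;
  irreducibility provides at least one such jump.\<close>

lemma excess_Max_pos:
  assumes "\<gamma> > 0" "\<omega> > 0" "k + \<omega> * Min S > 0"
  shows "excess \<gamma> \<omega> k (Max S) > 0"
proof -
  have gt1: "((k + \<omega> * Max S) / (k + \<omega> * y)) powr \<gamma> > 1" if "y \<in> S - {Max S}" for y
  proof -
    have "y < Max S" using that Max_ge[OF finite_S, of y] by auto
    then have "(k + \<omega> * Max S) / (k + \<omega> * y) > 1" using that assms income_pos[of \<omega> k y] by simp
    then show ?thesis using assms by (simp add: gr_one_powr)
  qed
  obtain y where y: "y \<in> S" "y \<noteq> Max S" "rate (Max S) y > 0" by (rule rate_out)
  show ?thesis unfolding excess_def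
  proof (rule sum_pos2)
    show "finite (S - {Max S})" using finite_S by simp
    show "y \<in> S - {Max S}" using y by simp
    show "0 < rate (Max S) y * (((k + \<omega> * Max S) / (k + \<omega> * y)) powr \<gamma> - 1)"
      using y gt1[of y] by simp
    show "0 \<le> rate (Max S) i * (((k + \<omega> * Max S) / (k + \<omega> * i)) powr \<gamma> - 1)" if "i \<in> S - {Max S}" for i
      using that gt1[of i] rate_nonneg[OF Max_S, of i] by simp
  qed
qed

lemma Theta_pos:
  assumes "\<gamma> > 0" "w > 0" "\<tau> < 1" "r * abar + w * (1 - \<tau>) * Min S > 0"
  shows "Theta S rate abar \<gamma> w \<tau> r > 0"
  unfolding Theta_eq_excess[OF assms(2-)]
  using excess_Max_pos[of \<gamma> "w * (1 - \<tau>)" "r * abar"] assms Max_S finite_S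
  by (subst Max_gr_iff) auto

text \<open>A larger rate means lower income at the limit, since abar \<le> 0. At a maximiser x for
  r the excess is positive, so it may be multiplied by the lower income belonging to s;
  \<open>excess_antimono\<close> bounds the product by the same income times the excess for s, and
  the income cancels.\<close>

lemma Theta_mono:
  assumes "\<gamma> > 0" "w > 0" "\<tau> < 1" "abar \<le> 0" "r \<le> s" "s * abar + w * (1 - \<tau>) * Min S > 0"
  shows "Theta S rate abar \<gamma> w \<tau> r \<le> Theta S rate abar \<gamma> w \<tau> s"
proof -
  let ?\<omega> = "w * (1 - \<tau>)"
  have le: "s * abar \<le> r * abar" using assms by (simp add: mult_right_mono_neg)
  then have f: "r * abar + ?\<omega> * Min S > 0" using assms by linarith
  have "Theta S rate abar \<gamma> w \<tau> r \<in> excess \<gamma> ?\<omega> (r * abar) ` S"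
    unfolding Theta_eq_excess[OF assms(2,3) f] using finite_S S_ne by (intro Max_in) auto
  then obtain x where x: "x \<in> S" "Theta S rate abar \<gamma> w \<tau> r = excess \<gamma> ?\<omega> (r * abar) x" by auto
  have pos: "0 < excess \<gamma> ?\<omega> (r * abar) x" using Theta_pos[OF assms(1-3) f] x by simp
  have p: "s * abar + ?\<omega> * x > 0" using income_pos[of ?\<omega> "s * abar" x] assms x by simp
  have "(s * abar + ?\<omega> * x) * excess \<gamma> ?\<omega> (r * abar) x \<le> (r * abar + ?\<omega> * x) * excess \<gamma> ?\<omega> (r * abar) x"
    using pos le by (intro mult_right_mono) auto
  also have "\<dots> \<le> (s * abar + ?\<omega> * x) * excess \<gamma> ?\<omega> (s * abar) x"
    using excess_antimono[of \<gamma> ?\<omega> "s * abar" "r * abar" x] assms le x by simp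
  finally have "excess \<gamma> ?\<omega> (r * abar) x \<le> excess \<gamma> ?\<omega> (s * abar) x" using p by simp
  also have "\<dots> \<le> Theta S rate abar \<gamma> w \<tau> s"
    unfolding Theta_eq_excess[OF assms(2,3,6)] using finite_S x by (intro Max_ge) auto
  finally show ?thesis using x by simp
qed

lemma continuous_on_Theta:
  assumes "w > 0" "\<tau> < 1"
  shows "continuous_on {r. r * abar + w * (1 - \<tau>) * Min S > 0} (Theta S rate abar \<gamma> w \<tau>)"
proof -
  let ?\<omega> = "w * (1 - \<tau>)"
  have pos: "r * abar + ?\<omega> * x > 0" if "r * abar + ?\<omega> * Min S > 0" "x \<in> S" for r x
    using income_pos[of ?\<omega> "r * abar" x] assms that by simp
  have "continuous_on {r. r * abar + ?\<omega> * Min S > 0} (\<lambda>r. Max ((\<lambda>x. excess \<gamma> ?\<omega> (r * abar) x) ` S))"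
    unfolding excess_def
    by (intro continuous_on_Max_image finite_S S_ne continuous_intros) (auto dest: pos)
  then show ?thesis
    by (rule continuous_on_cong[THEN iffD1, OF refl, rotated]) (simp add: Theta_eq_excess assms)
qed

text \<open>As r approaches b, income in the lowest state at the limit tends to 0 and its marginal
  utility to infinity. A state y that can jump there has unbounded excess.\<close>

lemma Theta_large:
  assumes "\<gamma> > 0" "w > 0" "\<tau> < 1" "abar < 0"
  defines "b \<equiv> w * (1 - \<tau>) * Min S / (- abar)"
  obtains r where "0 \<le> r" "r < b" "r + Theta S rate abar \<gamma> w \<tau> r > \<rho>"
proof -
  let ?\<omega> = "w * (1 - \<tau>)"
  have om: "?\<omega> > 0" using assms by simp
  have bpos: "b > 0" using om pos_S[OF Min_S] assms unfolding b_def by (intro divide_pos_pos mult_pos_pos) auto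
  obtain y where y: "y \<in> S" "y \<noteq> Min S" "rate y (Min S) > 0" by (rule rate_in)
  have ymin: "Min S < y" using y Min_le[OF finite_S, of y] by simp
  define L where "L = (\<Sum>v\<in>S - {y}. rate y v)"
  \<comment> \<open>B is the ratio of marginal utilities at which the jump from y to
    \<open>Min S\<close> outweighs both the absolute value of \<rho> and L, the most that the other
    jumps can subtract.\<close>
  define B where "B = (\<bar>\<rho>\<bar> + L + 1) / rate y (Min S) + 1"
  have L: "L \<ge> 0" unfolding L_def using y rate_nonneg by (intro sum_nonneg) auto
  have B: "B \<ge> 1" unfolding B_def using L y by simp
  define d where "d = ?\<omega> * (y - Min S)"
  have d: "d > 0" using om ymin by (simp add: d_def)
  \<comment> \<open>The income of the lowest state at the rate to be chosen: small enough for
    \<open>((e + d) / e) powr \<gamma> \<ge> B\<close>, and at most its value for r = 0, so that the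
    rate is nonnegative.\<close>
  define e where "e = min (b * (- abar)) (d / B powr (1 / \<gamma>))"
  have "b * (- abar) > 0" using bpos assms(4) by (intro mult_pos_pos) auto
  then have e: "e > 0" using d B by (simp add: e_def)
  define r where "r = b - e / (- abar)"
  have rm: "r * abar + ?\<omega> * Min S = e" using assms by (simp add: r_def b_def field_simps)
  have r1: "r < b" using e assms by (simp add: r_def divide_pos_neg)
  have "e \<le> b * (- abar)" by (simp add: e_def)
  then have r0: "0 \<le> r" using assms(4) by (simp add: r_def field_simps)
  have f: "r * abar + ?\<omega> * Min S > 0" using rm e by simp
  have num: "r * abar + ?\<omega> * y = e + d" using rm by (simp add: d_def algebra_simps)
  have "B powr (1 / \<gamma>) * e \<le> d" using B by (simp add: e_def field_simps min_def)
  then have "B powr (1 / \<gamma>) \<le> (e + d) / e" using e by (simp add: field_simps)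
  then have "(B powr (1 / \<gamma>)) powr \<gamma> \<le> ((e + d) / e) powr \<gamma>" using assms by (intro powr_mono2) auto
  then have pB: "B \<le> ((e + d) / e) powr \<gamma>" using B assms by (simp add: powr_powr)
  have ex: "excess \<gamma> ?\<omega> (r * abar) y = rate y (Min S) * (((e + d) / e) powr \<gamma> - 1) +
     (\<Sum>v\<in>S - {y} - {Min S}. rate y v * (((r * abar + ?\<omega> * y) / (r * abar + ?\<omega> * v)) powr \<gamma> - 1))"
    unfolding excess_def using finite_S Min_S y
    by (subst sum.remove[of _ "Min S"]) (auto simp: num rm)
  have "(\<Sum>v\<in>S - {y} - {Min S}. rate y v * (((r * abar + ?\<omega> * y) / (r * abar + ?\<omega> * v)) powr \<gamma> - 1))
     \<ge> (\<Sum>v\<in>S - {y} - {Min S}. - rate y v)"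
  proof (intro sum_mono)
    fix v assume "v \<in> S - {y} - {Min S}"
    then have "rate y v * (- 1) \<le> rate y v * (((r * abar + ?\<omega> * y) / (r * abar + ?\<omega> * v)) powr \<gamma> - 1)"
      using rate_nonneg y by (intro mult_left_mono) auto
    then show "- rate y v \<le> rate y v * (((r * abar + ?\<omega> * y) / (r * abar + ?\<omega> * v)) powr \<gamma> - 1)" by simp
  qed
  moreover have "(\<Sum>v\<in>S - {y} - {Min S}. rate y v) \<le> L"
    unfolding L_def using rate_nonneg y finite_S by (intro sum_mono2) auto
  ultimately have "excess \<gamma> ?\<omega> (r * abar) y \<ge> rate y (Min S) * (B - 1) - L"
    using ex pB y by (simp add: sum_negf) (smt (verit) mult_left_mono)
  also have "rate y (Min S) * (B - 1) - L = \<bar>\<rho>\<bar> + 1" using y by (simp add: B_def)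
  finally have "excess \<gamma> ?\<omega> (r * abar) y > \<rho>" by linarith
  moreover have "excess \<gamma> ?\<omega> (r * abar) y \<le> Theta S rate abar \<gamma> w \<tau> r"
    unfolding Theta_eq_excess[OF assms(2,3) f] using finite_S y by (intro Max_ge) auto
  ultimately show ?thesis using that[OF r0 r1] r0 by linarith
qed

theorem threshold_exists_unique:
  assumes "\<rho> > 0" "\<gamma> > 0" "w > 0" "\<tau> < 1" "abar \<le> 0"
  shows "\<exists>!rbar. rbar \<in> feasible_rates S \<rho> abar w \<tau> \<and> rbar = \<rho> - Theta S rate abar \<gamma> w \<tau> rbar"
proof -
  let ?T = "Theta S rate abar \<gamma> w \<tau>" and ?\<omega> = "w * (1 - \<tau>)"
  have om: "?\<omega> * Min S > 0" using assms pos_S[OF Min_S] by simp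
  have feas0: "r * abar + ?\<omega> * Min S > 0" if "r \<le> s" "s * abar + ?\<omega> * Min S > 0" for r s
    using that assms mult_right_mono_neg[of r s abar] by linarith
  \<comment> \<open>The right endpoint for the intermediate value theorem. For abar = 0, s = \<rho>
    works because Theta is positive; otherwise a rate close to the one at which the lowest income
    vanishes is taken.\<close>
  obtain s where s: "0 \<le> s" "s * abar + ?\<omega> * Min S > 0" "s + ?T s \<ge> \<rho>"
  proof (cases "abar = 0")
    case True
    have "?T \<rho> > 0" using Theta_pos[of \<gamma> w \<tau> \<rho> abar] assms True om by simp
    then show ?thesis using that[of \<rho>] assms True om by simp
  next
    case False
    then obtain r where r: "0 \<le> r" "r < ?\<omega> * Min S / (- abar)" "r + ?T r > \<rho>"
      using Theta_large[of \<gamma> w \<tau> abar \<rho>] assms by auto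
    have "abar < 0" using False assms by simp
    then have "r * abar + ?\<omega> * Min S > 0" using r(2) by (simp add: field_simps)
    then show ?thesis using that r by force
  qed
  \<comment> \<open>Monotonicity gives Theta at l at most Theta at s, so the sum at this left
    endpoint is at most \<rho>; the minimum with 0 keeps l \<le> s.\<close>
  define l where "l = min 0 (\<rho> - ?T s)"
  have ls: "l \<le> s" using s by (simp add: l_def)
  have "?T l \<le> ?T s" using assms s ls by (intro Theta_mono) auto
  then have lb: "l + ?T l \<le> \<rho>" by (simp add: l_def)
  have cont: "continuous_on {l..s} (\<lambda>r. r + ?T r)"
    using assms by (intro continuous_intros continuous_on_subset[OF continuous_on_Theta])
      (auto intro: feas0[OF _ s(2)])
  obtain rb where rb: "l \<le> rb" "rb \<le> s" "rb + ?T rb = \<rho>"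
    using IVT'[OF lb s(3) ls cont] by auto
  have f: "rb * abar + ?\<omega> * Min S > 0" using feas0[OF rb(2) s(2)] .
  \<comment> \<open>Positivity of Theta forces rb < \<rho>, which makes the root feasible.\<close>
  have "?T rb > 0" using Theta_pos[OF _ _ _ f] assms by simp
  then have ex: "rb \<in> feasible_rates S \<rho> abar w \<tau> \<and> rb = \<rho> - ?T rb"
    using f rb by (auto simp: feasible_rates_def)
  show ?thesis
  proof (rule ex1I[where P = "\<lambda>r. r \<in> feasible_rates S \<rho> abar w \<tau> \<and> r = \<rho> - ?T r", OF ex])
    fix x assume x: "x \<in> feasible_rates S \<rho> abar w \<tau> \<and> x = \<rho> - ?T x"
    have "?T x \<le> ?T rb" if "x \<le> rb" using that assms f by (intro Theta_mono) auto
    moreover have "?T rb \<le> ?T x" if "rb \<le> x" using that assms x by (intro Theta_mono) (auto simp: feasible_rates_def)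
    ultimately show "x = rb" using x rb by (metis add_diff_cancel_right' diff_left_mono linear order_antisym)
  qed
qed

text \<open>Since \<open>r + Theta r\<close> is strictly increasing and equals \<rho> at rbar,
  comparing r with rbar amounts to comparing the sum with \<rho>; a maximum is bounded exactly when
  each of its members is.\<close>

lemma threshold_iff:
  assumes "\<rho> > 0" "\<gamma> > 0" "w > 0" "\<tau> < 1" "abar \<le> 0"
    and rb: "rbar \<in> feasible_rates S \<rho> abar w \<tau>" "rbar = \<rho> - Theta S rate abar \<gamma> w \<tau> rbar"
    and r: "r \<in> feasible_rates S \<rho> abar w \<tau>"
  shows "r \<le> rbar \<longleftrightarrow> (\<forall>x\<in>S. excess \<gamma> (w * (1 - \<tau>)) (r * abar) x \<le> \<rho> - r)"
proof -
  let ?T = "Theta S rate abar \<gamma> w \<tau>"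
  have "(\<forall>x\<in>S. excess \<gamma> (w * (1 - \<tau>)) (r * abar) x \<le> \<rho> - r) \<longleftrightarrow> ?T r \<le> \<rho> - r"
    using Theta_eq_excess[of w \<tau> r abar] assms finite_S S_ne by (subst Theta_eq_excess) (auto simp: feasible_rates_def)
  moreover have "r \<le> rbar \<Longrightarrow> ?T r \<le> ?T rbar" "rbar \<le> r \<Longrightarrow> ?T rbar \<le> ?T r"
    using assms by (auto intro!: Theta_mono simp: feasible_rates_def)
  ultimately show ?thesis using rb(2) by linarith
qed

end

section \<open>Concave functions on a half line\<close>

lemma concave_three_points:
  fixes f :: "real \<Rightarrow> real"
  assumes "concave_on {0..} f" "0 \<le> a" "a < b" "b < c"
  shows "(c - b) * f a + (b - a) * f c \<le> (c - a) * f b"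
proof -
  define t where "t = (b - a) / (c - a)"
  have t: "0 \<le> t" "t \<le> 1" using assms by (auto simp: t_def)
  have b: "(1 - t) *\<^sub>R a + t *\<^sub>R c = b"
  proof -
    have "t * (c - a) = b - a" using assms by (simp add: t_def)
    then show ?thesis by (simp add: algebra_simps)
  qed
  have "f ((1 - t) *\<^sub>R a + t *\<^sub>R c) \<ge> (1 - t) * f a + t * f c"
    using assms t by (intro concave_onD) auto
  then have "(c - a) * ((1 - t) * f a + t * f c) \<le> (c - a) * f b"
    using assms unfolding b by (intro mult_left_mono) auto
  moreover have "(c - a) * (1 - t) = c - b" "(c - a) * t = b - a"
    using assms by (auto simp: t_def field_simps)
  ultimately show ?thesis by (metis (no_types, opaque_lifting) distrib_left mult.assoc)
qed

lemma concave_slopes: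
  fixes f :: "real \<Rightarrow> real"
  assumes "concave_on {0..} f" "0 \<le> a" "a < b" "b < c"
  shows "(f c - f a) / (c - a) \<le> (f b - f a) / (b - a)"
    and "(f c - f b) / (c - b) \<le> (f c - f a) / (c - a)"
    and "(f c - f b) / (c - b) \<le> (f b - f a) / (b - a)"
  using concave_three_points[OF assms] assms
  by (auto simp: divide_simps) (auto simp: algebra_simps)

text \<open>Chord slopes from 0 increase as h shrinks, so the derivative is their supremum.
  Concavity alone would allow an infinite slope at the endpoint; C excludes it.\<close>

lemma concave_has_right_derivative_at_0:
  fixes f :: "real \<Rightarrow> real"
  assumes f: "concave_on {0..} f" and C: "\<And>h. h > 0 \<Longrightarrow> f h - f 0 \<le> C * h"
  obtains D where "(f has_real_derivative D) (at 0 within {0..})"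
proof
  let ?s = "\<lambda>h. (f h - f 0) / h"
  define D where "D = (SUP h\<in>{0<..}. ?s h)"
  have bdd: "bdd_above (?s ` {0<..})" using C by (auto intro!: bdd_aboveI[of _ C] simp: divide_simps)
  have up: "?s h \<le> D" if "h > 0" for h unfolding D_def using that bdd by (intro cSUP_upper) auto
  have "((\<lambda>y. (f y - f 0) / (y - 0)) \<longlongrightarrow> D) (at 0 within {0..})"
  proof (rule tendstoI)
    fix e :: real assume e: "e > 0"
    obtain h where h: "h > 0" "?s h > D - e"
      using less_cSUP_iff[OF _ bdd, of "D - e"] e unfolding D_def by auto
    have "dist (?s y) D < e" if y: "0 < y" "y < h" for y
      using concave_slopes(1)[OF f _ y] up[of y] y h by (simp add: dist_real_def)
    then show "\<forall>\<^sub>F y in at 0 within {0..}. dist ((f y - f 0) / (y - 0)) D < e"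
      using h(1) by (auto simp: eventually_at intro!: exI[of _ h])
  qed
  then show "(f has_real_derivative D) (at 0 within {0..})" by (simp add: has_field_derivative_iff)
qed

text \<open>D is the supremum of the right chord slopes and lies below all left chord slopes. The
  hypothesis bounds the gap between the two chords of length h by a multiple of h, so both converge
  to D.\<close>

lemma concave_has_derivative_if_second_difference:
  fixes f :: "real \<Rightarrow> real"
  assumes f: "concave_on {0..} f" and x: "x > 0" and h0: "h0 > 0" "h0 \<le> x"
    and K: "\<And>h. 0 < h \<Longrightarrow> h \<le> h0 \<Longrightarrow> f (x + h) + f (x - h) - 2 * f x \<ge> - K * h\<^sup>2"
  obtains D where "(f has_real_derivative D) (at x)"
proof
  let ?s = "\<lambda>h. (f (x + h) - f x) / h" and ?l = "\<lambda>h. (f x - f (x - h)) / h"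
  have sl: "?s h \<le> ?l k" if "0 < h" "0 < k" "k \<le> x" for h k
    using concave_slopes(3)[OF f, of "x - k" x "x + h"] that by simp
  define D where "D = (SUP h\<in>{0<..}. ?s h)"
  have bdd: "bdd_above (?s ` {0<..})" using sl[of _ x] x by (auto intro!: bdd_aboveI[of _ "?l x"])
  have up: "?s h \<le> D" if "h > 0" for h unfolding D_def using that bdd by (intro cSUP_upper) auto
  have lo: "D \<le> ?l k" if "k > 0" "k \<le> x" for k unfolding D_def using that sl by (intro cSUP_least) auto
  have diff: "?l h - ?s h \<le> \<bar>K\<bar> * h" if "0 < h" "h \<le> h0" for h
  proof -
    have "?l h - ?s h = - (f (x + h) + f (x - h) - 2 * f x) / h"
      using that by (simp add: field_simps)
    also have "\<dots> \<le> (K * h\<^sup>2) / h" using K[OF that] that by (intro divide_right_mono) auto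
    also have "\<dots> = K * h" using that by (simp add: power2_eq_square)
    finally show ?thesis using that mult_right_mono[of K "\<bar>K\<bar>" h] by linarith
  qed
  have "((\<lambda>y. (f y - f x) / (y - x)) \<longlongrightarrow> D) (at x)"
  proof (rule tendstoI)
    fix e :: real assume e: "e > 0"
    define d where "d = min h0 (e / (\<bar>K\<bar> + 1))"
    have d: "d > 0" using e h0 by (simp add: d_def)
    have small: "\<bar>K\<bar> * h < e" if "0 < h" "h < d" for h
    proof -
      have "(\<bar>K\<bar> + 1) * h < e" using that by (simp add: d_def field_simps)
      then show ?thesis using that by (simp add: algebra_simps)
    qed
    have "dist ((f y - f x) / (y - x)) D < e" if y: "y \<noteq> x" "\<bar>y - x\<bar> < d" for y
    proof (cases "y > x")
      case True
      then have h: "0 < y - x" "y - x < d" "y - x \<le> h0" "y - x \<le> x" using y h0 by (auto simp: d_def)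
      show ?thesis
        using up[OF h(1)] lo[OF h(1,4)] diff[OF h(1,3)] small[OF h(1,2)] by (simp add: dist_real_def)
    next
      case False
      then have h: "0 < x - y" "x - y < d" "x - y \<le> h0" "x - y \<le> x" using y h0 by (auto simp: d_def)
      have "(f y - f x) / (y - x) = (f x - f (x - (x - y))) / (x - y)" using h by (simp add: field_simps)
      then show ?thesis
        using up[OF h(1)] lo[OF h(1,4)] diff[OF h(1,3)] small[OF h(1,2)] by (simp add: dist_real_def)
    qed
    then show "\<forall>\<^sub>F y in at x. dist ((f y - f x) / (y - x)) D < e"
      using d by (auto simp: eventually_at dist_real_def intro!: exI[of _ d])
  qed
  then show "(f has_real_derivative D) (at x)" by (simp add: has_field_derivative_iff)
qed

context
  fixes f f' :: "real \<Rightarrow> real"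
  assumes f: "concave_on {0..} f"
    and f': "\<And>x. x \<ge> 0 \<Longrightarrow> (f has_real_derivative f' x) (at x within {0..})"
begin

lemma concave_slope_le_derivative:
  assumes "0 \<le> x" "x < y" shows "(f y - f x) / (y - x) \<le> f' x"
proof (rule tendsto_lowerbound)
  show "((\<lambda>z. (f z - f x) / (z - x)) \<longlongrightarrow> f' x) (at_right x)"
    using f'[OF assms(1)] unfolding has_field_derivative_iff
    by (rule tendsto_within_subset) (use assms in auto)
  show "\<forall>\<^sub>F z in at_right x. (f y - f x) / (y - x) \<le> (f z - f x) / (z - x)"
    using concave_slopes(1)[OF f assms(1)] assms by (auto simp: eventually_at_right_field intro!: exI[of _ y])
qed simp

lemma concave_slope_ge_derivative:
  assumes "0 \<le> y" "y < x" shows "f' x \<le> (f x - f y) / (x - y)"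
proof (rule tendsto_upperbound)
  have "at x within {0..} = at x" using assms by (intro at_within_interior) simp
  then show "((\<lambda>z. (f x - f z) / (x - z)) \<longlongrightarrow> f' x) (at_left x)"
    using f'[of x] assms unfolding has_field_derivative_iff
    by (simp add: filterlim_at_split minus_divide_divide[of "f x - _", symmetric] del: minus_divide_divide)
  show "\<forall>\<^sub>F z in at_left x. (f x - f z) / (x - z) \<le> (f x - f y) / (x - y)"
    using concave_slopes(2)[OF f assms(1)] assms
    by (auto simp: eventually_at_left_field intro!: exI[of _ y])
qed simp

lemma concave_derivative_antimono:
  assumes "0 \<le> x" "x \<le> y" shows "f' y \<le> f' x"
  using concave_slope_le_derivative[of x y] concave_slope_ge_derivative[of x y] assms
  by (cases "x = y") auto

text \<open>Concavity puts f' z above every chord to a point y > z and below every chord from a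
  point y < z. With y fixed close to x these chord slopes depend continuously on z, which bounds f'
  near x from both sides; at x = 0 the upper bound is monotonicity.\<close>

lemma concave_derivative_continuous: "continuous_on {0..} f'"
  unfolding continuous_on_def
proof (intro ballI order_tendstoI)
  fix x :: real assume "x \<in> {0..}"
  then have x: "0 \<le> x" by simp
  have cont: "(f \<longlongrightarrow> f x) (at x within {0..})"
    using DERIV_continuous[OF f'[OF x]] by (simp add: continuous_within)
  have ev: "\<forall>\<^sub>F z in at x within {0..}. z \<ge> 0" by (simp add: eventually_at_topological) auto
  fix a assume a: "a < f' x"
  have "((\<lambda>z. (f z - f x) / (z - x)) \<longlongrightarrow> f' x) (at_right x)"
    using f'[OF x] unfolding has_field_derivative_iff
    by (rule tendsto_within_subset) (use x in auto)
  then have "\<forall>\<^sub>F y in at_right x. a < (f y - f x) / (y - x)" using a by (rule order_tendstoD)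
  then obtain y where y: "x < y" "a < (f y - f x) / (y - x)"
    unfolding eventually_at_right_field by (meson dense)
  have "((\<lambda>z. (f y - f z) / (y - z)) \<longlongrightarrow> (f y - f x) / (y - x)) (at x within {0..})"
    using y by (intro tendsto_intros cont) auto
  then have "\<forall>\<^sub>F z in at x within {0..}. a < (f y - f z) / (y - z)" using y(2) by (rule order_tendstoD)
  moreover have "\<forall>\<^sub>F z in at x within {0..}. z < y"
    using y(1) by (intro order_tendstoD(2)[OF tendsto_ident_at])
  ultimately show "\<forall>\<^sub>F z in at x within {0..}. a < f' z"
    using ev by eventually_elim (use concave_slope_le_derivative in force)
next
  fix x :: real assume "x \<in> {0..}"
  then have x: "0 \<le> x" by simp
  have cont: "(f \<longlongrightarrow> f x) (at x within {0..})"
    using DERIV_continuous[OF f'[OF x]] by (simp add: continuous_within)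
  have ev: "\<forall>\<^sub>F z in at x within {0..}. z \<ge> 0" by (simp add: eventually_at_topological) auto
  fix a assume a: "f' x < a"
  show "\<forall>\<^sub>F z in at x within {0..}. f' z < a"
  proof (cases "x = 0")
    case True
    show ?thesis using ev by eventually_elim (use concave_derivative_antimono[OF x] a True in force)
  next
    case False
    then have "at x within {0..} = at x" using x by (intro at_within_interior) simp
    then have "((\<lambda>z. (f x - f z) / (x - z)) \<longlongrightarrow> f' x) (at_left x)"
      using f'[OF x] unfolding has_field_derivative_iff
      by (simp add: filterlim_at_split minus_divide_divide[of "f x - _", symmetric] del: minus_divide_divide)
    then have "\<forall>\<^sub>F y in at_left x. (f x - f y) / (x - y) < a" using a by (rule order_tendstoD)
    moreover have "\<forall>\<^sub>F y in at_left x. 0 < y \<and> y < x"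
      using x False by (auto simp: eventually_at_left_field intro!: exI[of _ 0])
    ultimately have "\<forall>\<^sub>F y in at_left x. (f x - f y) / (x - y) < a \<and> 0 < y \<and> y < x"
      by eventually_elim simp
    then obtain y where y: "0 < y" "y < x" "(f x - f y) / (x - y) < a"
      using eventually_happens[of _ "at_left x"] by (auto simp: trivial_limit_at_left_real)
    have "((\<lambda>z. (f z - f y) / (z - y)) \<longlongrightarrow> (f x - f y) / (x - y)) (at x within {0..})"
      using y by (intro tendsto_intros cont) auto
    then have "\<forall>\<^sub>F z in at x within {0..}. (f z - f y) / (z - y) < a" using y(3) by (rule order_tendstoD)
    moreover have "\<forall>\<^sub>F z in at x within {0..}. y < z"
      using y(2) by (intro order_tendstoD(1)[OF tendsto_ident_at])
    ultimately show ?thesis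
      using ev by eventually_elim (rule le_less_trans[OF concave_slope_ge_derivative[of y]], use y in auto)
  qed
qed

end

section \<open>Linear state equations\<close>

lemma set_integrable_exp_times:
  assumes "set_integrable lborel {0..t} g"
  shows "set_integrable lborel {0..t} (\<lambda>s. exp (c * s) * g s :: real)"
proof -
  have "integrable lborel (\<lambda>s. exp (\<bar>c\<bar> * \<bar>t\<bar>) * (indicator {0..t} s *\<^sub>R g s))"
    using assms unfolding set_integrable_def by (intro integrable_mult_right)
  moreover have "(\<lambda>s. indicator {0..t} s *\<^sub>R (exp (c * s) * g s)) = (\<lambda>s. exp (c * s) * (indicator {0..t} s *\<^sub>R g s))"
    by (auto simp: fun_eq_iff)
  moreover have "(\<lambda>s. indicator {0..t} s *\<^sub>R g s) \<in> borel_measurable lborel"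
    using assms unfolding set_integrable_def by (rule borel_measurable_integrable)
  ultimately show ?thesis
    unfolding set_integrable_def
  proof (elim Bochner_Integration.integrable_bound)
    show "AE s in lborel. norm (indicator {0..t} s *\<^sub>R (exp (c * s) * g s)) \<le> norm (exp (\<bar>c\<bar> * \<bar>t\<bar>) * (indicator {0..t} s *\<^sub>R g s))"
    proof (intro AE_I2)
      fix s :: real
      have "c * s \<le> \<bar>c\<bar> * \<bar>t\<bar>" if "0 \<le> s" "s \<le> t"
        by (rule order_trans[OF mult_right_mono[OF abs_ge_self] mult_left_mono]) (use that in auto)
      then show "norm (indicator {0..t} s *\<^sub>R (exp (c * s) * g s)) \<le> norm (exp (\<bar>c\<bar> * \<bar>t\<bar>) * (indicator {0..t} s *\<^sub>R g s))"
        by (auto simp: indicator_def abs_mult intro!: mult_right_mono)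
    qed
  qed simp
qed

text \<open>Uniqueness for \<open>D' = r D\<close>, \<open>D 0 = 0\<close> in integrated form. The
  integral equation makes D continuous and hence differentiable, so that the integrating factor
  \<open>exp (- r s)\<close> applies.\<close>

lemma set_lebesgue_integral_has_derivative_zero:
  fixes D :: "real \<Rightarrow> real"
  assumes int: "\<And>t. t \<ge> 0 \<Longrightarrow> set_integrable lborel {0..t} D"
    and eq: "\<And>t. t \<ge> 0 \<Longrightarrow> D t = (LINT s:{0..t}|lborel. r * D s)"
    and t: "t \<ge> 0"
  shows "D t = 0"
proof -
  have io: "(\<lambda>s. r * D s) integrable_on {0..t}"
    using int[OF t] by (intro set_borel_integral_eq_integral(1) set_integrable_mult_right)
  have D: "D s = integral {0..s} (\<lambda>s. r * D s)" if "0 \<le> s" for s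
  proof -
    have "set_integrable lborel {0..s} (\<lambda>s. r * D s)" using int[OF that] by (intro set_integrable_mult_right)
    from set_borel_integral_eq_integral(2)[OF this] show ?thesis using eq[OF that] by simp
  qed
  have "continuous_on {0..t} (\<lambda>s. integral {0..s} (\<lambda>s. r * D s))"
    using io by (rule indefinite_integral_continuous_1)
  then have cont: "continuous_on {0..t} D"
    by (rule continuous_on_cong[THEN iffD1, OF refl, rotated]) (use D in auto)
  have der: "(D has_real_derivative r * D s) (at s within {0..t})" if s: "s \<in> {0..t}" for s
  proof -
    have "((\<lambda>s. integral {0..s} (\<lambda>s. r * D s)) has_real_derivative r * D s) (at s within {0..t})"
      using cont s by (intro integral_has_real_derivative continuous_intros)
    then show ?thesis by (rule has_field_derivative_transform_within[where d = 1]) (use D s in auto)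
  qed
  have "((\<lambda>s. exp (- r * s) * D s) has_real_derivative 0) (at s within {0..t})" if s: "s \<in> {0..t}" for s
    by (rule derivative_eq_intros der[OF s] refl | simp)+
  then have "\<exists>c. \<forall>s\<in>{0..t}. exp (- r * s) * D s = c"
    by (intro has_field_derivative_zero_constant) auto
  then obtain c where c: "\<And>s. s \<in> {0..t} \<Longrightarrow> exp (- r * s) * D s = c" by blast
  have "D 0 = 0" using D[of 0] by simp
  then have "c = 0" using c[of 0] t by simp
  then show ?thesis using c[of t] t by simp
qed

lemma integral_exp_interval:
  fixes r :: real
  assumes "v \<le> t"
  shows "(LINT s:{v..t}|lborel. r * exp (r * s)) = exp (r * t) - exp (r * v)"
proof -
  have "((\<lambda>s. r * exp (r * s)) has_integral (exp (r * t) - exp (r * v))) {v..t}"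
    by (rule fundamental_theorem_of_calculus[OF assms])
      (auto intro!: derivative_eq_intros simp: has_real_derivative_iff_has_vector_derivative[symmetric])
  moreover have "set_integrable lborel {v..t} (\<lambda>s. r * exp (r * s))"
    by (intro borel_integrable_atLeastAtMost' continuous_intros)
  ultimately show ?thesis by (simp only: set_borel_integral_eq_integral(2) integral_unique)
qed

text \<open>Integration by parts against a merely integrable h, obtained from Fubini on the triangle
  v \<le> s \<le> t.\<close>

lemma integral_exp_times_indefinite:
  fixes h :: "real \<Rightarrow> real"
  assumes h: "set_integrable lborel {0..t} h"
  shows "set_integrable lborel {0..t} (\<lambda>s. r * exp (r * s) * (LINT v:{0..s}|lborel. h v))"
    and "(LINT s:{0..t}|lborel. r * exp (r * s) * (LINT v:{0..s}|lborel. h v)) =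
     exp (r * t) * (LINT v:{0..t}|lborel. h v) - (LINT v:{0..t}|lborel. exp (r * v) * h v)"
proof -
  define k where "k = (\<lambda>v. indicator {0..t} v *\<^sub>R h v)"
  define g where "g = (\<lambda>s. indicator {0..t} s *\<^sub>R (r * exp (r * s)))"
  define f where "f = (\<lambda>(s, v). indicator {p. snd p \<le> fst p} (s, v) *\<^sub>R (g s * k v))"
  have k: "integrable lborel k" using h by (simp add: k_def set_integrable_def)
  have g: "integrable lborel g"
    unfolding g_def set_integrable_def[symmetric] by (intro borel_integrable_atLeastAtMost' continuous_intros)
  have km [measurable]: "k \<in> borel_measurable borel" and gm [measurable]: "g \<in> borel_measurable borel"
    using k g by (auto dest: borel_measurable_integrable)
  have "integrable (lborel \<Otimes>\<^sub>M lborel) (\<lambda>(s, v). g s * k v)"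
  proof (rule lborel_pair.Fubini_integrable)
    show "(\<lambda>(s, v). g s * k v) \<in> borel_measurable (lborel \<Otimes>\<^sub>M lborel)" by measurable
    have "integrable lborel (\<lambda>s. norm (g s) * (LINT v|lborel. norm (k v)))" using g by simp
    then show "integrable lborel (\<lambda>s. LINT v|lborel. norm (case (s, v) of (s, v) \<Rightarrow> g s * k v))"
      by (simp add: abs_mult)
  qed (use k in simp)
  then have fi: "integrable (lborel \<Otimes>\<^sub>M lborel) f"
  proof (rule Bochner_Integration.integrable_bound)
    have "{p \<in> space (borel \<Otimes>\<^sub>M borel). snd p \<le> fst p} \<in> sets (borel \<Otimes>\<^sub>M borel :: (real \<times> real) measure)"
      by measurable
    then have [measurable]: "{p. snd p \<le> fst p} \<in> sets (borel \<Otimes>\<^sub>M borel :: (real \<times> real) measure)"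
      by (simp add: space_pair_measure)
    then show "f \<in> borel_measurable (lborel \<Otimes>\<^sub>M lborel)" unfolding f_def by measurable
  qed (auto simp: f_def indicator_def)
  have s1: "(LINT v|lborel. f (s, v)) = indicator {0..t} s *\<^sub>R (r * exp (r * s) * (LINT v:{0..s}|lborel. h v))" for s
  proof -
    have "(LINT v|lborel. f (s, v)) = (LINT v|lborel. g s * (indicator {0..s} v *\<^sub>R h v))"
      by (intro Bochner_Integration.integral_cong refl) (auto simp: f_def k_def g_def indicator_def)
    then show ?thesis by (simp add: g_def set_lebesgue_integral_def)
  qed
  have s2: "(LINT s|lborel. f (s, v)) = indicator {0..t} v *\<^sub>R ((exp (r * t) - exp (r * v)) * h v)" for v
  proof -
    have "(LINT s|lborel. f (s, v)) = (LINT s|lborel. k v * (indicator {v..t} s *\<^sub>R (r * exp (r * s))))"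
      by (intro Bochner_Integration.integral_cong refl) (auto simp: f_def k_def g_def indicator_def)
    also have "\<dots> = k v * (LINT s:{v..t}|lborel. r * exp (r * s))"
      by (simp only: set_lebesgue_integral_def integral_mult_right_zero)
    also have "\<dots> = indicator {0..t} v *\<^sub>R ((exp (r * t) - exp (r * v)) * h v)"
    proof (cases "v \<in> {0..t}")
      case True
      then have "(LINT s:{v..t}|lborel. r * exp (r * s)) = exp (r * t) - exp (r * v)"
        by (intro integral_exp_interval) simp
      then show ?thesis using True by (simp only: k_def) simp
    qed (simp add: k_def)
    finally show ?thesis .
  qed
  have "integrable lborel (\<lambda>s. LINT v|lborel. f (s, v))"
    using lborel_pair.integrable_fst'[OF fi] .
  then show "set_integrable lborel {0..t} (\<lambda>s. r * exp (r * s) * (LINT v:{0..s}|lborel. h v))"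
    unfolding s1 by (simp add: set_integrable_def)
  have "(LINT s|lborel. LINT v|lborel. f (s, v)) = (LINT v|lborel. LINT s|lborel. f (s, v))"
    using lborel_pair.Fubini_integral[of "\<lambda>s v. f (s, v)"] fi by simp
  then have "(LINT s:{0..t}|lborel. r * exp (r * s) * (LINT v:{0..s}|lborel. h v)) =
      (LINT v:{0..t}|lborel. (exp (r * t) - exp (r * v)) * h v)"
    unfolding s1 s2 by (simp add: set_lebesgue_integral_def)
  also have "\<dots> = (LINT v:{0..t}|lborel. exp (r * t) * h v - exp (r * v) * h v)" by (simp add: left_diff_distrib)
  also have "\<dots> = (LINT v:{0..t}|lborel. exp (r * t) * h v) - (LINT v:{0..t}|lborel. exp (r * v) * h v)"
    using h set_integrable_exp_times[OF h] by (intro set_integral_diff set_integrable_mult_right)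
  finally show "(LINT s:{0..t}|lborel. r * exp (r * s) * (LINT v:{0..s}|lborel. h v)) =
     exp (r * t) * (LINT v:{0..t}|lborel. h v) - (LINT v:{0..t}|lborel. exp (r * v) * h v)" by simp
qed

text \<open>Variation of constants. The explicit formula solves the equation by
  \<open>integral_exp_times_indefinite\<close>; conversely the difference of two solutions solves
  the homogeneous equation and vanishes.\<close>

lemma has_drift_affine_iff:
  fixes A g :: "real \<Rightarrow> real"
  assumes g: "\<And>t. t \<ge> 0 \<Longrightarrow> set_integrable lborel {0..t} g"
  shows "has_drift a0 (\<lambda>t. r * A t + g t) A \<longleftrightarrow>
    (\<forall>t\<ge>0. A t = exp (r * t) * (a0 + (LINT s:{0..t}|lborel. exp (- r * s) * g s)))"
proof -
  define H where "H t = (LINT s:{0..t}|lborel. exp (- r * s) * g s)" for t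
  define B where "B t = exp (r * t) * (a0 + H t)" for t
  have hi: "set_integrable lborel {0..t} (\<lambda>s. exp (- r * s) * g s)" if "t \<ge> 0" for t
    using set_integrable_exp_times[OF g[OF that], of "- r"] .
  have rB: "set_integrable lborel {0..t} (\<lambda>s. r * B s)" and
    Beq: "B t = a0 + (LINT s:{0..t}|lborel. r * B s + g s)" if t: "t \<ge> 0" for t
  proof -
    have e: "set_integrable lborel {0..t} (\<lambda>s. a0 * (r * exp (r * s)))"
      by (intro borel_integrable_atLeastAtMost' continuous_intros)
    note H1 = integral_exp_times_indefinite[OF hi[OF t], where r = r, folded H_def]
    have rBeq: "(\<lambda>s. r * B s) = (\<lambda>s. a0 * (r * exp (r * s)) + r * exp (r * s) * H s)"
      by (auto simp: B_def algebra_simps)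
    show i: "set_integrable lborel {0..t} (\<lambda>s. r * B s)"
      unfolding rBeq using e H1(1) by (rule set_integral_add)
    have "(LINT v:{0..t}|lborel. exp (r * v) * (exp (- r * v) * g v)) = (LINT v:{0..t}|lborel. g v)"
      by (simp add: mult.assoc[symmetric] exp_minus)
    then have "(LINT s:{0..t}|lborel. r * B s) = a0 * (exp (r * t) - 1) + (exp (r * t) * H t - (LINT v:{0..t}|lborel. g v))"
      unfolding rBeq using H1(2) e H1(1) integral_exp_interval[OF t, of r] t by (simp add: set_integral_add)
    then show "B t = a0 + (LINT s:{0..t}|lborel. r * B s + g s)"
      using set_integral_add(2)[OF i g[OF t]] by (simp add: B_def algebra_simps)
  qed
  show ?thesis
  proof
    assume L: "has_drift a0 (\<lambda>t. r * A t + g t) A"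
    show "\<forall>t\<ge>0. A t = exp (r * t) * (a0 + (LINT s:{0..t}|lborel. exp (- r * s) * g s))"
    proof (cases "r = 0")
      \<comment> \<open>For r = 0 the formula is the equation. For other r, integrability of A is
        recovered from that of \<open>r * A\<close>, since \<open>has_drift\<close> only speaks of
        the whole drift.\<close>
      case True
      then show ?thesis using L by (simp add: has_drift_def)
    next
      case False
      have rA: "set_integrable lborel {0..t} (\<lambda>s. r * A s)" if "t \<ge> 0" for t
        using set_integral_diff(1)[of lborel "{0..t}" "\<lambda>t. r * A t + g t" g] L g[OF that] that
        by (simp add: has_drift_def)
      define D where "D t = A t - B t" for t
      have rD: "set_integrable lborel {0..t} (\<lambda>s. r * D s)" if "t \<ge> 0" for t
        using set_integral_diff(1)[OF rA[OF that] rB[OF that]] by (simp add: D_def right_diff_distrib)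
      have "D t = 0" if t: "t \<ge> 0" for t
      proof (rule set_lebesgue_integral_has_derivative_zero[OF _ _ t])
        show "set_integrable lborel {0..t} D" if "t \<ge> 0" for t
          using rD[OF that] False by (simp add: set_integrable_def mult.left_commute[of _ r])
        show "D t = (LINT s:{0..t}|lborel. r * D s)" if t: "t \<ge> 0" for t
        proof -
          have "D t = (LINT s:{0..t}|lborel. r * A s + g s) - (LINT s:{0..t}|lborel. r * B s + g s)"
            using Beq[OF t] L t by (simp add: D_def has_drift_def)
          also have "\<dots> = (LINT s:{0..t}|lborel. (r * A s + g s) - (r * B s + g s))"
            by (rule set_integral_diff(2)[symmetric])
              (use L t rB[OF t] g[OF t] in \<open>auto simp: has_drift_def intro!: set_integral_add\<close>)
          also have "\<dots> = (LINT s:{0..t}|lborel. r * D s)" by (simp add: D_def right_diff_distrib)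
          finally show ?thesis .
        qed
      qed
      then show ?thesis by (simp add: D_def B_def H_def)
    qed
  next
    assume R: "\<forall>t\<ge>0. A t = exp (r * t) * (a0 + (LINT s:{0..t}|lborel. exp (- r * s) * g s))"
    then have AB: "A t = B t" if "t \<ge> 0" for t using that by (simp add: B_def H_def)
    show "has_drift a0 (\<lambda>t. r * A t + g t) A"
      unfolding has_drift_def
    proof (intro allI impI conjI)
      fix t :: real assume t: "t \<ge> 0"
      have "set_integrable lborel {0..t} (\<lambda>t. r * B t + g t)" using rB[OF t] g[OF t] by (rule set_integral_add)
      then show "set_integrable lborel {0..t} (\<lambda>t. r * A t + g t)"
        by (rule set_integrable_cong[THEN iffD1, OF refl refl, rotated]) (simp add: AB)
      have "(LINT s:{0..t}|lborel. r * A s + g s) = (LINT s:{0..t}|lborel. r * B s + g s)"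
        by (intro set_lebesgue_integral_cong) (auto simp: AB)
      then show "A t = a0 + (LINT s:{0..t}|lborel. r * A s + g s)" using Beq[OF t] AB[OF t] by simp
    qed
  qed
qed

section \<open>Existence for scalar Caratheodory equations\<close>

lemma set_integrable_bounded_Icc:
  fixes g :: "real \<Rightarrow> real"
  assumes "g \<in> borel_measurable borel" "\<And>s. s \<in> {a..b} \<Longrightarrow> \<bar>g s\<bar> \<le> M"
  shows "set_integrable lborel {a..b} g"
  unfolding set_integrable_def
  by (rule integrableI_bounded_set_indicator[where B = M])
    (use assms emeasure_compact_finite[OF compact_Icc] in auto)

lemma set_integral_split:
  fixes g :: "real \<Rightarrow> real"
  assumes g: "set_integrable lborel {a..c} g" and "a \<le> b" "b \<le> c"
  shows "(LINT s:{a..c}|lborel. g s) = (LINT s:{a..b}|lborel. g s) + (LINT s:{b<..c}|lborel. g s)"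
proof -
  have "{a..c} = {a..b} \<union> {b<..c}" using assms by auto
  moreover have "set_integrable lborel {a..b} g" "set_integrable lborel {b<..c} g"
    by (rule set_integrable_subset[OF g]; use assms in auto)+
  moreover have "{a..b} \<inter> {b<..c} = {}" by auto
  ultimately show ?thesis by (simp add: set_integral_Un)
qed

lemma set_integral_singleton: "(LINT s:{a}|lborel. g s) = (0::real)" for a :: real
  unfolding set_lebesgue_integral_def
proof (rule integral_eq_zero_AE)
  have "AE s in lborel. s \<noteq> a" by (rule AE_lborel_singleton)
  then show "AE s in lborel. indicator {a} s *\<^sub>R g s = 0" by eventually_elim auto
qed

lemma indefinite_integral_lipschitz:
  fixes g :: "real \<Rightarrow> real"
  assumes g: "g \<in> borel_measurable borel" and M: "\<And>s. \<bar>g s\<bar> \<le> M"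
  shows "\<bar>(LINT u:{0..t}|lborel. g u) - (LINT u:{0..s}|lborel. g u)\<bar> \<le> M * \<bar>t - s\<bar>"
proof -
  have M0: "M \<ge> 0" using M[of 0] by linarith
  have int: "set_integrable lborel {a..b} g" for a b
    using g M by (rule set_integrable_bounded_Icc)
  have le: "\<bar>(LINT u:{0..t}|lborel. g u) - (LINT u:{0..s}|lborel. g u)\<bar> \<le> M * (t - s)" if st: "s \<le> t" for s t
  proof -
    have "(LINT u:{0..t}|lborel. g u) - (LINT u:{0..s}|lborel. g u)
        = (LINT u|lborel. indicator {0..t} u *\<^sub>R g u - indicator {0..s} u *\<^sub>R g u)"
      unfolding set_lebesgue_integral_def using int unfolding set_integrable_def
      by (intro Bochner_Integration.integral_diff[symmetric])
    also have "\<bar>\<dots>\<bar> \<le> (LINT u|lborel. indicator {s..t} u * M)"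
    proof (rule order_trans[OF integral_abs_bound integral_mono])
      show "integrable lborel (\<lambda>x. \<bar>indicator {0..t} x *\<^sub>R g x - indicator {0..s} x *\<^sub>R g x\<bar>)"
        using int unfolding set_integrable_def by (intro integrable_abs Bochner_Integration.integrable_diff)
      show "\<bar>indicator {0..t} x *\<^sub>R g x - indicator {0..s} x *\<^sub>R g x\<bar> \<le> indicator {s..t} x * M" for x
        using M[of x] M0 st by (auto simp: indicator_def)
      show "integrable lborel (\<lambda>u. indicator {s..t} u * M)"
        using set_integrable_bounded_Icc[of "\<lambda>_. M" s t M] M0 by (simp add: set_integrable_def)
    qed
    also have "\<dots> = M * (t - s)" using st by simp
    finally show ?thesis .
  qed
  show ?thesis
  proof (cases "s \<le> t")
    case True then show ?thesis using le[of s t] by simp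
  next
    case False then show ?thesis using le[of t s] by (simp add: abs_minus_commute)
  qed
qed

text \<open>Tonelli's proof of Peano's theorem, for a right-hand side measurable in time and
  continuous in the state. Equations with a delay \<delta> have solutions with the common Lipschitz
  constant M; Arzela-Ascoli provides a uniform limit as \<delta> tends to 0, and dominated
  convergence passes to the limit in the integral.\<close>

lemma caratheodory_bounded:
  fixes F :: "real \<Rightarrow> real \<Rightarrow> real"
  assumes meas: "\<And>\<alpha>. continuous_on UNIV \<alpha> \<Longrightarrow> (\<lambda>s. F s (\<alpha> s)) \<in> borel_measurable borel"
    and cont: "\<And>s. continuous_on UNIV (F s)" and M: "\<And>s x. \<bar>F s x\<bar> \<le> M" and h: "h > 0"
  obtains \<alpha> where "continuous_on UNIV \<alpha>" "\<And>t. t \<in> {0..h} \<Longrightarrow> \<alpha> t = x0 + (LINT s:{0..t}|lborel. F s (\<alpha> s))"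
proof -
  have M0: "M \<ge> 0" using M[of 0 0] by linarith
  have delayed: "\<exists>\<alpha>. (\<forall>s t. \<bar>\<alpha> t - \<alpha> s\<bar> \<le> M * \<bar>t - s\<bar>) \<and>
      (\<forall>t\<le>h. \<alpha> t = x0 + (LINT s:{0..t}|lborel. F s (\<alpha> (s - \<delta>))))" if \<delta>: "\<delta> > 0" for \<delta>
  proof -
    \<comment> \<open>Picard iterates of the delayed equation. The delay makes iterate k exact up to
      time \<open>k * \<delta>\<close> (\<open>stab\<close>), so finitely many iterations solve it
      up to h.\<close>
    define \<beta> where "\<beta> = rec_nat (\<lambda>_. x0) (\<lambda>_ \<beta> t. x0 + (LINT s:{0..t}|lborel. F s (\<beta> (s - \<delta>))))"
    have \<beta>0: "\<beta> 0 = (\<lambda>_. x0)" and \<beta>S: "\<beta> (Suc k) t = x0 + (LINT s:{0..t}|lborel. F s (\<beta> k (s - \<delta>)))" for k t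
      by (auto simp: \<beta>_def)
    have lip: "\<bar>\<beta> k t - \<beta> k s\<bar> \<le> M * \<bar>t - s\<bar>" for k s t
    proof (induction k arbitrary: s t)
      case 0 then show ?case using M0 by (simp add: \<beta>0)
    next
      case (Suc k)
      have "M-lipschitz_on UNIV (\<beta> k)" using Suc M0 by (intro lipschitz_onI) (auto simp: dist_real_def)
      then have "continuous_on UNIV (\<beta> k)" by (rule lipschitz_on_continuous_on)
      then have "continuous_on UNIV (\<lambda>s. \<beta> k (s - \<delta>))"
        by (rule continuous_on_compose2) (auto intro: continuous_intros)
      from indefinite_integral_lipschitz[OF meas[OF this] M] show ?case by (simp add: \<beta>S)
    qed
    have stab: "\<beta> (Suc k) t = \<beta> k t" if "t \<le> real k * \<delta>" for k t
      using that
    proof (induction k arbitrary: t)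
      case 0
      then have "{0..t} = {} \<or> {0..t} = {0}" by auto
      moreover have "(LINT s:{0}|lborel. F s x0) = 0" by (rule set_integral_singleton)
      ultimately show ?case by (auto simp: \<beta>S \<beta>0 set_lebesgue_integral_def)
    next
      case (Suc k)
      have "(LINT s:{0..t}|lborel. F s (\<beta> (Suc k) (s - \<delta>))) = (LINT s:{0..t}|lborel. F s (\<beta> k (s - \<delta>)))"
        using Suc.prems Suc.IH by (intro set_lebesgue_integral_cong) (auto simp: algebra_simps)
      then show ?case by (simp add: \<beta>S)
    qed
    obtain K :: nat where K: "h / \<delta> \<le> real K" using real_arch_simple by blast
    have hK: "h \<le> real K * \<delta>" using K \<delta> by (simp add: field_simps)
    have "\<beta> (Suc K) t = x0 + (LINT s:{0..t}|lborel. F s (\<beta> (Suc K) (s - \<delta>)))" if "t \<le> h" for t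
    proof -
      have "(LINT s:{0..t}|lborel. F s (\<beta> (Suc K) (s - \<delta>))) = (LINT s:{0..t}|lborel. F s (\<beta> K (s - \<delta>)))"
        using that hK \<delta> stab[of _ K] by (intro set_lebesgue_integral_cong) auto
      then show ?thesis by (simp add: \<beta>S)
    qed
    then show ?thesis using lip by blast
  qed
  define \<delta> where "\<delta> n = 1 / real (Suc n)" for n
  have \<delta>: "\<delta> n > 0" for n by (simp add: \<delta>_def)
  have \<delta>0: "\<delta> \<longlonglongrightarrow> 0" unfolding \<delta>_def by (rule LIMSEQ_Suc[OF lim_1_over_n])
  obtain \<alpha> where lip: "\<And>n s t. \<bar>\<alpha> n t - \<alpha> n s\<bar> \<le> M * \<bar>t - s\<bar>"
    and eq: "\<And>n t. t \<le> h \<Longrightarrow> \<alpha> n t = x0 + (LINT s:{0..t}|lborel. F s (\<alpha> n (s - \<delta> n)))"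
  proof -
    have "\<forall>n. \<exists>\<alpha>. (\<forall>s t. \<bar>\<alpha> t - \<alpha> s\<bar> \<le> M * \<bar>t - s\<bar>) \<and>
        (\<forall>t\<le>h. \<alpha> t = x0 + (LINT s:{0..t}|lborel. F s (\<alpha> (s - \<delta> n))))"
      by (intro allI delayed \<delta>)
    from choice[OF this] show thesis
    proof (elim exE)
      fix \<alpha> assume a: "\<forall>n. (\<forall>s t. \<bar>\<alpha> n t - \<alpha> n s\<bar> \<le> M * \<bar>t - s\<bar>) \<and>
        (\<forall>t\<le>h. \<alpha> n t = x0 + (LINT s:{0..t}|lborel. F s (\<alpha> n (s - \<delta> n))))"
      show thesis
        by (rule that[of \<alpha>]) (rule a[rule_format, THEN conjunct1, rule_format] a[rule_format, THEN conjunct2, rule_format], assumption?)+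
    qed
  qed
  have \<alpha>0: "\<alpha> n 0 = x0" for n
  proof -
    have "(LINT s:{0}|lborel. F s (\<alpha> n (s - \<delta> n))) = 0" by (rule set_integral_singleton)
    then show ?thesis using eq[of 0 n] h by simp
  qed
  obtain g k where g: "continuous_on {0..h} g" "strict_mono (k :: nat \<Rightarrow> nat)"
    and conv: "\<And>e. 0 < e \<Longrightarrow> \<exists>N. \<forall>n x. n \<ge> N \<and> x \<in> {0..h} \<longrightarrow> norm (\<alpha> (k n) x - g x) < e"
  proof (rule Arzela_Ascoli[of "{0..h}" \<alpha> "\<bar>x0\<bar> + M * h"])
    show "norm (\<alpha> n x) \<le> \<bar>x0\<bar> + M * h" if "x \<in> {0..h}" for n x
    proof -
      have "\<bar>\<alpha> n x - \<alpha> n 0\<bar> \<le> M * x" using lip[of n x 0] that by simp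
      also have "\<dots> \<le> M * h" using that M0 by (intro mult_left_mono) auto
      finally show ?thesis using \<alpha>0[of n] by auto
    qed
    show "\<exists>d>0. \<forall>n y. y \<in> {0..h} \<and> norm (x - y) < d \<longrightarrow> norm (\<alpha> n x - \<alpha> n y) < e"
      if "x \<in> {0..h}" "0 < e" for x e
    proof (intro exI[of _ "e / (M + 1)"] conjI allI impI)
      fix n y assume y: "y \<in> {0..h} \<and> norm (x - y) < e / (M + 1)"
      have "norm (\<alpha> n x - \<alpha> n y) \<le> M * \<bar>x - y\<bar>" using lip[of n x y] by simp
      also have "\<dots> \<le> (M + 1) * \<bar>x - y\<bar>" by (intro mult_right_mono) auto
      also have "\<dots> < e" using y M0 by (simp add: field_simps)
      finally show "norm (\<alpha> n x - \<alpha> n y) < e" .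
    qed (use that M0 in simp)
  qed auto
  have lim: "(\<lambda>n. \<alpha> (k n) t) \<longlonglongrightarrow> g t" if "t \<in> {0..h}" for t
    using conv that by (intro LIMSEQ_I) blast
  \<comment> \<open>The limit lives on \<open>{0..h}\<close> and is extended by constants, because
    \<open>meas\<close> concerns functions continuous on the whole line.\<close>
  define \<alpha>' where "\<alpha>' t = g (max 0 (min t h))" for t
  have c': "continuous_on UNIV \<alpha>'"
    unfolding \<alpha>'_def
    by (rule continuous_on_compose2[OF g(1)]) (use h in \<open>auto intro!: continuous_intros\<close>)
  have \<alpha>'g: "\<alpha>' t = g t" if "t \<in> {0..h}" for t using that by (simp add: \<alpha>'_def)
  have "\<alpha>' t = x0 + (LINT s:{0..t}|lborel. F s (\<alpha>' s))" if t: "t \<in> {0..h}" for t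
  proof -
    have "(\<lambda>n. LINT s:{0..t}|lborel. F s (\<alpha> (k n) (s - \<delta> (k n)))) \<longlonglongrightarrow> (LINT s:{0..t}|lborel. F s (\<alpha>' s))"
      unfolding set_lebesgue_integral_def
    proof (rule integral_dominated_convergence[where w = "\<lambda>s. indicator {0..t} s * M"])
      show "(\<lambda>s. indicator {0..t} s *\<^sub>R F s (\<alpha>' s)) \<in> borel_measurable lborel"
        using meas[OF c'] by measurable
      show "(\<lambda>s. indicator {0..t} s *\<^sub>R F s (\<alpha> (k n) (s - \<delta> (k n)))) \<in> borel_measurable lborel" for n
      proof -
        have "M-lipschitz_on UNIV (\<alpha> (k n))" using lip M0 by (intro lipschitz_onI) (auto simp: dist_real_def)
        then have "continuous_on UNIV (\<alpha> (k n))" by (rule lipschitz_on_continuous_on)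
        then have "continuous_on UNIV (\<lambda>s. \<alpha> (k n) (s - \<delta> (k n)))"
          by (rule continuous_on_compose2) (auto intro: continuous_intros)
        from meas[OF this] show ?thesis by measurable
      qed
      show "integrable lborel (\<lambda>s. indicator {0..t} s * M)"
        using set_integrable_bounded_Icc[of "\<lambda>_. M" 0 t M] M0 by (simp add: set_integrable_def)
      show "AE s in lborel. norm (indicator {0..t} s *\<^sub>R F s (\<alpha> (k n) (s - \<delta> (k n)))) \<le> indicator {0..t} s * M" for n
        using M by (auto simp: indicator_def)
      show "AE s in lborel. (\<lambda>n. indicator {0..t} s *\<^sub>R F s (\<alpha> (k n) (s - \<delta> (k n)))) \<longlonglongrightarrow> indicator {0..t} s *\<^sub>R F s (\<alpha>' s)"
      proof (rule AE_I2)
        fix s :: real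
        show "(\<lambda>n. indicator {0..t} s *\<^sub>R F s (\<alpha> (k n) (s - \<delta> (k n)))) \<longlonglongrightarrow> indicator {0..t} s *\<^sub>R F s (\<alpha>' s)"
        proof (cases "s \<in> {0..t}")
          case True
          have "(\<lambda>n. \<alpha> (k n) (s - \<delta> (k n)) - \<alpha> (k n) s) \<longlonglongrightarrow> 0"
          proof (rule Lim_null_comparison)
            show "\<forall>\<^sub>F n in sequentially. norm (\<alpha> (k n) (s - \<delta> (k n)) - \<alpha> (k n) s) \<le> M * \<delta> (k n)"
            proof (intro always_eventually allI)
              fix n
              show "norm (\<alpha> (k n) (s - \<delta> (k n)) - \<alpha> (k n) s) \<le> M * \<delta> (k n)"
                using lip[of "k n" "s - \<delta> (k n)" s] \<delta>[of "k n"] by simp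
            qed
            show "(\<lambda>n. M * \<delta> (k n)) \<longlonglongrightarrow> 0"
              using tendsto_mult_right_zero[OF LIMSEQ_subseq_LIMSEQ[OF \<delta>0 g(2)]] by (simp add: o_def)
          qed
          moreover have s: "s \<in> {0..h}" using True t by simp
          have "(\<lambda>n. \<alpha> (k n) s) \<longlonglongrightarrow> \<alpha>' s" unfolding \<alpha>'g[OF s] by (rule lim[OF s])
          ultimately have "(\<lambda>n. (\<alpha> (k n) (s - \<delta> (k n)) - \<alpha> (k n) s) + \<alpha> (k n) s) \<longlonglongrightarrow> 0 + \<alpha>' s"
            by (rule tendsto_add)
          then have "(\<lambda>n. \<alpha> (k n) (s - \<delta> (k n))) \<longlonglongrightarrow> \<alpha>' s" by simp
          then have "(\<lambda>n. F s (\<alpha> (k n) (s - \<delta> (k n)))) \<longlonglongrightarrow> F s (\<alpha>' s)"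
            by (rule isCont_tendsto_compose[rotated]) (use cont[of s] in \<open>simp add: continuous_on_eq_continuous_at\<close>)
          then show ?thesis using True by simp
        qed simp
      qed
    qed
    then have "(\<lambda>n. x0 + (LINT s:{0..t}|lborel. F s (\<alpha> (k n) (s - \<delta> (k n))))) \<longlonglongrightarrow> x0 + (LINT s:{0..t}|lborel. F s (\<alpha>' s))"
      by (intro tendsto_add tendsto_const)
    then have "(\<lambda>n. \<alpha> (k n) t) \<longlonglongrightarrow> x0 + (LINT s:{0..t}|lborel. F s (\<alpha>' s))"
      using t by (subst eq) auto
    from LIMSEQ_unique[OF lim[OF t] this] show ?thesis unfolding \<alpha>'g[OF t] .
  qed
  then show ?thesis using that c' by blast
qed

section \<open>Global nonnegative solutions under linear growth\<close>

context
  fixes F :: "real \<Rightarrow> real \<Rightarrow> real" and L :: real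
  assumes meas: "\<And>\<alpha>. continuous_on UNIV \<alpha> \<Longrightarrow> (\<lambda>s. F s (\<alpha> s)) \<in> borel_measurable borel"
    and cont: "\<And>s. continuous_on UNIV (F s)"
    and bdd: "\<And>X. \<exists>M. \<forall>s x. \<bar>x\<bar> \<le> X \<longrightarrow> \<bar>F s x\<bar> \<le> M"
    and growth: "\<And>s x. x \<ge> 0 \<Longrightarrow> F s x \<le> L * (1 + x)" and L: "L > 0"
    and inward: "\<And>s. F s 0 \<ge> 0"
begin

lemma caratheodory_set_integrable:
  assumes \<alpha>: "continuous_on UNIV \<alpha>"
  shows "set_integrable lborel {a..b} (\<lambda>s. F s (\<alpha> s))"
proof -
  have "bounded (\<alpha> ` {a..b})"
    by (intro compact_imp_bounded compact_continuous_image continuous_on_subset[OF \<alpha>]) auto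
  then obtain X where "\<forall>s\<in>{a..b}. \<bar>\<alpha> s\<bar> \<le> X" by (auto simp: bounded_iff)
  then have X: "\<And>s. s \<in> {a..b} \<Longrightarrow> \<bar>\<alpha> s\<bar> \<le> X" by blast
  obtain M where M: "\<And>s x. \<bar>x\<bar> \<le> X \<Longrightarrow> \<bar>F s x\<bar> \<le> M" using bdd by meson
  show ?thesis using meas[OF \<alpha>] M[OF X] by (rule set_integrable_bounded_Icc)
qed

text \<open>The state is truncated to \<open>{0..X}\<close> to make the right-hand side bounded, and
  the truncation turns out to be inactive: linear growth over a time \<open>1 / (2 * L)\<close>
  cannot pass X, and below 0 the truncated drift is the one at 0, which points inward.\<close>

lemma caratheodory_step:
  assumes x0: "x0 \<ge> 0"
  obtains \<alpha> where "continuous_on UNIV \<alpha>"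
    "\<And>t. t \<in> {0..1 / (2 * L)} \<Longrightarrow> \<alpha> t \<ge> 0 \<and> \<alpha> t = x0 + (LINT s:{0..t}|lborel. F (T + s) (\<alpha> s))"
proof -
  define h where "h = 1 / (2 * L)"
  have h: "h > 0" "L * h = 1 / 2" using L by (auto simp: h_def)
  \<comment> \<open>X is the fixed point of \<open>x0 + (1 + X) / 2\<close>, the bound that the
    growth condition gives up to time h.\<close>
  define X where "X = 2 * x0 + 1"
  have X: "X \<ge> 0" using x0 by (simp add: X_def)
  define cl where "cl = (\<lambda>x. max 0 (min x X))"
  have cl: "continuous_on UNIV cl" unfolding cl_def by (intro continuous_intros)
  have clX: "0 \<le> cl x" "cl x \<le> X" for x using X by (auto simp: cl_def)
  define G where "G s x = F (T + s) (cl x)" for s x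
  obtain M where M: "\<And>s x. \<bar>x\<bar> \<le> X \<Longrightarrow> \<bar>F s x\<bar> \<le> M" using bdd by meson
  have measG: "(\<lambda>s. G s (\<alpha> s)) \<in> borel_measurable borel" if "continuous_on UNIV \<alpha>" for \<alpha>
  proof -
    have "continuous_on UNIV (\<lambda>s. cl (\<alpha> (s - T)))"
      by (rule continuous_on_compose2[OF cl]) (auto intro!: continuous_on_compose2[OF that] continuous_intros)
    note meas[OF this, measurable]
    have "(\<lambda>s. G s (\<alpha> s)) = (\<lambda>s. (\<lambda>s. F s (cl (\<alpha> (s - T)))) (T + s))" by (simp add: G_def)
    moreover have "\<dots> \<in> borel_measurable borel" by (rule measurable_compose[of "\<lambda>s. T + s" borel borel]) measurable
    ultimately show ?thesis by simp
  qed
  obtain \<alpha> where c: "continuous_on UNIV \<alpha>"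
    and eq: "\<And>t. t \<in> {0..h} \<Longrightarrow> \<alpha> t = x0 + (LINT s:{0..t}|lborel. G s (\<alpha> s))"
  proof (rule caratheodory_bounded[of G M h x0])
    show "continuous_on UNIV (G s)" for s
      unfolding G_def by (rule continuous_on_compose2[OF cont cl]) auto
    show "\<bar>G s x\<bar> \<le> M" for s x using M[of "cl x"] clX[of x] by (simp add: G_def)
  qed (use measG h in auto)
  have Mx: "\<bar>G s x\<bar> \<le> M" for s x using M[of "cl x"] clX[of x] by (simp add: G_def)
  have int: "set_integrable lborel {a..b} (\<lambda>s. G s (\<alpha> s))" for a b
    using measG[OF c] Mx by (rule set_integrable_bounded_Icc)
  have upper: "\<alpha> t \<le> X" if t: "t \<in> {0..h}" for t
  proof -
    have "(LINT s:{0..t}|lborel. G s (\<alpha> s)) \<le> (LINT s:{0..t}|lborel. L * (1 + X))"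
    proof (rule set_integral_mono[OF int])
      show "G s (\<alpha> s) \<le> L * (1 + X)" for s
        unfolding G_def using clX[of "\<alpha> s"] L by (intro order_trans[OF growth] mult_left_mono) auto
    qed (rule set_integrable_bounded_Icc[of _ _ _ "L * (1 + X)"], use L X in auto)
    also have "\<dots> = t * (L * (1 + X))" using t by (simp add: set_lebesgue_integral_def)
    also have "\<dots> \<le> h * (L * (1 + X))" using t L X by (intro mult_right_mono) auto
    also have "\<dots> = (1 + X) / 2" using h(2) by (simp add: mult.assoc[symmetric] mult.commute[of h])
    also have "\<dots> = x0 + 1" by (simp add: X_def)
    finally show ?thesis using eq[OF t] x0 by (simp add: X_def)
  qed
  have \<alpha>0: "\<alpha> 0 = x0"
  proof -
    have "(LINT s:{0}|lborel. G s (\<alpha> s)) = 0" by (rule set_integral_singleton)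
    then show ?thesis using eq[of 0] h by simp
  qed
  have lower: "\<alpha> t \<ge> 0" if t: "t \<in> {0..h}" for t
  proof (rule ccontr)
    assume neg: "\<not> \<alpha> t \<ge> 0"
    define U where "U = {0..t} \<inter> \<alpha> -` {0..}"
    have "closed U" unfolding U_def
      by (intro continuous_closed_preimage continuous_on_subset[OF c]) auto
    moreover have "0 \<in> U" using \<alpha>0 x0 t by (simp add: U_def)
    moreover have bU: "bdd_above U" by (auto simp: U_def)
    ultimately have sU: "Sup U \<in> U" by (intro closed_contains_Sup) auto
    \<comment> \<open>The last time before t with a nonnegative state. From there on the drift is
      nonnegative, so the state cannot end below 0.\<close>
    define s0 where "s0 = Sup U"
    have "s0 \<in> {0..t} \<inter> \<alpha> -` {0..}" using sU by (simp add: s0_def U_def)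
    then have s0: "0 \<le> s0" "s0 < t" "\<alpha> s0 \<ge> 0" using neg by (auto simp: less_le)
    have out: "\<alpha> s < 0" if "s0 < s" "s \<le> t" for s
    proof (rule ccontr)
      assume "\<not> \<alpha> s < 0"
      then have "s \<in> U" using that s0 by (simp add: U_def)
      then show False using cSup_upper[OF _ bU, of s] that by (simp add: s0_def)
    qed
    have "(LINT s:{0..t}|lborel. G s (\<alpha> s)) = (LINT s:{0..s0}|lborel. G s (\<alpha> s)) + (LINT s:{s0<..t}|lborel. G s (\<alpha> s))"
      using s0 by (intro set_integral_split int) auto
    moreover have "(LINT s:{s0<..t}|lborel. G s (\<alpha> s)) \<ge> 0"
      unfolding set_lebesgue_integral_def
    proof (rule integral_nonneg_AE, intro AE_I2)
      fix s
      show "0 \<le> indicator {s0<..t} s *\<^sub>R G s (\<alpha> s)"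
      proof (cases "s \<in> {s0<..t}")
        case True
        then have "cl (\<alpha> s) = 0" using out[of s] X by (simp add: cl_def)
        then show ?thesis using inward by (simp add: G_def)
      qed simp
    qed
    ultimately have "\<alpha> t \<ge> \<alpha> s0" using eq[OF t] eq[of s0] s0 t by simp
    then show False using s0 neg by simp
  qed
  have "\<alpha> t = x0 + (LINT s:{0..t}|lborel. F (T + s) (\<alpha> s))" if t: "t \<in> {0..h}" for t
  proof -
    have "(LINT s:{0..t}|lborel. G s (\<alpha> s)) = (LINT s:{0..t}|lborel. F (T + s) (\<alpha> s))"
      using t upper lower by (intro set_lebesgue_integral_cong) (auto simp: G_def cl_def)
    then show ?thesis using eq[OF t] by simp
  qed
  note sol = this
  show ?thesis
  proof (rule that[OF c])
    fix t assume "t \<in> {0..1 / (2 * L)}"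
    then have t: "t \<in> {0..h}" by (simp add: h_def)
    show "\<alpha> t \<ge> 0 \<and> \<alpha> t = x0 + (LINT s:{0..t}|lborel. F (T + s) (\<alpha> s))"
      using lower[OF t] sol[OF t] by (rule conjI)
  qed
qed

definition solves_upto :: "real \<Rightarrow> real \<Rightarrow> (real \<Rightarrow> real) \<Rightarrow> bool" where
  "solves_upto x0 T \<alpha> \<longleftrightarrow> continuous_on UNIV \<alpha> \<and>
     (\<forall>t\<in>{0..T}. \<alpha> t \<ge> 0 \<and> \<alpha> t = x0 + (LINT s:{0..t}|lborel. F s (\<alpha> s)))"

text \<open>The step length depends on L alone and not on the state reached, so repeated extension
  covers the half line.\<close>

lemma solves_upto_extend:
  assumes \<alpha>: "solves_upto x0 T \<alpha>" and T: "T \<ge> 0"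
  obtains \<alpha>' where "solves_upto x0 (T + 1 / (2 * L)) \<alpha>'" "\<And>t. t \<le> T \<Longrightarrow> \<alpha>' t = \<alpha> t"
proof -
  define h where "h = 1 / (2 * L)"
  have h: "h > 0" using L by (simp add: h_def)
  have c: "continuous_on UNIV \<alpha>" using \<alpha> unfolding solves_upto_def by (rule conjunct1)
  have sol: "\<alpha> t \<ge> 0 \<and> \<alpha> t = x0 + (LINT s:{0..t}|lborel. F s (\<alpha> s))" if "t \<in> {0..T}" for t
    using \<alpha>[unfolded solves_upto_def, THEN conjunct2] that by (rule bspec)
  note pos = sol[THEN conjunct1] and eq = sol[THEN conjunct2]
  have aT: "\<alpha> T \<ge> 0" by (rule pos) (use T in simp)
  obtain \<beta> where cb: "continuous_on UNIV \<beta>"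
    and b: "\<And>t. t \<in> {0..h} \<Longrightarrow> \<beta> t \<ge> 0 \<and> \<beta> t = \<alpha> T + (LINT s:{0..t}|lborel. F (T + s) (\<beta> s))"
  proof (rule caratheodory_step[OF aT, where T = T, folded h_def])
    fix \<beta> assume "continuous_on UNIV \<beta>"
      and "\<And>t. t \<in> {0..h} \<Longrightarrow> \<beta> t \<ge> 0 \<and> \<beta> t = \<alpha> T + (LINT s:{0..t}|lborel. F (T + s) (\<beta> s))"
    then show thesis by (rule that)
  qed
  have b0: "\<beta> 0 = \<alpha> T"
  proof -
    have "(LINT s:{0}|lborel. F (T + s) (\<beta> s)) = 0" by (rule set_integral_singleton)
    then show ?thesis using b[of 0] h by simp
  qed
  define \<alpha>' where "\<alpha>' t = (if t \<le> T then \<alpha> t else \<beta> (t - T))" for t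
  have "continuous_on ({..T} \<union> {T..}) \<alpha>'"
    unfolding \<alpha>'_def
    by (intro continuous_on_If continuous_on_subset[OF c] continuous_on_compose2[OF cb] continuous_intros)
      (use b0 in auto)
  moreover have "{..T} \<union> {T..} = UNIV" by auto
  ultimately have c': "continuous_on UNIV \<alpha>'" by simp
  have "\<alpha>' t \<ge> 0 \<and> \<alpha>' t = x0 + (LINT s:{0..t}|lborel. F s (\<alpha>' s))" if t: "t \<in> {0..T + h}" for t
  proof (cases "t \<le> T")
    case True
    have "(LINT s:{0..t}|lborel. F s (\<alpha>' s)) = (LINT s:{0..t}|lborel. F s (\<alpha> s))"
      using True by (intro set_lebesgue_integral_cong) (auto simp: \<alpha>'_def)
    then show ?thesis using eq[of t] pos[of t] t True by (simp add: \<alpha>'_def)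
  next
    case False
    have "(LINT s:{0..t}|lborel. F s (\<alpha>' s)) = (LINT s:{0..T}|lborel. F s (\<alpha>' s)) + (LINT s:{T<..t}|lborel. F s (\<alpha>' s))"
      using False T by (intro set_integral_split caratheodory_set_integrable[OF c']) auto
    moreover have "(LINT s:{0..T}|lborel. F s (\<alpha>' s)) = (LINT s:{0..T}|lborel. F s (\<alpha> s))"
      by (intro set_lebesgue_integral_cong) (auto simp: \<alpha>'_def)
    moreover have "(LINT s:{T<..t}|lborel. F s (\<alpha>' s)) = (LINT s:{0..t - T}|lborel. F (T + s) (\<beta> s))"
    proof -
      have "(LINT s:{T<..t}|lborel. F s (\<alpha>' s)) = (LINT s|lborel. indicator {T<..t} (T + 1 * s) *\<^sub>R F (T + 1 * s) (\<alpha>' (T + 1 * s)))"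
        unfolding set_lebesgue_integral_def
        by (subst lborel_integral_real_affine[where c = 1 and t = T]) auto
      also have "\<dots> = (LINT s|lborel. indicator {0..t - T} s *\<^sub>R F (T + s) (\<beta> s))"
      proof (rule integral_cong_AE)
        have [measurable]: "(\<lambda>s. F s (\<alpha>' s)) \<in> borel_measurable borel" by (rule meas[OF c'])
        have m: "(\<lambda>s. (\<lambda>s. F s (\<alpha>' s)) (T + 1 * s)) \<in> borel_measurable borel"
          by (rule measurable_compose[of "\<lambda>s. T + 1 * s" borel borel]) measurable
        then show "(\<lambda>s. indicator {T<..t} (T + 1 * s) *\<^sub>R F (T + 1 * s) (\<alpha>' (T + 1 * s))) \<in> borel_measurable lborel"
          by measurable
        have "continuous_on UNIV (\<lambda>s. \<beta> (s - T))" by (rule continuous_on_compose2[OF cb]) (auto intro: continuous_intros)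
        from meas[OF this] have [measurable]: "(\<lambda>s. F s (\<beta> (s - T))) \<in> borel_measurable borel" .
        have "(\<lambda>s. (\<lambda>s. F s (\<beta> (s - T))) (T + s)) \<in> borel_measurable borel"
          by (rule measurable_compose[of "\<lambda>s. T + s" borel borel]) measurable
        then show "(\<lambda>s. indicator {0..t - T} s *\<^sub>R F (T + s) (\<beta> s)) \<in> borel_measurable lborel" by simp
        have "AE s in lborel. s \<noteq> (0::real)" by (rule AE_lborel_singleton)
        then show "AE s in lborel. indicator {T<..t} (T + 1 * s) *\<^sub>R F (T + 1 * s) (\<alpha>' (T + 1 * s)) =
            indicator {0..t - T} s *\<^sub>R F (T + s) (\<beta> s)"
          by eventually_elim (auto simp: indicator_def \<alpha>'_def)
      qed
      finally show ?thesis unfolding set_lebesgue_integral_def .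
    qed
    ultimately have "(LINT s:{0..t}|lborel. F s (\<alpha>' s)) = \<alpha> T - x0 + (\<beta> (t - T) - \<alpha> T)"
      using eq[of T] b[of "t - T"] T t False by simp
    then show ?thesis using b[of "t - T"] t False by (simp add: \<alpha>'_def)
  qed
  note sol' = this
  have "solves_upto x0 (T + h) \<alpha>'" unfolding solves_upto_def by (rule conjI[OF c' ballI[OF sol']])
  then show ?thesis by (intro that[of \<alpha>']) (simp_all add: \<alpha>'_def h_def)
qed

lemma caratheodory_half_line:
  assumes x0: "x0 \<ge> 0"
  obtains \<alpha> where "\<And>t. t \<ge> 0 \<Longrightarrow> \<alpha> t \<ge> 0" "has_drift x0 (\<lambda>s. F s (\<alpha> s)) \<alpha>"
proof -
  define h where "h = 1 / (2 * L)"
  have h: "h > 0" using L by (simp add: h_def)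
  have "\<exists>A. \<forall>n. solves_upto x0 (real n * h) (A n) \<and> (\<forall>t \<le> real n * h. A (Suc n) t = A n t)"
  proof (rule dependent_nat_choice)
    have "(LINT s:{0}|lborel. F s x0) = 0" by (rule set_integral_singleton)
    then show "\<exists>\<alpha>. solves_upto x0 (real 0 * h) \<alpha>"
      using x0 by (intro exI[of _ "\<lambda>_. x0"]) (simp add: solves_upto_def)
    fix \<alpha> n assume a: "solves_upto x0 (real n * h) \<alpha>"
    have nh: "real n * h \<ge> 0" using h by simp
    obtain \<alpha>' where "solves_upto x0 (real n * h + h) \<alpha>'" "\<And>t. t \<le> real n * h \<Longrightarrow> \<alpha>' t = \<alpha> t"
    proof (rule solves_upto_extend[OF a nh, folded h_def])
      fix \<alpha>' assume "solves_upto x0 (real n * h + h) \<alpha>'" "\<And>t. t \<le> real n * h \<Longrightarrow> \<alpha>' t = \<alpha> t"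
      then show thesis by (rule that)
    qed
    moreover have "real (Suc n) * h = real n * h + h" by (simp add: algebra_simps)
    ultimately show "\<exists>\<alpha>'. solves_upto x0 (real (Suc n) * h) \<alpha>' \<and> (\<forall>t\<le>real n * h. \<alpha>' t = \<alpha> t)" by auto
  qed
  then obtain A where A: "\<And>n. solves_upto x0 (real n * h) (A n)"
    and AS: "\<And>n t. t \<le> real n * h \<Longrightarrow> A (Suc n) t = A n t" by blast
  have Amn: "A m t = A n t" if "t \<le> real n * h" "n \<le> m" for m n t
    using that(2)
  proof (induction m rule: dec_induct)
    case (step m)
    have "real n * h \<le> real m * h" using step h by (intro mult_right_mono) auto
    then show ?case using step AS[of t m] that by simp
  qed simp
  define N where "N t = nat \<lceil>t / h\<rceil>" for t
  have N: "t \<le> real (N t) * h" for t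
  proof -
    have "t / h \<le> real (N t)" by (simp add: N_def real_nat_ceiling_ge)
    then show ?thesis using h by (simp add: field_simps)
  qed
  define \<alpha> where "\<alpha> t = A (N t) t" for t
  have \<alpha>A: "\<alpha> s = A (N t) s" if "s \<le> t" for s t
  proof -
    have "N s \<le> N t" unfolding N_def using that h by (intro nat_mono ceiling_mono divide_right_mono) auto
    then show ?thesis unfolding \<alpha>_def using Amn[OF N[of s], of "N t"] by simp
  qed
  have Asol: "A n t \<ge> 0 \<and> A n t = x0 + (LINT s:{0..t}|lborel. F s (A n s))"
    if "t \<in> {0..real n * h}" for t n
    using A[of n, unfolded solves_upto_def, THEN conjunct2] that by (rule bspec)
  note Apos = Asol[THEN conjunct1] and Aeq = Asol[THEN conjunct2]
  have "\<alpha> t \<ge> 0" if "t \<ge> 0" for t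
    unfolding \<alpha>_def by (rule Apos) (use N[of t] that in simp)
  moreover have "has_drift x0 (\<lambda>s. F s (\<alpha> s)) \<alpha>"
    unfolding has_drift_def
  proof (intro allI impI conjI)
    fix t :: real assume t: "t \<ge> 0"
    note cA = A[of "N t", unfolded solves_upto_def, THEN conjunct1]
    have "set_integrable lborel {0..t} (\<lambda>s. F s (\<alpha> s)) = set_integrable lborel {0..t} (\<lambda>s. F s (A (N t) s))"
      by (rule set_integrable_cong) (simp_all add: \<alpha>A[of _ t])
    then show "set_integrable lborel {0..t} (\<lambda>s. F s (\<alpha> s))"
      using caratheodory_set_integrable[OF cA] by simp
    have "(LINT s:{0..t}|lborel. F s (\<alpha> s)) = (LINT s:{0..t}|lborel. F s (A (N t) s))"
      by (intro set_lebesgue_integral_cong) (auto simp: \<alpha>A[of _ t])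
    then show "\<alpha> t = x0 + (LINT s:{0..t}|lborel. F s (\<alpha> s))"
      using Aeq[of t "N t"] N[of t] t by (simp add: \<alpha>_def)
  qed
  ultimately show ?thesis using that by blast
qed

end

section \<open>The transition semigroup\<close>

context income_chain
begin

definition gen :: "(real \<Rightarrow> real) \<Rightarrow> real \<Rightarrow> real" where
  "gen f x = (\<Sum>y\<in>S. generator S rate x y * f y)"

definition semigroup :: "real \<Rightarrow> (real \<Rightarrow> real) \<Rightarrow> real \<Rightarrow> real" where
  "semigroup t f x = (\<Sum>y\<in>S. transition_prob S rate t x y * f y)"

lemma gen_eq:
  assumes "x \<in> S" shows "gen f x = (\<Sum>y\<in>S - {x}. rate x y * (f y - f x))"
proof -
  have "gen f x = generator S rate x x * f x + (\<Sum>y\<in>S - {x}. generator S rate x y * f y)"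
    unfolding gen_def using finite_S assms by (simp add: sum.remove)
  also have "(\<Sum>y\<in>S - {x}. generator S rate x y * f y) = (\<Sum>y\<in>S - {x}. rate x y * f y)"
    by (intro sum.cong) (auto simp: generator_def)
  finally show ?thesis
    by (simp add: generator_def right_diff_distrib sum_subtractf sum_distrib_right)
qed

lemma gen_const: "x \<in> S \<Longrightarrow> gen (\<lambda>_. c) x = 0"
  by (simp add: gen_eq)

lemma gen_add: "gen (\<lambda>y. f y + g y) x = gen f x + gen g x"
  by (simp add: gen_def distrib_left sum.distrib)

lemma generator_pow_bound:
  obtains C where "C \<ge> 0" "\<And>n x y. x \<in> S \<Longrightarrow> \<bar>generator_pow S rate n x y\<bar> \<le> C ^ n"
proof
  define C where "C = (\<Sum>x\<in>S. \<Sum>v\<in>S. \<bar>generator S rate x v\<bar>)"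
  show C: "C \<ge> 0" by (auto simp: C_def intro!: sum_nonneg)
  fix n x y assume "x \<in> S"
  then show "\<bar>generator_pow S rate n x y\<bar> \<le> C ^ n"
  proof (induction n arbitrary: x)
    case (Suc n)
    have "\<bar>generator_pow S rate (Suc n) x y\<bar> \<le> (\<Sum>v\<in>S. \<bar>generator S rate x v * generator_pow S rate n v y\<bar>)"
      by (simp add: sum_abs)
    also have "\<dots> \<le> (\<Sum>v\<in>S. \<bar>generator S rate x v\<bar> * C ^ n)"
      by (intro sum_mono) (auto simp: abs_mult intro!: mult_left_mono Suc.IH)
    also have "\<dots> \<le> C * C ^ n"
      unfolding sum_distrib_right[symmetric] C_def
      using finite_S Suc.prems C
      by (intro mult_right_mono member_le_sum[of x S "\<lambda>x. \<Sum>v\<in>S. \<bar>generator S rate x v\<bar>"] sum_nonneg)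
        (auto simp: C_def[symmetric])
    finally show ?case by simp
  qed simp
qed

text \<open>The recursion multiplies by the generator on the left; the forward equation needs the
  factor on the right.\<close>

lemma generator_pow_Suc_right:
  "x \<in> S \<Longrightarrow> y \<in> S \<Longrightarrow> generator_pow S rate (Suc n) x y = (\<Sum>v\<in>S. generator_pow S rate n x v * generator S rate v y)"
proof (induction n arbitrary: x)
  case 0
  then show ?case using finite_S by (simp add: if_distrib[of "\<lambda>u. _ * u"] if_distrib[of "\<lambda>u. u * _"] cong: if_cong)
next
  case (Suc n)
  have "generator_pow S rate (Suc (Suc n)) x y = (\<Sum>u\<in>S. generator S rate x u * generator_pow S rate (Suc n) u y)"
    by simp
  also have "\<dots> = (\<Sum>u\<in>S. \<Sum>v\<in>S. generator S rate x u * (generator_pow S rate n u v * generator S rate v y))"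
    by (intro sum.cong refl) (simp only: Suc.IH Suc.prems sum_distrib_left)
  also have "\<dots> = (\<Sum>v\<in>S. \<Sum>u\<in>S. generator S rate x u * (generator_pow S rate n u v * generator S rate v y))"
    by (rule sum.swap)
  also have "\<dots> = (\<Sum>v\<in>S. generator_pow S rate (Suc n) x v * generator S rate v y)"
    by (simp add: sum_distrib_right mult.assoc)
  finally show ?case .
qed

lemma transition_prob_summable:
  assumes "x \<in> S" shows "summable (\<lambda>n. generator_pow S rate n x y / fact n * t ^ n)"
proof -
  obtain C where C: "C \<ge> 0" "\<And>n x y. x \<in> S \<Longrightarrow> \<bar>generator_pow S rate n x y\<bar> \<le> C ^ n"
    using generator_pow_bound by blast
  have "summable (\<lambda>n. (C * \<bar>t\<bar>) ^ n /\<^sub>R fact n)" by (rule summable_exp_generic)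
  then show ?thesis
  proof (rule summable_comparison_test[rotated], intro exI[of _ 0] allI impI)
    fix n
    have "\<bar>generator_pow S rate n x y\<bar> * \<bar>t\<bar> ^ n \<le> C ^ n * \<bar>t\<bar> ^ n"
      using C assms by (intro mult_right_mono) auto
    then show "norm (generator_pow S rate n x y / fact n * t ^ n) \<le> (C * \<bar>t\<bar>) ^ n /\<^sub>R fact n"
      by (simp add: abs_mult power_abs power_mult_distrib divide_simps)
  qed
qed

lemma transition_prob_powser:
  "transition_prob S rate t x y = (\<Sum>n. generator_pow S rate n x y / fact n * t ^ n)"
  unfolding transition_prob_def by (simp add: mult.commute)

lemma transition_prob_0: "transition_prob S rate 0 x y = (if y = x then 1 else 0)"
  unfolding transition_prob_powser powser_zero by simp

text \<open>Kolmogorov's forward equation, by termwise differentiation of the exponential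
  series.\<close>

lemma transition_prob_has_derivative:
  assumes x: "x \<in> S" and y: "y \<in> S"
  shows "((\<lambda>t. transition_prob S rate t x y) has_real_derivative
    (\<Sum>v\<in>S. transition_prob S rate t x v * generator S rate v y)) (at t)"
proof -
  let ?c = "\<lambda>n. generator_pow S rate n x y / fact n"
  have "((\<lambda>t. \<Sum>n. ?c n * t ^ n) has_real_derivative (\<Sum>n. diffs ?c n * t ^ n)) (at t)"
    using transition_prob_summable[OF x] by (intro termdiffs_strong_converges_everywhere)
  moreover have "(\<Sum>n. diffs ?c n * t ^ n) = (\<Sum>v\<in>S. transition_prob S rate t x v * generator S rate v y)"
  proof -
    have "diffs ?c n = (\<Sum>v\<in>S. generator_pow S rate n x v / fact n * generator S rate v y)" for n
    proof -
      have "diffs ?c n = generator_pow S rate (Suc n) x y / fact n"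
        unfolding diffs_def fact_Suc using of_nat_neq_0[of n, where 'a = real]
        by (simp add: divide_simps del: of_nat_Suc generator_pow.simps)
      then show ?thesis unfolding generator_pow_Suc_right[OF x y] by (simp add: sum_divide_distrib)
    qed
    then have "diffs ?c n * t ^ n = (\<Sum>v\<in>S. (generator_pow S rate n x v / fact n * t ^ n) * generator S rate v y)" for n
      by (simp only: sum_distrib_right) (simp add: mult_ac)
    then have "(\<Sum>n. diffs ?c n * t ^ n) = (\<Sum>n. \<Sum>v\<in>S. (generator_pow S rate n x v / fact n * t ^ n) * generator S rate v y)"
      by simp
    also have "\<dots> = (\<Sum>v\<in>S. \<Sum>n. (generator_pow S rate n x v / fact n * t ^ n) * generator S rate v y)"
      using transition_prob_summable[OF x] by (intro suminf_sum summable_mult2)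
    also have "\<dots> = (\<Sum>v\<in>S. transition_prob S rate t x v * generator S rate v y)"
      unfolding transition_prob_powser
      using transition_prob_summable[OF x] by (intro sum.cong refl suminf_mult2[symmetric])
    finally show ?thesis .
  qed
  ultimately show ?thesis by (simp add: transition_prob_powser)
qed

lemma semigroup_0: "x \<in> S \<Longrightarrow> semigroup 0 f x = f x"
  using finite_S by (simp add: semigroup_def transition_prob_0 if_distrib[of "\<lambda>u. u * _"] cong: if_cong)

lemma semigroup_has_derivative:
  assumes x: "x \<in> S"
  shows "((\<lambda>t. semigroup t f x) has_real_derivative semigroup t (gen f) x) (at t)"
proof -
  have "((\<lambda>t. semigroup t f x) has_real_derivative
    (\<Sum>y\<in>S. (\<Sum>v\<in>S. transition_prob S rate t x v * generator S rate v y) * f y)) (at t)"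
    unfolding semigroup_def by (intro DERIV_sum DERIV_cmult_right transition_prob_has_derivative x)
  moreover have "(\<Sum>y\<in>S. (\<Sum>v\<in>S. transition_prob S rate t x v * generator S rate v y) * f y) = semigroup t (gen f) x"
    unfolding semigroup_def gen_def sum_distrib_right sum_distrib_left
    by (subst sum.swap) (simp add: mult.assoc)
  ultimately show ?thesis by simp
qed

lemma continuous_on_semigroup: "x \<in> S \<Longrightarrow> continuous_on A (\<lambda>t. semigroup t f x)"
  using semigroup_has_derivative by (intro DERIV_continuous_on) (blast intro: has_field_derivative_at_within)

section \<open>Laws of the income process\<close>

definition sat :: "real \<Rightarrow> real \<Rightarrow> 'w set" where
  "sat t y = {\<omega> \<in> space M. inc t \<omega> = y}"

lemma measurable_F_mono:
  assumes "0 \<le> s" "s \<le> t" "f \<in> measurable (F s) N" shows "f \<in> measurable (F t) N"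
  using assms(3) space_F sets_F_mono[OF assms(2)] by (auto simp: measurable_def)

lemma measurable_from_F:
  assumes "0 \<le> s" "f \<in> measurable (F s) N" shows "f \<in> measurable M N"
  using assms sub_F[of s] by (auto simp: measurable_def subalgebra_def)

lemma sat_sets_F: "t \<ge> 0 \<Longrightarrow> sat t y \<in> sets (F t)"
  using adapted[of t] measurable_sets[of "inc t" "F t" borel "{y}"] space_F[of t]
  by (simp add: sat_def vimage_def Int_def conj_commute)

lemma sat_sets: "t \<ge> 0 \<Longrightarrow> sat t y \<in> sets M"
  using sat_sets_F[of t y] sub_F[of t] by (auto simp: subalgebra_def)

lemma transition_prob_inc_eq:
  assumes "s \<ge> 0" "\<omega> \<in> space M"
  shows "transition_prob S rate t (inc s \<omega>) y = (\<Sum>x\<in>S. indicator (sat s x) \<omega> * transition_prob S rate t x y)"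
  using finite_S inc_in_S[OF assms] assms
  by (subst sum.remove[of _ "inc s \<omega>"]) (auto intro!: sum.neutral simp: sat_def indicator_def)

text \<open>Integrating over an event of \<open>F s\<close> removes the conditional expectation,
  which is determined only almost everywhere, and leaves an identity between numbers.\<close>

lemma markov_set_eq:
  assumes s: "s \<ge> 0" and t: "t \<ge> 0" and y: "y \<in> S" and A: "A \<in> sets (F s)"
  shows "measure M (A \<inter> sat (s + t) y) = (\<Sum>x\<in>S. measure M (A \<inter> sat s x) * transition_prob S rate t x y)"
proof -
  interpret fs: finite_measure_subalgebra M "F s"
    by unfold_locales (rule sub_F[OF s])
  have AM [measurable]: "A \<in> sets M" using A sub_F[OF s] by (auto simp: subalgebra_def)
  have st: "sat (s + t) y \<in> sets M" using s t by (intro sat_sets) simp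
  have sx [measurable]: "sat s x \<in> sets M" for x using s by (rule sat_sets)
  have i: "integrable M (indicator (sat (s + t) y) :: 'w \<Rightarrow> real)"
    using st by (auto intro!: integrable_real_indicator simp: emeasure_eq_measure)
  have "measure M (A \<inter> sat (s + t) y) = (\<integral>\<omega>\<in>A. indicator (sat (s + t) y) \<omega> \<partial>M)"
    using AM st unfolding set_lebesgue_integral_def
    by (simp add: indicator_inter_arith[symmetric])
  also have "\<dots> = (\<integral>\<omega>\<in>A. real_cond_exp M (F s) (indicator (sat (s + t) y)) \<omega> \<partial>M)"
    by (rule fs.real_cond_exp_intA[OF i A])
  also have "\<dots> = (\<integral>\<omega>. (\<Sum>x\<in>S. indicator (A \<inter> sat s x) \<omega> * transition_prob S rate t x y) \<partial>M)"
    unfolding set_lebesgue_integral_def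
  proof (rule integral_cong_AE)
    show "(\<lambda>\<omega>. indicator A \<omega> *\<^sub>R real_cond_exp M (F s) (indicator (sat (s + t) y)) \<omega>) \<in> borel_measurable M"
      using AM by measurable
    show "(\<lambda>\<omega>. \<Sum>x\<in>S. indicator (A \<inter> sat s x) \<omega> * transition_prob S rate t x y) \<in> borel_measurable M"
      by measurable
    show "AE \<omega> in M. indicator A \<omega> *\<^sub>R real_cond_exp M (F s) (indicator (sat (s + t) y)) \<omega> =
        (\<Sum>x\<in>S. indicator (A \<inter> sat s x) \<omega> * transition_prob S rate t x y)"
      using markov[OF s t y, folded sat_def] AE_space
    proof eventually_elim
      case (elim \<omega>)
      then show ?case
        using transition_prob_inc_eq[OF s elim(2), of t y]
        by (simp add: indicator_inter_arith sum_distrib_left mult.assoc)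
    qed
  qed
  also have "\<dots> = (\<Sum>x\<in>S. measure M (A \<inter> sat s x) * transition_prob S rate t x y)"
  proof (subst Bochner_Integration.integral_sum)
    show "integrable M (\<lambda>\<omega>. indicator (A \<inter> sat s x) \<omega> * transition_prob S rate t x y)" for x
      by (intro integrable_mult_left integrable_real_indicator) (auto simp: emeasure_eq_measure)
    have "A \<inter> sat s x \<inter> space M = A \<inter> sat s x" for x by (auto simp: sat_def)
    then show "(\<Sum>x\<in>S. \<integral>\<omega>. indicator (A \<inter> sat s x) \<omega> * transition_prob S rate t x y \<partial>M) =
      (\<Sum>x\<in>S. measure M (A \<inter> sat s x) * transition_prob S rate t x y)" by simp
  qed
  finally show ?thesis .
qed

lemma sat_disjoint: "x \<noteq> y \<Longrightarrow> sat t x \<inter> sat t y = {}"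
  by (auto simp: sat_def)

lemma sum_measure_sat:
  assumes t: "t \<ge> 0" and A: "A \<in> sets M"
  shows "(\<Sum>y\<in>S. measure M (A \<inter> sat t y)) = measure M A"
proof -
  have "A = (\<Union>y\<in>S. A \<inter> sat t y)" using inc_in_S[OF t] sets.sets_into_space[OF A] by (auto simp: sat_def)
  then have "measure M A = measure M (\<Union>y\<in>S. A \<inter> sat t y)" by simp
  also have "\<dots> = (\<Sum>y\<in>S. measure M (A \<inter> sat t y))"
    using finite_S A sat_sets[OF t]
    by (intro finite_measure_finite_Union) (auto simp: disjoint_family_on_def sat_def)
  finally show ?thesis by simp
qed

lemma measure_sat_stationary:
  assumes t: "t \<ge> 0" shows "measure M (sat t y) = measure M (sat 0 y)"
proof -
  let ?P = "(\<Pi>\<^sub>M t\<in>{0..}. borel) :: (real \<Rightarrow> real) measure"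
  define B where "B = {f \<in> space ?P. f (0::real) = (y::real)}"
  have c: "(\<lambda>f. f 0) \<in> measurable ?P borel" by (rule measurable_component_singleton) simp
  have B: "B \<in> sets ?P"
    using measurable_sets[OF c, of "{y}"] by (simp add: B_def vimage_def Int_def conj_commute)
  have m: "(\<lambda>\<omega>. \<lambda>t\<in>{0..}. inc (h + t) \<omega>) \<in> measurable M ?P" if "h \<ge> 0" for h
    using that by (intro measurable_restrict measurable_from_F[OF _ adapted]) auto
  have "emeasure M (sat h y) = emeasure (distr M ?P (\<lambda>\<omega>. \<lambda>t\<in>{0..}. inc (h + t) \<omega>)) B" if h: "h \<ge> 0" for h
  proof -
    have "(\<lambda>\<omega>. \<lambda>t\<in>{0..}. inc (h + t) \<omega>) -` B \<inter> space M = sat h y"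
      using measurable_space[OF m[OF h]] by (auto simp: B_def sat_def)
    then show ?thesis using emeasure_distr[OF m[OF h] B] by simp
  qed
  from this[OF t] this[of 0] have "ennreal (measure M (sat t y)) = ennreal (measure M (sat 0 y))"
    using stationary[OF t] by (simp add: emeasure_eq_measure)
  then show ?thesis by simp
qed

lemma stationary_equation:
  assumes "t \<ge> 0" "y \<in> S"
  shows "(\<Sum>x\<in>S. measure M (sat 0 x) * transition_prob S rate t x y) = measure M (sat 0 y)"
proof -
  have "space M \<in> sets (F 0)" using sets.top[of "F 0"] by (simp add: space_F)
  moreover have "space M \<inter> sat s x = sat s x" for s x by (auto simp: sat_def)
  ultimately show ?thesis
    using markov_set_eq[of 0 t y "space M"] assms measure_sat_stationary[of t y] by simp
qed

lemma joint_law_0: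
  assumes "x \<in> S" "y \<in> S" "t \<ge> 0"
  shows "measure M (sat 0 x \<inter> sat t y) = measure M (sat 0 x) * transition_prob S rate t x y"
proof -
  have "measure M (sat 0 x \<inter> sat t y) = (\<Sum>v\<in>S. measure M (sat 0 x \<inter> sat 0 v) * transition_prob S rate t v y)"
    using markov_set_eq[of 0 t y "sat 0 x"] sat_sets_F[of 0 x] assms by simp
  also have "\<dots> = measure M (sat 0 x \<inter> sat 0 x) * transition_prob S rate t x y +
      (\<Sum>v\<in>S - {x}. measure M (sat 0 x \<inter> sat 0 v) * transition_prob S rate t v y)"
    using finite_S assms by (intro sum.remove) auto
  also have "(\<Sum>v\<in>S - {x}. measure M (sat 0 x \<inter> sat 0 v) * transition_prob S rate t v y) = 0"
    by (intro sum.neutral) (auto simp: sat_disjoint)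
  finally show ?thesis by simp
qed

text \<open>If the probability of y vanished on the interval, so would its derivative, which by the
  forward equation is then a sum of nonnegative terms. Hence it would vanish for every predecessor
  of y, and along a path of positive rates for x itself, against continuity at time 0. Nonnegativity
  is a hypothesis because it is established only later, with the help of this lemma.\<close>

lemma transition_prob_positive:
  assumes x: "x \<in> S" and y: "y \<in> S" and e: "e > 0"
    and nn: "\<And>t v. t \<ge> 0 \<Longrightarrow> v \<in> S \<Longrightarrow> transition_prob S rate t x v \<ge> 0"
  shows "\<exists>t\<in>{0<..<e}. transition_prob S rate t x y > 0"
proof (rule ccontr)
  let ?P = "\<lambda>t. transition_prob S rate t x"
  assume "\<not> ?thesis"
  then have zero: "\<forall>t\<in>{0<..<e}. ?P t y = 0" using nn[OF _ y] by (metis greaterThanLessThan_iff less_le)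
  have xy: "(x, y) \<in> {(u, v). u \<in> S \<and> v \<in> S \<and> u \<noteq> v \<and> rate u v > 0}\<^sup>*"
    using irreducible x y unfolding irreducible_rates_def by blast
  have "\<forall>t\<in>{0<..<e}. ?P t u = 0"
    if "(u, y) \<in> {(u, v). u \<in> S \<and> v \<in> S \<and> u \<noteq> v \<and> rate u v > 0}\<^sup>*" for u
    using that
  proof (induction rule: converse_rtrancl_induct)
    case base then show ?case by (rule zero)
  next
    case (step u v)
    then have uv: "u \<in> S" "v \<in> S" "u \<noteq> v" "rate u v > 0" by auto
    show ?case
    proof
      fix t assume t: "t \<in> {0<..<e}"
      have "((\<lambda>t. ?P t v) has_real_derivative (\<Sum>a\<in>S. ?P t a * generator S rate a v)) (at t)"
        by (rule transition_prob_has_derivative[OF x uv(2)])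
      moreover have "((\<lambda>t. ?P t v) has_real_derivative 0) (at t)"
      proof (rule has_field_derivative_transform_within_open[of "\<lambda>_. 0"])
        show "open {0<..<e}" "t \<in> {0<..<e}" using t by auto
      qed (use step.IH in auto)
      ultimately have "(\<Sum>a\<in>S. ?P t a * generator S rate a v) = 0" by (rule DERIV_unique)
      moreover have "?P t a * generator S rate a v \<ge> 0" if "a \<in> S" for a
        using step.IH t that nn[of t a] rate_nonneg[of a v] uv by (cases "a = v") (auto simp: generator_def)
      ultimately have "?P t u * generator S rate u v = 0"
        using finite_S uv by (subst (asm) sum_nonneg_eq_0_iff) auto
      then show "?P t u = 0" using uv by (simp add: generator_def)
    qed
  qed
  from this[OF xy] have "\<forall>t\<in>{0<..<e}. ?P t x = 0" .
  moreover have "((\<lambda>t. ?P t x) \<longlongrightarrow> 1) (at_right 0)"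
  proof -
    have "isCont (\<lambda>t. ?P t x) 0" using transition_prob_has_derivative[OF x x] by (rule DERIV_isCont)
    then have "((\<lambda>t. ?P t x) \<longlongrightarrow> 1) (at 0)" by (simp add: isCont_def transition_prob_0)
    then show ?thesis by (rule filterlim_mono) (auto simp: at_le)
  qed
  moreover have "\<forall>\<^sub>F t in at_right 0. t \<in> {0<..<e}"
    using e by (simp add: eventually_at_right_field) (auto intro: exI[of _ e])
  ultimately have "((\<lambda>t. 0 :: real) \<longlongrightarrow> 1) (at_right (0::real))"
    by (elim Lim_transform_eventually) (auto elim: eventually_mono)
  then show False using tendsto_unique[OF trivial_limit_at_right_real _ tendsto_const] by fastforce
qed

text \<open>Some initial state x has positive mass, from x the state y is reached with positive
  probability, and stationarity carries this back to time 0.\<close>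

lemma measure_sat_pos:
  assumes y: "y \<in> S" shows "measure M (sat 0 y) > 0"
proof -
  have "(\<Sum>x\<in>S. measure M (sat 0 x)) = 1"
    using sum_measure_sat[of 0 "space M"] prob_space by (simp add: Int_absorb1 sets.sets_into_space sat_sets)
  then obtain x where x: "x \<in> S" "measure M (sat 0 x) > 0"
    using measure_nonneg by (metis less_eq_real_def sum.neutral zero_neq_one)
  have nnt: "measure M (sat 0 v) * transition_prob S rate t v u \<ge> 0" if "t \<ge> 0" "u \<in> S" "v \<in> S" for t u v
    using joint_law_0[OF that(3,2,1)] by (metis measure_nonneg)
  have nn: "transition_prob S rate t x v \<ge> 0" if "t \<ge> 0" "v \<in> S" for t v
    using nnt[OF that x(1)] x(2) by (simp add: zero_le_mult_iff)
  obtain t where t: "t \<in> {0<..<1}" "transition_prob S rate t x y > 0"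
    using transition_prob_positive[OF x(1) y _ nn, of 1] by auto
  have "0 < measure M (sat 0 x) * transition_prob S rate t x y" using x t by simp
  also have "\<dots> \<le> (\<Sum>v\<in>S. measure M (sat 0 v) * transition_prob S rate t v y)"
    using finite_S x t nnt y by (intro member_le_sum) auto
  also have "\<dots> = measure M (sat 0 y)" using stationary_equation y t by simp
  finally show ?thesis .
qed

lemma transition_prob_nonneg:
  assumes "x \<in> S" "y \<in> S" "t \<ge> 0" shows "transition_prob S rate t x y \<ge> 0"
  using joint_law_0[OF assms] measure_sat_pos[OF assms(1)]
  by (metis measure_nonneg zero_le_mult_iff not_less)

lemma transition_prob_sum:
  assumes "x \<in> S" "t \<ge> 0" shows "(\<Sum>y\<in>S. transition_prob S rate t x y) = 1"
proof -
  have "measure M (sat 0 x) * (\<Sum>y\<in>S. transition_prob S rate t x y) = (\<Sum>y\<in>S. measure M (sat 0 x \<inter> sat t y))"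
    unfolding sum_distrib_left using joint_law_0 assms by (intro sum.cong) auto
  also have "\<dots> = measure M (sat 0 x)" using assms by (intro sum_measure_sat sat_sets) auto
  finally show ?thesis using measure_sat_pos[OF assms(1)] by simp
qed

lemma semigroup_nonneg:
  "x \<in> S \<Longrightarrow> t \<ge> 0 \<Longrightarrow> (\<And>y. y \<in> S \<Longrightarrow> f y \<ge> 0) \<Longrightarrow> semigroup t f x \<ge> 0"
  by (auto simp: semigroup_def intro!: sum_nonneg mult_nonneg_nonneg transition_prob_nonneg)

lemma semigroup_bound:
  assumes "x \<in> S" "t \<ge> 0" "\<And>y. y \<in> S \<Longrightarrow> \<bar>f y\<bar> \<le> B"
  shows "\<bar>semigroup t f x\<bar> \<le> B"
proof -
  have "\<bar>semigroup t f x\<bar> \<le> (\<Sum>y\<in>S. transition_prob S rate t x y * B)"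
    unfolding semigroup_def using assms transition_prob_nonneg[OF assms(1) _ assms(2)]
    by (intro order_trans[OF sum_abs] sum_mono) (auto simp: abs_mult intro!: mult_mono)
  also have "\<dots> = B" by (simp add: sum_distrib_right[symmetric] transition_prob_sum assms)
  finally show ?thesis .
qed

text \<open>Differentiate \<open>exp (- \<alpha> s) * semigroup s f x\<close> and integrate over the half line.\<close>

lemma resolvent_identity:
  assumes x: "x \<in> S" and \<alpha>: "\<alpha> > 0" and h: "\<And>y. y \<in> S \<Longrightarrow> \<alpha> * f y - gen f y \<ge> 0"
  shows "(\<integral>\<^sup>+s. ennreal (exp (- \<alpha> * s) * semigroup s (\<lambda>y. \<alpha> * f y - gen f y) x) * indicator {0..} s \<partial>lborel) = ennreal (f x)"
proof -
  let ?h = "\<lambda>y. \<alpha> * f y - gen f y"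
  let ?F = "\<lambda>s. - (exp (- \<alpha> * s) * semigroup s f x)"
  have sg: "semigroup s ?h x = \<alpha> * semigroup s f x - semigroup s (gen f) x" for s
    by (simp add: semigroup_def right_diff_distrib sum_subtractf sum_distrib_left mult.left_commute)
  obtain B where B: "\<And>y. y \<in> S \<Longrightarrow> \<bar>f y\<bar> \<le> B"
    using finite_S by (metis (no_types, lifting) Max_ge finite_imageI image_eqI)
  have "(\<integral>\<^sup>+s. ennreal (exp (- \<alpha> * s) * semigroup s ?h x) * indicator {0..} s \<partial>lborel) = ennreal (0 - ?F 0)"
  proof (rule nn_integral_FTC_atLeast)
    show "(\<lambda>s. exp (- \<alpha> * s) * semigroup s ?h x) \<in> borel_measurable borel"
      by (intro borel_measurable_continuous_onI continuous_intros continuous_on_semigroup x)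
    show "DERIV ?F s :> exp (- \<alpha> * s) * semigroup s ?h x" for s
      unfolding sg by (auto intro!: derivative_eq_intros semigroup_has_derivative x simp: algebra_simps)
    show "0 \<le> exp (- \<alpha> * s) * semigroup s ?h x" if "0 \<le> s" for s
      using semigroup_nonneg[OF x that, of ?h] h by simp
    show "(?F \<longlongrightarrow> 0) at_top"
    proof (rule Lim_null_comparison)
      show "\<forall>\<^sub>F s in at_top. norm (?F s) \<le> exp (- \<alpha> * s) * B"
        using eventually_ge_at_top[of 0]
        by eventually_elim (auto simp: abs_mult intro!: semigroup_bound x B)
      show "((\<lambda>s. exp (- \<alpha> * s) * B) \<longlongrightarrow> 0) at_top"
        using \<alpha> by real_asymp
    qed
  qed
  then show ?thesis using semigroup_0[OF x] by simp
qed

end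

section \<open>Laws conditioned on the initial income\<close>

context income_chain
begin

abbreviation law :: "real \<Rightarrow> 'w measure" where
  "law x \<equiv> law_from M inc x"

lemma law_eq: "law x = uniform_measure M (sat 0 x)"
  by (simp add: law_from_def sat_def)

lemma sets_law [simp, measurable_cong]: "sets (law x) = sets M"
  by (simp add: law_eq)

lemma space_law [simp]: "space (law x) = space M"
  by (simp add: law_eq)

lemma prob_space_law: "x \<in> S \<Longrightarrow> prob_space (law x)"
  unfolding law_eq using measure_sat_pos[of x]
  by (intro prob_space_uniform_measure) (auto simp: emeasure_eq_measure)

lemma emeasure_law:
  assumes "x \<in> S" "A \<in> sets M"
  shows "emeasure (law x) A = ennreal (measure M (sat 0 x \<inter> A) / measure M (sat 0 x))"
  using assms measure_sat_pos[of x] sat_sets[of 0 x]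
  by (simp add: law_eq emeasure_eq_measure divide_ennreal)

lemma AE_law_iff: "x \<in> S \<Longrightarrow> (AE \<omega> in law x. P \<omega>) \<longleftrightarrow> (AE \<omega> in M. \<omega> \<in> sat 0 x \<longrightarrow> P \<omega>)"
  unfolding law_eq using measure_sat_pos[of x] sat_sets[of 0 x]
  by (intro AE_uniform_measure) (auto simp: emeasure_eq_measure)

lemma AE_law: "x \<in> S \<Longrightarrow> AE \<omega> in M. P \<omega> \<Longrightarrow> AE \<omega> in law x. P \<omega>"
  by (simp add: AE_law_iff) (auto elim: eventually_mono)

lemma AE_law_initial: "x \<in> S \<Longrightarrow> AE \<omega> in law x. inc 0 \<omega> = x"
  by (simp add: AE_law_iff sat_def)

lemma law_markov_set:
  assumes x: "x \<in> S" and s: "s \<ge> 0" and t: "t \<ge> 0" and y: "y \<in> S" and A: "A \<in> sets (F s)"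
  shows "emeasure (law x) (A \<inter> sat (s + t) y) =
     (\<Sum>v\<in>S. emeasure (law x) (A \<inter> sat s v) * ennreal (transition_prob S rate t v y))"
proof -
  have AM: "A \<in> sets M" using A sub_F[OF s] by (auto simp: subalgebra_def)
  have sx: "sat u v \<in> sets M" if "u \<ge> 0" for u v using that by (rule sat_sets)
  have "sat 0 x \<in> sets (F s)" using sat_sets_F[of 0 x] sets_F_mono[OF s] by auto
  then have "sat 0 x \<inter> A \<in> sets (F s)" using A by auto
  then have "measure M (sat 0 x \<inter> A \<inter> sat (s + t) y) = (\<Sum>v\<in>S. measure M (sat 0 x \<inter> A \<inter> sat s v) * transition_prob S rate t v y)"
    by (rule markov_set_eq[OF s t y])
  then have "measure M (sat 0 x \<inter> (A \<inter> sat (s + t) y)) / measure M (sat 0 x) =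
     (\<Sum>v\<in>S. measure M (sat 0 x \<inter> (A \<inter> sat s v)) / measure M (sat 0 x) * transition_prob S rate t v y)"
    by (simp add: sum_divide_distrib Int_assoc)
  then have "emeasure (law x) (A \<inter> sat (s + t) y) =
     ennreal (\<Sum>v\<in>S. measure M (sat 0 x \<inter> (A \<inter> sat s v)) / measure M (sat 0 x) * transition_prob S rate t v y)"
    using emeasure_law[OF x, of "A \<inter> sat (s + t) y"] AM sx s t by simp
  also have "\<dots> = (\<Sum>v\<in>S. ennreal (measure M (sat 0 x \<inter> (A \<inter> sat s v)) / measure M (sat 0 x) * transition_prob S rate t v y))"
    using transition_prob_nonneg[OF _ y t] by (intro sum_ennreal[symmetric]) auto
  also have "\<dots> = (\<Sum>v\<in>S. emeasure (law x) (A \<inter> sat s v) * ennreal (transition_prob S rate t v y))"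
  proof (intro sum.cong refl)
    fix v assume v: "v \<in> S"
    have "emeasure (law x) (A \<inter> sat s v) = ennreal (measure M (sat 0 x \<inter> (A \<inter> sat s v)) / measure M (sat 0 x))"
      using AM sx s by (intro emeasure_law x) auto
    then show "ennreal (measure M (sat 0 x \<inter> (A \<inter> sat s v)) / measure M (sat 0 x) * transition_prob S rate t v y)
       = emeasure (law x) (A \<inter> sat s v) * ennreal (transition_prob S rate t v y)"
      using transition_prob_nonneg[OF v y t] by (simp only: ennreal_mult divide_nonneg_nonneg measure_nonneg)
  qed
  finally show ?thesis .
qed

text \<open>By \<open>law_markov_set\<close>, the density given by the indicator of income y at
  \<open>s + t\<close> and the density given by the transition probabilities to y define the same
  measure on \<open>F s\<close>. Integrals of every \<open>F s\<close>-measurable k therefore agree,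
  and summing over y with weights f gives the claim.\<close>

lemma law_markov:
  assumes x: "x \<in> S" and s: "s \<ge> 0" and t: "t \<ge> 0"
    and k [measurable]: "k \<in> borel_measurable (F s)" and f: "\<And>y. y \<in> S \<Longrightarrow> f y \<ge> 0"
  shows "(\<integral>\<^sup>+\<omega>. k \<omega> * ennreal (f (inc (s + t) \<omega>)) \<partial>law x) =
     (\<integral>\<^sup>+\<omega>. k \<omega> * ennreal (semigroup t f (inc s \<omega>)) \<partial>law x)"
proof -
  let ?P = "transition_prob S rate t"
  have kM [measurable]: "k \<in> borel_measurable M" using k by (rule measurable_from_F[OF s])
  have st: "s + t \<ge> 0" using s t by simp
  have sx [measurable]: "sat s v \<in> sets M" "sat (s + t) v \<in> sets M" for v
    using sat_sets[OF s] sat_sets[OF st] by auto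
  have sub: "subalgebra (density (law x) g) (F s)" for g
    using sub_F[OF s] by (auto simp: subalgebra_def)
  have indicator_sum: "g (inc u \<omega>) = (\<Sum>v\<in>S. indicator (sat u v) \<omega> * g v)"
    if "u \<ge> 0" "\<omega> \<in> space M" for u \<omega> and g :: "real \<Rightarrow> ennreal"
    using finite_S inc_in_S[OF that] that
    by (subst sum.remove[of _ "inc u \<omega>"]) (auto intro!: sum.neutral simp: sat_def indicator_def)
  have one: "(\<integral>\<^sup>+\<omega>. k \<omega> * indicator (sat (s + t) y) \<omega> \<partial>law x) = (\<integral>\<^sup>+\<omega>. k \<omega> * (\<Sum>v\<in>S. indicator (sat s v) \<omega> * ennreal (?P v y)) \<partial>law x)"
    if y: "y \<in> S" for y
  proof -
    define D1 where "D1 = density (law x) (indicator (sat (s + t) y))"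
    define D2 where "D2 = density (law x) (\<lambda>\<omega>. \<Sum>v\<in>S. indicator (sat s v) \<omega> * ennreal (?P v y))"
    have m1: "(indicator (sat (s + t) y) :: _ \<Rightarrow> ennreal) \<in> borel_measurable (law x)"
      by measurable
    have m2: "(\<lambda>\<omega>. \<Sum>v\<in>S. indicator (sat s v) \<omega> * ennreal (?P v y)) \<in> borel_measurable (law x)"
      by measurable
    have "restr_to_subalg D1 (F s) = restr_to_subalg D2 (F s)"
    proof (rule measure_eqI)
      show "sets (restr_to_subalg D1 (F s)) = sets (restr_to_subalg D2 (F s))"
        by (simp add: sets_restr_to_subalg sub D1_def D2_def)
      fix A assume "A \<in> sets (restr_to_subalg D1 (F s))"
      then have A: "A \<in> sets (F s)" by (simp add: sets_restr_to_subalg sub D1_def)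
      then have AM [measurable]: "A \<in> sets M" using sub_F[OF s] by (auto simp: subalgebra_def)
      have "emeasure D1 A = (\<integral>\<^sup>+\<omega>. indicator (A \<inter> sat (s + t) y) \<omega> \<partial>law x)"
        unfolding D1_def
        by (subst emeasure_density[OF m1]) (simp, intro nn_integral_cong, simp add: indicator_inter_arith mult.commute)
      also have "\<dots> = emeasure (law x) (A \<inter> sat (s + t) y)"
        by (rule nn_integral_indicator) measurable
      also have "\<dots> = (\<Sum>v\<in>S. emeasure (law x) (A \<inter> sat s v) * ennreal (?P v y))"
        by (rule law_markov_set[OF x s t y A])
      also have "\<dots> = (\<Sum>v\<in>S. \<integral>\<^sup>+\<omega>. indicator (A \<inter> sat s v) \<omega> * ennreal (?P v y) \<partial>law x)"
        by (intro sum.cong refl) (simp add: nn_integral_multc)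
      also have "\<dots> = (\<integral>\<^sup>+\<omega>. (\<Sum>v\<in>S. indicator (A \<inter> sat s v) \<omega> * ennreal (?P v y)) \<partial>law x)"
        by (intro nn_integral_sum[symmetric]) measurable
      also have "\<dots> = emeasure D2 A"
        unfolding D2_def
        by (subst emeasure_density[OF m2]) (simp, intro nn_integral_cong, simp add: indicator_inter_arith sum_distrib_left mult_ac)
      finally show "emeasure (restr_to_subalg D1 (F s)) A = emeasure (restr_to_subalg D2 (F s)) A"
        using A by (simp add: emeasure_restr_to_subalg sub D1_def D2_def)
    qed
    moreover have "subalgebra D1 (F s)" "subalgebra D2 (F s)" unfolding D1_def D2_def by (rule sub)+
    note nn_integral_subalgebra2[OF this(1) k] nn_integral_subalgebra2[OF this(2) k]
    ultimately have "(\<integral>\<^sup>+\<omega>. k \<omega> \<partial>D1) = (\<integral>\<^sup>+\<omega>. k \<omega> \<partial>D2)" by simp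
    then show ?thesis
      unfolding D1_def D2_def using m1 m2 by (simp add: nn_integral_density mult.commute)
  qed
  have "(\<integral>\<^sup>+\<omega>. k \<omega> * ennreal (f (inc (s + t) \<omega>)) \<partial>law x)
     = (\<integral>\<^sup>+\<omega>. (\<Sum>y\<in>S. ennreal (f y) * (k \<omega> * indicator (sat (s + t) y) \<omega>)) \<partial>law x)"
  proof (rule nn_integral_cong)
    fix \<omega> assume "\<omega> \<in> space (law x)"
    then have \<omega>: "\<omega> \<in> space M" by simp
    show "k \<omega> * ennreal (f (inc (s + t) \<omega>)) = (\<Sum>y\<in>S. ennreal (f y) * (k \<omega> * indicator (sat (s + t) y) \<omega>))"
      unfolding indicator_sum[OF st \<omega>, of "\<lambda>y. ennreal (f y)"] by (simp add: sum_distrib_left mult_ac)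
  qed
  also have "\<dots> = (\<Sum>y\<in>S. ennreal (f y) * (\<integral>\<^sup>+\<omega>. k \<omega> * indicator (sat (s + t) y) \<omega> \<partial>law x))"
    by (subst nn_integral_sum) (auto simp: nn_integral_cmult)
  also have "\<dots> = (\<Sum>y\<in>S. ennreal (f y) * (\<integral>\<^sup>+\<omega>. k \<omega> * (\<Sum>v\<in>S. indicator (sat s v) \<omega> * ennreal (?P v y)) \<partial>law x))"
    by (simp add: one)
  also have "\<dots> = (\<integral>\<^sup>+\<omega>. (\<Sum>y\<in>S. ennreal (f y) * (k \<omega> * (\<Sum>v\<in>S. indicator (sat s v) \<omega> * ennreal (?P v y)))) \<partial>law x)"
    by (subst nn_integral_sum) (auto simp: nn_integral_cmult)
  also have "\<dots> = (\<integral>\<^sup>+\<omega>. k \<omega> * ennreal (semigroup t f (inc s \<omega>)) \<partial>law x)"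
  proof (rule nn_integral_cong)
    fix \<omega> assume "\<omega> \<in> space (law x)"
    then have \<omega>: "\<omega> \<in> space M" by simp
    have iS: "inc s \<omega> \<in> S" by (rule inc_in_S[OF s \<omega>])
    have "(\<Sum>v\<in>S. indicator (sat s v) \<omega> * ennreal (?P v y)) = ennreal (?P (inc s \<omega>) y)" for y
      by (rule indicator_sum[OF s \<omega>, symmetric])
    then have "(\<Sum>y\<in>S. ennreal (f y) * (k \<omega> * (\<Sum>v\<in>S. indicator (sat s v) \<omega> * ennreal (?P v y))))
      = (\<Sum>y\<in>S. ennreal (f y) * (k \<omega> * ennreal (?P (inc s \<omega>) y)))"
      by simp
    also have "\<dots> = (\<Sum>y\<in>S. k \<omega> * ennreal (?P (inc s \<omega>) y * f y))"
      using transition_prob_nonneg[OF iS _ t] f by (intro sum.cong refl) (auto simp: ennreal_mult mult_ac)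
    also have "\<dots> = k \<omega> * ennreal (semigroup t f (inc s \<omega>))"
      unfolding semigroup_def using transition_prob_nonneg[OF iS _ t] f
      by (simp add: sum_distrib_left[symmetric] sum_ennreal)
    finally show "(\<Sum>y\<in>S. ennreal (f y) * (k \<omega> * (\<Sum>v\<in>S. indicator (sat s v) \<omega> * ennreal (?P v y)))) = k \<omega> * ennreal (semigroup t f (inc s \<omega>))" .
  qed
  finally show ?thesis .
qed

lemma law_sat:
  assumes "x \<in> S" "y \<in> S" "t \<ge> 0"
  shows "measure (law x) (sat t y) = transition_prob S rate t x y"
proof -
  have "emeasure (law x) (sat t y) = ennreal (transition_prob S rate t x y)"
    using emeasure_law[OF assms(1), of "sat t y"] sat_sets[OF assms(3)] joint_law_0[OF assms] measure_sat_pos[OF assms(1)] by simp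
  then show ?thesis using transition_prob_nonneg[OF assms] by (simp add: measure_def)
qed

section \<open>A right-continuous progressive version of income\<close>

definition regular :: "'w set" where
  "regular = {\<omega> \<in> space M. \<forall>t\<ge>0. continuous (at_right t) (\<lambda>s. inc s \<omega>)}"

text \<open>Paths of \<open>inc\<close> are right-continuous only almost surely, whereas progressive
  measurability concerns every path. The exceptional paths get a constant income; completeness of
  the filtration keeps the result adapted.\<close>

definition Z :: "real \<Rightarrow> 'w \<Rightarrow> real" where
  "Z t \<omega> = (if \<omega> \<in> regular then inc t \<omega> else Min S)"

lemma AE_regular: "AE \<omega> in M. \<omega> \<in> regular"
  using cadlag AE_space by eventually_elim (simp add: regular_def)

lemma regular_sets_F: "t \<ge> 0 \<Longrightarrow> regular \<in> sets (F t)"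
proof -
  assume t: "t \<ge> 0"
  obtain N where N: "{\<omega> \<in> space M. \<not> \<omega> \<in> regular} \<subseteq> N" "emeasure M N = 0" "N \<in> sets M"
    using AE_regular by (rule AE_E)
  have "space M - regular \<in> null_sets M"
    by (rule complete2[of _ N]) (use N in auto)
  then have "space M - regular \<in> sets (F t)" using complete_F sets_F_mono[OF t] by auto
  then have "space (F t) - (space M - regular) \<in> sets (F t)" by (rule sets.compl_sets)
  moreover have "space (F t) - (space M - regular) = regular" by (auto simp: space_F regular_def)
  ultimately show ?thesis by simp
qed

lemma AE_Z: "AE \<omega> in M. \<forall>t. Z t \<omega> = inc t \<omega>"
  using AE_regular by eventually_elim (simp add: Z_def)

lemma AE_law_Z: "x \<in> S \<Longrightarrow> AE \<omega> in law x. \<forall>t. Z t \<omega> = inc t \<omega>"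
  by (rule AE_law[OF _ AE_Z])

lemma Z_in_S: "t \<ge> 0 \<Longrightarrow> \<omega> \<in> space M \<Longrightarrow> Z t \<omega> \<in> S"
  using inc_in_S Min_S by (simp add: Z_def)

lemma Z_adapted:
  assumes t: "t \<ge> 0" shows "Z t \<in> borel_measurable (F t)"
proof -
  note regular_sets_F[OF t, measurable] adapted[OF t, measurable]
  show ?thesis unfolding Z_def by measurable
qed

lemma Z_right_continuous:
  assumes t: "t \<ge> 0" and \<omega>: "\<omega> \<in> space M"
  shows "((\<lambda>s. Z s \<omega>) \<longlongrightarrow> Z t \<omega>) (at_right t)"
proof (cases "\<omega> \<in> regular")
  case True
  then show ?thesis using t by (simp add: Z_def) (simp add: regular_def continuous_within)
qed (simp add: Z_def)

text \<open>A right limit among finitely many values is attained on an interval.\<close>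

lemma Z_locally_constant:
  assumes t: "t \<ge> 0" and \<omega>: "\<omega> \<in> space M"
  obtains b where "b > t" "\<And>s. t \<le> s \<Longrightarrow> s < b \<Longrightarrow> Z s \<omega> = Z t \<omega>"
proof -
  have "finite (S - {Z t \<omega>})" using finite_S by simp
  then have "open (- (S - {Z t \<omega>}))" by (intro open_Compl finite_imp_closed)
  then have "\<forall>\<^sub>F s in at_right t. Z s \<omega> \<in> - (S - {Z t \<omega>})"
    using Z_right_continuous[OF assms] by (intro topological_tendstoD) auto
  then obtain b where b: "b > t" "\<And>s. t < s \<Longrightarrow> s < b \<Longrightarrow> Z s \<omega> \<in> - (S - {Z t \<omega>})"
    unfolding eventually_at_right_field by blast
  have "Z s \<omega> = Z t \<omega>" if "t \<le> s" "s < b" for s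
    using b(2)[of s] Z_in_S[of s \<omega>] that t \<omega> by (cases "s = t") auto
  then show ?thesis using that b by blast
qed

abbreviation prog_space :: "real \<Rightarrow> (real \<times> 'w) measure" where
  "prog_space t \<equiv> restrict_space borel {0..t} \<Otimes>\<^sub>M F t"

lemma progressively_measurable_iff:
  "progressively_measurable F c \<longleftrightarrow> (\<forall>t\<ge>0. (\<lambda>p. c (fst p) (snd p)) \<in> borel_measurable (prog_space t))"
  by (simp add: progressively_measurable_def case_prod_beta')

lemma progressively_measurableI:
  "(\<And>t. t \<ge> 0 \<Longrightarrow> (\<lambda>p. c (fst p) (snd p)) \<in> borel_measurable (prog_space t)) \<Longrightarrow> progressively_measurable F c"
  by (simp add: progressively_measurable_iff)

lemma progressively_measurableD:
  "progressively_measurable F c \<Longrightarrow> t \<ge> 0 \<Longrightarrow> (\<lambda>p. c (fst p) (snd p)) \<in> borel_measurable (prog_space t)"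
  by (simp add: progressively_measurable_iff)

lemma space_prog_space: "space (prog_space t) = {0..t} \<times> space M"
  by (simp add: space_pair_measure space_F)

lemma fst_prog_space [measurable]: "fst \<in> borel_measurable (prog_space t)"
  by (rule measurable_compose[OF measurable_fst]) (rule measurable_restrict_space1, simp)

lemma progressively_measurable_Z: "progressively_measurable F Z"
proof (rule progressively_measurableI)
  fix t :: real assume t: "t \<ge> 0"
  \<comment> \<open>Time is rounded up to a multiple of \<open>1 / Suc n\<close> strictly beyond it
    and capped at t. Rounding up suits right-continuity; the cap keeps the sampled income measurable
    for \<open>F t\<close> and returns t itself at time t.\<close>
  define u where "u n i = min t (real (Suc i) / real (Suc n))" for n i
  have u: "0 \<le> u n i" "u n i \<le> t" for n i using t by (auto simp: u_def)
  define a where "a n p = Z (u n (nat \<lfloor>fst p * real (Suc n)\<rfloor>)) (snd p)" for n and p :: "real \<times> 'w"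
  have Zu: "(\<lambda>p. Z (u n i) (snd p)) \<in> borel_measurable (prog_space t)" for n i
    by (rule measurable_compose[OF measurable_snd measurable_F_mono[OF u Z_adapted[OF u(1)]]])
  have "a n \<in> borel_measurable (prog_space t)" for n
    unfolding a_def by (rule measurable_compose_countable[OF Zu]) measurable
  then show "(\<lambda>p. Z (fst p) (snd p)) \<in> borel_measurable (prog_space t)"
  proof (rule borel_measurable_LIMSEQ_real[rotated])
    fix p assume "p \<in> space (prog_space t)"
    then obtain s \<omega> where p: "p = (s, \<omega>)" "0 \<le> s" "s \<le> t" "\<omega> \<in> space M"
      by (auto simp: space_prog_space)
    have fl: "s < real (Suc (nat \<lfloor>s * real (Suc n)\<rfloor>)) / real (Suc n)"
      "real (Suc (nat \<lfloor>s * real (Suc n)\<rfloor>)) / real (Suc n) \<le> s + 1 / real (Suc n)" for n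
    proof -
      define k where "k = \<lfloor>s * real (Suc n)\<rfloor>"
      have k: "0 \<le> k" "real_of_int k \<le> s * real (Suc n)" "s * real (Suc n) < real_of_int k + 1"
        using p(2) by (auto simp: k_def)
      then have "real (Suc (nat k)) = real_of_int k + 1" by simp
      then show "s < real (Suc (nat \<lfloor>s * real (Suc n)\<rfloor>)) / real (Suc n)"
        "real (Suc (nat \<lfloor>s * real (Suc n)\<rfloor>)) / real (Suc n) \<le> s + 1 / real (Suc n)"
        using k unfolding k_def[symmetric] by (simp_all only:) (simp_all add: field_simps del: of_nat_Suc)
    qed
    show "(\<lambda>n. a n p) \<longlonglongrightarrow> Z (fst p) (snd p)"
    proof (cases "s = t")
      case True
      have "u n (nat \<lfloor>s * real (Suc n)\<rfloor>) = t" for n using fl(1)[of n] True by (simp add: u_def del: of_nat_Suc)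
      then show ?thesis using True by (simp add: a_def p(1))
    next
      case False
      obtain b where b: "b > s" "\<And>v. s \<le> v \<Longrightarrow> v < b \<Longrightarrow> Z v \<omega> = Z s \<omega>"
        using Z_locally_constant[OF p(2,4)] by blast
      obtain N where N: "1 / real (Suc N) < b - s" using b(1) nat_approx_posE[of "b - s"] by auto
      have "a n p = Z s \<omega>" if "n \<ge> N" for n
      proof -
        have "1 / real (Suc n) \<le> 1 / real (Suc N)" using that by (intro divide_left_mono) auto
        then have "u n (nat \<lfloor>s * real (Suc n)\<rfloor>) < b"
          using fl(2)[of n] N by (simp add: u_def min_less_iff_disj del: of_nat_Suc)
        moreover have "s \<le> u n (nat \<lfloor>s * real (Suc n)\<rfloor>)"
          using fl(1)[of n] p(3) by (simp add: u_def del: of_nat_Suc)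
        ultimately show ?thesis
          using b(2)[of "u n (nat \<lfloor>s * real (Suc n)\<rfloor>)"] by (simp add: a_def p(1) del: of_nat_Suc)
      qed
      then show ?thesis
        by (intro tendsto_eventually) (auto simp: eventually_sequentially p(1))
    qed
  qed
qed

lemma finite_range_measurable:
  fixes f :: "real \<Rightarrow> 'b::{second_countable_topology, real_normed_vector}"
  assumes X: "X \<in> borel_measurable N" and S: "\<And>p. p \<in> space N \<Longrightarrow> X p \<in> S"
  shows "(\<lambda>p. f (X p)) \<in> borel_measurable N"
proof (rule measurable_cong[THEN iffD1])
  show "(\<lambda>p. \<Sum>y\<in>S. indicator {y} (X p) *\<^sub>R f y) \<in> borel_measurable N"
    using X by measurable
  show "(\<Sum>y\<in>S. indicator {y} (X p) *\<^sub>R f y) = f (X p)" if "p \<in> space N" for p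
    using finite_S S[OF that] by (subst sum.remove[of _ "X p"]) (auto intro!: sum.neutral)
qed

lemma progressively_measurable_fun_Z:
  fixes f :: "real \<Rightarrow> real"
  shows "progressively_measurable F (\<lambda>t \<omega>. f (Z t \<omega>))"
proof (rule progressively_measurableI)
  fix t :: real assume "t \<ge> 0"
  show "(\<lambda>p. f (Z (fst p) (snd p))) \<in> borel_measurable (prog_space t)"
    by (rule finite_range_measurable[OF progressively_measurableD[OF progressively_measurable_Z \<open>t \<ge> 0\<close>]])
      (auto simp: space_prog_space Z_in_S)
qed

end

section \<open>Cumulative discounted spending along a path\<close>

definition halfline :: "real measure" where
  "halfline = restrict_space lborel {0..}"

lemma space_halfline [simp]: "space halfline = {0..}"
  by (simp add: halfline_def space_restrict_space)

lemma sets_halfline: "sets halfline = sets (restrict_space borel {0..})"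
  by (simp add: halfline_def sets_restrict_space)

lemma measurable_halfline: "f \<in> measurable borel N \<Longrightarrow> f \<in> measurable halfline N"
  unfolding halfline_def by (intro measurable_restrict_space1) simp

lemma ident_halfline [measurable]: "(\<lambda>x. x) \<in> borel_measurable halfline"
  by (intro measurable_halfline) simp

lemma measurable_into_halfline:
  "f \<in> borel_measurable N \<Longrightarrow> (\<And>x. x \<in> space N \<Longrightarrow> f x \<ge> 0) \<Longrightarrow> f \<in> measurable N halfline"
  unfolding halfline_def by (intro measurable_restrict_space2) auto

lemma Icc_sets_halfline: "0 \<le> a \<Longrightarrow> {a..b} \<in> sets halfline"
  by (auto simp: halfline_def sets_restrict_space intro!: image_eqI[of _ _ "{a..b}"])

lemma nn_integral_halfline: "(\<integral>\<^sup>+s. f s \<partial>halfline) = (\<integral>\<^sup>+s. f s * indicator {0..} s \<partial>lborel)"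
  unfolding halfline_def by (rule nn_integral_restrict_space) simp

lemma sigma_finite_halfline: "sigma_finite_measure halfline"
  unfolding halfline_def by (intro sigma_finite_measure_restrict_space sigma_finite_lborel) simp

lemma AE_halfline_neq: "AE s in halfline. s \<noteq> a"
  unfolding halfline_def using AE_lborel_singleton[of a] by (subst AE_restrict_space_iff) auto

text \<open>An initial segment of time differs from \<open>{0..Sup I}\<close> at most by its
  endpoint, a null set.\<close>

lemma nn_integral_initial_segment:
  assumes I: "I \<subseteq> {0..}" "I \<noteq> {}" "bdd_above I" and down: "\<And>s v. s \<in> I \<Longrightarrow> 0 \<le> v \<Longrightarrow> v \<le> s \<Longrightarrow> v \<in> I"
  shows "(\<integral>\<^sup>+s. f s * indicator I s \<partial>halfline) = (\<integral>\<^sup>+s. f s * indicator {..Sup I} s \<partial>halfline)"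
proof (rule nn_integral_cong_AE)
  have "AE s in halfline. s \<in> space halfline" by (rule AE_space)
  with AE_halfline_neq[of "Sup I"]
  show "AE s in halfline. f s * indicator I s = f s * indicator {..Sup I} s"
  proof eventually_elim
    case (elim s)
    have "s \<le> Sup I" if "s \<in> I" using that I by (intro cSup_upper)
    moreover have "s \<in> I" if "s < Sup I"
      using less_cSupD[OF I(2) that] elim down by (auto intro: less_imp_le)
    ultimately show ?case using elim by (auto simp: indicator_def)
  qed
qed

text \<open>Values in \<open>ennreal\<close> give the amount a meaning before integrability is
  known. A negative flow counts as 0.\<close>

definition cum :: "real \<Rightarrow> (real \<Rightarrow> real) \<Rightarrow> real \<Rightarrow> ennreal" where
  "cum r e t = (\<integral>\<^sup>+s. ennreal (exp (- r * s) * e s) * indicator {..t} s \<partial>halfline)"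

lemma cum_mono_time: "s \<le> t \<Longrightarrow> cum r e s \<le> cum r e t"
  unfolding cum_def by (intro nn_integral_mono mult_left_mono) (auto simp: indicator_def)

lemma cum_mono: "(\<And>s. 0 \<le> s \<Longrightarrow> s \<le> t \<Longrightarrow> e s \<le> f s) \<Longrightarrow> cum r e t \<le> cum r f t"
  unfolding cum_def by (intro nn_integral_mono) (auto simp: indicator_def intro!: ennreal_leI)

lemma cum_cong: "(\<And>s. 0 \<le> s \<Longrightarrow> s \<le> t \<Longrightarrow> e s = f s) \<Longrightarrow> cum r e t = cum r f t"
  unfolding cum_def by (intro nn_integral_cong) (auto simp: indicator_def)

lemma cum_add:
  assumes [measurable]: "e \<in> borel_measurable halfline" "f \<in> borel_measurable halfline"
    and "\<And>s. s \<ge> 0 \<Longrightarrow> e s \<ge> 0" "\<And>s. s \<ge> 0 \<Longrightarrow> f s \<ge> 0"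
  shows "cum r (\<lambda>s. e s + f s) t = cum r e t + cum r f t"
proof -
  have "cum r (\<lambda>s. e s + f s) t = (\<integral>\<^sup>+s. ennreal (exp (- r * s) * e s) * indicator {..t} s + ennreal (exp (- r * s) * f s) * indicator {..t} s \<partial>halfline)"
    unfolding cum_def using assms(3,4)
    by (intro nn_integral_cong) (auto simp: distrib_left ennreal_plus indicator_def)
  also have "\<dots> = cum r e t + cum r f t"
    unfolding cum_def by (intro nn_integral_add) measurable
  finally show ?thesis .
qed

lemma cum_cmult:
  assumes [measurable]: "e \<in> borel_measurable halfline" and c: "c \<ge> 0"
  shows "cum r (\<lambda>s. c * e s) t = ennreal c * cum r e t"
  unfolding cum_def using c
  by (subst nn_integral_cmult[symmetric])
    (auto simp: ennreal_mult'[symmetric] mult_ac indicator_def intro!: nn_integral_cong)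

lemma cum_nonpos_time: "t \<le> 0 \<Longrightarrow> cum r e t = 0"
proof -
  assume t: "t \<le> 0"
  have "AE s in halfline. s \<in> space halfline" by (rule AE_space)
  with AE_halfline_neq[of 0] have "AE s in halfline. ennreal (exp (- r * s) * e s) * indicator {..t} s = 0"
    by eventually_elim (use t in auto)
  then show ?thesis unfolding cum_def by (subst nn_integral_cong_AE[of _ "\<lambda>_. 0"]) auto
qed

text \<open>As a function of t, \<open>cum\<close> is the mass of \<open>{0..t}\<close> under the
  measure with density \<open>exp (- r * s) * e s\<close>, which has no atoms. Continuity from below
  and, for finite mass, from above gives the two limits.\<close>

lemma
  assumes [measurable]: "e \<in> borel_measurable halfline"
  shows cum_left_limit: "(\<And>s. s < t \<Longrightarrow> cum r e s \<le> b) \<Longrightarrow> cum r e t \<le> b"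
    and cum_right_limit: "(\<And>s. cum r e s < \<infinity>) \<Longrightarrow> 0 \<le> t \<Longrightarrow> t < u \<Longrightarrow> (\<And>s. t < s \<Longrightarrow> s \<le> u \<Longrightarrow> b \<le> cum r e s) \<Longrightarrow> b \<le> cum r e t"
proof -
  define \<mu> where "\<mu> = density halfline (\<lambda>s. ennreal (exp (- r * s) * e s))"
  have sets\<mu>: "sets \<mu> = sets halfline" by (simp add: \<mu>_def)
  have eq: "cum r e t = emeasure \<mu> {0..t}" for t
    unfolding \<mu>_def using Icc_sets_halfline[of 0 t]
    by (subst emeasure_density) (auto simp: cum_def indicator_def intro!: nn_integral_cong)
  show "cum r e t \<le> b" if b: "\<And>s. s < t \<Longrightarrow> cum r e s \<le> b"
  proof -
    have null: "emeasure \<mu> {0..t} \<le> emeasure \<mu> (\<Union>n. {0..t - 1 / real (Suc n)})"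
    proof (rule emeasure_mono_AE)
      have "AE s in \<mu>. s \<noteq> t" unfolding \<mu>_def
        using AE_halfline_neq[of t] by (subst AE_density) (auto elim: eventually_mono)
      then show "AE s in \<mu>. s \<in> {0..t} \<longrightarrow> s \<in> (\<Union>n. {0..t - 1 / real (Suc n)})"
      proof eventually_elim
        case (elim s)
        show ?case
        proof
          assume s: "s \<in> {0..t}"
          then have "0 < t - s" using elim by auto
          then obtain n where "1 / real (Suc n) < t - s" using nat_approx_posE by blast
          then show "s \<in> (\<Union>n. {0..t - 1 / real (Suc n)})" using s by (auto intro!: exI[of _ n] simp del: of_nat_Suc)
        qed
      qed
      show "(\<Union>n. {0..t - 1 / real (Suc n)}) \<in> sets \<mu>"
        unfolding sets\<mu> by (intro sets.countable_UN image_subsetI Icc_sets_halfline) auto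
    qed
    also have "emeasure \<mu> (\<Union>n. {0..t - 1 / real (Suc n)}) = (SUP n. emeasure \<mu> {0..t - 1 / real (Suc n)})"
    proof (rule SUP_emeasure_incseq[symmetric])
      show "range (\<lambda>n. {0..t - 1 / real (Suc n)}) \<subseteq> sets \<mu>"
        unfolding sets\<mu> by (intro image_subsetI Icc_sets_halfline) auto
      show "incseq (\<lambda>n. {0..t - 1 / real (Suc n)})"
        by (intro incseq_SucI) (auto simp: frac_le intro: order_trans)
    qed
    also have "\<dots> \<le> b"
      unfolding eq[symmetric] by (intro SUP_least b) simp
    finally show ?thesis unfolding eq .
  qed
  show "b \<le> cum r e t"
    if fin: "\<And>s. cum r e s < \<infinity>" and t: "0 \<le> t" "t < u" and b: "\<And>s. t < s \<Longrightarrow> s \<le> u \<Longrightarrow> b \<le> cum r e s"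
  proof -
    define v where "v n = t + (u - t) / real (Suc n)" for n
    have v: "t < v n" "v n \<le> u" for n
    proof -
      have "(u - t) / real (Suc n) \<le> (u - t) / 1" using t by (intro divide_left_mono) auto
      then show "t < v n" "v n \<le> u" using t by (auto simp: v_def)
    qed
    have "(INF n. emeasure \<mu> {0..v n}) = emeasure \<mu> (\<Inter>n. {0..v n})"
    proof (rule INF_emeasure_decseq)
      show "range (\<lambda>n. {0..v n}) \<subseteq> sets \<mu>"
        unfolding sets\<mu> by (intro image_subsetI Icc_sets_halfline) auto
      have "v (Suc n) \<le> v n" for n unfolding v_def using t by (intro add_mono order_refl divide_left_mono) auto
      then show "decseq (\<lambda>n. {0..v n})" by (intro decseq_SucI) (auto intro: order_trans)
      show "emeasure \<mu> {0..v n} \<noteq> \<infinity>" for n using fin[of "v n"] by (simp add: eq)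
    qed
    moreover have "(\<Inter>n. {0..v n}) = {0..t}"
    proof (intro equalityI subsetI)
      fix s assume s: "s \<in> (\<Inter>n. {0..v n})"
      have "v \<longlonglongrightarrow> t + (u - t) * 0"
        unfolding v_def divide_inverse by (intro tendsto_intros LIMSEQ_inverse_real_of_nat)
      then have "s \<le> t" using s by (intro LIMSEQ_le_const[of v]) auto
      then show "s \<in> {0..t}" using s by auto
    next
      fix s assume "s \<in> {0..t}"
      then show "s \<in> (\<Inter>n. {0..v n})" using v(1) by (auto intro: order_trans less_imp_le)
    qed
    ultimately have "cum r e t = (INF n. cum r e (v n))" by (simp add: eq)
    also have "\<dots> \<ge> b" using b v by (intro INF_greatest) auto
    finally show ?thesis .
  qed
qed

text \<open>The times at which less than \<eta> has been spent form an initial segment, so stopping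
  replaces t by its supremum. Continuity of \<open>cum\<close> makes the amount at the supremum
  exactly \<eta> when \<eta> is reached by time t.\<close>

lemma cum_stopped:
  assumes e [measurable]: "e \<in> borel_measurable halfline" and fin: "\<And>s. cum r e s < \<infinity>" and \<eta>: "\<eta> > 0"
  shows "cum r (\<lambda>s. if cum r e s < \<eta> then e s else 0) t = min (cum r e t) \<eta>"
proof (cases "t \<ge> 0")
  case False
  then show ?thesis by (simp add: cum_nonpos_time)
next
  case t: True
  define I where "I = {s\<in>{0..t}. cum r e s < \<eta>}"
  have I: "I \<subseteq> {0..}" "0 \<in> I" "bdd_above I" using \<eta> t by (auto simp: I_def cum_nonpos_time)
  have "cum r (\<lambda>s. if cum r e s < \<eta> then e s else 0) t = (\<integral>\<^sup>+s. ennreal (exp (- r * s) * e s) * indicator I s \<partial>halfline)"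
    unfolding cum_def[of _ "\<lambda>s. if _ s then _ s else 0"]
    by (intro nn_integral_cong) (auto simp: I_def indicator_def)
  also have "\<dots> = cum r e (Sup I)"
    unfolding cum_def using I by (intro nn_integral_initial_segment)
      (auto simp: I_def intro: le_less_trans[OF cum_mono_time])
  also have "\<dots> = min (cum r e t) \<eta>"
  proof (cases "cum r e t < \<eta>")
    case True
    then have "I = {0..t}" by (auto simp: I_def intro: le_less_trans[OF cum_mono_time])
    then show ?thesis using True t by simp
  next
    case False
    have "Sup I \<le> t" using I by (intro cSup_least) (auto simp: I_def)
    have "cum r e (Sup I) \<le> \<eta>"
    proof (rule cum_left_limit[OF e])
      fix s assume s: "s < Sup I"
      then obtain i where "i \<in> I" "s < i" using less_cSupD[of I s] I by auto
      then show "cum r e s \<le> \<eta>" using cum_mono_time[of s i r e] by (auto simp: I_def)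
    qed
    moreover have "\<eta> \<le> cum r e (Sup I)"
    proof (cases "Sup I = t")
      case True then show ?thesis using False by simp
    next
      case Sup: False
      show ?thesis
      proof (rule cum_right_limit[OF e fin])
        show "0 \<le> Sup I" using I by (intro cSup_upper)
        show "Sup I < t" using Sup \<open>Sup I \<le> t\<close> by simp
        fix s assume s: "Sup I < s" "s \<le> t"
        then have "s \<notin> I" using cSup_upper[of s I] I by force
        moreover have "0 \<le> s" using s cSup_upper[of 0 I] I by simp
        ultimately show "\<eta> \<le> cum r e s" using s by (auto simp: I_def)
      qed
    qed
    ultimately show ?thesis using False by simp
  qed
  finally show ?thesis .
qed

lemma cum_eq_integral:
  assumes e: "e \<in> borel_measurable halfline" and pos: "\<forall>s\<ge>0. e s \<ge> 0"
  shows "cum r e t < \<infinity> \<longleftrightarrow> set_integrable lborel {0..t} e"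
    and "set_integrable lborel {0..t} e \<Longrightarrow> cum r e t = ennreal (LINT s:{0..t}|lborel. exp (- r * s) * e s)"
    and "set_integrable lborel {0..t} e \<Longrightarrow> (LINT s:{0..t}|lborel. exp (- r * s) * e s) \<ge> 0"
proof -
  have m: "(\<lambda>s. indicator {0..t} s *\<^sub>R (exp (- r * s) * e s)) \<in> borel_measurable lborel"
  proof -
    define g where "g s = indicator {0..} s *\<^sub>R e s" for s
    have g: "g \<in> borel_measurable borel"
      using e unfolding halfline_def g_def by (subst (asm) borel_measurable_restrict_space_iff) auto
    have "(\<lambda>s. indicator {0..t} s *\<^sub>R (exp (- r * s) * g s)) \<in> borel_measurable borel"
      by (intro borel_measurable_scaleR borel_measurable_times g borel_measurable_continuous_onI
          continuous_intros borel_measurable_indicator) simp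
    moreover have "(\<lambda>s. indicator {0..t} s *\<^sub>R (exp (- r * s) * g s)) = (\<lambda>s. indicator {0..t} s *\<^sub>R (exp (- r * s) * e s))"
      by (auto simp: fun_eq_iff indicator_def g_def)
    ultimately show ?thesis by simp
  qed
  have nn: "0 \<le> indicator {0..t} s *\<^sub>R (exp (- r * s) * e s)" for s
    using pos by (auto simp: indicator_def)
  have eq: "cum r e t = (\<integral>\<^sup>+s. ennreal (indicator {0..t} s *\<^sub>R (exp (- r * s) * e s)) \<partial>lborel)"
    unfolding cum_def nn_integral_halfline by (intro nn_integral_cong) (auto simp: indicator_def)
  have iff: "set_integrable lborel {0..t} e \<longleftrightarrow> set_integrable lborel {0..t} (\<lambda>s. exp (- r * s) * e s)"
    using set_integrable_exp_times[of t e "- r"] set_integrable_exp_times[of t "\<lambda>s. exp (- r * s) * e s" r]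
    by (auto simp: mult.assoc[symmetric] exp_add[symmetric])
  show fin: "cum r e t < \<infinity> \<longleftrightarrow> set_integrable lborel {0..t} e"
    unfolding iff eq unfolding set_integrable_def using m nn
    by (subst integrable_iff_bounded) auto
  show "cum r e t = ennreal (LINT s:{0..t}|lborel. exp (- r * s) * e s)" if "set_integrable lborel {0..t} e"
    using that unfolding eq iff unfolding set_integrable_def set_lebesgue_integral_def
    by (intro nn_integral_eq_integral) (use nn in auto)
  show "(LINT s:{0..t}|lborel. exp (- r * s) * e s) \<ge> 0" if "set_integrable lborel {0..t} e"
    unfolding set_lebesgue_integral_def by (intro integral_nonneg_AE AE_I2 nn)
qed

text \<open>Variation of constants expresses wealth by discounted integrals, and discounting
  \<open>r * abar\<close> over time absorbs the constant limit. This eliminates the wealth process: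
  feasibility becomes an inequality between cumulative amounts, which is convenient for adding,
  scaling and stopping controls.\<close>

lemma budget_iff:
  fixes c y :: "real \<Rightarrow> real"
  assumes c: "c \<in> borel_measurable halfline" "\<And>s. s \<ge> 0 \<Longrightarrow> c s \<ge> 0"
    and y: "y \<in> borel_measurable halfline" "\<And>s. s \<ge> 0 \<Longrightarrow> y s + r * abar \<ge> 0" "\<And>s. s \<ge> 0 \<Longrightarrow> \<bar>y s\<bar> \<le> B"
    and a: "a \<ge> abar"
  shows "(\<forall>t\<ge>0. set_integrable lborel {0..t} c) \<and>
      (\<exists>A. has_drift a (\<lambda>t. r * A t + y t - c t) A \<and> (\<forall>t\<ge>0. A t \<ge> abar)) \<longleftrightarrow>
    (\<forall>t\<ge>0. cum r c t \<le> ennreal (a - abar) + cum r (\<lambda>s. y s + r * abar) t)"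
proof -
  have ym: "(\<lambda>s. y s + r * abar) \<in> borel_measurable halfline" using y(1) by measurable
  have yi: "set_integrable lborel {0..t} y" for t
  proof -
    have "(\<lambda>s. indicator {0..} s *\<^sub>R y s) \<in> borel_measurable lborel"
      using y(1) unfolding halfline_def by (subst (asm) borel_measurable_restrict_space_iff) auto
    then have "set_integrable lborel {0..t} (\<lambda>s. indicator {0..} s *\<^sub>R y s)"
      by (intro set_integrable_bounded_Icc[where M = B]) (use y(3) in auto)
    then show ?thesis unfolding set_integrable_def
      by (rule Bochner_Integration.integrable_cong[THEN iffD1, OF refl, rotated]) (auto simp: indicator_def)
  qed
  have yi': "set_integrable lborel {0..t} (\<lambda>s. y s + r * abar)" for t
    using yi[of t] set_integrable_bounded_Icc[of "\<lambda>_. r * abar" 0 t "\<bar>r * abar\<bar>"]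
    by (intro set_integral_add(1)) auto
  have pos: "\<forall>s\<ge>0. y s + r * abar \<ge> 0" "\<forall>s\<ge>0. c s \<ge> 0" using y(2) c(2) by auto
  note cy = cum_eq_integral[OF ym pos(1), where r = r]
  note cc = cum_eq_integral[OF c(1) pos(2), where r = r]
  have yexp: "(LINT s:{0..t}|lborel. exp (- r * s) * (y s + r * abar)) =
      (LINT s:{0..t}|lborel. exp (- r * s) * y s) + abar * (1 - exp (- r * t))" if t: "t \<ge> 0" for t
  proof -
    have i: "set_integrable lborel {0..t} (\<lambda>s. exp (- r * s) * y s)"
      using set_integrable_exp_times[OF yi, of t "- r"] .
    have j: "set_integrable lborel {0..t} (\<lambda>s. - abar * (- r * exp (- r * s)))"
      by (intro borel_integrable_atLeastAtMost' continuous_intros)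
    have e: "(\<lambda>s. exp (- r * s) * (y s + r * abar)) = (\<lambda>s. exp (- r * s) * y s + - abar * (- r * exp (- r * s)))"
      by (auto simp: fun_eq_iff algebra_simps)
    have k: "(LINT s:{0..t}|lborel. - abar * (- r * exp (- r * s))) = - abar * (exp (- r * t) - 1)"
      by (subst set_integral_mult_right) (simp only: integral_exp_interval[OF t] mult_zero_right exp_zero)
    show ?thesis
      unfolding e set_integral_add(2)[OF i j] k by (simp add: algebra_simps)
  qed
  have key: "exp (r * t) * (a + (LINT s:{0..t}|lborel. exp (- r * s) * (y s - c s))) \<ge> abar \<longleftrightarrow>
      cum r c t \<le> ennreal (a - abar) + cum r (\<lambda>s. y s + r * abar) t"
    if t: "t \<ge> 0" and ci: "set_integrable lborel {0..t} c" for t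
  proof -
    let ?C = "LINT s:{0..t}|lborel. exp (- r * s) * c s" and ?Y = "LINT s:{0..t}|lborel. exp (- r * s) * y s"
    have "(LINT s:{0..t}|lborel. exp (- r * s) * (y s - c s)) = ?Y - ?C"
      unfolding right_diff_distrib
      by (intro set_integral_diff(2)) (use set_integrable_exp_times[OF yi, of t "- r"] set_integrable_exp_times[OF ci, of "- r"] in auto)
    moreover have "exp (r * t) * X \<ge> abar \<longleftrightarrow> exp (- r * t) * abar \<le> X" for X :: real
      by (simp add: exp_minus divide_simps mult.commute)
    ultimately have "exp (r * t) * (a + (LINT s:{0..t}|lborel. exp (- r * s) * (y s - c s))) \<ge> abar \<longleftrightarrow>
      exp (- r * t) * abar \<le> a + (?Y - ?C)"
      by simp
    also have "\<dots> \<longleftrightarrow> ?C \<le> (a - abar) + (LINT s:{0..t}|lborel. exp (- r * s) * (y s + r * abar))"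
      unfolding yexp[OF t] by (auto simp: algebra_simps)
    also have "\<dots> \<longleftrightarrow> ennreal ?C \<le> ennreal ((a - abar) + (LINT s:{0..t}|lborel. exp (- r * s) * (y s + r * abar)))"
      using a cy(3)[OF yi'] by (intro ennreal_le_iff[symmetric]) auto
    also have "\<dots> \<longleftrightarrow> cum r c t \<le> ennreal (a - abar) + cum r (\<lambda>s. y s + r * abar) t"
      unfolding cc(2)[OF ci] cy(2)[OF yi'] using a cy(3)[OF yi'] by (simp add: ennreal_plus)
    finally show ?thesis .
  qed
  have drift_iff: "(\<exists>A. has_drift a (\<lambda>t. r * A t + y t - c t) A \<and> (\<forall>t\<ge>0. A t \<ge> abar)) \<longleftrightarrow>
      (\<forall>t\<ge>0. cum r c t \<le> ennreal (a - abar) + cum r (\<lambda>s. y s + r * abar) t)"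
    if ci: "\<And>t. t \<ge> 0 \<Longrightarrow> set_integrable lborel {0..t} c"
  proof -
    have g: "set_integrable lborel {0..t} (\<lambda>t. y t - c t)" if "t \<ge> 0" for t
      using yi ci[OF that] by (intro set_integral_diff(1)) auto
    have hd: "has_drift a (\<lambda>t. r * A t + y t - c t) A \<longleftrightarrow>
      (\<forall>t\<ge>0. A t = exp (r * t) * (a + (LINT s:{0..t}|lborel. exp (- r * s) * (y s - c s))))" for A
      using has_drift_affine_iff[of "\<lambda>t. y t - c t" a r A, OF g] by (simp add: add_diff_eq)
    show ?thesis
      unfolding hd using key[OF _ ci] by (auto intro!: exI[of _ "\<lambda>t. exp (r * t) * (a + (LINT s:{0..t}|lborel. exp (- r * s) * (y s - c s)))"])
  qed
  \<comment> \<open>The finite right-hand side also returns the local integrability of c.\<close>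
  have fin: "set_integrable lborel {0..t} c"
    if "cum r c t \<le> ennreal (a - abar) + cum r (\<lambda>s. y s + r * abar) t" for t
    using that cc(1)[of t] cy(1)[of t] yi'[of t] by (auto simp: less_top[symmetric] top_unique)
  show ?thesis
  proof
    assume "(\<forall>t\<ge>0. set_integrable lborel {0..t} c) \<and>
      (\<exists>A. has_drift a (\<lambda>t. r * A t + y t - c t) A \<and> (\<forall>t\<ge>0. A t \<ge> abar))"
    then show "\<forall>t\<ge>0. cum r c t \<le> ennreal (a - abar) + cum r (\<lambda>s. y s + r * abar) t"
      using drift_iff by blast
  next
    assume R: "\<forall>t\<ge>0. cum r c t \<le> ennreal (a - abar) + cum r (\<lambda>s. y s + r * abar) t"
    then have "\<forall>t\<ge>0. set_integrable lborel {0..t} c" using fin by blast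
    then show "(\<forall>t\<ge>0. set_integrable lborel {0..t} c) \<and>
      (\<exists>A. has_drift a (\<lambda>t. r * A t + y t - c t) A \<and> (\<forall>t\<ge>0. A t \<ge> abar))"
      using drift_iff R by blast
  qed
qed

lemma nn_integral_halfline_shift:
  fixes g :: "real \<Rightarrow> ennreal"
  assumes g: "g \<in> borel_measurable halfline" and t: "t \<ge> 0"
  shows "(\<integral>\<^sup>+u. g (t + u) \<partial>halfline) = (\<integral>\<^sup>+s. g s * indicator {t..} s \<partial>halfline)"
proof -
  define f where "f s = g s * indicator {0..} s * indicator {t..} s" for s
  have "(\<lambda>s. g s * indicator {0..} s) \<in> borel_measurable lborel"
    using g unfolding halfline_def by (subst (asm) borel_measurable_restrict_space_iff_ennreal) auto
  then have f: "f \<in> borel_measurable borel" unfolding f_def by simp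
  have "(\<integral>\<^sup>+u. g (t + u) \<partial>halfline) = (\<integral>\<^sup>+u. f (t + 1 * u) \<partial>lborel)"
    unfolding nn_integral_halfline f_def using t by (intro nn_integral_cong) (auto simp: indicator_def)
  also have "\<dots> = (\<integral>\<^sup>+s. f s \<partial>lborel)"
    using nn_integral_real_affine[OF f, of 1 t] by simp
  also have "\<dots> = (\<integral>\<^sup>+s. g s * indicator {t..} s \<partial>halfline)"
    unfolding nn_integral_halfline f_def by (intro nn_integral_cong) (auto simp: indicator_def)
  finally show ?thesis .
qed

section \<open>The household and its discounted path measure\<close>

locale household = income_chain M F S rate inc
  for M :: "'w measure" and F :: "real \<Rightarrow> 'w measure" and S :: "real set"
    and rate :: "real \<Rightarrow> real \<Rightarrow> real" and inc :: "real \<Rightarrow> 'w \<Rightarrow> real" +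
  fixes \<rho> abar \<gamma> w \<tau> r :: real
  assumes \<rho>: "\<rho> > 0" and \<gamma>: "\<gamma> > 0" and w: "w > 0" and \<tau>: "\<tau> < 1" and r: "r < \<rho>"
    and feasible: "r * abar + w * (1 - \<tau>) * Min S > 0"
begin

lemma measurable_prog_pair:
  assumes f: "f \<in> borel_measurable N" "\<And>x. x \<in> space N \<Longrightarrow> f x \<in> {0..t}"
    and g: "g \<in> measurable N (F t)"
  shows "(\<lambda>x. (f x, g x)) \<in> measurable N (prog_space t)"
  using f g by (intro measurable_Pair measurable_restrict_space2) auto

lemma ident_measurable_F: "t \<ge> 0 \<Longrightarrow> (\<lambda>x. x) \<in> measurable M (F t)"
  using sub_F[of t] by (intro measurableI) (auto simp: subalgebra_def)

lemma section_measurable: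
  assumes c: "progressively_measurable F c" and t: "t \<ge> 0"
  shows "c t \<in> borel_measurable (F t)"
  using measurable_compose[OF measurable_prog_pair[of "\<lambda>_. t" "F t" t "\<lambda>x. x"] progressively_measurableD[OF c t]] t
  by simp

text \<open>Progressive measurability speaks of bounded time intervals; the processes frozen at time
  n are jointly measurable and converge pointwise.\<close>

lemma joint_measurable:
  assumes c: "progressively_measurable F c"
  shows "(\<lambda>p. c (fst p) (snd p)) \<in> borel_measurable (halfline \<Otimes>\<^sub>M M)"
proof (rule borel_measurable_LIMSEQ_real)
  fix n :: nat
  have "(\<lambda>p. (min (fst p) (real n), snd p)) \<in> measurable (halfline \<Otimes>\<^sub>M M) (prog_space (real n))"
  proof (rule measurable_prog_pair)
    show "(\<lambda>p. min (fst p) (real n)) \<in> borel_measurable (halfline \<Otimes>\<^sub>M M)" by measurable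
    show "snd \<in> measurable (halfline \<Otimes>\<^sub>M M) (F (real n))"
      by (rule measurable_compose[OF measurable_snd ident_measurable_F]) simp
  qed (auto simp: space_pair_measure)
  from measurable_compose[OF this progressively_measurableD[OF c]]
  show "(\<lambda>p. c (min (fst p) (real n)) (snd p)) \<in> borel_measurable (halfline \<Otimes>\<^sub>M M)" by simp
next
  fix p :: "real \<times> 'w"
  obtain N :: nat where N: "fst p \<le> real N" using real_arch_simple by blast
  have "\<forall>\<^sub>F n in sequentially. c (min (fst p) (real n)) (snd p) = c (fst p) (snd p)"
    using eventually_ge_at_top[of N] by eventually_elim (use N in \<open>auto simp: min_def\<close>)
  then show "(\<lambda>n. c (min (fst p) (real n)) (snd p)) \<longlonglongrightarrow> c (fst p) (snd p)"
    by (rule tendsto_eventually)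
qed

lemma joint_measurable_compose:
  assumes "progressively_measurable F c" "f \<in> measurable N halfline" "g \<in> measurable N M"
  shows "(\<lambda>x. c (f x) (g x)) \<in> borel_measurable N"
  using measurable_compose[OF measurable_Pair[OF assms(2,3)] joint_measurable[OF assms(1)]] by simp

lemma path_measurable:
  assumes "progressively_measurable F c" "\<omega> \<in> space M"
  shows "(\<lambda>s. c s \<omega>) \<in> borel_measurable halfline"
  by (rule joint_measurable_compose[OF assms(1)]) (use assms(2) in \<open>auto intro: measurable_ident_sets\<close>)

lemma progressive_cum:
  assumes e: "progressively_measurable F e" and t: "t \<ge> 0"
  shows "(\<lambda>p. cum r (\<lambda>v. e v (snd p)) (fst p)) \<in> borel_measurable (prog_space t)"
proof (rule measurable_cong[THEN iffD2])
  let ?L = "restrict_space lborel {0..t}"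
  show "cum r (\<lambda>v. e v (snd p)) (fst p) = (\<integral>\<^sup>+v. ennreal (exp (- r * v) * e v (snd p)) * (if v \<le> fst p then 1 else 0) \<partial>?L)"
    if "p \<in> space (prog_space t)" for p
    using that unfolding cum_def nn_integral_halfline space_prog_space
    by (subst nn_integral_restrict_space) (auto simp: indicator_def intro!: nn_integral_cong)
  interpret L: sigma_finite_measure ?L
    by (intro sigma_finite_measure_restrict_space sigma_finite_lborel) simp
  have v: "snd \<in> borel_measurable (prog_space t \<Otimes>\<^sub>M ?L)"
    by (rule measurable_compose[OF measurable_snd]) (rule measurable_restrict_space1, simp)
  have s: "(\<lambda>q. fst (fst q)) \<in> borel_measurable (prog_space t \<Otimes>\<^sub>M ?L)"
    by (rule measurable_compose[OF measurable_fst fst_prog_space])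
  have "(\<lambda>q. (snd q, snd (fst q))) \<in> measurable (prog_space t \<Otimes>\<^sub>M ?L) (prog_space t)"
    by (rule measurable_prog_pair[OF v]) (auto simp: space_pair_measure space_restrict_space)
  from measurable_compose[OF this progressively_measurableD[OF e t]]
  have ev: "(\<lambda>q. e (snd q) (snd (fst q))) \<in> borel_measurable (prog_space t \<Otimes>\<^sub>M ?L)" by simp
  show "(\<lambda>p. \<integral>\<^sup>+v. ennreal (exp (- r * v) * e v (snd p)) * (if v \<le> fst p then 1 else 0) \<partial>?L) \<in> borel_measurable (prog_space t)"
    by (rule L.borel_measurable_nn_integral) (use v s ev in \<open>simp add: case_prod_beta'\<close>)
qed

lemma joint_cum:
  assumes e: "progressively_measurable F e"
  shows "(\<lambda>p. cum r (\<lambda>v. e v (snd p)) (fst p)) \<in> borel_measurable (halfline \<Otimes>\<^sub>M M)"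
proof -
  interpret H: sigma_finite_measure halfline by (rule sigma_finite_halfline)
  have v: "snd \<in> borel_measurable ((halfline \<Otimes>\<^sub>M M) \<Otimes>\<^sub>M halfline)"
    by (rule measurable_compose[OF measurable_snd ident_halfline])
  have s: "(\<lambda>q. fst (fst q)) \<in> borel_measurable ((halfline \<Otimes>\<^sub>M M) \<Otimes>\<^sub>M halfline)"
    by (rule measurable_compose[OF measurable_fst measurable_compose[OF measurable_fst ident_halfline]])
  have ev: "(\<lambda>q. e (snd q) (snd (fst q))) \<in> borel_measurable ((halfline \<Otimes>\<^sub>M M) \<Otimes>\<^sub>M halfline)"
    by (rule joint_measurable_compose[OF e]) measurable
  have "(\<lambda>p. \<integral>\<^sup>+v. ennreal (exp (- r * v) * e v (snd p)) * (if v \<le> fst p then 1 else 0) \<partial>halfline) \<in> borel_measurable (halfline \<Otimes>\<^sub>M M)"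
    by (rule H.borel_measurable_nn_integral) (use v s ev in \<open>simp add: case_prod_beta'\<close>)
  then show ?thesis
    unfolding cum_def by (rule measurable_cong[THEN iffD1, rotated]) (auto intro!: nn_integral_cong simp: indicator_def)
qed

text \<open>The amount spent by time t depends on the path up to t only, so switching controls when
  it crosses a level stays progressive. All stopped controls below are built this way.\<close>

lemma progressive_if_cum:
  assumes e: "progressively_measurable F e" and f: "progressively_measurable F f" and g: "progressively_measurable F g"
  shows "progressively_measurable F (\<lambda>t \<omega>. if cum r (\<lambda>v. e v \<omega>) t < \<eta> then f t \<omega> else g t \<omega>)"
proof (rule progressively_measurableI)
  fix t :: real assume t: "t \<ge> 0"
  note [measurable] = progressive_cum[OF e t] progressively_measurableD[OF f t] progressively_measurableD[OF g t]
  show "(\<lambda>p. if cum r (\<lambda>v. e v (snd p)) (fst p) < \<eta> then f (fst p) (snd p) else g (fst p) (snd p)) \<in> borel_measurable (prog_space t)"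
    by measurable
qed

section \<open>The discounted measure on time and paths\<close>

definition discount :: "real measure" where
  "discount = density halfline (\<lambda>t. ennreal (exp (- \<rho> * t)))"

text \<open>Integrals under \<open>Q z\<close> are expected discounted time integrals. With time and
  path in one finite measure space, payoffs and costs become single Lebesgue integrals.\<close>

definition Q :: "real \<Rightarrow> (real \<times> 'w) measure" where
  "Q z = discount \<Otimes>\<^sub>M law z"

lemma sets_discount [measurable_cong]: "sets discount = sets halfline"
  by (simp add: discount_def)

lemma space_discount [simp]: "space discount = {0..}"
  by (simp add: discount_def)

lemma sets_Q [measurable_cong]: "sets (Q z) = sets (halfline \<Otimes>\<^sub>M M)"
  unfolding Q_def by (intro sets_pair_measure_cong sets_discount sets_law)

lemma space_Q [simp]: "space (Q z) = {0..} \<times> space M"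
  by (simp add: Q_def space_pair_measure)

lemma nn_integral_discount:
  "f \<in> borel_measurable halfline \<Longrightarrow> (\<integral>\<^sup>+t. f t \<partial>discount) = (\<integral>\<^sup>+t. ennreal (exp (- \<rho> * t)) * f t \<partial>halfline)"
  unfolding discount_def by (intro nn_integral_density) measurable

lemma nn_integral_exp_halfline:
  assumes "a > 0" shows "(\<integral>\<^sup>+t. ennreal (exp (- a * t)) \<partial>halfline) = ennreal (1 / a)"
proof -
  have "(\<integral>\<^sup>+t. ennreal (exp (- a * t)) * indicator {0..} t \<partial>lborel) = ennreal (0 - (- exp (- a * 0) / a))"
  proof (rule nn_integral_FTC_atLeast)
    show "DERIV (\<lambda>t. - exp (- a * t) / a) t :> exp (- a * t)" for t
      using assms by (auto intro!: derivative_eq_intros)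
    show "((\<lambda>t. - exp (- a * t) / a) \<longlongrightarrow> 0) at_top" using assms by real_asymp
  qed auto
  then show ?thesis by (simp add: nn_integral_halfline)
qed

lemma finite_measure_discount: "finite_measure discount"
proof (rule finite_measureI)
  have "emeasure discount (space discount) = (\<integral>\<^sup>+t. 1 \<partial>discount)" by simp
  also have "\<dots> = ennreal (1 / \<rho>)" using nn_integral_exp_halfline[OF \<rho>] by (subst nn_integral_discount) auto
  finally show "emeasure discount (space discount) \<noteq> \<infinity>" by simp
qed

context
  fixes z :: real
  assumes z: "z \<in> S"
begin

lemma Q_pair: "pair_sigma_finite discount (law z)"
  using finite_measure_discount prob_space_law[OF z]
  by (intro pair_sigma_finite.intro) (auto simp: finite_measure_def prob_space_def)

lemma finite_measure_Q: "finite_measure (Q z)"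
proof -
  interpret D: finite_measure discount by (rule finite_measure_discount)
  interpret L: prob_space "law z" by (rule prob_space_law[OF z])
  show ?thesis
  proof (rule finite_measureI)
    have "emeasure (Q z) (space (Q z)) = emeasure discount (space discount) * emeasure (law z) (space (law z))"
      unfolding Q_def space_pair_measure by (intro L.emeasure_pair_measure_Times sets.top)
    then show "emeasure (Q z) (space (Q z)) \<noteq> \<infinity>"
      using D.finite_emeasure_space L.emeasure_space_1 by (simp add: ennreal_mult_eq_top_iff)
  qed
qed

lemma nn_integral_Q:
  assumes f: "f \<in> borel_measurable (halfline \<Otimes>\<^sub>M M)"
  shows "(\<integral>\<^sup>+p. f p \<partial>Q z) = (\<integral>\<^sup>+\<omega>. (\<integral>\<^sup>+t. ennreal (exp (- \<rho> * t)) * f (t, \<omega>) \<partial>halfline) \<partial>law z)"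
    and "(\<integral>\<^sup>+p. f p \<partial>Q z) = (\<integral>\<^sup>+t. ennreal (exp (- \<rho> * t)) * (\<integral>\<^sup>+\<omega>. f (t, \<omega>) \<partial>law z) \<partial>halfline)"
proof -
  interpret P: pair_sigma_finite discount "law z" by (rule Q_pair)
  have fQ: "f \<in> borel_measurable (discount \<Otimes>\<^sub>M law z)"
    using f by (simp add: measurable_cong_sets[OF sets_Q refl, unfolded Q_def])
  have "(\<integral>\<^sup>+p. f p \<partial>Q z) = (\<integral>\<^sup>+\<omega>. (\<integral>\<^sup>+t. f (t, \<omega>) \<partial>discount) \<partial>law z)"
    using P.nn_integral_snd[OF fQ] by (simp add: Q_def)
  also have "\<dots> = (\<integral>\<^sup>+\<omega>. (\<integral>\<^sup>+t. ennreal (exp (- \<rho> * t)) * f (t, \<omega>) \<partial>halfline) \<partial>law z)"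
  proof (intro nn_integral_cong nn_integral_discount)
    fix \<omega> assume "\<omega> \<in> space (law z)"
    then show "(\<lambda>t. f (t, \<omega>)) \<in> borel_measurable halfline"
      using measurable_compose[OF measurable_Pair2' f] by simp
  qed
  finally show "(\<integral>\<^sup>+p. f p \<partial>Q z) = (\<integral>\<^sup>+\<omega>. (\<integral>\<^sup>+t. ennreal (exp (- \<rho> * t)) * f (t, \<omega>) \<partial>halfline) \<partial>law z)" .
  have "(\<integral>\<^sup>+p. f p \<partial>Q z) = (\<integral>\<^sup>+t. (\<integral>\<^sup>+\<omega>. f (t, \<omega>) \<partial>law z) \<partial>discount)"
    using P.M2.nn_integral_fst[OF fQ] by (simp add: Q_def)
  also have "\<dots> = (\<integral>\<^sup>+t. ennreal (exp (- \<rho> * t)) * (\<integral>\<^sup>+\<omega>. f (t, \<omega>) \<partial>law z) \<partial>halfline)"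
  proof (rule nn_integral_discount)
    show "(\<lambda>t. \<integral>\<^sup>+\<omega>. f (t, \<omega>) \<partial>law z) \<in> borel_measurable halfline"
      using P.M2.borel_measurable_nn_integral_fst[OF fQ] by (simp add: measurable_cong_sets[OF sets_discount refl])
  qed
  finally show "(\<integral>\<^sup>+p. f p \<partial>Q z) = (\<integral>\<^sup>+t. ennreal (exp (- \<rho> * t)) * (\<integral>\<^sup>+\<omega>. f (t, \<omega>) \<partial>law z) \<partial>halfline)" .
qed

lemma AE_Q:
  assumes "AE \<omega> in law z. \<forall>t\<ge>0. P t \<omega>"
  shows "AE p in Q z. P (fst p) (snd p)"
proof -
  interpret L: prob_space "law z" by (rule prob_space_law[OF z])
  obtain N where N: "{\<omega> \<in> space (law z). \<not> (\<forall>t\<ge>0. P t \<omega>)} \<subseteq> N" "emeasure (law z) N = 0" "N \<in> sets (law z)"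
    using assms by (rule AE_E)
  have "emeasure (Q z) ({0..} \<times> N) = emeasure discount {0..} * emeasure (law z) N"
    unfolding Q_def using sets.top[of discount] N(3) by (intro L.emeasure_pair_measure_Times) auto
  moreover have "{0..} \<times> N \<in> sets (Q z)"
    using sets.top[of discount] N(3) unfolding Q_def by (intro pair_measureI) auto
  ultimately have "{0..} \<times> N \<in> null_sets (Q z)" using N(2) by auto
  then show ?thesis by (rule AE_I') (use N(1) in force)
qed

lemma AE_Q_Z: "AE p in Q z. Z (fst p) (snd p) \<in> S \<and> fst p \<ge> 0 \<and> snd p \<in> space M"
  by (rule AE_I2) (auto simp: Z_in_S)

text \<open>
  Both identities express that \<open>exp (- \<alpha> t) f (Z t)\<close> is the conditional expectation at time \<open>t\<close> of
  the integral of \<open>exp (- \<alpha> s) h (Z s)\<close> over \<open>s \<ge> t\<close>; the second one integrates this against the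
  spending flow \<open>e\<close> and exchanges the order of integration.
\<close>

lemma resolvent_Q:
  assumes \<alpha>: "\<alpha> = \<rho> - r + \<theta>" "\<alpha> > 0" and h: "\<And>y. y \<in> S \<Longrightarrow> \<alpha> * f y - gen f y \<ge> 0"
  shows "(\<integral>\<^sup>+p. ennreal (exp ((r - \<theta>) * fst p) * (\<alpha> * f (Z (fst p) (snd p)) - gen f (Z (fst p) (snd p)))) \<partial>Q z) = ennreal (f z)"
proof -
  interpret L: prob_space "law z" by (rule prob_space_law[OF z])
  define h where "h y = \<alpha> * f y - gen f y" for y
  have hm: "progressively_measurable F (\<lambda>t \<omega>. h (Z t \<omega>))" by (rule progressively_measurable_fun_Z)
  have "(\<lambda>p. ennreal (exp ((r - \<theta>) * fst p) * h (Z (fst p) (snd p)))) \<in> borel_measurable (halfline \<Otimes>\<^sub>M M)"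
    using joint_measurable[OF hm] by measurable
  then have "(\<integral>\<^sup>+p. ennreal (exp ((r - \<theta>) * fst p) * h (Z (fst p) (snd p))) \<partial>Q z) =
     (\<integral>\<^sup>+t. ennreal (exp (- \<rho> * t)) * (\<integral>\<^sup>+\<omega>. ennreal (exp ((r - \<theta>) * t) * h (Z t \<omega>)) \<partial>law z) \<partial>halfline)"
    by (subst nn_integral_Q(2)) auto
  also have "\<dots> = (\<integral>\<^sup>+t. ennreal (exp (- \<alpha> * t) * semigroup t h z) \<partial>halfline)"
  proof (rule nn_integral_cong)
    fix t assume "t \<in> space halfline"
    then have t: "t \<ge> 0" by simp
    have [measurable]: "(\<lambda>\<omega>. h (Z t \<omega>)) \<in> borel_measurable M"
      using section_measurable[OF hm t] by (rule measurable_from_F[OF t])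
    have "(\<integral>\<^sup>+\<omega>. ennreal (h (Z t \<omega>)) \<partial>law z) = (\<integral>\<^sup>+\<omega>. 1 * ennreal (h (inc (0 + t) \<omega>)) \<partial>law z)"
      using AE_law_Z[OF z] by (intro nn_integral_cong_AE) (auto elim: eventually_mono)
    also have "\<dots> = (\<integral>\<^sup>+\<omega>. 1 * ennreal (semigroup t h (inc 0 \<omega>)) \<partial>law z)"
      using t assms(3) by (intro law_markov z) (auto simp: h_def)
    also have "\<dots> = (\<integral>\<^sup>+\<omega>. ennreal (semigroup t h z) \<partial>law z)"
      using AE_law_initial[OF z] by (intro nn_integral_cong_AE) (auto elim: eventually_mono)
    also have "\<dots> = ennreal (semigroup t h z)" using L.emeasure_space_1 by simp
    finally have e: "(\<integral>\<^sup>+\<omega>. ennreal (h (Z t \<omega>)) \<partial>law z) = ennreal (semigroup t h z)" .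
    have nn: "semigroup t h z \<ge> 0" using assms(3) by (intro semigroup_nonneg z t) (auto simp: h_def)
    have "(\<integral>\<^sup>+\<omega>. ennreal (exp ((r - \<theta>) * t) * h (Z t \<omega>)) \<partial>law z) = ennreal (exp ((r - \<theta>) * t)) * ennreal (semigroup t h z)"
      unfolding e[symmetric] by (subst nn_integral_cmult[symmetric]) (auto simp: ennreal_mult'[symmetric])
    then show "ennreal (exp (- \<rho> * t)) * (\<integral>\<^sup>+\<omega>. ennreal (exp ((r - \<theta>) * t) * h (Z t \<omega>)) \<partial>law z) =
       ennreal (exp (- \<alpha> * t) * semigroup t h z)"
      using nn by (simp add: ennreal_mult[symmetric] mult.assoc[symmetric] exp_add[symmetric] \<alpha>(1)) (simp add: algebra_simps)
  qed
  also have "\<dots> = ennreal (f z)"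
    using resolvent_identity[OF z \<alpha>(2) h] unfolding nn_integral_halfline h_def .
  finally show ?thesis by (simp add: h_def)
qed

lemma cost_identity:
  assumes \<alpha>: "\<alpha> = \<rho> - r + \<theta>" "\<alpha> > 0" and hn: "\<And>y. y \<in> S \<Longrightarrow> \<alpha> * f y - gen f y \<ge> 0"
    and e: "progressively_measurable F e"
  shows "(\<integral>\<^sup>+p. ennreal (e (fst p) (snd p)) * ennreal (exp (- \<theta> * fst p) * f (Z (fst p) (snd p))) \<partial>Q z) =
    (\<integral>\<^sup>+p. cum r (\<lambda>v. e v (snd p)) (fst p) *
       ennreal (exp ((r - \<theta>) * fst p) * (\<alpha> * f (Z (fst p) (snd p)) - gen f (Z (fst p) (snd p)))) \<partial>Q z)"
proof -
  interpret H: sigma_finite_measure halfline by (rule sigma_finite_halfline)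
  interpret L: prob_space "law z" by (rule prob_space_law[OF z])
  interpret HL: pair_sigma_finite halfline "law z" by unfold_locales
  interpret HH: pair_sigma_finite halfline halfline by unfold_locales
  define h where "h y = \<alpha> * f y - gen f y" for y
  have h: "h y \<ge> 0" if "y \<in> S" for y using hn[OF that] by (simp add: h_def)
  have fm: "progressively_measurable F (\<lambda>t \<omega>. f (Z t \<omega>))" and hm: "progressively_measurable F (\<lambda>t \<omega>. h (Z t \<omega>))"
    by (rule progressively_measurable_fun_Z)+
  note [measurable (raw)] = joint_measurable_compose[OF fm] joint_measurable_compose[OF hm] joint_measurable_compose[OF e]
  \<comment> \<open>The price at time t is written as a resolvent integral of h, the Markov property
    turns the semigroup into \<open>h (Z (t + u))\<close> under the expectation, and s = t + u
    restores calendar time.\<close>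
  have inner: "(\<integral>\<^sup>+\<omega>. ennreal (e t \<omega>) * ennreal (f (Z t \<omega>)) \<partial>law z) =
     (\<integral>\<^sup>+\<omega>. \<integral>\<^sup>+s. ennreal (exp (\<alpha> * t)) * (ennreal (e t \<omega>) * (ennreal (exp (- \<alpha> * s) * h (Z s \<omega>)) * indicator {t..} s)) \<partial>halfline \<partial>law z)"
    if t: "t \<ge> 0" for t
  proof -
    have tm: "(\<lambda>_. t) \<in> measurable N halfline" for N :: "'n measure" using t by (intro measurable_const) simp
    have tum: "(\<lambda>u. t + u) \<in> measurable halfline halfline"
      using t by (intro measurable_into_halfline) auto
    have etF: "(\<lambda>\<omega>. ennreal (e t \<omega>)) \<in> borel_measurable (F t)" using section_measurable[OF e t] by measurable
    have etM [measurable]: "(\<lambda>\<omega>. ennreal (e t \<omega>)) \<in> borel_measurable (law z)"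
      using measurable_from_F[OF t etF] by simp
    have sgm [measurable]: "(\<lambda>p. semigroup (fst p) h (Z t (snd p))) \<in> borel_measurable (halfline \<Otimes>\<^sub>M law z)"
    proof -
      have "(\<lambda>p. \<Sum>y\<in>S. indicator {y} (Z t (snd p)) * semigroup (fst p) h y) \<in> borel_measurable (halfline \<Otimes>\<^sub>M law z)"
      proof (intro borel_measurable_sum borel_measurable_times)
        fix y assume "y \<in> S"
        then have "(\<lambda>u. semigroup u h y) \<in> borel_measurable halfline"
          by (intro measurable_halfline borel_measurable_continuous_onI continuous_on_semigroup)
        then show "(\<lambda>p. semigroup (fst p) h y) \<in> borel_measurable (halfline \<Otimes>\<^sub>M law z)"
          by (rule measurable_compose[OF measurable_fst])
        have "Z t \<in> borel_measurable M" using Z_adapted[OF t] by (rule measurable_from_F[OF t])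
        then have "(\<lambda>p. Z t (snd p)) \<in> borel_measurable (halfline \<Otimes>\<^sub>M law z)"
          by (intro measurable_compose[OF measurable_snd]) simp
        then show "(\<lambda>p. indicator {y} (Z t (snd p)) :: real) \<in> borel_measurable (halfline \<Otimes>\<^sub>M law z)"
          by measurable
      qed
      then show ?thesis
      proof (rule measurable_cong[THEN iffD1, rotated])
        fix p assume "p \<in> space (halfline \<Otimes>\<^sub>M law z)"
        then have "Z t (snd p) \<in> S" using Z_in_S[OF t] by (auto simp: space_pair_measure)
        then show "(\<Sum>y\<in>S. indicator {y} (Z t (snd p)) * semigroup (fst p) h y) = semigroup (fst p) h (Z t (snd p))"
          using finite_S by (subst sum.remove[of _ "Z t (snd p)"]) (auto intro!: sum.neutral)
      qed
    qed
    have "(\<integral>\<^sup>+\<omega>. ennreal (e t \<omega>) * ennreal (f (Z t \<omega>)) \<partial>law z)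
      = (\<integral>\<^sup>+\<omega>. \<integral>\<^sup>+u. ennreal (exp (- \<alpha> * u)) * (ennreal (e t \<omega>) * ennreal (semigroup u h (Z t \<omega>))) \<partial>halfline \<partial>law z)"
    proof (rule nn_integral_cong)
      fix \<omega> assume "\<omega> \<in> space (law z)"
      then have \<omega>: "\<omega> \<in> space M" and ZS: "Z t \<omega> \<in> S" using Z_in_S[OF t] by auto
      have "(\<lambda>u. ennreal (exp (- \<alpha> * u) * semigroup u h (Z t \<omega>))) \<in> borel_measurable halfline"
        using ZS by (intro measurable_halfline measurable_compose[OF _ measurable_ennreal]
          borel_measurable_continuous_onI continuous_intros continuous_on_semigroup)
      then have "ennreal (e t \<omega>) * (\<integral>\<^sup>+u. ennreal (exp (- \<alpha> * u) * semigroup u h (Z t \<omega>)) \<partial>halfline)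
        = (\<integral>\<^sup>+u. ennreal (e t \<omega>) * ennreal (exp (- \<alpha> * u) * semigroup u h (Z t \<omega>)) \<partial>halfline)"
        by (intro nn_integral_cmult[symmetric])
      moreover have "(\<integral>\<^sup>+u. ennreal (exp (- \<alpha> * u) * semigroup u h (Z t \<omega>)) \<partial>halfline) = ennreal (f (Z t \<omega>))"
        using resolvent_identity[OF ZS \<alpha>(2) hn] unfolding nn_integral_halfline h_def .
      ultimately show "ennreal (e t \<omega>) * ennreal (f (Z t \<omega>)) =
          (\<integral>\<^sup>+u. ennreal (exp (- \<alpha> * u)) * (ennreal (e t \<omega>) * ennreal (semigroup u h (Z t \<omega>))) \<partial>halfline)"
        by (simp add: ennreal_mult' mult.left_commute)
    qed
    also have "\<dots> = (\<integral>\<^sup>+u. \<integral>\<^sup>+\<omega>. ennreal (exp (- \<alpha> * u)) * (ennreal (e t \<omega>) * ennreal (semigroup u h (Z t \<omega>))) \<partial>law z \<partial>halfline)"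
      by (rule HL.Fubini') (simp add: case_prod_beta')
    also have "\<dots> = (\<integral>\<^sup>+u. \<integral>\<^sup>+\<omega>. ennreal (exp (- \<alpha> * u)) * (ennreal (e t \<omega>) * ennreal (h (Z (t + u) \<omega>))) \<partial>law z \<partial>halfline)"
    proof (rule nn_integral_cong)
      fix u assume "u \<in> space halfline"
      then have u: "u \<ge> 0" by simp
      have "Z t \<in> borel_measurable M" using Z_adapted[OF t] by (rule measurable_from_F[OF t])
      then have [measurable]: "(\<lambda>\<omega>. semigroup u h (Z t \<omega>)) \<in> borel_measurable M"
        by (rule finite_range_measurable) (rule Z_in_S[OF t])
      have [measurable]: "(\<lambda>\<omega>. h (Z (t + u) \<omega>)) \<in> borel_measurable M"
        using section_measurable[OF hm, of "t + u"] measurable_from_F[of "t + u"] t u by simp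
      have "(\<integral>\<^sup>+\<omega>. ennreal (e t \<omega>) * ennreal (semigroup u h (Z t \<omega>)) \<partial>law z) =
          (\<integral>\<^sup>+\<omega>. ennreal (e t \<omega>) * ennreal (semigroup u h (inc t \<omega>)) \<partial>law z)"
        using AE_law_Z[OF z] by (intro nn_integral_cong_AE) (auto elim: eventually_mono)
      also have "\<dots> = (\<integral>\<^sup>+\<omega>. ennreal (e t \<omega>) * ennreal (h (inc (t + u) \<omega>)) \<partial>law z)"
        using h by (intro law_markov[OF z t u etF, symmetric])
      also have "\<dots> = (\<integral>\<^sup>+\<omega>. ennreal (e t \<omega>) * ennreal (h (Z (t + u) \<omega>)) \<partial>law z)"
        using AE_law_Z[OF z] by (intro nn_integral_cong_AE) (auto elim: eventually_mono)
      finally show "(\<integral>\<^sup>+\<omega>. ennreal (exp (- \<alpha> * u)) * (ennreal (e t \<omega>) * ennreal (semigroup u h (Z t \<omega>))) \<partial>law z) =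
        (\<integral>\<^sup>+\<omega>. ennreal (exp (- \<alpha> * u)) * (ennreal (e t \<omega>) * ennreal (h (Z (t + u) \<omega>))) \<partial>law z)"
        by (simp add: nn_integral_cmult)
    qed
    also have "\<dots> = (\<integral>\<^sup>+\<omega>. \<integral>\<^sup>+u. ennreal (exp (- \<alpha> * u)) * (ennreal (e t \<omega>) * ennreal (h (Z (t + u) \<omega>))) \<partial>halfline \<partial>law z)"
    proof (rule HL.Fubini'[symmetric])
      have "(\<lambda>p. h (Z (t + fst p) (snd p))) \<in> borel_measurable (halfline \<Otimes>\<^sub>M law z)"
        by (rule joint_measurable_compose[OF hm measurable_compose[OF measurable_fst tum]]) measurable
      then show "(\<lambda>(u, \<omega>). ennreal (exp (- \<alpha> * u)) * (ennreal (e t \<omega>) * ennreal (h (Z (t + u) \<omega>)))) \<in> borel_measurable (halfline \<Otimes>\<^sub>M law z)"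
        by (simp add: case_prod_beta')
    qed
    also have "\<dots> = (\<integral>\<^sup>+\<omega>. \<integral>\<^sup>+s. ennreal (exp (\<alpha> * t)) * (ennreal (e t \<omega>) * (ennreal (exp (- \<alpha> * s) * h (Z s \<omega>)) * indicator {t..} s)) \<partial>halfline \<partial>law z)"
    proof (rule nn_integral_cong)
      fix \<omega> assume "\<omega> \<in> space (law z)"
      then have \<omega>: "\<omega> \<in> space M" by simp
      let ?g = "\<lambda>s. ennreal (exp (\<alpha> * t)) * (ennreal (e t \<omega>) * ennreal (exp (- \<alpha> * s) * h (Z s \<omega>)))"
      have "?g \<in> borel_measurable halfline" using path_measurable[OF hm \<omega>] by measurable
      from nn_integral_halfline_shift[OF this t]
      have "(\<integral>\<^sup>+u. ?g (t + u) \<partial>halfline) = (\<integral>\<^sup>+s. ?g s * indicator {t..} s \<partial>halfline)" .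
      moreover have "?g (t + u) = ennreal (exp (- \<alpha> * u)) * (ennreal (e t \<omega>) * ennreal (h (Z (t + u) \<omega>)))" for u
      proof -
        have "exp (\<alpha> * t) * exp (- \<alpha> * (t + u)) = exp (- \<alpha> * u)" by (simp add: exp_add[symmetric] algebra_simps)
        then have eq: "ennreal (exp (\<alpha> * t)) * ennreal (exp (- \<alpha> * (t + u))) = ennreal (exp (- \<alpha> * u))"
          by (simp add: ennreal_mult'[symmetric])
        have "ennreal (exp (- \<alpha> * (t + u)) * h (Z (t + u) \<omega>)) = ennreal (exp (- \<alpha> * (t + u))) * ennreal (h (Z (t + u) \<omega>))"
          by (rule ennreal_mult') simp
        then show ?thesis unfolding eq[symmetric] by (simp only: mult_ac)
      qed
      ultimately show "(\<integral>\<^sup>+u. ennreal (exp (- \<alpha> * u)) * (ennreal (e t \<omega>) * ennreal (h (Z (t + u) \<omega>))) \<partial>halfline) =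
         (\<integral>\<^sup>+s. ennreal (exp (\<alpha> * t)) * (ennreal (e t \<omega>) * (ennreal (exp (- \<alpha> * s) * h (Z s \<omega>)) * indicator {t..} s)) \<partial>halfline)"
        by (simp add: mult.assoc)
    qed
    finally show ?thesis .
  qed
  \<comment> \<open>Spending at t is charged at all later times s. Integrating over t for fixed s
    leaves \<open>cum\<close> up to time s.\<close>
  let ?E = "\<lambda>t \<omega> s. ennreal (exp (- r * t) * e t \<omega>) * (ennreal (exp (- \<alpha> * s) * h (Z s \<omega>)) * (if t \<le> s then 1 else 0))"
  have expt: "ennreal (exp (- \<rho> * t)) * (ennreal (exp (- \<theta> * t)) * (ennreal (exp (\<alpha> * t)) * (ennreal a * b))) = ennreal (exp (- r * t) * a) * b" for t a b
  proof -
    have "exp (- \<rho> * t) * exp (- \<theta> * t) * exp (\<alpha> * t) = exp (- r * t)"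
      by (simp add: exp_add[symmetric] \<alpha>(1) algebra_simps)
    then have eq: "ennreal (exp (- \<rho> * t)) * ennreal (exp (- \<theta> * t)) * ennreal (exp (\<alpha> * t)) = ennreal (exp (- r * t))"
      by (simp add: ennreal_mult'[symmetric])
    have "ennreal (exp (- r * t) * a) = ennreal (exp (- r * t)) * ennreal a" by (rule ennreal_mult') simp
    then show ?thesis unfolding eq[symmetric] by (simp only: mult.assoc)
  qed
  have Em: "(\<lambda>((t, \<omega>), s). ?E t \<omega> s) \<in> borel_measurable ((halfline \<Otimes>\<^sub>M law z) \<Otimes>\<^sub>M halfline)"
  proof -
    have fs: "(\<lambda>x. fst (fst x)) \<in> measurable ((halfline \<Otimes>\<^sub>M law z) \<Otimes>\<^sub>M halfline) halfline"
      "(\<lambda>x. snd (fst x)) \<in> measurable ((halfline \<Otimes>\<^sub>M law z) \<Otimes>\<^sub>M halfline) M"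
      "snd \<in> measurable ((halfline \<Otimes>\<^sub>M law z) \<Otimes>\<^sub>M halfline) halfline"
      by measurable
    have [measurable]: "(\<lambda>x. fst (fst x)) \<in> borel_measurable ((halfline \<Otimes>\<^sub>M law z) \<Otimes>\<^sub>M halfline)"
      "snd \<in> borel_measurable ((halfline \<Otimes>\<^sub>M law z) \<Otimes>\<^sub>M halfline)"
      using measurable_compose[OF fs(1) ident_halfline] measurable_compose[OF fs(3) ident_halfline] by auto
    note [measurable] = joint_measurable_compose[OF e fs(1,2)] joint_measurable_compose[OF hm fs(3,2)]
    show ?thesis by (simp add: case_prod_beta')
  qed
  have "(\<integral>\<^sup>+p. ennreal (e (fst p) (snd p)) * ennreal (exp (- \<theta> * fst p) * f (Z (fst p) (snd p))) \<partial>Q z) =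
    (\<integral>\<^sup>+t. ennreal (exp (- \<rho> * t)) * (\<integral>\<^sup>+\<omega>. ennreal (e t \<omega>) * ennreal (exp (- \<theta> * t) * f (Z t \<omega>)) \<partial>law z) \<partial>halfline)"
    using joint_measurable[OF e] joint_measurable[OF fm] by (subst nn_integral_Q(2)) auto
  also have "\<dots> = (\<integral>\<^sup>+t. \<integral>\<^sup>+\<omega>. \<integral>\<^sup>+s. ?E t \<omega> s \<partial>halfline \<partial>law z \<partial>halfline)"
  proof (rule nn_integral_cong)
    fix t assume "t \<in> space halfline"
    then have t: "t \<ge> 0" by simp
    have tm: "(\<lambda>_. t) \<in> measurable (law z) halfline" using t by (intro measurable_const) simp
    have [measurable]: "(\<lambda>\<omega>. e t \<omega>) \<in> borel_measurable (law z)" "(\<lambda>\<omega>. f (Z t \<omega>)) \<in> borel_measurable (law z)"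
      by (rule joint_measurable_compose[OF e tm] joint_measurable_compose[OF fm tm]; simp)+
    have km: "(\<lambda>p. ennreal (exp (\<alpha> * t)) * (ennreal (e t (fst p)) * (ennreal (exp (- \<alpha> * snd p) * h (Z (snd p) (fst p))) * indicator {t..} (snd p)))) \<in> borel_measurable (law z \<Otimes>\<^sub>M halfline)"
    proof -
      have [measurable]: "(\<lambda>p. h (Z (snd p) (fst p))) \<in> borel_measurable (law z \<Otimes>\<^sub>M halfline)"
        by (rule joint_measurable_compose[OF hm]) measurable
      show ?thesis by measurable
    qed
    have out: "(\<integral>\<^sup>+\<omega>. ennreal (e t \<omega>) * ennreal (exp (- \<theta> * t) * f (Z t \<omega>)) \<partial>law z) =
      ennreal (exp (- \<theta> * t)) * (\<integral>\<^sup>+\<omega>. ennreal (e t \<omega>) * ennreal (f (Z t \<omega>)) \<partial>law z)"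
      by (subst nn_integral_cmult[symmetric]) (auto simp: ennreal_mult' mult.left_commute)
    have "ennreal (exp (- \<rho> * t)) * (\<integral>\<^sup>+\<omega>. ennreal (e t \<omega>) * ennreal (exp (- \<theta> * t) * f (Z t \<omega>)) \<partial>law z) =
      (\<integral>\<^sup>+\<omega>. \<integral>\<^sup>+s. ennreal (exp (- \<rho> * t)) * (ennreal (exp (- \<theta> * t)) * (ennreal (exp (\<alpha> * t)) * (ennreal (e t \<omega>) * (ennreal (exp (- \<alpha> * s) * h (Z s \<omega>)) * indicator {t..} s)))) \<partial>halfline \<partial>law z)"
    proof -
      let ?k = "\<lambda>\<omega> s. ennreal (exp (\<alpha> * t)) * (ennreal (e t \<omega>) * (ennreal (exp (- \<alpha> * s) * h (Z s \<omega>)) * indicator {t..} s))"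
      have k1: "?k \<omega> \<in> borel_measurable halfline" if "\<omega> \<in> space M" for \<omega>
        using measurable_compose[OF measurable_Pair1'[of \<omega> "law z" halfline] km] that by simp
      have k2: "(\<lambda>\<omega>. \<integral>\<^sup>+s. ?k \<omega> s \<partial>halfline) \<in> borel_measurable (law z)"
        using H.borel_measurable_nn_integral_fst[OF km] by simp
      have "(\<integral>\<^sup>+\<omega>. \<integral>\<^sup>+s. ennreal (exp (- \<rho> * t)) * (ennreal (exp (- \<theta> * t)) * ?k \<omega> s) \<partial>halfline \<partial>law z) =
         (\<integral>\<^sup>+\<omega>. ennreal (exp (- \<rho> * t)) * (ennreal (exp (- \<theta> * t)) * (\<integral>\<^sup>+s. ?k \<omega> s \<partial>halfline)) \<partial>law z)"
        using k1 by (intro nn_integral_cong) (simp add: nn_integral_cmult)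
      also have "\<dots> = ennreal (exp (- \<rho> * t)) * (ennreal (exp (- \<theta> * t)) * (\<integral>\<^sup>+\<omega>. \<integral>\<^sup>+s. ?k \<omega> s \<partial>halfline \<partial>law z))"
        using k2 by (simp add: nn_integral_cmult)
      finally show ?thesis unfolding out inner[OF t] by (rule sym)
    qed
    also have "\<dots> = (\<integral>\<^sup>+\<omega>. \<integral>\<^sup>+s. ?E t \<omega> s \<partial>halfline \<partial>law z)"
    proof (intro nn_integral_cong)
      fix \<omega> s
      have i: "indicator {t..} s = (if t \<le> s then 1 else 0 :: ennreal)" by (simp add: indicator_def)
      show "ennreal (exp (- \<rho> * t)) * (ennreal (exp (- \<theta> * t)) * (ennreal (exp (\<alpha> * t)) * (ennreal (e t \<omega>) * (ennreal (exp (- \<alpha> * s) * h (Z s \<omega>)) * indicator {t..} s)))) = ?E t \<omega> s"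
        unfolding expt i ..
    qed
    finally show "ennreal (exp (- \<rho> * t)) * (\<integral>\<^sup>+\<omega>. ennreal (e t \<omega>) * ennreal (exp (- \<theta> * t) * f (Z t \<omega>)) \<partial>law z) =
      (\<integral>\<^sup>+\<omega>. \<integral>\<^sup>+s. ?E t \<omega> s \<partial>halfline \<partial>law z)" .
  qed
  also have "\<dots> = (\<integral>\<^sup>+\<omega>. \<integral>\<^sup>+t. \<integral>\<^sup>+s. ?E t \<omega> s \<partial>halfline \<partial>halfline \<partial>law z)"
  proof (rule HL.Fubini'[symmetric])
    show "(\<lambda>(t, \<omega>). \<integral>\<^sup>+s. ?E t \<omega> s \<partial>halfline) \<in> borel_measurable (halfline \<Otimes>\<^sub>M law z)"
      using H.borel_measurable_nn_integral_fst[OF Em] by (simp add: case_prod_beta')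
  qed
  also have "\<dots> = (\<integral>\<^sup>+\<omega>. \<integral>\<^sup>+s. \<integral>\<^sup>+t. ?E t \<omega> s \<partial>halfline \<partial>halfline \<partial>law z)"
  proof (rule nn_integral_cong)
    fix \<omega> assume "\<omega> \<in> space (law z)"
    then have \<omega>: "\<omega> \<in> space M" by simp
    have [measurable]: "(\<lambda>t. e t \<omega>) \<in> borel_measurable halfline" "(\<lambda>t. h (Z t \<omega>)) \<in> borel_measurable halfline"
      using path_measurable[OF e \<omega>] path_measurable[OF hm \<omega>] by auto
    have [measurable]: "fst \<in> borel_measurable (halfline \<Otimes>\<^sub>M halfline)" "snd \<in> borel_measurable (halfline \<Otimes>\<^sub>M halfline)"
      by (rule measurable_compose[OF measurable_fst ident_halfline] measurable_compose[OF measurable_snd ident_halfline])+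
    show "(\<integral>\<^sup>+t. \<integral>\<^sup>+s. ?E t \<omega> s \<partial>halfline \<partial>halfline) = (\<integral>\<^sup>+s. \<integral>\<^sup>+t. ?E t \<omega> s \<partial>halfline \<partial>halfline)"
      by (rule HH.Fubini'[symmetric, of "\<lambda>t s. ?E t \<omega> s"]) (simp add: case_prod_beta')
  qed
  also have "\<dots> = (\<integral>\<^sup>+\<omega>. \<integral>\<^sup>+s. ennreal (exp (- \<rho> * s)) * (cum r (\<lambda>v. e v \<omega>) s * ennreal (exp ((r - \<theta>) * s) * h (Z s \<omega>))) \<partial>halfline \<partial>law z)"
  proof (intro nn_integral_cong)
    fix \<omega> s assume "\<omega> \<in> space (law z)" "s \<in> space halfline"
    then have \<omega>: "\<omega> \<in> space M" by simp
    have [measurable]: "(\<lambda>t. e t \<omega>) \<in> borel_measurable halfline" using path_measurable[OF e \<omega>] .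
    have "(\<integral>\<^sup>+t. ?E t \<omega> s \<partial>halfline) = (\<integral>\<^sup>+t. ennreal (exp (- \<alpha> * s) * h (Z s \<omega>)) * (ennreal (exp (- r * t) * e t \<omega>) * indicator {..s} t) \<partial>halfline)"
      by (intro nn_integral_cong) (simp add: indicator_def mult.commute)
    also have "\<dots> = ennreal (exp (- \<alpha> * s) * h (Z s \<omega>)) * cum r (\<lambda>v. e v \<omega>) s"
      unfolding cum_def by (rule nn_integral_cmult) measurable
    finally have c: "(\<integral>\<^sup>+t. ?E t \<omega> s \<partial>halfline) = ennreal (exp (- \<alpha> * s) * h (Z s \<omega>)) * cum r (\<lambda>v. e v \<omega>) s" .
    have d: "ennreal (exp (- \<alpha> * s) * h (Z s \<omega>)) = ennreal (exp (- \<rho> * s)) * ennreal (exp ((r - \<theta>) * s) * h (Z s \<omega>))"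
      by (simp add: ennreal_mult'[symmetric] mult.assoc[symmetric] exp_add[symmetric] \<alpha>(1)) (simp add: algebra_simps)
    show "(\<integral>\<^sup>+t. ?E t \<omega> s \<partial>halfline) = ennreal (exp (- \<rho> * s)) * (cum r (\<lambda>v. e v \<omega>) s * ennreal (exp ((r - \<theta>) * s) * h (Z s \<omega>)))"
      unfolding c unfolding d by (simp only: mult_ac)
  qed
  also have "\<dots> = (\<integral>\<^sup>+p. cum r (\<lambda>v. e v (snd p)) (fst p) * ennreal (exp ((r - \<theta>) * fst p) * h (Z (fst p) (snd p))) \<partial>Q z)"
    using joint_cum[OF e] joint_measurable[OF hm] by (subst nn_integral_Q(1)) auto
  finally show ?thesis by (simp add: h_def)
qed

end

end

section \<open>Payoffs and the value function\<close>

context household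
begin

text \<open>
  Wealth is measured from the borrowing limit: \<open>x\<close> stands for \<open>a - abar\<close>, and income at wealth \<open>x\<close> is
  \<open>earnings y + r * x\<close>.
\<close>

definition earnings :: "real \<Rightarrow> real" where
  "earnings y = r * abar + w * (1 - \<tau>) * y"

text \<open>Admissibility with the wealth process eliminated by \<open>budget_iff\<close> and with Z
  in place of \<open>inc\<close>.\<close>

definition adm :: "real \<Rightarrow> real \<Rightarrow> (real \<Rightarrow> 'w \<Rightarrow> real) \<Rightarrow> bool" where
  "adm x z c \<longleftrightarrow> progressively_measurable F c \<and> (\<forall>t\<ge>0. \<forall>\<omega>\<in>space M. c t \<omega> > 0) \<and>
     (AE \<omega> in law z. \<forall>t\<ge>0. cum r (\<lambda>s. c s \<omega>) t \<le> ennreal x + cum r (\<lambda>s. earnings (Z s \<omega>)) t)"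

definition J :: "real \<Rightarrow> (real \<Rightarrow> 'w \<Rightarrow> real) \<Rightarrow> real" where
  "J z c = (\<integral>p. crra \<gamma> (c (fst p) (snd p)) \<partial>Q z)"

text \<open>Admissible controls outside this class have payoff minus infinity
  (\<open>payoff_eq\<close>); leaving them out makes V a supremum of real numbers.\<close>

definition good :: "real \<Rightarrow> real \<Rightarrow> (real \<Rightarrow> 'w \<Rightarrow> real) \<Rightarrow> bool" where
  "good x z c \<longleftrightarrow> adm x z c \<and> integrable (Q z) (\<lambda>p. crra \<gamma> (c (fst p) (snd p)))"

definition V :: "real \<Rightarrow> real \<Rightarrow> real" where
  "V x z = Sup (J z ` {c. good x z c})"

lemma wt_pos: "w * (1 - \<tau>) > 0"
  using w \<tau> by simp

lemma earnings_Min_pos: "earnings (Min S) > 0"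
  using feasible by (simp add: earnings_def)

lemma earnings_mono: "x \<le> y \<Longrightarrow> earnings x \<le> earnings y"
  unfolding earnings_def by (intro add_left_mono mult_left_mono) (use wt_pos in auto)

lemma earnings_bounds:
  assumes "y \<in> S"
  shows "earnings (Min S) \<le> earnings y" "earnings y \<le> earnings (Max S)" "earnings y > 0"
  using assms finite_S earnings_Min_pos earnings_mono[of "Min S" y] earnings_mono[of y "Max S"] by auto

lemma adm_progressive: "adm x z c \<Longrightarrow> progressively_measurable F c"
  by (simp add: adm_def)

lemma adm_pos: "adm x z c \<Longrightarrow> t \<ge> 0 \<Longrightarrow> \<omega> \<in> space M \<Longrightarrow> c t \<omega> > 0"
  by (simp add: adm_def)

lemma measurable_Q:
  "progressively_measurable F c \<Longrightarrow> (\<lambda>p. c (fst p) (snd p)) \<in> borel_measurable (Q z)"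
  using joint_measurable by (simp add: measurable_cong_sets[OF sets_Q refl])

lemma fst_measurable_Q: "fst \<in> borel_measurable (Q z)"
  unfolding measurable_cong_sets[OF sets_Q refl] by (rule measurable_compose[OF measurable_fst ident_halfline])

lemma measurable_Q_Z: "(\<lambda>p. f (Z (fst p) (snd p)) :: real) \<in> borel_measurable (Q z)"
  by (rule measurable_Q[OF progressively_measurable_fun_Z])

lemma finite_fun_bound:
  obtains B where "B \<ge> 0" "\<And>y. y \<in> S \<Longrightarrow> \<bar>f y :: real\<bar> \<le> B"
proof
  show "0 \<le> (\<Sum>y\<in>S. \<bar>f y\<bar>)" by (simp add: sum_nonneg)
  show "\<bar>f y\<bar> \<le> (\<Sum>y\<in>S. \<bar>f y\<bar>)" if "y \<in> S" for y using finite_S that by (intro member_le_sum) auto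
qed

lemma cum_earnings_finite:
  assumes "\<omega> \<in> space M" shows "cum r (\<lambda>s. earnings (Z s \<omega>)) t < \<infinity>"
proof -
  have m: "(\<lambda>s. earnings (Z s \<omega>)) \<in> borel_measurable halfline"
    by (rule path_measurable[OF progressively_measurable_fun_Z assms])
  have pos: "\<forall>s\<ge>0. earnings (Z s \<omega>) \<ge> 0" using earnings_bounds(3) Z_in_S assms by (auto intro: less_imp_le)
  have "set_integrable lborel {0..t} (\<lambda>s. indicator {0..} s *\<^sub>R earnings (Z s \<omega>))"
  proof (rule set_integrable_bounded_Icc[where M = "earnings (Max S)"])
    show "(\<lambda>s. indicator {0..} s *\<^sub>R earnings (Z s \<omega>)) \<in> borel_measurable borel"
      using m unfolding halfline_def by (subst (asm) borel_measurable_restrict_space_iff) auto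
    show "\<bar>indicator {0..} s *\<^sub>R earnings (Z s \<omega>)\<bar> \<le> earnings (Max S)" if "s \<in> {0..t}" for s
      using that earnings_bounds(2,3)[OF Z_in_S[of s \<omega>]] assms by auto
  qed
  then have "set_integrable lborel {0..t} (\<lambda>s. earnings (Z s \<omega>))"
    by (rule set_integrable_cong[THEN iffD1, OF refl refl, rotated]) auto
  then show ?thesis using cum_eq_integral(1)[OF m pos] by simp
qed

lemma admissible_iff:
  assumes z: "z \<in> S" and a: "a \<ge> abar"
  shows "admissible M F inc abar w \<tau> r a z c \<longleftrightarrow> adm (a - abar) z c"
proof (cases "progressively_measurable F c \<and> (\<forall>t\<ge>0. \<forall>\<omega>\<in>space M. c t \<omega> > 0)")
  case False
  then show ?thesis unfolding admissible_def adm_def by blast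
next
  case True
  then have c: "progressively_measurable F c" and pos: "\<And>t \<omega>. t \<ge> 0 \<Longrightarrow> \<omega> \<in> space M \<Longrightarrow> c t \<omega> > 0" by auto
  define P where "P \<omega> \<alpha> \<longleftrightarrow> has_drift a (\<lambda>t. r * \<alpha> t + w * (1 - \<tau>) * inc t \<omega> - c t \<omega>) \<alpha> \<and> (\<forall>t\<ge>0. \<alpha> t \<ge> abar)" for \<omega> and \<alpha> :: "real \<Rightarrow> real"
  have path: "(\<forall>t\<ge>0. set_integrable lborel {0..t} (\<lambda>s. c s \<omega>)) \<and> (\<exists>\<alpha>. P \<omega> \<alpha>) \<longleftrightarrow>
      (\<forall>t\<ge>0. cum r (\<lambda>s. c s \<omega>) t \<le> ennreal (a - abar) + cum r (\<lambda>s. earnings (Z s \<omega>)) t)"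
    if \<omega>: "\<omega> \<in> space M" and Zi: "\<forall>t. Z t \<omega> = inc t \<omega>" for \<omega>
  proof -
    have "(\<forall>t\<ge>0. set_integrable lborel {0..t} (\<lambda>s. c s \<omega>)) \<and> (\<exists>\<alpha>. P \<omega> \<alpha>) \<longleftrightarrow>
      (\<forall>t\<ge>0. cum r (\<lambda>s. c s \<omega>) t \<le> ennreal (a - abar) + cum r (\<lambda>s. w * (1 - \<tau>) * Z s \<omega> + r * abar) t)"
      unfolding P_def Zi[rule_format, symmetric]
    proof (rule budget_iff[where B = "w * (1 - \<tau>) * Max S"])
      show "(\<lambda>s. c s \<omega>) \<in> borel_measurable halfline" by (rule path_measurable[OF c \<omega>])
      show "(\<lambda>s. w * (1 - \<tau>) * Z s \<omega>) \<in> borel_measurable halfline"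
        by (rule path_measurable[OF progressively_measurable_fun_Z \<omega>])
      show "0 \<le> c s \<omega>" if "0 \<le> s" for s using pos[OF that \<omega>] by simp
      show "0 \<le> w * (1 - \<tau>) * Z s \<omega> + r * abar" if "0 \<le> s" for s
        using earnings_bounds(3)[OF Z_in_S[OF that \<omega>]] by (simp add: earnings_def)
      show "\<bar>w * (1 - \<tau>) * Z s \<omega>\<bar> \<le> w * (1 - \<tau>) * Max S" if "0 \<le> s" for s
      proof -
        have "0 < Z s \<omega>" "Z s \<omega> \<le> Max S" using pos_S Z_in_S[OF that \<omega>] finite_S by auto
        then have "0 \<le> w * (1 - \<tau>) * Z s \<omega>"
          using wt_pos by (intro mult_nonneg_nonneg[of "w * (1 - \<tau>)"]) auto
        moreover have "w * (1 - \<tau>) * Z s \<omega> \<le> w * (1 - \<tau>) * Max S"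
          using wt_pos \<open>Z s \<omega> \<le> Max S\<close> by (intro mult_left_mono) auto
        ultimately show ?thesis by (simp only: abs_of_nonneg)
      qed
    qed (rule a)
    then show ?thesis by (simp add: earnings_def add.commute)
  qed
  have "admissible M F inc abar w \<tau> r a z c \<longleftrightarrow>
    (AE \<omega> in law z. \<forall>t\<ge>0. set_integrable lborel {0..t} (\<lambda>s. c s \<omega>)) \<and> (\<exists>A. AE \<omega> in law z. P \<omega> (\<lambda>t. A t \<omega>))"
    unfolding admissible_def P_def using True by simp
  \<comment> \<open>The wealth process is chosen path by path, which exchanges existence with the
    almost-everywhere quantifier.\<close>
  also have "(\<exists>A. AE \<omega> in law z. P \<omega> (\<lambda>t. A t \<omega>)) \<longleftrightarrow> (AE \<omega> in law z. \<exists>\<alpha>. P \<omega> \<alpha>)"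
  proof
    assume "\<exists>A. AE \<omega> in law z. P \<omega> (\<lambda>t. A t \<omega>)"
    then show "AE \<omega> in law z. \<exists>\<alpha>. P \<omega> \<alpha>" by (auto elim: eventually_mono)
  next
    assume "AE \<omega> in law z. \<exists>\<alpha>. P \<omega> \<alpha>"
    then have "AE \<omega> in law z. P \<omega> (\<lambda>t. (SOME \<alpha>. P \<omega> \<alpha>) t)" by eventually_elim (metis someI_ex)
    then show "\<exists>A. AE \<omega> in law z. P \<omega> (\<lambda>t. A t \<omega>)" by (intro exI[of _ "\<lambda>t \<omega>. (SOME \<alpha>. P \<omega> \<alpha>) t"])
  qed
  also have "(AE \<omega> in law z. \<forall>t\<ge>0. set_integrable lborel {0..t} (\<lambda>s. c s \<omega>)) \<and> (AE \<omega> in law z. \<exists>\<alpha>. P \<omega> \<alpha>) \<longleftrightarrow>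
    (AE \<omega> in law z. (\<forall>t\<ge>0. set_integrable lborel {0..t} (\<lambda>s. c s \<omega>)) \<and> (\<exists>\<alpha>. P \<omega> \<alpha>))"
    by (rule AE_conj_iff[symmetric])
  also have "\<dots> \<longleftrightarrow> (AE \<omega> in law z. \<forall>t\<ge>0. cum r (\<lambda>s. c s \<omega>) t \<le> ennreal (a - abar) + cum r (\<lambda>s. earnings (Z s \<omega>)) t)"
  proof -
    have ae: "AE \<omega> in law z. ((\<forall>t\<ge>0. set_integrable lborel {0..t} (\<lambda>s. c s \<omega>)) \<and> (\<exists>\<alpha>. P \<omega> \<alpha>)) \<longleftrightarrow>
      (\<forall>t\<ge>0. cum r (\<lambda>s. c s \<omega>) t \<le> ennreal (a - abar) + cum r (\<lambda>s. earnings (Z s \<omega>)) t)"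
      using AE_law_Z[OF z] AE_space by eventually_elim (rule path, auto)
    show ?thesis by (rule eventually_cong[OF ae]) simp
  qed
  also have "\<dots> \<longleftrightarrow> adm (a - abar) z c" using True by (simp add: adm_def)
  finally show ?thesis .
qed

context
  fixes z :: real
  assumes z: "z \<in> S"
begin

text \<open>The cost identity with f = 1 turns consumption into its cumulative amount, with weight
  \<open>exp (r * t) * (\<rho> - r)\<close> of total mass 1. The pathwise budget then bounds it:
  initial wealth counts once and earnings are at most those of the highest state. That the weight is
  positive is where r < \<rho> enters.\<close>

lemma nn_integral_consumption_le:
  assumes c: "adm x z c" and x: "x \<ge> 0"
  shows "(\<integral>\<^sup>+p. ennreal (c (fst p) (snd p)) \<partial>Q z) \<le> ennreal (x + earnings (Max S) * measure (Q z) (space (Q z)))"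
proof -
  interpret finite_measure "Q z" by (rule finite_measure_Q[OF z])
  let ?k = "\<lambda>p. ennreal (exp (r * fst p) * (\<rho> - r))"
  have yp: "progressively_measurable F (\<lambda>t \<omega>. earnings (Z t \<omega>))" by (rule progressively_measurable_fun_Z)
  have [measurable]: "?k \<in> borel_measurable (Q z)" using fst_measurable_Q by measurable
  have cumy [measurable]: "(\<lambda>p. cum r (\<lambda>v. earnings (Z v (snd p))) (fst p)) \<in> borel_measurable (Q z)"
    using joint_cum[OF yp] by (simp add: measurable_cong_sets[OF sets_Q refl])
  have id: "(\<integral>\<^sup>+p. ennreal (e (fst p) (snd p)) \<partial>Q z) = (\<integral>\<^sup>+p. cum r (\<lambda>v. e v (snd p)) (fst p) * ?k p \<partial>Q z)"
    if "progressively_measurable F e" for e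
  proof -
    have ae: "AE p in Q z. gen (\<lambda>_. 1) (Z (fst p) (snd p)) = 0"
      using AE_Q_Z[OF z] by eventually_elim (simp add: gen_const)
    have "(\<integral>\<^sup>+p. ennreal (e (fst p) (snd p)) \<partial>Q z) = (\<integral>\<^sup>+p. cum r (\<lambda>v. e v (snd p)) (fst p) *
       ennreal (exp (r * fst p) * ((\<rho> - r) - gen (\<lambda>_. 1) (Z (fst p) (snd p)))) \<partial>Q z)"
      using cost_identity[OF z _ _ _ that, of "\<rho> - r" 0 "\<lambda>_. 1"] r by (simp add: gen_const)
    also have "\<dots> = (\<integral>\<^sup>+p. cum r (\<lambda>v. e v (snd p)) (fst p) * ?k p \<partial>Q z)"
      by (rule nn_integral_cong_AE) (use ae in eventually_elim, simp)
    finally show ?thesis .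
  qed
  have k1: "(\<integral>\<^sup>+p. ?k p \<partial>Q z) = 1"
  proof -
    have ae: "AE p in Q z. gen (\<lambda>_. 1) (Z (fst p) (snd p)) = 0"
      using AE_Q_Z[OF z] by eventually_elim (simp add: gen_const)
    have "(\<integral>\<^sup>+p. ?k p \<partial>Q z) = (\<integral>\<^sup>+p. ennreal (exp (r * fst p) * ((\<rho> - r) - gen (\<lambda>_. 1) (Z (fst p) (snd p)))) \<partial>Q z)"
      by (rule nn_integral_cong_AE) (use ae in eventually_elim, simp)
    also have "\<dots> = 1" using resolvent_Q[OF z, of "\<rho> - r" 0 "\<lambda>_. 1"] r by (simp add: gen_const)
    finally show ?thesis .
  qed
  have "(\<integral>\<^sup>+p. ennreal (c (fst p) (snd p)) \<partial>Q z) = (\<integral>\<^sup>+p. cum r (\<lambda>v. c v (snd p)) (fst p) * ?k p \<partial>Q z)"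
    by (rule id[OF adm_progressive[OF c]])
  also have "\<dots> \<le> (\<integral>\<^sup>+p. ennreal x * ?k p + cum r (\<lambda>v. earnings (Z v (snd p))) (fst p) * ?k p \<partial>Q z)"
  proof (rule nn_integral_mono_AE)
    have "AE \<omega> in law z. \<forall>t\<ge>0. cum r (\<lambda>s. c s \<omega>) t \<le> ennreal x + cum r (\<lambda>s. earnings (Z s \<omega>)) t"
      using c by (simp add: adm_def)
    from AE_Q[OF z this] show "AE p in Q z. cum r (\<lambda>v. c v (snd p)) (fst p) * ?k p \<le> ennreal x * ?k p + cum r (\<lambda>v. earnings (Z v (snd p))) (fst p) * ?k p"
      by eventually_elim (auto simp: distrib_right[symmetric] intro: mult_right_mono)
  qed
  also have "\<dots> = ennreal x * (\<integral>\<^sup>+p. ?k p \<partial>Q z) + (\<integral>\<^sup>+p. cum r (\<lambda>v. earnings (Z v (snd p))) (fst p) * ?k p \<partial>Q z)"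
    by (subst nn_integral_add) (auto simp: nn_integral_cmult)
  also have "\<dots> = ennreal x + (\<integral>\<^sup>+p. ennreal (earnings (Z (fst p) (snd p))) \<partial>Q z)"
    unfolding k1 id[OF yp, symmetric] by simp
  also have "\<dots> \<le> ennreal x + (\<integral>\<^sup>+p. ennreal (earnings (Max S)) \<partial>Q z)"
    by (intro add_left_mono nn_integral_mono_AE, use AE_Q_Z[OF z] in eventually_elim) (auto intro!: ennreal_leI earnings_bounds)
  also have "\<dots> = ennreal (x + earnings (Max S) * measure (Q z) (space (Q z)))"
    using x earnings_bounds(3)[OF Max_S] by (simp add: emeasure_eq_measure ennreal_mult ennreal_plus)
  finally show ?thesis .
qed

lemma consumption_integrable:
  assumes c: "adm x z c" and x: "x \<ge> 0"
  shows "integrable (Q z) (\<lambda>p. c (fst p) (snd p))"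
    and "(\<integral>p. c (fst p) (snd p) \<partial>Q z) \<le> x + earnings (Max S) * measure (Q z) (space (Q z))"
proof -
  have [measurable]: "(\<lambda>p. c (fst p) (snd p)) \<in> borel_measurable (Q z)" by (rule measurable_Q[OF adm_progressive[OF c]])
  have pos: "AE p in Q z. 0 \<le> c (fst p) (snd p)"
    using AE_Q_Z[OF z] by eventually_elim (auto intro: less_imp_le adm_pos[OF c])
  have lt: "(\<integral>\<^sup>+p. ennreal (c (fst p) (snd p)) \<partial>Q z) < \<infinity>"
    using nn_integral_consumption_le[OF assms] by (rule order.strict_trans1) simp
  show i: "integrable (Q z) (\<lambda>p. c (fst p) (snd p))"
    by (rule integrableI_nonneg[OF _ pos lt]) measurable
  have "x + earnings (Max S) * measure (Q z) (space (Q z)) \<ge> 0"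
    using x earnings_bounds(3)[OF Max_S] by simp
  then show "(\<integral>p. c (fst p) (snd p) \<partial>Q z) \<le> x + earnings (Max S) * measure (Q z) (space (Q z))"
    using nn_integral_consumption_le[OF assms] nn_integral_eq_integral[OF i pos] by simp
qed

lemma crra_le_affine: "c > 0 \<Longrightarrow> crra \<gamma> c \<le> crra \<gamma> 1 + (c - 1)"
  using crra_tangent[OF \<gamma>, of 1 c] by simp

text \<open>Utility lies below an affine function of consumption, which is integrable. So the
  positive part of the payoff is finite, and minus infinity is the only alternative to integrable
  utility.\<close>

lemma payoff_eq:
  assumes c: "adm x z c" and x: "x \<ge> 0"
  shows "payoff M inc \<rho> \<gamma> z c = (if integrable (Q z) (\<lambda>p. crra \<gamma> (c (fst p) (snd p))) then ereal (J z c) else - \<infinity>)"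
proof -
  interpret finite_measure "Q z" by (rule finite_measure_Q[OF z])
  let ?u = "\<lambda>p. crra \<gamma> (c (fst p) (snd p))"
  have mu: "?u \<in> borel_measurable (halfline \<Otimes>\<^sub>M M)"
    using joint_measurable[OF adm_progressive[OF c]] by measurable
  then have [measurable]: "?u \<in> borel_measurable (Q z)" by (simp add: measurable_cong_sets[OF sets_Q refl])
  have conv: "(\<integral>\<^sup>+\<omega>. (\<integral>\<^sup>+t\<in>{0..}. ennreal (s * (exp (- \<rho> * t) * crra \<gamma> (c t \<omega>))) \<partial>lborel) \<partial>law z) = (\<integral>\<^sup>+p. ennreal (s * ?u p) \<partial>Q z)" for s
  proof -
    have "(\<lambda>p. ennreal (s * ?u p)) \<in> borel_measurable (halfline \<Otimes>\<^sub>M M)" using mu by measurable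
    then have "(\<integral>\<^sup>+p. ennreal (s * ?u p) \<partial>Q z) = (\<integral>\<^sup>+\<omega>. \<integral>\<^sup>+t. ennreal (exp (- \<rho> * t)) * ennreal (s * crra \<gamma> (c t \<omega>)) \<partial>halfline \<partial>law z)"
      by (subst nn_integral_Q(1)[OF z]) auto
    also have "\<dots> = (\<integral>\<^sup>+\<omega>. (\<integral>\<^sup>+t\<in>{0..}. ennreal (s * (exp (- \<rho> * t) * crra \<gamma> (c t \<omega>))) \<partial>lborel) \<partial>law z)"
      unfolding nn_integral_halfline by (intro nn_integral_cong) (simp add: ennreal_mult'[symmetric] mult.left_commute)
    finally show ?thesis by simp
  qed
  have pay: "payoff M inc \<rho> \<gamma> z c = enn2ereal (\<integral>\<^sup>+p. ennreal (?u p) \<partial>Q z) - enn2ereal (\<integral>\<^sup>+p. ennreal (- ?u p) \<partial>Q z)"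
    unfolding payoff_def using conv[of 1] conv[of "-1"] by simp
  have P: "(\<integral>\<^sup>+p. ennreal (?u p) \<partial>Q z) < \<infinity>"
  proof -
    have i: "integrable (Q z) (\<lambda>p. \<bar>crra \<gamma> 1\<bar> + c (fst p) (snd p))"
      using consumption_integrable[OF assms] by simp
    have "AE p in Q z. ?u p \<le> \<bar>crra \<gamma> 1\<bar> + c (fst p) (snd p)"
      using AE_Q_Z[OF z]
    proof eventually_elim
      case (elim p)
      then have "c (fst p) (snd p) > 0" by (intro adm_pos[OF c]) auto
      then show ?case using crra_le_affine[of "c (fst p) (snd p)"] by linarith
    qed
    then have "(\<integral>\<^sup>+p. ennreal (?u p) \<partial>Q z) \<le> (\<integral>\<^sup>+p. ennreal (norm (\<bar>crra \<gamma> 1\<bar> + c (fst p) (snd p))) \<partial>Q z)"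
      by (intro nn_integral_mono_AE) (auto elim!: eventually_mono intro!: ennreal_leI)
    also have "\<dots> < \<infinity>" using i unfolding integrable_iff_bounded by simp
    finally show ?thesis .
  qed
  show ?thesis
  proof (cases "integrable (Q z) ?u")
    case True
    have N: "(\<integral>\<^sup>+p. ennreal (- ?u p) \<partial>Q z) < \<infinity>"
    proof -
      have "(\<integral>\<^sup>+p. ennreal (- ?u p) \<partial>Q z) \<le> (\<integral>\<^sup>+p. ennreal (norm (?u p)) \<partial>Q z)"
        by (intro nn_integral_mono ennreal_leI) simp
      also have "\<dots> < \<infinity>" using True unfolding integrable_iff_bounded by simp
      finally show ?thesis .
    qed
    have "J z c = enn2real (\<integral>\<^sup>+p. ennreal (?u p) \<partial>Q z) - enn2real (\<integral>\<^sup>+p. ennreal (- ?u p) \<partial>Q z)"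
      unfolding J_def by (rule real_lebesgue_integral_def[OF True])
    moreover have "enn2ereal a = ereal (enn2real a)" if "a < \<infinity>" for a :: ennreal
      using that by (cases a) (auto simp: enn2ereal_ennreal)
    ultimately show ?thesis using True P N unfolding pay by simp
  next
    case False
    have "(\<integral>\<^sup>+p. ennreal (- ?u p) \<partial>Q z) = \<infinity>"
    proof (rule ccontr)
      assume "(\<integral>\<^sup>+p. ennreal (- ?u p) \<partial>Q z) \<noteq> \<infinity>"
      moreover have "(\<integral>\<^sup>+p. ennreal (norm (?u p)) \<partial>Q z) = (\<integral>\<^sup>+p. ennreal (?u p) + ennreal (- ?u p) \<partial>Q z)"
      proof (rule nn_integral_cong)
        fix p show "ennreal (norm (?u p)) = ennreal (?u p) + ennreal (- ?u p)"
          by (cases "?u p \<ge> 0") (auto simp: ennreal_neg)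
      qed
      then have "(\<integral>\<^sup>+p. ennreal (norm (?u p)) \<partial>Q z) = (\<integral>\<^sup>+p. ennreal (?u p) \<partial>Q z) + (\<integral>\<^sup>+p. ennreal (- ?u p) \<partial>Q z)"
        by (simp add: nn_integral_add)
      ultimately have "(\<integral>\<^sup>+p. ennreal (norm (?u p)) \<partial>Q z) < \<infinity>" using P by (auto simp: less_top)
      then show False using False by (auto simp: integrable_iff_bounded)
    qed
    moreover obtain b where "b \<ge> 0" "(\<integral>\<^sup>+p. ennreal (?u p) \<partial>Q z) = ennreal b"
      using P by (cases "(\<integral>\<^sup>+p. ennreal (?u p) \<partial>Q z)") auto
    ultimately show ?thesis using False unfolding pay by (simp add: enn2ereal_ennreal)
  qed
qed

lemma J_upper:
  assumes c: "good x z c" and x: "x \<ge> 0"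
  shows "J z c \<le> \<bar>crra \<gamma> 1\<bar> * measure (Q z) (space (Q z)) + (x + earnings (Max S) * measure (Q z) (space (Q z)))"
proof -
  interpret finite_measure "Q z" by (rule finite_measure_Q[OF z])
  have adm: "adm x z c" using c by (simp add: good_def)
  have "J z c \<le> (\<integral>p. \<bar>crra \<gamma> 1\<bar> + c (fst p) (snd p) \<partial>Q z)"
    unfolding J_def
  proof (rule integral_mono_AE)
    show "AE p in Q z. crra \<gamma> (c (fst p) (snd p)) \<le> \<bar>crra \<gamma> 1\<bar> + c (fst p) (snd p)"
      using AE_Q_Z[OF z]
    proof eventually_elim
      case (elim p)
      then have "c (fst p) (snd p) > 0" by (intro adm_pos[OF adm]) auto
      then show ?case using crra_le_affine[of "c (fst p) (snd p)"] by linarith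
    qed
  qed (use c consumption_integrable[OF adm x] in \<open>auto simp: good_def\<close>)
  also have "\<dots> = \<bar>crra \<gamma> 1\<bar> * measure (Q z) (space (Q z)) + (\<integral>p. c (fst p) (snd p) \<partial>Q z)"
    using consumption_integrable[OF adm x] by (subst Bochner_Integration.integral_add) auto
  finally show ?thesis using consumption_integrable(2)[OF adm x] by linarith
qed

lemma bdd_above_J: "x \<ge> 0 \<Longrightarrow> bdd_above (J z ` {c. good x z c})"
  using J_upper by (intro bdd_aboveI) auto

lemma integrable_fun_Z: "integrable (Q z) (\<lambda>p. f (Z (fst p) (snd p)) :: real)"
proof -
  interpret finite_measure "Q z" by (rule finite_measure_Q[OF z])
  obtain B where B: "B \<ge> 0" "\<And>y. y \<in> S \<Longrightarrow> \<bar>f y\<bar> \<le> B" using finite_fun_bound by blast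
  have "AE p in Q z. norm (f (Z (fst p) (snd p))) \<le> B"
    using AE_Q_Z[OF z] by eventually_elim (use B in simp)
  then show ?thesis by (rule integrable_const_bound) (rule measurable_Q_Z)
qed

text \<open>Consuming current earnings is affordable from every x, and its utility takes finitely
  many values. This makes the supremum defining V one over a nonempty set.\<close>

lemma good_earnings: "x \<ge> 0 \<Longrightarrow> good x z (\<lambda>t \<omega>. earnings (Z t \<omega>))"
  unfolding good_def adm_def
  using progressively_measurable_fun_Z[of earnings] earnings_bounds(3) Z_in_S integrable_fun_Z[of "\<lambda>y. crra \<gamma> (earnings y)"]
  by auto

lemma J_le_V: "x \<ge> 0 \<Longrightarrow> good x z c \<Longrightarrow> J z c \<le> V x z"
  unfolding V_def by (rule cSup_upper[OF _ bdd_above_J]) auto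

lemma V_leI: "x \<ge> 0 \<Longrightarrow> (\<And>c. good x z c \<Longrightarrow> J z c \<le> b) \<Longrightarrow> V x z \<le> b"
  unfolding V_def using good_earnings by (intro cSup_least) auto

lemma V_approx:
  assumes "x \<ge> 0" "\<epsilon> > 0" obtains c where "good x z c" "J z c > V x z - \<epsilon>"
proof -
  have "V x z - \<epsilon> < Sup (J z ` {c. good x z c})" using assms by (simp add: V_def)
  then obtain j where "j \<in> J z ` {c. good x z c}" "V x z - \<epsilon> < j"
    by (rule less_cSupE) (use good_earnings[OF assms(1)] in auto)
  then show ?thesis using that by auto
qed

lemma value_fun_eq:
  assumes a: "a \<ge> abar"
  shows "value_fun M F inc \<rho> abar \<gamma> w \<tau> r a z = V (a - abar) z"
proof -
  let ?A = "{c. admissible M F inc abar w \<tau> r a z c}" and ?x = "a - abar"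
  have x: "?x \<ge> 0" using a by simp
  define s where "s = (SUP c\<in>?A. payoff M inc \<rho> \<gamma> z c)"
  have le: "s \<le> ereal (V ?x z)"
    unfolding s_def
  proof (rule SUP_least)
    fix c assume "c \<in> ?A"
    then have c: "adm ?x z c" using admissible_iff[OF z a] by simp
    show "payoff M inc \<rho> \<gamma> z c \<le> ereal (V ?x z)"
      unfolding payoff_eq[OF c x] using J_le_V[OF x] c by (auto simp: good_def)
  qed
  have ge: "ereal (J z c) \<le> s" if c: "good ?x z c" for c
  proof -
    have "adm ?x z c" using c by (simp add: good_def)
    then have "payoff M inc \<rho> \<gamma> z c \<le> s" unfolding s_def using admissible_iff[OF z a] by (intro SUP_upper) simp
    then show ?thesis using payoff_eq[OF \<open>adm ?x z c\<close> x] c by (simp add: good_def)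
  qed
  obtain s' where s': "s = ereal s'"
    using le ge[OF good_earnings[OF x]] by (cases s) auto
  have "V ?x z \<le> s'" using ge s' by (intro V_leI x) simp
  then have "s = ereal (V ?x z)" using le s' by simp
  then show ?thesis unfolding value_fun_def s_def[symmetric] by simp
qed

end

end

section \<open>Upper bounds for the increments of the value function\<close>

text \<open>Slack in the tangent inequality above \<open>b\<close>: use the tangent at \<open>b + \<mu> / \<kappa>\<close>.\<close>

lemma crra_tangent_slack_uniform:
  assumes \<gamma>: "\<gamma> > 0" and b: "0 < b1"
  obtains \<mu>0 C where "\<mu>0 > 0" "C \<ge> 0"
    "\<And>b c \<mu>. b1 \<le> b \<Longrightarrow> b \<le> b2 \<Longrightarrow> b \<le> c \<Longrightarrow> 0 \<le> \<mu> \<Longrightarrow> \<mu> \<le> \<mu>0 \<Longrightarrow>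
       crra \<gamma> c \<le> crra \<gamma> b + (b powr (- \<gamma>) - \<mu>) * (c - b) + C * \<mu>\<^sup>2"
proof
  \<comment> \<open>\<kappa> bounds the decay rate of marginal utility from below and \<Phi> from
    above on the relevant interval. Moving from b by \<open>\<delta> = \<mu> / \<kappa>\<close>
    lowers marginal utility by at least \<mu>; choosing \<kappa> as the bound for \<mu> keeps
    \<delta> \<le> 1.\<close>
  define \<kappa> where "\<kappa> = \<gamma> * (max b1 b2 + 1) powr (- \<gamma> - 1)"
  define \<Phi> where "\<Phi> = \<gamma> * b1 powr (- \<gamma> - 1)"
  have g1: "- \<gamma> - 1 = - (\<gamma> + 1)" by simp
  show k0: "\<kappa> > 0" unfolding \<kappa>_def using assms by simp
  show "\<Phi> / \<kappa>\<^sup>2 \<ge> 0" using assms by (simp add: \<Phi>_def)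
  fix b c \<mu> assume b12: "b1 \<le> b" "b \<le> b2" and c: "b \<le> c" and m: "0 \<le> \<mu>" "\<mu> \<le> \<kappa>"
  have b0: "b > 0" using b b12 by simp
  define \<delta> where "\<delta> = \<mu> / \<kappa>"
  have d: "0 \<le> \<delta>" "\<delta> \<le> 1" using m k0 by (auto simp: \<delta>_def)
  have dk: "\<kappa> * \<delta> = \<mu>" using k0 by (simp add: \<delta>_def)
  have t1: "crra \<gamma> c \<le> crra \<gamma> (b + \<delta>) + (b + \<delta>) powr (- \<gamma>) * (c - (b + \<delta>))"
    using \<gamma> b0 d c by (intro crra_tangent) auto
  have t2: "crra \<gamma> (b + \<delta>) \<le> crra \<gamma> b + b powr (- \<gamma>) * (b + \<delta> - b)"
    using \<gamma> b0 d by (intro crra_tangent) auto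
  have "(b + \<delta>) powr (- \<gamma>) \<ge> b powr (- \<gamma>) - \<gamma> * b powr (- \<gamma> - 1) * (b + \<delta> - b)"
    using \<gamma> b0 d by (intro powr_minus_tangent) auto
  moreover have "\<gamma> * b powr (- \<gamma> - 1) * \<delta> \<le> \<Phi> * \<delta>"
    unfolding \<Phi>_def g1 using \<gamma> b b12 d by (intro mult_right_mono mult_left_mono powr_minus_antimono) auto
  moreover have "b + \<delta> - b = \<delta>" by simp
  ultimately have t3: "b powr (- \<gamma>) - (b + \<delta>) powr (- \<gamma>) \<le> \<Phi> * \<delta>" by simp
  have "b powr (- \<gamma>) \<ge> (b + \<delta>) powr (- \<gamma>) - \<gamma> * (b + \<delta>) powr (- \<gamma> - 1) * (b - (b + \<delta>))"
    using \<gamma> b0 d by (intro powr_minus_tangent) auto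
  moreover have "\<kappa> * \<delta> \<le> \<gamma> * (b + \<delta>) powr (- \<gamma> - 1) * \<delta>"
    unfolding \<kappa>_def g1 using \<gamma> b0 b12 d
    by (intro mult_right_mono mult_left_mono powr_minus_antimono) auto
  ultimately have t4: "(b + \<delta>) powr (- \<gamma>) \<le> b powr (- \<gamma>) - \<mu>" unfolding dk by (simp add: algebra_simps)
  have t5: "(b powr (- \<gamma>) - (b + \<delta>) powr (- \<gamma>)) * \<delta> \<le> (\<Phi> * \<delta>) * \<delta>"
    using t3 d by (intro mult_right_mono) auto
  have t6: "(b + \<delta>) powr (- \<gamma>) * (c - b) \<le> (b powr (- \<gamma>) - \<mu>) * (c - b)"
    using t4 c by (intro mult_right_mono) auto
  have "(\<Phi> * \<delta>) * \<delta> = \<Phi> / \<kappa>\<^sup>2 * \<mu>\<^sup>2"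
    using k0 by (simp add: \<delta>_def power2_eq_square field_simps)
  then show "crra \<gamma> c \<le> crra \<gamma> b + (b powr (- \<gamma>) - \<mu>) * (c - b) + \<Phi> / \<kappa>\<^sup>2 * \<mu>\<^sup>2"
    using t1 t2 t5 t6 by (simp add: algebra_simps)
qed

text \<open>Discounted interest on x up to time t amounts to \<open>x * (1 - exp (- r * t))\<close>.
  Consuming earnings plus interest is therefore affordable from wealth x.\<close>

lemma cum_const_le:
  assumes "x \<ge> 0" "r * x \<ge> 0"
  shows "cum r (\<lambda>_. r * x) t \<le> ennreal x"
proof (cases "t \<ge> 0")
  case True
  have i: "set_integrable lborel {0..t} (\<lambda>_. r * x)"
    by (rule set_integrable_bounded_Icc[of _ _ _ "\<bar>r * x\<bar>"]) auto
  have "(LINT s:{0..t}|lborel. exp (- r * s) * (r * x)) = (LINT s:{0..t}|lborel. - x * (- r * exp (- r * s)))"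
    by (simp add: mult_ac)
  also have "\<dots> = - x * (exp (- r * t) - 1)"
    by (subst set_integral_mult_right) (simp only: integral_exp_interval[OF True] mult_zero_right exp_zero)
  also have "\<dots> \<le> x" using assms by (simp add: algebra_simps)
  finally show ?thesis
    using cum_eq_integral(2)[of "\<lambda>_. r * x" t r] i assms by (auto intro: ennreal_leI)
qed (simp add: cum_nonpos_time)

section \<open>Real-valued forms of the resolvent and cost identities\<close>

context household
begin

context
  fixes z :: real
  assumes z: "z \<in> S"
begin

lemma integrable_exp_Q:
  assumes "\<rho> - a > 0"
  shows "integrable (Q z) (\<lambda>p. exp (a * fst p))" and "(\<integral>p. exp (a * fst p) \<partial>Q z) = 1 / (\<rho> - a)"
proof -
  interpret L: prob_space "law z" by (rule prob_space_law[OF z])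
  have m: "(\<lambda>p. exp (a * fst p)) \<in> borel_measurable (Q z)" using fst_measurable_Q by measurable
  have "(\<lambda>p. ennreal (exp (a * fst p))) \<in> borel_measurable (halfline \<Otimes>\<^sub>M M)"
    using m unfolding measurable_cong_sets[OF sets_Q refl] by measurable
  then have "(\<integral>\<^sup>+p. ennreal (exp (a * fst p)) \<partial>Q z) = (\<integral>\<^sup>+t. ennreal (exp (- \<rho> * t)) * (\<integral>\<^sup>+\<omega>. ennreal (exp (a * t)) \<partial>law z) \<partial>halfline)"
    by (subst nn_integral_Q(2)[OF z]) auto
  also have "\<dots> = (\<integral>\<^sup>+t. ennreal (exp (- (\<rho> - a) * t)) \<partial>halfline)"
    using L.emeasure_space_1 by (intro nn_integral_cong) (simp add: ennreal_mult'[symmetric] exp_add[symmetric] algebra_simps)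
  also have "\<dots> = ennreal (1 / (\<rho> - a))" by (rule nn_integral_exp_halfline[OF assms])
  finally have e: "(\<integral>\<^sup>+p. ennreal (exp (a * fst p)) \<partial>Q z) = ennreal (1 / (\<rho> - a))" .
  show "integrable (Q z) (\<lambda>p. exp (a * fst p))"
    by (rule integrableI_nonneg[OF m]) (use e in auto)
  show "(\<integral>p. exp (a * fst p) \<partial>Q z) = 1 / (\<rho> - a)"
    by (subst integral_eq_nn_integral) (use e m assms in auto)
qed

lemma integrable_exp_fun_Z:
  assumes "\<rho> - a > 0" shows "integrable (Q z) (\<lambda>p. exp (a * fst p) * f (Z (fst p) (snd p)))"
proof -
  obtain B where B: "B \<ge> 0" "\<And>y. y \<in> S \<Longrightarrow> \<bar>f y\<bar> \<le> B"
    using finite_fun_bound[of f] by metis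
  have i: "integrable (Q z) (\<lambda>p. B * exp (a * fst p))" using integrable_exp_Q(1)[OF assms] by simp
  have "AE p in Q z. norm (exp (a * fst p) * f (Z (fst p) (snd p))) \<le> norm (B * exp (a * fst p))"
    using AE_Q_Z[OF z] by eventually_elim (use B in \<open>simp add: abs_mult mult.commute mult_left_mono\<close>)
  then show ?thesis
    by (rule Bochner_Integration.integrable_bound[OF i, rotated]) (use fst_measurable_Q measurable_Q_Z in measurable)
qed

lemma resolvent_real_nonneg:
  assumes \<alpha>: "\<alpha> = \<rho> - r + \<theta>" "\<alpha> > 0" and h: "\<And>y. y \<in> S \<Longrightarrow> \<alpha> * f y - gen f y \<ge> 0" and f: "\<And>y. y \<in> S \<Longrightarrow> f y \<ge> 0"
  shows "(\<integral>p. exp ((r - \<theta>) * fst p) * (\<alpha> * f (Z (fst p) (snd p)) - gen f (Z (fst p) (snd p))) \<partial>Q z) = f z"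
proof -
  let ?g = "\<lambda>p. exp ((r - \<theta>) * fst p) * (\<alpha> * f (Z (fst p) (snd p)) - gen f (Z (fst p) (snd p)))"
  have i: "integrable (Q z) ?g"
    using integrable_exp_fun_Z[of "r - \<theta>" "\<lambda>y. \<alpha> * f y - gen f y"] \<alpha> by simp
  have nn: "AE p in Q z. 0 \<le> ?g p" using AE_Q_Z[OF z] by eventually_elim (use h in simp)
  have "ennreal (\<integral>p. ?g p \<partial>Q z) = ennreal (f z)"
    using nn_integral_eq_integral[OF i nn] resolvent_Q[OF z \<alpha> h] by simp
  then show ?thesis using integral_nonneg_AE[OF nn] f[OF z] by simp
qed

text \<open>The generator annihilates constants, so a large constant makes both f and
  \<open>\<alpha> f - gen f\<close> nonnegative. Subtracting the identity for the constant extends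
  the \<open>ennreal\<close> identities to f of arbitrary sign.\<close>

lemma nonneg_shift:
  assumes \<alpha>: "\<alpha> > 0"
  obtains C where "C \<ge> 0" "\<And>y. y \<in> S \<Longrightarrow> f y + C \<ge> 0" "\<And>y. y \<in> S \<Longrightarrow> \<alpha> * (f y + C) - gen (\<lambda>y. f y + C) y \<ge> 0"
proof -
  obtain B1 where B1: "B1 \<ge> 0" "\<And>y. y \<in> S \<Longrightarrow> \<bar>f y\<bar> \<le> B1"
    using finite_fun_bound[of f] by metis
  obtain B2 where B2: "B2 \<ge> 0" "\<And>y. y \<in> S \<Longrightarrow> \<bar>\<alpha> * f y - gen f y\<bar> \<le> B2"
    using finite_fun_bound[of "\<lambda>y. \<alpha> * f y - gen f y"] by metis
  define C where "C = B1 + B2 / \<alpha>"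
  have aC: "\<alpha> * C \<ge> B2" using \<alpha> B1 by (simp add: C_def field_simps)
  have "C \<ge> B1" "C \<ge> 0" using \<alpha> B1 B2 by (auto simp: C_def)
  show ?thesis
  proof
    show "C \<ge> 0" by fact
    fix y assume y: "y \<in> S"
    show "f y + C \<ge> 0" using B1(2)[OF y] \<open>C \<ge> B1\<close> by linarith
    show "\<alpha> * (f y + C) - gen (\<lambda>y. f y + C) y \<ge> 0"
      using B2(2)[OF y] aC gen_add[of f "\<lambda>_. C" y] gen_const[OF y, of C] by (simp add: algebra_simps)
  qed
qed

lemma resolvent_real:
  assumes \<alpha>: "\<alpha> = \<rho> - r + \<theta>" "\<alpha> > 0"
  shows "integrable (Q z) (\<lambda>p. exp ((r - \<theta>) * fst p) * (\<alpha> * f (Z (fst p) (snd p)) - gen f (Z (fst p) (snd p))))"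
    and "(\<integral>p. exp ((r - \<theta>) * fst p) * (\<alpha> * f (Z (fst p) (snd p)) - gen f (Z (fst p) (snd p))) \<partial>Q z) = f z"
proof -
  have ra: "\<rho> - (r - \<theta>) > 0" using \<alpha> by simp
  show i: "integrable (Q z) (\<lambda>p. exp ((r - \<theta>) * fst p) * (\<alpha> * f (Z (fst p) (snd p)) - gen f (Z (fst p) (snd p))))"
    for f using integrable_exp_fun_Z[OF ra, of "\<lambda>y. \<alpha> * f y - gen f y"] by simp
  obtain C where C: "C \<ge> 0" "\<And>y. y \<in> S \<Longrightarrow> f y + C \<ge> 0" "\<And>y. y \<in> S \<Longrightarrow> \<alpha> * (f y + C) - gen (\<lambda>y. f y + C) y \<ge> 0"
    using nonneg_shift[OF \<alpha>(2)] by blast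
  have 1: "(\<integral>p. exp ((r - \<theta>) * fst p) * (\<alpha> * (f (Z (fst p) (snd p)) + C) - gen (\<lambda>y. f y + C) (Z (fst p) (snd p))) \<partial>Q z) = f z + C"
    using resolvent_real_nonneg[OF \<alpha> C(3,2)] by simp
  have "\<alpha> * C - gen (\<lambda>_. C) y \<ge> 0" if "y \<in> S" for y using that \<alpha> C(1) by (simp add: gen_const)
  then have 2: "(\<integral>p. exp ((r - \<theta>) * fst p) * (\<alpha> * C - gen (\<lambda>_. C) (Z (fst p) (snd p))) \<partial>Q z) = C"
    using resolvent_real_nonneg[OF \<alpha>, of "\<lambda>_. C"] C(1) by simp
  have "exp ((r - \<theta>) * fst p) * (\<alpha> * f (Z (fst p) (snd p)) - gen f (Z (fst p) (snd p))) =
     exp ((r - \<theta>) * fst p) * (\<alpha> * (f (Z (fst p) (snd p)) + C) - gen (\<lambda>y. f y + C) (Z (fst p) (snd p)))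
     - exp ((r - \<theta>) * fst p) * (\<alpha> * C - gen (\<lambda>_. C) (Z (fst p) (snd p)))" for p :: "real \<times> 'w"
    using gen_add[of f "\<lambda>_. C" "Z (fst p) (snd p)"] by (simp add: algebra_simps)
  then show "(\<integral>p. exp ((r - \<theta>) * fst p) * (\<alpha> * f (Z (fst p) (snd p)) - gen f (Z (fst p) (snd p))) \<partial>Q z) = f z"
    using Bochner_Integration.integral_diff[OF i[of "\<lambda>y. f y + C"] i[of "\<lambda>_. C"]] 1 2 by simp
qed

context
  fixes e :: "real \<Rightarrow> 'w \<Rightarrow> real" and \<eta> :: real
  assumes e: "progressively_measurable F e" and e0: "\<And>t \<omega>. t \<ge> 0 \<Longrightarrow> \<omega> \<in> space M \<Longrightarrow> e t \<omega> \<ge> 0"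
    and \<eta>: "\<eta> \<ge> 0" and bound: "AE \<omega> in law z. \<forall>t\<ge>0. cum r (\<lambda>v. e v \<omega>) t \<le> ennreal \<eta>"
begin

definition spent :: "real \<times> 'w \<Rightarrow> real" where
  "spent p = enn2real (cum r (\<lambda>v. e v (snd p)) (fst p))"

lemma spent_measurable: "spent \<in> borel_measurable (Q z)"
  unfolding spent_def using joint_cum[OF e] unfolding measurable_cong_sets[OF sets_Q refl] by measurable

lemma spent_bounds: "AE p in Q z. cum r (\<lambda>v. e v (snd p)) (fst p) = ennreal (spent p) \<and> 0 \<le> spent p \<and> spent p \<le> \<eta>"
  using AE_Q[OF z bound]
proof eventually_elim
  case (elim p)
  then show ?case using \<eta>
    by (cases "cum r (\<lambda>v. e v (snd p)) (fst p)") (auto simp: spent_def top_unique)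
qed

lemma integrable_spent:
  assumes "integrable (Q z) g" shows "integrable (Q z) (\<lambda>p. spent p * g p)"
proof -
  have i: "integrable (Q z) (\<lambda>p. \<eta> * g p)" using assms by simp
  have "AE p in Q z. norm (spent p * g p) \<le> norm (\<eta> * g p)"
    using spent_bounds by eventually_elim (use \<eta> in \<open>auto simp: abs_mult intro!: mult_right_mono\<close>)
  then show ?thesis
    by (rule Bochner_Integration.integrable_bound[OF i, rotated])
      (use spent_measurable borel_measurable_integrable[OF assms] in measurable)
qed

lemma cost_real_nonneg:
  assumes \<alpha>: "\<alpha> = \<rho> - r + \<theta>" "\<alpha> > 0" and h: "\<And>y. y \<in> S \<Longrightarrow> \<alpha> * f y - gen f y \<ge> 0" and f: "\<And>y. y \<in> S \<Longrightarrow> f y \<ge> 0"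
  shows "integrable (Q z) (\<lambda>p. e (fst p) (snd p) * (exp (- \<theta> * fst p) * f (Z (fst p) (snd p))))"
    and "(\<integral>p. e (fst p) (snd p) * (exp (- \<theta> * fst p) * f (Z (fst p) (snd p))) \<partial>Q z) =
      (\<integral>p. spent p * (exp ((r - \<theta>) * fst p) * (\<alpha> * f (Z (fst p) (snd p)) - gen f (Z (fst p) (snd p)))) \<partial>Q z)"
proof -
  let ?l = "\<lambda>p. e (fst p) (snd p) * (exp (- \<theta> * fst p) * f (Z (fst p) (snd p)))"
  let ?g = "\<lambda>p. exp ((r - \<theta>) * fst p) * (\<alpha> * f (Z (fst p) (snd p)) - gen f (Z (fst p) (snd p)))"
  have i: "integrable (Q z) (\<lambda>p. spent p * ?g p)" by (rule integrable_spent[OF resolvent_real(1)[OF \<alpha>]])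
  have nn: "AE p in Q z. 0 \<le> spent p * ?g p"
    using AE_Q_Z[OF z] spent_bounds by eventually_elim (use h in simp)
  have nl: "AE p in Q z. 0 \<le> ?l p"
    using AE_Q_Z[OF z] by eventually_elim (use e0 f in simp)
  have lm: "?l \<in> borel_measurable (Q z)"
    using measurable_Q[OF e] fst_measurable_Q measurable_Q_Z[of f] by measurable
  have "(\<integral>\<^sup>+p. ennreal (?l p) \<partial>Q z) = (\<integral>\<^sup>+p. ennreal (e (fst p) (snd p)) * ennreal (exp (- \<theta> * fst p) * f (Z (fst p) (snd p))) \<partial>Q z)"
    by (rule nn_integral_cong_AE, use AE_Q_Z[OF z] in eventually_elim) (use e0 f in \<open>auto intro!: ennreal_mult\<close>)
  also have "\<dots> = (\<integral>\<^sup>+p. cum r (\<lambda>v. e v (snd p)) (fst p) * ennreal (?g p) \<partial>Q z)"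
    by (rule cost_identity[OF z \<alpha> h e])
  also have "\<dots> = (\<integral>\<^sup>+p. ennreal (spent p * ?g p) \<partial>Q z)"
    by (rule nn_integral_cong_AE, use spent_bounds in eventually_elim) (simp add: ennreal_mult')
  also have "\<dots> = ennreal (\<integral>p. spent p * ?g p \<partial>Q z)"
    by (rule nn_integral_eq_integral[OF i nn])
  finally have eq: "(\<integral>\<^sup>+p. ennreal (?l p) \<partial>Q z) = ennreal (\<integral>p. spent p * ?g p \<partial>Q z)" .
  show il: "integrable (Q z) ?l"
    by (rule integrableI_nonneg[OF lm nl]) (simp only: eq, simp)
  have "ennreal (\<integral>p. ?l p \<partial>Q z) = ennreal (\<integral>p. spent p * ?g p \<partial>Q z)"
    using nn_integral_eq_integral[OF il nl] eq by simp
  then show "(\<integral>p. ?l p \<partial>Q z) = (\<integral>p. spent p * ?g p \<partial>Q z)"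
    using integral_nonneg_AE[OF nl] integral_nonneg_AE[OF nn] by simp
qed

lemma cost_real:
  assumes \<alpha>: "\<alpha> = \<rho> - r + \<theta>" "\<alpha> > 0"
  shows "integrable (Q z) (\<lambda>p. e (fst p) (snd p) * (exp (- \<theta> * fst p) * f (Z (fst p) (snd p))))"
    and "(\<integral>p. e (fst p) (snd p) * (exp (- \<theta> * fst p) * f (Z (fst p) (snd p))) \<partial>Q z) =
      (\<integral>p. spent p * (exp ((r - \<theta>) * fst p) * (\<alpha> * f (Z (fst p) (snd p)) - gen f (Z (fst p) (snd p)))) \<partial>Q z)"
proof -
  obtain C where C: "C \<ge> 0" "\<And>y. y \<in> S \<Longrightarrow> f y + C \<ge> 0" "\<And>y. y \<in> S \<Longrightarrow> \<alpha> * (f y + C) - gen (\<lambda>y. f y + C) y \<ge> 0"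
    using nonneg_shift[OF \<alpha>(2)] by blast
  have C': "\<alpha> * C - gen (\<lambda>_. C) y \<ge> 0" if "y \<in> S" for y using that \<alpha> C(1) by (simp add: gen_const)
  note 1 = cost_real_nonneg[OF \<alpha>, of "\<lambda>y. f y + C", OF C(3,2), simplified]
    and 2 = cost_real_nonneg[OF \<alpha>, of "\<lambda>_. C", OF C' C(1), simplified]
  have l: "e (fst p) (snd p) * (exp (- \<theta> * fst p) * f (Z (fst p) (snd p))) =
    e (fst p) (snd p) * (exp (- \<theta> * fst p) * (f (Z (fst p) (snd p)) + C)) - e (fst p) (snd p) * (exp (- \<theta> * fst p) * C)" for p :: "real \<times> 'w"
    by (simp add: algebra_simps)
  show "integrable (Q z) (\<lambda>p. e (fst p) (snd p) * (exp (- \<theta> * fst p) * f (Z (fst p) (snd p))))"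
    unfolding l using Bochner_Integration.integrable_diff[OF 1(1) 2(1)] by simp
  have g: "exp ((r - \<theta>) * fst p) * (\<alpha> * f (Z (fst p) (snd p)) - gen f (Z (fst p) (snd p))) =
     exp ((r - \<theta>) * fst p) * (\<alpha> * (f (Z (fst p) (snd p)) + C) - gen (\<lambda>y. f y + C) (Z (fst p) (snd p)))
     - exp ((r - \<theta>) * fst p) * (\<alpha> * C - gen (\<lambda>_. C) (Z (fst p) (snd p)))" for p :: "real \<times> 'w"
    using gen_add[of f "\<lambda>_. C" "Z (fst p) (snd p)"] by (simp add: algebra_simps)
  have "(\<integral>p. e (fst p) (snd p) * (exp (- \<theta> * fst p) * f (Z (fst p) (snd p))) \<partial>Q z) =
    (\<integral>p. spent p * (exp ((r - \<theta>) * fst p) * (\<alpha> * (f (Z (fst p) (snd p)) + C) - gen (\<lambda>y. f y + C) (Z (fst p) (snd p)))) \<partial>Q z) -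
    (\<integral>p. spent p * (exp ((r - \<theta>) * fst p) * (\<alpha> * C - gen (\<lambda>_. C) (Z (fst p) (snd p)))) \<partial>Q z)"
    unfolding l using Bochner_Integration.integral_diff[OF 1(1) 2(1)] 1(2) 2(2) by simp
  also have "\<dots> = (\<integral>p. spent p * (exp ((r - \<theta>) * fst p) * (\<alpha> * (f (Z (fst p) (snd p)) + C) - gen (\<lambda>y. f y + C) (Z (fst p) (snd p)))) -
     spent p * (exp ((r - \<theta>) * fst p) * (\<alpha> * C - gen (\<lambda>_. C) (Z (fst p) (snd p)))) \<partial>Q z)"
    by (intro Bochner_Integration.integral_diff[symmetric] integrable_spent resolvent_real(1)[OF \<alpha>, of "\<lambda>y. f y + C"] resolvent_real(1)[OF \<alpha>, of "\<lambda>_. C"])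
  finally show "(\<integral>p. e (fst p) (snd p) * (exp (- \<theta> * fst p) * f (Z (fst p) (snd p))) \<partial>Q z) =
      (\<integral>p. spent p * (exp ((r - \<theta>) * fst p) * (\<alpha> * f (Z (fst p) (snd p)) - gen f (Z (fst p) (snd p)))) \<partial>Q z)"
    unfolding g by (simp only: right_diff_distrib)
qed

end

end

end

section \<open>Increments of the value function from cut consumption\<close>

context household
begin

text \<open>The utility of c' lies between those of c and of \<open>min c b\<close>, so cutting down
  to levels of at least b preserves integrability.\<close>

lemma crra_min_integrable:
  assumes u: "integrable N (\<lambda>p. crra \<gamma> (c p))" and m: "c' \<in> borel_measurable N"
    and b: "b > 0" and fin: "finite_measure N"
    and le: "AE p in N. c p > 0 \<and> c' p \<le> c p \<and> min (c p) b \<le> c' p"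
  shows "integrable N (\<lambda>p. crra \<gamma> (c' p))"
proof -
  interpret finite_measure N by (rule fin)
  have i: "integrable N (\<lambda>p. \<bar>crra \<gamma> (c p)\<bar> + \<bar>crra \<gamma> b\<bar>)" using u by simp
  have "AE p in N. norm (crra \<gamma> (c' p)) \<le> norm (\<bar>crra \<gamma> (c p)\<bar> + \<bar>crra \<gamma> b\<bar>)"
    using le
  proof eventually_elim
    case (elim p)
    have "crra \<gamma> (c' p) \<le> crra \<gamma> (c p)" using elim b by (intro crra_mono) (auto simp: min_def split: if_splits)
    moreover have "crra \<gamma> (min (c p) b) \<le> crra \<gamma> (c' p)" using elim b by (intro crra_mono) auto
    moreover have "crra \<gamma> (min (c p) b) = crra \<gamma> (c p) \<or> crra \<gamma> (min (c p) b) = crra \<gamma> b" by (simp add: min_def)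
    ultimately show ?case by auto
  qed
  then show ?thesis
    by (rule Bochner_Integration.integrable_bound[OF i, rotated]) (use m in measurable)
qed

context
  fixes z :: real
  assumes z: "z \<in> S"
begin

text \<open>
  From wealth \<open>x + \<eta>\<close> to wealth \<open>x\<close>: cut consumption down to current income until the
  discounted amount saved in this way reaches \<open>\<eta>\<close>.
\<close>

lemma cut_consumption:
  assumes x: "x \<ge> 0" "r * x \<ge> 0" and \<eta>: "\<eta> > 0" and c: "good (x + \<eta>) z c"
  obtains c' e where "good x z c'" "progressively_measurable F e"
    "\<And>t \<omega>. t \<ge> 0 \<Longrightarrow> \<omega> \<in> space M \<Longrightarrow> e t \<omega> \<ge> 0"
    "AE \<omega> in law z. \<forall>t\<ge>0. cum r (\<lambda>v. e v \<omega>) t \<le> ennreal \<eta>"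
    "\<And>t \<omega>. (c' t \<omega> = c t \<omega> \<and> e t \<omega> = 0) \<or>
       (c' t \<omega> = min (c t \<omega>) (earnings (Z t \<omega>) + r * x) \<and> e t \<omega> = max 0 (c t \<omega> - (earnings (Z t \<omega>) + r * x)))"
proof -
  have adm: "adm (x + \<eta>) z c" using c by (simp add: good_def)
  note cp = adm_progressive[OF adm]
  define b where "b t \<omega> = earnings (Z t \<omega>) + r * x" for t \<omega>
  have bp: "progressively_measurable F b" unfolding b_def by (rule progressively_measurable_fun_Z)
  have bpos: "b t \<omega> \<ge> earnings (Min S)" if "t \<ge> 0" "\<omega> \<in> space M" for t \<omega>
    using earnings_bounds(1)[OF Z_in_S[OF that]] x by (simp add: b_def)
  define e0 where "e0 t \<omega> = max 0 (c t \<omega> - b t \<omega>)" for t \<omega>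
  have e0p: "progressively_measurable F e0" and minp: "progressively_measurable F (\<lambda>t \<omega>. min (c t \<omega>) (b t \<omega>))"
    and zerop: "progressively_measurable F (\<lambda>t \<omega>. 0)"
  proof (rule_tac [!] progressively_measurableI)
    fix t :: real assume t: "t \<ge> 0"
    note [measurable] = progressively_measurableD[OF cp t] progressively_measurableD[OF bp t]
    show "(\<lambda>p. e0 (fst p) (snd p)) \<in> borel_measurable (prog_space t)" unfolding e0_def by measurable
    show "(\<lambda>p. min (c (fst p) (snd p)) (b (fst p) (snd p))) \<in> borel_measurable (prog_space t)" by measurable
  qed simp
  define K where "K t \<omega> = cum r (\<lambda>v. e0 v \<omega>) t" for t \<omega>
  define e where "e t \<omega> = (if K t \<omega> < ennreal \<eta> then e0 t \<omega> else 0)" for t \<omega>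
  define c' where "c' t \<omega> = (if K t \<omega> < ennreal \<eta> then min (c t \<omega>) (b t \<omega>) else c t \<omega>)" for t \<omega>
  have ep: "progressively_measurable F e" unfolding e_def K_def by (rule progressive_if_cum[OF e0p e0p zerop])
  have c'p: "progressively_measurable F c'" unfolding c'_def K_def by (rule progressive_if_cum[OF e0p minp cp])
  have e_nn: "e t \<omega> \<ge> 0" for t \<omega> by (simp add: e_def e0_def)
  have c'_pos: "c' t \<omega> > 0" if "t \<ge> 0" "\<omega> \<in> space M" for t \<omega>
    using adm_pos[OF adm that] bpos[OF that] earnings_Min_pos by (auto simp: c'_def)
  have sum: "c' t \<omega> + e t \<omega> = c t \<omega>" for t \<omega> by (auto simp: c'_def e_def e0_def)
  have budget: "AE \<omega> in law z. (\<forall>t\<ge>0. cum r (\<lambda>s. c' s \<omega>) t \<le> ennreal x + cum r (\<lambda>s. earnings (Z s \<omega>)) t) \<and>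
     (\<forall>t\<ge>0. cum r (\<lambda>s. e s \<omega>) t \<le> ennreal \<eta>)"
  proof -
    have "AE \<omega> in law z. \<forall>t\<ge>0. cum r (\<lambda>s. c s \<omega>) t \<le> ennreal (x + \<eta>) + cum r (\<lambda>s. earnings (Z s \<omega>)) t"
      using adm by (simp add: adm_def)
    with AE_space show ?thesis
    proof eventually_elim
      case (elim \<omega>)
      then have \<omega>: "\<omega> \<in> space M" by simp
      have [measurable]: "(\<lambda>s. e0 s \<omega>) \<in> borel_measurable halfline" "(\<lambda>s. e s \<omega>) \<in> borel_measurable halfline"
        "(\<lambda>s. c' s \<omega>) \<in> borel_measurable halfline" "(\<lambda>s. earnings (Z s \<omega>)) \<in> borel_measurable halfline"
        using path_measurable[OF e0p \<omega>] path_measurable[OF ep \<omega>] path_measurable[OF c'p \<omega>]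
          path_measurable[OF progressively_measurable_fun_Z \<omega>] by auto
      have fin: "cum r (\<lambda>s. e0 s \<omega>) s < \<infinity>" for s
      proof (cases "s \<ge> 0")
        case True
        have "cum r (\<lambda>v. e0 v \<omega>) s \<le> cum r (\<lambda>v. c v \<omega>) s"
          by (rule cum_mono) (use adm_pos[OF adm _ \<omega>] bpos[OF _ \<omega>] earnings_Min_pos in \<open>force simp: e0_def\<close>)
        also have "\<dots> \<le> ennreal (x + \<eta>) + cum r (\<lambda>s. earnings (Z s \<omega>)) s" using elim(2) True by blast
        also have "\<dots> < \<infinity>" using cum_earnings_finite[OF \<omega>] by (simp add: less_top)
        finally show ?thesis .
      qed (simp add: cum_nonpos_time)
      have ce: "cum r (\<lambda>s. e s \<omega>) t = min (K t \<omega>) (ennreal \<eta>)" for t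
        unfolding e_def K_def by (rule cum_stopped) (use fin \<eta> in auto)
      have "cum r (\<lambda>s. c' s \<omega>) t \<le> ennreal x + cum r (\<lambda>s. earnings (Z s \<omega>)) t" if t: "t \<ge> 0" for t
      \<comment> \<open>Before \<eta> is saved, c' stays below income at wealth x and is affordable
        by itself. Afterwards exactly \<eta> has been saved, the difference of the two
        budgets.\<close>
      proof (cases "K t \<omega> < ennreal \<eta>")
        case True
        have "cum r (\<lambda>s. c' s \<omega>) t \<le> cum r (\<lambda>s. r * x + earnings (Z s \<omega>)) t"
        proof (rule cum_mono)
          fix s assume s: "0 \<le> s" "s \<le> t"
          have "K s \<omega> < ennreal \<eta>" using cum_mono_time[OF s(2), of r "\<lambda>v. e0 v \<omega>"] True
            unfolding K_def by (rule le_less_trans)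
          then show "c' s \<omega> \<le> r * x + earnings (Z s \<omega>)" by (simp add: c'_def b_def)
        qed
        also have "\<dots> = cum r (\<lambda>_. r * x) t + cum r (\<lambda>s. earnings (Z s \<omega>)) t"
          using x earnings_bounds(3)[OF Z_in_S[OF _ \<omega>]] by (intro cum_add) (auto intro: less_imp_le)
        also have "\<dots> \<le> ennreal x + cum r (\<lambda>s. earnings (Z s \<omega>)) t"
          by (intro add_right_mono cum_const_le x)
        finally show ?thesis .
      next
        case False
        have "cum r (\<lambda>s. c' s \<omega>) t + ennreal \<eta> = cum r (\<lambda>s. c' s \<omega> + e s \<omega>) t"
          using False c'_pos[OF _ \<omega>] e_nn by (subst cum_add) (auto simp: ce min_def intro: less_imp_le)
        also have "\<dots> \<le> ennreal (x + \<eta>) + cum r (\<lambda>s. earnings (Z s \<omega>)) t"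
          unfolding sum using elim(2) t by blast
        also have "\<dots> = ennreal x + cum r (\<lambda>s. earnings (Z s \<omega>)) t + ennreal \<eta>"
          using x \<eta> by (simp add: ennreal_plus add_ac)
        finally show ?thesis using ennreal_add_left_cancel_le[of "ennreal \<eta>"] by (simp add: add.commute)
      qed
      then show ?case by (auto simp: ce)
    qed
  qed
  have "adm x z c'" unfolding adm_def using c'p c'_pos budget by (auto elim: eventually_mono)
  moreover have "integrable (Q z) (\<lambda>p. crra \<gamma> (c' (fst p) (snd p)))"
  proof (rule crra_min_integrable)
    show "integrable (Q z) (\<lambda>p. crra \<gamma> (c (fst p) (snd p)))" using c by (simp add: good_def)
    show "AE p in Q z. c (fst p) (snd p) > 0 \<and> c' (fst p) (snd p) \<le> c (fst p) (snd p) \<and>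
      min (c (fst p) (snd p)) (earnings (Min S)) \<le> c' (fst p) (snd p)"
      using AE_Q_Z[OF z]
    proof eventually_elim
      case (elim p)
      then show ?case using adm_pos[OF adm, of "fst p" "snd p"] bpos[of "fst p" "snd p"] by (auto simp: c'_def)
    qed
  qed (use measurable_Q[OF c'p] earnings_Min_pos finite_measure_Q[OF z] in auto)
  ultimately have "good x z c'" by (simp add: good_def)
  moreover have "AE \<omega> in law z. \<forall>t\<ge>0. cum r (\<lambda>v. e v \<omega>) t \<le> ennreal \<eta>"
    using budget by (auto elim: eventually_mono)
  ultimately show ?thesis
    using that ep e_nn by (auto simp: c'_def e_def e0_def b_def)
qed

text \<open>By u, the utility lost per unit saved in \<open>cut_consumption\<close> is at most
  \<open>f0 - m exp (- \<theta> t) f1\<close>, up to a quadratic error with expected discounted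
  integral \<open>C * m\<^sup>2 / (\<rho> + 2 * \<theta>)\<close>. The cost identity replaces saving
  by cumulative saving times the weight in G. As G makes this weight nonnegative, cumulative saving
  may be replaced by its bound \<eta>, and the resolvent identity evaluates the rest at z.\<close>

lemma V_increment_le:
  assumes x: "x \<ge> 0" "r * x \<ge> 0" and \<eta>: "\<eta> > 0" and \<theta>: "\<theta> \<ge> 0" and m: "m \<ge> 0"
    and u: "\<And>y t c. y \<in> S \<Longrightarrow> t \<ge> 0 \<Longrightarrow> earnings y + r * x \<le> c \<Longrightarrow>
      crra \<gamma> c \<le> crra \<gamma> (earnings y + r * x) + (f0 y - m * exp (- \<theta> * t) * f1 y) * (c - (earnings y + r * x)) + C * (m * exp (- \<theta> * t))\<^sup>2"
    and G: "\<And>y s. y \<in> S \<Longrightarrow> s \<ge> 0 \<Longrightarrow>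
      ((\<rho> - r) * f0 y - gen f0 y) - m * (exp (- \<theta> * s) * ((\<rho> - r + \<theta>) * f1 y - gen f1 y)) \<ge> 0"
    and C: "C \<ge> 0"
  shows "V (x + \<eta>) z - V x z \<le> \<eta> * (f0 z - m * f1 z) + C * m\<^sup>2 / (\<rho> + 2 * \<theta>)"
proof -
  have "J z c \<le> V x z + (\<eta> * (f0 z - m * f1 z) + C * m\<^sup>2 / (\<rho> + 2 * \<theta>))" if c: "good (x + \<eta>) z c" for c
  proof -
    obtain c' e where c': "good x z c'" and e: "progressively_measurable F e"
      "\<And>t \<omega>. t \<ge> 0 \<Longrightarrow> \<omega> \<in> space M \<Longrightarrow> e t \<omega> \<ge> 0"
      "AE \<omega> in law z. \<forall>t\<ge>0. cum r (\<lambda>v. e v \<omega>) t \<le> ennreal \<eta>"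
      and cases: "\<And>t \<omega>. (c' t \<omega> = c t \<omega> \<and> e t \<omega> = 0) \<or>
       (c' t \<omega> = min (c t \<omega>) (earnings (Z t \<omega>) + r * x) \<and> e t \<omega> = max 0 (c t \<omega> - (earnings (Z t \<omega>) + r * x)))"
    proof (rule cut_consumption[OF x \<eta> c])
      fix c' e assume "good x z c'" "progressively_measurable F e"
        "\<And>t \<omega>. t \<ge> 0 \<Longrightarrow> \<omega> \<in> space M \<Longrightarrow> e t \<omega> \<ge> 0"
        "AE \<omega> in law z. \<forall>t\<ge>0. cum r (\<lambda>v. e v \<omega>) t \<le> ennreal \<eta>"
        "\<And>t \<omega>. (c' t \<omega> = c t \<omega> \<and> e t \<omega> = 0) \<or>
         (c' t \<omega> = min (c t \<omega>) (earnings (Z t \<omega>) + r * x) \<and> e t \<omega> = max 0 (c t \<omega> - (earnings (Z t \<omega>) + r * x)))"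
      then show thesis by (rule that)
    qed
    have \<eta>0: "\<eta> \<ge> 0" using \<eta> by simp
    have \<alpha>0: "\<rho> - r > 0" and \<alpha>\<theta>: "\<rho> - r + \<theta> > 0" using r \<theta> by auto
    let ?sp = "spent e"
    let ?h0 = "\<lambda>p. exp (r * fst p) * ((\<rho> - r) * f0 (Z (fst p) (snd p)) - gen f0 (Z (fst p) (snd p)))"
    let ?h1 = "\<lambda>p. exp ((r - \<theta>) * fst p) * ((\<rho> - r + \<theta>) * f1 (Z (fst p) (snd p)) - gen f1 (Z (fst p) (snd p)))"
    let ?c0 = "\<lambda>p. e (fst p) (snd p) * f0 (Z (fst p) (snd p))"
    let ?c1 = "\<lambda>p. e (fst p) (snd p) * (exp (- \<theta> * fst p) * f1 (Z (fst p) (snd p)))"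
    let ?er = "\<lambda>p. C * m\<^sup>2 * exp (- (2 * \<theta>) * fst p)"
    have h0: "integrable (Q z) ?h0" "(\<integral>p. ?h0 p \<partial>Q z) = f0 z"
      using resolvent_real[OF z, of "\<rho> - r" 0 f0] \<alpha>0 by simp_all
    have h1: "integrable (Q z) ?h1" "(\<integral>p. ?h1 p \<partial>Q z) = f1 z"
      using resolvent_real[OF z, of "\<rho> - r + \<theta>" \<theta> f1] \<alpha>\<theta> by simp_all
    have k0: "integrable (Q z) ?c0" "(\<integral>p. ?c0 p \<partial>Q z) = (\<integral>p. ?sp p * ?h0 p \<partial>Q z)"
      using cost_real[OF z e(1,2) \<eta>0 e(3), of "\<rho> - r" 0 f0] \<alpha>0 by simp_all
    have k1: "integrable (Q z) ?c1" "(\<integral>p. ?c1 p \<partial>Q z) = (\<integral>p. ?sp p * ?h1 p \<partial>Q z)"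
      using cost_real[OF z e(1,2) \<eta>0 e(3), of "\<rho> - r + \<theta>" \<theta> f1] \<alpha>\<theta> by simp_all
    have s0: "integrable (Q z) (\<lambda>p. ?sp p * ?h0 p)" and s1: "integrable (Q z) (\<lambda>p. ?sp p * ?h1 p)"
      using integrable_spent[OF z e(1,2) \<eta>0 e(3)] h0(1) h1(1) by auto
    have sb: "AE p in Q z. cum r (\<lambda>v. e v (snd p)) (fst p) = ennreal (?sp p) \<and> 0 \<le> ?sp p \<and> ?sp p \<le> \<eta>"
      by (rule spent_bounds[OF z _ _ \<eta>0]) (use e in auto)
    have er: "integrable (Q z) ?er" "(\<integral>p. ?er p \<partial>Q z) = C * m\<^sup>2 / (\<rho> + 2 * \<theta>)"
      using integrable_exp_Q[OF z, of "- (2 * \<theta>)"] \<rho> \<theta> by (simp_all add: field_simps)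
    have iu: "integrable (Q z) (\<lambda>p. crra \<gamma> (c (fst p) (snd p)))" "integrable (Q z) (\<lambda>p. crra \<gamma> (c' (fst p) (snd p)))"
      using c c' by (auto simp: good_def)
    have "J z c - J z c' = (\<integral>p. crra \<gamma> (c (fst p) (snd p)) - crra \<gamma> (c' (fst p) (snd p)) \<partial>Q z)"
      unfolding J_def using iu by simp
    also have "\<dots> \<le> (\<integral>p. ?c0 p - m * ?c1 p + ?er p \<partial>Q z)"
    proof (rule integral_mono_AE)
      show "AE p in Q z. crra \<gamma> (c (fst p) (snd p)) - crra \<gamma> (c' (fst p) (snd p)) \<le> ?c0 p - m * ?c1 p + ?er p"
        using AE_Q_Z[OF z]
      proof eventually_elim
        case (elim p)
        define t \<omega> where "t = fst p" and "\<omega> = snd p"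
        have t: "t \<ge> 0" "\<omega> \<in> space M" "Z t \<omega> \<in> S" using elim by (auto simp: t_def \<omega>_def)
        have sq: "C * (m * exp (- \<theta> * t))\<^sup>2 = C * m\<^sup>2 * exp (- (2 * \<theta>) * t)"
          by (simp add: power2_eq_square exp_add[symmetric] algebra_simps)
        have nn: "0 \<le> C * m\<^sup>2 * exp (- (2 * \<theta>) * t)" using C by simp
        show ?case
          using cases[of t \<omega>]
        proof
          assume "c' t \<omega> = c t \<omega> \<and> e t \<omega> = 0"
          then show ?thesis using nn by (simp add: t_def \<omega>_def)
        next
          let ?b = "earnings (Z t \<omega>) + r * x"
          assume a: "c' t \<omega> = min (c t \<omega>) ?b \<and> e t \<omega> = max 0 (c t \<omega> - ?b)"
          show ?thesis
          proof (cases "?b \<le> c t \<omega>")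
            case True
            then have "crra \<gamma> (c t \<omega>) \<le> crra \<gamma> ?b + (f0 (Z t \<omega>) - m * exp (- \<theta> * t) * f1 (Z t \<omega>)) * (c t \<omega> - ?b) + C * (m * exp (- \<theta> * t))\<^sup>2"
              by (rule u[OF t(3,1)])
            moreover have b: "c' t \<omega> = ?b" "e t \<omega> = c t \<omega> - ?b" using True a by auto
            ultimately have "crra \<gamma> (c t \<omega>) \<le> crra \<gamma> (c' t \<omega>) + (f0 (Z t \<omega>) - m * exp (- \<theta> * t) * f1 (Z t \<omega>)) * e t \<omega> +
                C * m\<^sup>2 * exp (- (2 * \<theta>) * t)"
              by (simp only: b sq)
            then show ?thesis by (simp add: t_def[symmetric] \<omega>_def[symmetric] algebra_simps)
          next
            case False
            then have "c' t \<omega> = c t \<omega>" "e t \<omega> = 0" using a by auto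
            then show ?thesis using nn by (simp add: t_def \<omega>_def)
          qed
        qed
      qed
    qed (use iu k0 k1 er in auto)
    also have "\<dots> = (\<integral>p. ?c0 p \<partial>Q z) - m * (\<integral>p. ?c1 p \<partial>Q z) + C * m\<^sup>2 / (\<rho> + 2 * \<theta>)"
      using k0(1) k1(1) er by simp
    also have "(\<integral>p. ?c0 p \<partial>Q z) - m * (\<integral>p. ?c1 p \<partial>Q z) = (\<integral>p. ?sp p * ?h0 p - m * (?sp p * ?h1 p) \<partial>Q z)"
      unfolding k0(2) k1(2) using s0 s1 by simp
    also have "\<dots> \<le> (\<integral>p. \<eta> * (?h0 p - m * ?h1 p) \<partial>Q z)"
    proof (rule integral_mono_AE)
      show "AE p in Q z. ?sp p * ?h0 p - m * (?sp p * ?h1 p) \<le> \<eta> * (?h0 p - m * ?h1 p)"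
        using AE_Q_Z[OF z] sb
      proof eventually_elim
        case (elim p)
        have "?h0 p - m * ?h1 p = exp (r * fst p) * (((\<rho> - r) * f0 (Z (fst p) (snd p)) - gen f0 (Z (fst p) (snd p))) -
          m * (exp (- \<theta> * fst p) * ((\<rho> - r + \<theta>) * f1 (Z (fst p) (snd p)) - gen f1 (Z (fst p) (snd p)))))"
        proof -
          have "exp ((r - \<theta>) * fst p) = exp (r * fst p) * exp (- \<theta> * fst p)"
            by (simp add: exp_add[symmetric] algebra_simps)
          then show ?thesis by (simp only: right_diff_distrib mult.assoc mult.left_commute[of m])
        qed
        also have "\<dots> \<ge> 0" using G[of "Z (fst p) (snd p)" "fst p"] elim by (intro mult_nonneg_nonneg) auto
        finally have "?sp p * (?h0 p - m * ?h1 p) \<le> \<eta> * (?h0 p - m * ?h1 p)"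
          using elim by (intro mult_right_mono) auto
        then show ?case by (simp only: right_diff_distrib mult.left_commute[of m])
      qed
    qed (use s0 s1 h0 h1 in auto)
    also have "\<dots> = \<eta> * (f0 z - m * f1 z)" using h0 h1 by simp
    finally show ?thesis using J_le_V[OF z x(1) c'] by linarith
  qed
  then have "V (x + \<eta>) z \<le> V x z + (\<eta> * (f0 z - m * f1 z) + C * m\<^sup>2 / (\<rho> + 2 * \<theta>))"
    using x \<eta> by (intro V_leI z) auto
  then show ?thesis by simp
qed

end

end

section \<open>Slopes of the value function\<close>

context household
begin

definition marginal :: "real \<Rightarrow> real \<Rightarrow> real" where
  "marginal x y = (earnings y + r * x) powr (- \<gamma>)"

lemma gen_marginal:
  assumes k: "k + w * (1 - \<tau>) * Min S > 0" and y: "y \<in> S"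
  shows "gen (\<lambda>v. (k + w * (1 - \<tau>) * v) powr (- \<gamma>)) y =
    (k + w * (1 - \<tau>) * y) powr (- \<gamma>) * excess \<gamma> (w * (1 - \<tau>)) k y"
  unfolding gen_eq[OF y] excess_def sum_distrib_left
proof (intro sum.cong refl)
  fix v assume v: "v \<in> S - {y}"
  have p: "k + w * (1 - \<tau>) * y > 0" "k + w * (1 - \<tau>) * v > 0"
    using income_pos[OF wt_pos k] y v by auto
  then have "((k + w * (1 - \<tau>) * y) / (k + w * (1 - \<tau>) * v)) powr \<gamma> =
     (k + w * (1 - \<tau>) * v) powr (- \<gamma>) / (k + w * (1 - \<tau>) * y) powr (- \<gamma>)"
    by (simp add: powr_divide powr_minus divide_simps)
  then show "rate y v * ((k + w * (1 - \<tau>) * v) powr (- \<gamma>) - (k + w * (1 - \<tau>) * y) powr (- \<gamma>)) =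
     (k + w * (1 - \<tau>) * y) powr (- \<gamma>) * (rate y v * (((k + w * (1 - \<tau>) * y) / (k + w * (1 - \<tau>) * v)) powr \<gamma> - 1))"
    using p by (simp add: right_diff_distrib)
qed

lemma gen_marginal_x:
  assumes x: "r * x \<ge> 0" and y: "y \<in> S"
  shows "gen (marginal x) y = marginal x y * excess \<gamma> (w * (1 - \<tau>)) (r * (abar + x)) y"
proof -
  have "r * (abar + x) + w * (1 - \<tau>) * Min S > 0" using feasible x by (simp add: algebra_simps)
  from gen_marginal[OF this y] show ?thesis
    unfolding marginal_def earnings_def by (simp add: algebra_simps)
qed

lemma earnings_interest_pos: "r * x \<ge> 0 \<Longrightarrow> y \<in> S \<Longrightarrow> earnings y + r * x > 0"
  using earnings_bounds(3)[of y] by linarith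

lemma marginal_pos: "r * x \<ge> 0 \<Longrightarrow> y \<in> S \<Longrightarrow> marginal x y > 0"
  using earnings_interest_pos[of x y] by (simp add: marginal_def)

definition patient :: bool where
  "patient \<longleftrightarrow> (\<forall>y\<in>S. excess \<gamma> (w * (1 - \<tau>)) (r * abar) y \<le> \<rho> - r)"

text \<open>
  With nonnegative interest on wealth, \<open>excess_antimono\<close> carries the inequality from the borrowing
  limit to all higher wealth levels.
\<close>

lemma marginal_supersolution:
  assumes p: "patient" and x: "r * x \<ge> 0" and y: "y \<in> S"
  shows "(\<rho> - r) * marginal x y - gen (marginal x) y \<ge> 0"
proof -
  let ?\<omega> = "w * (1 - \<tau>)"
  let ?l = "r * (abar + x) + ?\<omega> * y" and ?k = "r * abar + ?\<omega> * y"
  have le: "r * abar \<le> r * (abar + x)" using x by (simp add: algebra_simps)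
  have l: "?l > 0" "?k > 0" "?k \<le> ?l"
    using earnings_interest_pos[OF x y] earnings_bounds(3)[OF y] le by (auto simp: earnings_def algebra_simps)
  have "?l * excess \<gamma> ?\<omega> (r * (abar + x)) y \<le> ?k * excess \<gamma> ?\<omega> (r * abar) y"
    using excess_antimono[OF \<gamma> wt_pos feasible le y] .
  also have "\<dots> \<le> ?k * (\<rho> - r)" using p y l by (intro mult_left_mono) (auto simp: patient_def)
  also have "\<dots> \<le> ?l * (\<rho> - r)" using l r by (intro mult_right_mono) auto
  finally have "excess \<gamma> ?\<omega> (r * (abar + x)) y \<le> \<rho> - r" using l by simp
  then have "marginal x y * excess \<gamma> ?\<omega> (r * (abar + x)) y \<le> marginal x y * (\<rho> - r)"
    using marginal_pos[OF x y] by (intro mult_left_mono) auto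
  then show ?thesis unfolding gen_marginal_x[OF x y] by (simp add: mult.commute)
qed

text \<open>From the lowest state every jump raises income and lowers marginal utility. There the
  supersolution inequality holds with room \<open>(\<rho> - r) * marginal x (Min S)\<close>, the
  source of the strict loss in that state.\<close>

lemma gen_marginal_Min:
  assumes "r * x \<ge> 0" shows "gen (marginal x) (Min S) \<le> 0"
  unfolding gen_eq[OF Min_S]
proof (rule sum_nonpos)
  fix v assume v: "v \<in> S - {Min S}"
  then have "Min S \<le> v" using finite_S by auto
  then have "marginal x v \<le> marginal x (Min S)"
    unfolding marginal_def using earnings_interest_pos[OF assms Min_S] earnings_mono[of "Min S" v] \<gamma>
    by (intro powr_minus_antimono) auto
  then show "rate (Min S) v * (marginal x v - marginal x (Min S)) \<le> 0"
    using rate_nonneg[OF Min_S, of v] v by (intro mult_nonneg_nonpos) auto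
qed

context
  fixes z :: real
  assumes z: "z \<in> S"
begin

text \<open>The largest marginal utility of limit income, taken as a constant price, is a
  supersolution for every r < \<rho>, since the generator annihilates constants. The bound excludes
  an infinite slope at the limit.\<close>

lemma V_increment_at_limit:
  assumes "\<eta> > 0" shows "V \<eta> z - V 0 z \<le> \<eta> * earnings (Min S) powr (- \<gamma>)"
proof -
  let ?B = "earnings (Min S) powr (- \<gamma>)"
  have "V (0 + \<eta>) z - V 0 z \<le> \<eta> * (?B - 0 * 0) + 0 * 0\<^sup>2 / (\<rho> + 2 * 0)"
  proof (rule V_increment_le[OF z, where ?f0.0 = "\<lambda>_. ?B" and ?f1.0 = "\<lambda>_. 0"])
    fix y t c :: real assume y: "y \<in> S" and c: "earnings y + r * 0 \<le> c"
    have b: "earnings y > 0" using earnings_bounds[OF y] by simp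
    have "crra \<gamma> c \<le> crra \<gamma> (earnings y) + earnings y powr (- \<gamma>) * (c - earnings y)"
      using b c \<gamma> by (intro crra_tangent) auto
    also have "earnings y powr (- \<gamma>) * (c - earnings y) \<le> ?B * (c - earnings y)"
      using c earnings_bounds[OF y] earnings_Min_pos \<gamma> by (intro mult_right_mono powr_minus_antimono) auto
    finally show "crra \<gamma> c \<le> crra \<gamma> (earnings y + r * 0) + (?B - 0 * exp (- 0 * t) * 0) * (c - (earnings y + r * 0)) + 0 * (0 * exp (- 0 * t))\<^sup>2"
      by simp
  next
    fix y s :: real assume "y \<in> S"
    then show "((\<rho> - r) * ?B - gen (\<lambda>_. ?B) y) - 0 * (exp (- 0 * s) * ((\<rho> - r + 0) * 0 - gen (\<lambda>_. 0) y)) \<ge> 0"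
      using r by (simp add: gen_const)
  qed (use assms in auto)
  then show ?thesis by simp
qed

lemma V_increment_patient:
  assumes p: "patient" and x: "x \<ge> 0" "r * x \<ge> 0" and \<eta>: "\<eta> > 0"
  shows "V (x + \<eta>) z - V x z \<le> \<eta> * marginal x z"
proof -
  have "V (x + \<eta>) z - V x z \<le> \<eta> * (marginal x z - 0 * 0) + 0 * 0\<^sup>2 / (\<rho> + 2 * 0)"
  proof (rule V_increment_le[OF z x \<eta>, where ?f0.0 = "marginal x" and ?f1.0 = "\<lambda>_. 0"])
    fix y t c :: real assume y: "y \<in> S" and c: "earnings y + r * x \<le> c"
    have "crra \<gamma> c \<le> crra \<gamma> (earnings y + r * x) + (earnings y + r * x) powr (- \<gamma>) * (c - (earnings y + r * x))"
      using earnings_interest_pos[OF x(2) y] c \<gamma> by (intro crra_tangent) auto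
    then show "crra \<gamma> c \<le> crra \<gamma> (earnings y + r * x) + (marginal x y - 0 * exp (- 0 * t) * 0) * (c - (earnings y + r * x)) + 0 * (0 * exp (- 0 * t))\<^sup>2"
      by (simp add: marginal_def)
  next
    fix y s :: real assume "y \<in> S"
    then show "((\<rho> - r) * marginal x y - gen (marginal x) y) - 0 * (exp (- 0 * s) * ((\<rho> - r + 0) * 0 - gen (\<lambda>_. 0) y)) \<ge> 0"
      using marginal_supersolution[OF p x(2)] by simp
  qed auto
  then show ?thesis by simp
qed

end

definition rate_Min :: real where
  "rate_Min = (\<Sum>v\<in>S - {Min S}. rate (Min S) v)"

lemma rate_Min_nonneg: "rate_Min \<ge> 0"
  unfolding rate_Min_def using rate_nonneg[OF Min_S] by (intro sum_nonneg) auto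

text \<open>The perturbation f1 is the indicator of the lowest state. There the supersolution has
  room for \<open>m * (\<rho> - r + \<theta> + rate_Min)\<close>, and in the other states
  \<open>gen f1 \<ge> 0\<close> works in its favour. The constants serve all wealth up to X because
  later x moves with the increment.\<close>

lemma V_increment_Min:
  "\<exists>\<mu>0>0. \<exists>C\<ge>0. \<forall>x \<eta> m \<theta> :: real. patient \<longrightarrow> 0 \<le> x \<longrightarrow> x \<le> X \<longrightarrow> r * x \<ge> 0 \<longrightarrow> \<eta> > 0 \<longrightarrow> \<theta> \<ge> 0 \<longrightarrow> 0 \<le> m \<longrightarrow> m \<le> \<mu>0 \<longrightarrow>
      m * (\<rho> - r + \<theta> + rate_Min) \<le> (\<rho> - r) * marginal x (Min S) \<longrightarrow>
      V (x + \<eta>) (Min S) - V x (Min S) \<le> \<eta> * (marginal x (Min S) - m) + C * m\<^sup>2 / (\<rho> + 2 * \<theta>)"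
proof -
  obtain \<mu>0 C where \<mu>0: "\<mu>0 > 0" and C: "C \<ge> 0" and slack:
    "\<And>b c \<mu>. earnings (Min S) \<le> b \<Longrightarrow> b \<le> earnings (Min S) + \<bar>r\<bar> * \<bar>X\<bar> \<Longrightarrow> b \<le> c \<Longrightarrow> 0 \<le> \<mu> \<Longrightarrow> \<mu> \<le> \<mu>0 \<Longrightarrow>
       crra \<gamma> c \<le> crra \<gamma> b + (b powr (- \<gamma>) - \<mu>) * (c - b) + C * \<mu>\<^sup>2"
  proof (rule crra_tangent_slack_uniform[OF \<gamma> earnings_Min_pos])
    fix \<mu>0 C :: real assume "\<mu>0 > 0" "C \<ge> 0"
      "\<And>b c \<mu>. earnings (Min S) \<le> b \<Longrightarrow> b \<le> earnings (Min S) + \<bar>r\<bar> * \<bar>X\<bar> \<Longrightarrow> b \<le> c \<Longrightarrow> 0 \<le> \<mu> \<Longrightarrow> \<mu> \<le> \<mu>0 \<Longrightarrow>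
       crra \<gamma> c \<le> crra \<gamma> b + (b powr (- \<gamma>) - \<mu>) * (c - b) + C * \<mu>\<^sup>2"
    then show thesis by (rule that)
  qed
  show ?thesis
  proof (rule exI[of _ \<mu>0], intro conjI \<mu>0, rule exI[of _ C], intro conjI C allI impI)
    fix x \<eta> m \<theta> :: real assume p: "patient" and x: "0 \<le> x" "x \<le> X" "r * x \<ge> 0" and \<eta>: "\<eta> > 0" and \<theta>: "\<theta> \<ge> 0"
      and m: "0 \<le> m" "m \<le> \<mu>0" "m * (\<rho> - r + \<theta> + rate_Min) \<le> (\<rho> - r) * marginal x (Min S)"
    let ?f1 = "\<lambda>y. if y = Min S then 1 else 0 :: real"
    have "V (x + \<eta>) (Min S) - V x (Min S) \<le> \<eta> * (marginal x (Min S) - m * ?f1 (Min S)) + C * m\<^sup>2 / (\<rho> + 2 * \<theta>)"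
    proof (rule V_increment_le[OF Min_S x(1,3) \<eta> \<theta> m(1), where ?f0.0 = "marginal x" and ?f1.0 = ?f1])
      fix y t c :: real assume y: "y \<in> S" and t: "t \<ge> 0" and c: "earnings y + r * x \<le> c"
      have e1: "0 < exp (- \<theta> * t)" "exp (- \<theta> * t) \<le> 1" using \<theta> t by auto
      show "crra \<gamma> c \<le> crra \<gamma> (earnings y + r * x) + (marginal x y - m * exp (- \<theta> * t) * ?f1 y) * (c - (earnings y + r * x)) + C * (m * exp (- \<theta> * t))\<^sup>2"
      proof (cases "y = Min S")
        case True
        have "r * x \<le> \<bar>r\<bar> * \<bar>X\<bar>" 
          by (rule order_trans[OF mult_right_mono[OF abs_ge_self] mult_left_mono]) (use x in auto)
        moreover have "m * exp (- \<theta> * t) \<le> \<mu>0" using m(1,2) e1 mult_left_mono[of "exp (- \<theta> * t)" 1 m] by linarith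
        ultimately show ?thesis
          using slack[of "earnings y + r * x" c "m * exp (- \<theta> * t)"] x c m True by (simp add: marginal_def)
      next
        case False
        have "crra \<gamma> c \<le> crra \<gamma> (earnings y + r * x) + (earnings y + r * x) powr (- \<gamma>) * (c - (earnings y + r * x))"
          using earnings_interest_pos[OF x(3) y] c \<gamma> by (intro crra_tangent) auto
        moreover have "0 \<le> C * (m * exp (- \<theta> * t))\<^sup>2" using C by simp
        ultimately show ?thesis using False by (simp add: marginal_def)
      qed
    next
      fix y s :: real assume y: "y \<in> S" and s: "s \<ge> 0"
      have e1: "0 < exp (- \<theta> * s)" "exp (- \<theta> * s) \<le> 1" using \<theta> s by auto
      show "((\<rho> - r) * marginal x y - gen (marginal x) y) - m * (exp (- \<theta> * s) * ((\<rho> - r + \<theta>) * ?f1 y - gen ?f1 y)) \<ge> 0"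
      proof (cases "y = Min S")
        case True
        have "gen ?f1 (Min S) = - rate_Min"
          unfolding gen_eq[OF Min_S] rate_Min_def sum_negf[symmetric] by (intro sum.cong) auto
        then have eq: "m * (exp (- \<theta> * s) * ((\<rho> - r + \<theta>) * ?f1 y - gen ?f1 y)) = exp (- \<theta> * s) * (m * (\<rho> - r + \<theta> + rate_Min))"
          using True by (simp add: algebra_simps)
        have "0 \<le> m * (\<rho> - r + \<theta> + rate_Min)" using m(1) r \<theta> rate_Min_nonneg by simp
        then have "exp (- \<theta> * s) * (m * (\<rho> - r + \<theta> + rate_Min)) \<le> 1 * (m * (\<rho> - r + \<theta> + rate_Min))"
          using e1 by (intro mult_right_mono) auto
        then show ?thesis using m(3) gen_marginal_Min[OF x(3)] unfolding eq unfolding True by linarith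
      next
        case False
        have "gen ?f1 y = (\<Sum>v\<in>S - {y}. rate y v * ?f1 v)"
          unfolding gen_eq[OF y] using False by (intro sum.cong) auto
        also have "\<dots> \<ge> 0" using rate_nonneg[OF y] by (intro sum_nonneg) auto
        finally have "m * (exp (- \<theta> * s) * gen ?f1 y) \<ge> 0" using m e1 by simp
        then show ?thesis using marginal_supersolution[OF p x(3) y] False by simp
      qed
    qed (rule C)
    then show "V (x + \<eta>) (Min S) - V x (Min S) \<le> \<eta> * (marginal x (Min S) - m) + C * m\<^sup>2 / (\<rho> + 2 * \<theta>)" by simp
  qed
qed

text \<open>For r < 0 the increment estimates are confined to x = 0, so the chord starts at the
  limit. Its length a is fixed, and with \<theta> = 0 the gain \<open>a * m\<close>, linear in m,
  beats the quadratic error for small m.\<close>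

lemma V_slope_Min_nonpos_interest:
  assumes p: "patient" and r0: "r \<le> 0" and a: "a > 0"
  shows "(V a (Min S) - V 0 (Min S)) / a < marginal 0 (Min S)"
proof -
  obtain \<mu>0 C where \<mu>0: "\<mu>0 > 0" and C: "C \<ge> 0" and inc: "\<forall>x \<eta> m \<theta> :: real. patient \<longrightarrow> 0 \<le> x \<longrightarrow> x \<le> 0 \<longrightarrow> r * x \<ge> 0 \<longrightarrow> \<eta> > 0 \<longrightarrow> \<theta> \<ge> 0 \<longrightarrow> 0 \<le> m \<longrightarrow> m \<le> \<mu>0 \<longrightarrow>
      m * (\<rho> - r + \<theta> + rate_Min) \<le> (\<rho> - r) * marginal x (Min S) \<longrightarrow>
      V (x + \<eta>) (Min S) - V x (Min S) \<le> \<eta> * (marginal x (Min S) - m) + C * m\<^sup>2 / (\<rho> + 2 * \<theta>)"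
    using V_increment_Min[of 0] by blast
  let ?q = "marginal 0 (Min S)"
  have q: "?q > 0" using marginal_pos[of 0 "Min S"] Min_S by simp
  have R: "\<rho> - r + rate_Min > 0" using r rate_Min_nonneg by simp
  \<comment> \<open>The three bounds are the range of the slack estimate, the room of the
    supersolution, and the inequality \<open>C * m\<^sup>2 / \<rho> < a * m\<close>.\<close>
  define m where "m = min \<mu>0 (min ((\<rho> - r) * ?q / (\<rho> - r + rate_Min)) (a * \<rho> / (2 * C + 1)))"
  have m0: "m > 0" using \<mu>0 q r R a \<rho> C by (simp add: m_def)
  have m1: "m * (\<rho> - r + 0 + rate_Min) \<le> (\<rho> - r) * ?q"
  proof -
    have "m \<le> (\<rho> - r) * ?q / (\<rho> - r + rate_Min)" by (simp add: m_def)
    then show ?thesis using R by (simp add: field_simps)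
  qed
  have "V (0 + a) (Min S) - V 0 (Min S) \<le> a * (?q - m) + C * m\<^sup>2 / (\<rho> + 2 * 0)"
    using m0 a m1 by (intro inc[rule_format] p) (auto simp: m_def)
  moreover have "C * m\<^sup>2 / \<rho> < a * m"
  proof -
    have "m \<le> a * \<rho> / (2 * C + 1)" by (simp add: m_def)
    then have "m * (2 * C + 1) \<le> a * \<rho>" using C by (simp add: field_simps)
    moreover have "m * (2 * C + 1) = 2 * (m * C) + m" by (simp add: algebra_simps)
    ultimately have "m * C < a * \<rho>" using m0 C mult_nonneg_nonneg[of m C] by linarith
    then have "m * (m * C) < m * (a * \<rho>)" using m0 by simp
    then show ?thesis using \<rho> by (simp add: field_simps power2_eq_square)
  qed
  ultimately have "V a (Min S) - V 0 (Min S) < a * ?q" by (simp add: algebra_simps)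
  then show ?thesis using a by (simp add: field_simps)
qed

text \<open>For r > 0 marginal utility is larger at the start of the chord than at a, by an amount
  of order \<eta>, so the chord must be short. A short chord leaves little gain against the
  quadratic error, which is why \<theta> has to grow.\<close>

lemma V_slope_Min_pos_interest:
  assumes p: "patient" and r0: "r > 0" and a: "a > 0"
  obtains \<eta> where "0 < \<eta>" "\<eta> < a" "(V a (Min S) - V (a - \<eta>) (Min S)) / \<eta> < marginal a (Min S)"
proof -
  obtain \<mu>0 C where \<mu>0: "\<mu>0 > 0" and C: "C \<ge> 0" and inc: "\<forall>x \<eta> m \<theta> :: real. patient \<longrightarrow> 0 \<le> x \<longrightarrow> x \<le> a \<longrightarrow> r * x \<ge> 0 \<longrightarrow> \<eta> > 0 \<longrightarrow> \<theta> \<ge> 0 \<longrightarrow> 0 \<le> m \<longrightarrow> m \<le> \<mu>0 \<longrightarrow>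
      m * (\<rho> - r + \<theta> + rate_Min) \<le> (\<rho> - r) * marginal x (Min S) \<longrightarrow>
      V (x + \<eta>) (Min S) - V x (Min S) \<le> \<eta> * (marginal x (Min S) - m) + C * m\<^sup>2 / (\<rho> + 2 * \<theta>)"
    using V_increment_Min[of a] by blast
  define g0 where "g0 = (\<rho> - r) * marginal a (Min S)"
  have ra: "r * x \<ge> 0" if "x \<ge> 0" for x using that r0 by simp
  have g0: "g0 > 0" using marginal_pos[OF ra Min_S, of a] a r by (simp add: g0_def)
  define \<Phi> where "\<Phi> = \<gamma> * earnings (Min S) powr (- \<gamma> - 1)"
  have \<Phi>: "\<Phi> > 0" using \<gamma> earnings_Min_pos by (simp add: \<Phi>_def)
  \<comment> \<open>With \<open>\<theta> = g0 / (2 * m)\<close> half of the room g0 goes to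
    \<theta>, and the error \<open>C * m\<^sup>2 / (2 * \<theta>)\<close> is
    \<open>(C / g0) * m ^ 3\<close>. Taking \<open>\<eta> = N * m\<^sup>2\<close> makes it at most a
    quarter of \<open>\<eta> * m\<close>; another quarter covers the change of marginal utility
    between \<open>a - \<eta>\<close> and a.\<close>
  define N where "N = 4 * C / g0 + 1"
  have N: "N \<ge> 1" using C g0 by (simp add: N_def)
  have R: "\<rho> - r + rate_Min > 0" using r rate_Min_nonneg by simp
  have rP: "r * \<Phi> * N > 0" using r0 \<Phi> N by simp
  \<comment> \<open>The last three bounds give the other half of the room g0, the inequality \<eta>
    < a, and the change of marginal utility.\<close>
  define m where "m = min (min \<mu>0 1) (min (g0 / (2 * (\<rho> - r + rate_Min))) (min (a / (2 * N)) (1 / (4 * (r * \<Phi> * N)))))"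
  have m0: "m > 0" using \<mu>0 g0 R a N rP by (simp add: m_def)
  have mle: "m \<le> \<mu>0" "m \<le> 1" "m \<le> g0 / (2 * (\<rho> - r + rate_Min))" "m \<le> a / (2 * N)" "m \<le> 1 / (4 * (r * \<Phi> * N))"
    by (auto simp: m_def)
  define \<theta> where "\<theta> = g0 / (2 * m)"
  have \<theta>: "\<theta> > 0" using g0 m0 by (simp add: \<theta>_def)
  define \<eta> where "\<eta> = N * m\<^sup>2"
  have \<eta>0: "\<eta> > 0" using N m0 by (simp add: \<eta>_def)
  have mm: "m\<^sup>2 \<le> m" using m0 mle(2) mult_left_mono[of m 1 m] by (simp add: power2_eq_square)
  have \<eta>a: "\<eta> < a"
  proof -
    have "\<eta> \<le> N * m" unfolding \<eta>_def using mm N by (intro mult_left_mono) auto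
    also have "\<dots> \<le> a / 2" using mle(4) N by (simp add: field_simps)
    finally show ?thesis using a by simp
  qed
  define x where "x = a - \<eta>"
  have x: "0 \<le> x" "x \<le> a" using \<eta>a \<eta>0 by (auto simp: x_def)
  have bx: "earnings (Min S) \<le> earnings (Min S) + r * x" "0 < earnings (Min S) + r * x" "earnings (Min S) + r * x \<le> earnings (Min S) + r * a"
    using ra[OF x(1)] earnings_Min_pos mult_left_mono[OF x(2), of r] r0 by auto
  have q_mono: "marginal a (Min S) \<le> marginal x (Min S)"
    unfolding marginal_def using bx \<gamma> by (intro powr_minus_antimono) auto
  have "m * (\<rho> - r + \<theta> + rate_Min) = m * (\<rho> - r + rate_Min) + g0 / 2"
    using m0 by (simp add: \<theta>_def field_simps)
  also have "\<dots> \<le> g0" using mle(3) R by (simp add: field_simps)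
  also have "\<dots> \<le> (\<rho> - r) * marginal x (Min S)" unfolding g0_def using q_mono r by (intro mult_left_mono) auto
  finally have cond: "m * (\<rho> - r + \<theta> + rate_Min) \<le> (\<rho> - r) * marginal x (Min S)" .
  have "V (x + \<eta>) (Min S) - V x (Min S) \<le> \<eta> * (marginal x (Min S) - m) + C * m\<^sup>2 / (\<rho> + 2 * \<theta>)"
    using x ra[OF x(1)] \<eta>0 \<theta> m0 mle cond by (intro inc[rule_format] p) auto
  also have "C * m\<^sup>2 / (\<rho> + 2 * \<theta>) \<le> C * m\<^sup>2 / (2 * \<theta>)"
    using C \<theta> \<rho> by (intro divide_left_mono) auto
  also have "C * m\<^sup>2 / (2 * \<theta>) = (C / g0) * m * m\<^sup>2" using m0 g0 by (simp add: \<theta>_def field_simps power2_eq_square)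
  also have "\<dots> \<le> (N / 4) * m * m\<^sup>2"
  proof (intro mult_right_mono)
    show "C / g0 \<le> N / 4" using g0 by (simp add: N_def add_divide_distrib)
  qed (use m0 in auto)
  also have "\<dots> = \<eta> * (m / 4)" by (simp add: \<eta>_def)
  finally have 1: "V (x + \<eta>) (Min S) - V x (Min S) \<le> \<eta> * (marginal x (Min S) - m + m / 4)" by (simp add: algebra_simps)
  have "marginal a (Min S) \<ge> marginal x (Min S) - \<gamma> * (earnings (Min S) + r * x) powr (- \<gamma> - 1) * ((earnings (Min S) + r * a) - (earnings (Min S) + r * x))"
    unfolding marginal_def using \<gamma> bx by (intro powr_minus_tangent) auto
  moreover have "(earnings (Min S) + r * a) - (earnings (Min S) + r * x) = r * \<eta>" by (simp add: x_def algebra_simps)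
  moreover have "\<gamma> * (earnings (Min S) + r * x) powr (- \<gamma> - 1) * (r * \<eta>) \<le> \<Phi> * (r * \<eta>)"
  proof -
    have g1: "- \<gamma> - 1 = - (\<gamma> + 1)" by simp
    have "(earnings (Min S) + r * x) powr (- (\<gamma> + 1)) \<le> earnings (Min S) powr (- (\<gamma> + 1))"
      using bx earnings_Min_pos \<gamma> by (intro powr_minus_antimono) auto
    then show ?thesis unfolding \<Phi>_def g1
      using \<gamma> r0 \<eta>0 by (intro mult_right_mono mult_left_mono) auto
  qed
  moreover have "\<Phi> * (r * \<eta>) \<le> m / 4"
  proof -
    have "r * \<Phi> * N * m \<le> 1 / 4" using mle(5) rP by (simp add: field_simps)
    then have "r * \<Phi> * N * m * m \<le> 1 / 4 * m" using m0 by (intro mult_right_mono) auto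
    then show ?thesis by (simp add: \<eta>_def power2_eq_square mult_ac)
  qed
  ultimately have "marginal x (Min S) \<le> marginal a (Min S) + m / 4" by simp
  then have "marginal x (Min S) - m + m / 4 < marginal a (Min S)" using m0 by simp
  then have "\<eta> * (marginal x (Min S) - m + m / 4) < \<eta> * marginal a (Min S)" using \<eta>0 by simp
  then have "V a (Min S) - V (a - \<eta>) (Min S) < \<eta> * marginal a (Min S)" using 1 by (simp add: x_def)
  then have "(V a (Min S) - V (a - \<eta>) (Min S)) / \<eta> < marginal a (Min S)" using \<eta>0 by (simp add: field_simps)
  then show ?thesis using that \<eta>0 \<eta>a by blast
qed

end

section \<open>Regularity of the value function\<close>

lemma crra_concave:
  assumes "\<gamma> > 0" "a > 0" "b > 0" "u \<ge> 0" "v \<ge> 0" "u + v = (1::real)"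
  shows "u * crra \<gamma> a + v * crra \<gamma> b \<le> crra \<gamma> (u * a + v * b)"
proof -
  define m where "m = u * a + v * b"
  have m: "m > 0"
  proof (cases "u = 0")
    case True then show ?thesis using assms by (simp add: m_def)
  next
    case False then show ?thesis using assms by (auto simp: m_def intro!: add_pos_nonneg mult_pos_pos)
  qed
  have "u * crra \<gamma> a + v * crra \<gamma> b \<le> u * (crra \<gamma> m + m powr (- \<gamma>) * (a - m)) + v * (crra \<gamma> m + m powr (- \<gamma>) * (b - m))"
    using assms m by (intro add_mono mult_left_mono crra_tangent) auto
  also have "\<dots> = (u + v) * crra \<gamma> m + m powr (- \<gamma>) * (m - (u + v) * m)"
    by (simp add: m_def algebra_simps)
  finally show ?thesis using assms(6) by (simp add: m_def)
qed

lemma integrable_bounded_times: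
  fixes f g :: "'a \<Rightarrow> real"
  assumes f: "integrable N f" and g: "g \<in> borel_measurable N" and B: "AE x in N. \<bar>g x\<bar> \<le> B"
  shows "integrable N (\<lambda>x. g x * f x)"
proof -
  have i: "integrable N (\<lambda>x. \<bar>B\<bar> * f x)" using f by simp
  have "AE x in N. norm (g x * f x) \<le> norm (\<bar>B\<bar> * f x)"
    using B by eventually_elim (auto simp: abs_mult intro!: mult_right_mono)
  then show ?thesis
    by (rule Bochner_Integration.integrable_bound[OF i, rotated]) (use g borel_measurable_integrable[OF f] in measurable)
qed

context household
begin

context
  fixes z :: real
  assumes z: "z \<in> S"
begin

text \<open>Above, utility is dominated by an affine function of consumption, which the budget makes
  integrable; only a lower bound has to be supplied.\<close>

lemma good_if_bounded_below:
  assumes c: "adm x z c" and x: "x \<ge> 0" and l: "integrable (Q z) l"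
    and le: "AE p in Q z. l p \<le> crra \<gamma> (c (fst p) (snd p))"
  shows "good x z c"
proof -
  interpret finite_measure "Q z" by (rule finite_measure_Q[OF z])
  have i: "integrable (Q z) (\<lambda>p. \<bar>l p\<bar> + (\<bar>crra \<gamma> 1\<bar> + c (fst p) (snd p)))"
    using l consumption_integrable(1)[OF z c x] by simp
  have "AE p in Q z. norm (crra \<gamma> (c (fst p) (snd p))) \<le> norm (\<bar>l p\<bar> + (\<bar>crra \<gamma> 1\<bar> + c (fst p) (snd p)))"
    using le AE_Q_Z[OF z]
  proof eventually_elim
    case (elim p)
    then have "c (fst p) (snd p) > 0" by (intro adm_pos[OF c]) auto
    then show ?case using elim(1) crra_le_affine[OF z, of "c (fst p) (snd p)"] by simp
  qed
  then have "integrable (Q z) (\<lambda>p. crra \<gamma> (c (fst p) (snd p)))"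
    by (rule Bochner_Integration.integrable_bound[OF i, rotated])
      (use measurable_Q[OF adm_progressive[OF c]] in measurable)
  then show ?thesis using c by (simp add: good_def)
qed

text \<open>The budget in terms of \<open>cum\<close> is linear, so mixtures of controls are
  affordable from mixed wealth; concave utility does the rest.\<close>

lemma V_concave: "concave_on {0..} (\<lambda>x. V x z)"
  unfolding concave_on_iff
proof (intro conjI ballI allI impI)
  fix x y u v :: real
  assume x: "x \<in> {0..}" and y: "y \<in> {0..}" and uv: "u \<ge> 0" "v \<ge> 0" "u + v = 1"
  let ?m = "u *\<^sub>R x + v *\<^sub>R y"
  have m: "?m \<ge> 0" using x y uv by simp
  show "V ?m z \<ge> u * V x z + v * V y z"
  proof (rule field_le_epsilon)
    fix \<epsilon> :: real assume \<epsilon>: "\<epsilon> > 0"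
    obtain c where c: "good x z c" "J z c > V x z - \<epsilon>" using V_approx[OF z _ \<epsilon>, of x] x by auto
    obtain d where d: "good y z d" "J z d > V y z - \<epsilon>" using V_approx[OF z _ \<epsilon>, of y] y by auto
    have ac: "adm x z c" and ad: "adm y z d" using c d by (auto simp: good_def)
    define f where "f t \<omega> = u * c t \<omega> + v * d t \<omega>" for t \<omega>
    have fp: "progressively_measurable F f"
    proof (rule progressively_measurableI)
      fix t :: real assume t: "t \<ge> 0"
      note [measurable] = progressively_measurableD[OF adm_progressive[OF ac] t] progressively_measurableD[OF adm_progressive[OF ad] t]
      show "(\<lambda>p. f (fst p) (snd p)) \<in> borel_measurable (prog_space t)" unfolding f_def by measurable
    qed
    have fpos: "f t \<omega> > 0" if "t \<ge> 0" "\<omega> \<in> space M" for t \<omega>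
    proof (cases "u = 0")
      case True then show ?thesis using uv adm_pos[OF ad that] by (simp add: f_def)
    next
      case False then show ?thesis using uv adm_pos[OF ac that] adm_pos[OF ad that]
        by (auto simp: f_def intro!: add_pos_nonneg mult_pos_pos)
    qed
    have "AE \<omega> in law z. \<forall>t\<ge>0. cum r (\<lambda>s. f s \<omega>) t \<le> ennreal ?m + cum r (\<lambda>s. earnings (Z s \<omega>)) t"
    proof -
      have "AE \<omega> in law z. \<forall>t\<ge>0. cum r (\<lambda>s. c s \<omega>) t \<le> ennreal x + cum r (\<lambda>s. earnings (Z s \<omega>)) t"
        "AE \<omega> in law z. \<forall>t\<ge>0. cum r (\<lambda>s. d s \<omega>) t \<le> ennreal y + cum r (\<lambda>s. earnings (Z s \<omega>)) t"
        using ac ad by (auto simp: adm_def)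
      with AE_space show ?thesis
      proof eventually_elim
        case (elim \<omega>)
        then have \<omega>: "\<omega> \<in> space M" by simp
        have [measurable]: "(\<lambda>s. c s \<omega>) \<in> borel_measurable halfline" "(\<lambda>s. d s \<omega>) \<in> borel_measurable halfline"
          using path_measurable[OF adm_progressive[OF ac] \<omega>] path_measurable[OF adm_progressive[OF ad] \<omega>] by auto
        show ?case
        proof (intro allI impI)
          fix t :: real assume t: "t \<ge> 0"
          let ?Y = "cum r (\<lambda>s. earnings (Z s \<omega>)) t"
          have "cum r (\<lambda>s. f s \<omega>) t = cum r (\<lambda>s. u * c s \<omega>) t + cum r (\<lambda>s. v * d s \<omega>) t"
            unfolding f_def using uv adm_pos[OF ac _ \<omega>] adm_pos[OF ad _ \<omega>]
            by (intro cum_add) (auto intro: mult_nonneg_nonneg less_imp_le)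
          also have "\<dots> = ennreal u * cum r (\<lambda>s. c s \<omega>) t + ennreal v * cum r (\<lambda>s. d s \<omega>) t"
            using uv by (simp add: cum_cmult)
          also have "\<dots> \<le> ennreal u * (ennreal x + ?Y) + ennreal v * (ennreal y + ?Y)"
            using elim t by (intro add_mono mult_left_mono) auto
          also have "\<dots> = (ennreal u * ennreal x + ennreal v * ennreal y) + (ennreal u + ennreal v) * ?Y"
            by (simp add: distrib_left distrib_right add_ac)
          also have "(ennreal u + ennreal v) = 1" using uv by (simp add: ennreal_plus[symmetric])
          also have "ennreal u * ennreal x + ennreal v * ennreal y = ennreal ?m"
            using uv x y by (simp add: ennreal_mult ennreal_plus)
          finally show "cum r (\<lambda>s. f s \<omega>) t \<le> ennreal ?m + ?Y" by simp
        qed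
      qed
    qed
    then have af: "adm ?m z f" using fp fpos by (simp add: adm_def)
    let ?l = "\<lambda>p. u * crra \<gamma> (c (fst p) (snd p)) + v * crra \<gamma> (d (fst p) (snd p))"
    have il: "integrable (Q z) ?l" using c(1) d(1) by (simp add: good_def)
    have le: "AE p in Q z. ?l p \<le> crra \<gamma> (f (fst p) (snd p))"
      using AE_Q_Z[OF z] unfolding f_def
      by eventually_elim (use adm_pos[OF ac] adm_pos[OF ad] uv \<gamma> in \<open>intro crra_concave; simp\<close>)
    have gf: "good ?m z f" by (rule good_if_bounded_below[OF af m il le])
    have "u * J z c + v * J z d = (\<integral>p. ?l p \<partial>Q z)"
      unfolding J_def using c(1) d(1) by (simp add: good_def)
    also have "\<dots> \<le> J z f"
      unfolding J_def using le il gf by (intro integral_mono_AE) (auto simp: good_def)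
    also have "\<dots> \<le> V ?m z" by (rule J_le_V[OF z m gf])
    finally have "u * J z c + v * J z d \<le> V ?m z" .
    moreover have "u * (V x z - \<epsilon>) + v * (V y z - \<epsilon>) \<le> u * J z c + v * J z d"
      using c(2) d(2) uv by (intro add_mono mult_left_mono) auto
    moreover have "u * (V x z - \<epsilon>) + v * (V y z - \<epsilon>) = u * V x z + v * V y z - (u + v) * \<epsilon>" by (simp add: algebra_simps)
    ultimately show "u * V x z + v * V y z \<le> V ?m z + \<epsilon>" using uv by simp
  qed
qed simp

text \<open>
  Scaling consumption by \<open>1 \<plusminus> \<theta>\<close> until initial wealth \<open>x\<close> is used up is feasible from wealth \<open>(1 \<plusminus> \<theta>) x\<close>.
\<close>

lemma scaled_budget:
  assumes c: "adm x z c" and x: "x > 0" and \<theta>: "-1/2 \<le> \<theta>" "\<theta> \<le> 1/2"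
  shows "adm (x + \<theta> * x) z (\<lambda>t \<omega>. c t \<omega> + \<theta> * (if cum r (\<lambda>v. c v \<omega>) t < ennreal x then c t \<omega> else 0))"
proof -
  note cp = adm_progressive[OF c]
  define e where "e t \<omega> = (if cum r (\<lambda>v. c v \<omega>) t < ennreal x then c t \<omega> else 0)" for t \<omega>
  have zerop: "progressively_measurable F (\<lambda>t \<omega>. 0)" by (rule progressively_measurableI) simp
  have ep: "progressively_measurable F e" unfolding e_def by (rule progressive_if_cum[OF cp cp zerop])
  have fp: "progressively_measurable F (\<lambda>t \<omega>. c t \<omega> + \<theta> * e t \<omega>)"
  proof (rule progressively_measurableI)
    fix t :: real assume t: "t \<ge> 0"
    note [measurable] = progressively_measurableD[OF cp t] progressively_measurableD[OF ep t]
    show "(\<lambda>p. c (fst p) (snd p) + \<theta> * e (fst p) (snd p)) \<in> borel_measurable (prog_space t)" by measurable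
  qed
  have e_bounds: "0 \<le> e t \<omega>" "e t \<omega> \<le> c t \<omega>" if "t \<ge> 0" "\<omega> \<in> space M" for t \<omega>
    using adm_pos[OF c that] by (auto simp: e_def)
  have fpos: "c t \<omega> + \<theta> * e t \<omega> > 0" if "t \<ge> 0" "\<omega> \<in> space M" for t \<omega>
  proof -
    have "\<theta> * e t \<omega> \<ge> (-1/2) * e t \<omega>" using \<theta> e_bounds[OF that] by (intro mult_right_mono) auto
    then show ?thesis using e_bounds[OF that] adm_pos[OF c that] by linarith
  qed
  have "AE \<omega> in law z. \<forall>t\<ge>0. cum r (\<lambda>s. c s \<omega>) t \<le> ennreal x + cum r (\<lambda>s. earnings (Z s \<omega>)) t"
    using c by (simp add: adm_def)
  with AE_space have "AE \<omega> in law z. \<forall>t\<ge>0. cum r (\<lambda>s. c s \<omega> + \<theta> * e s \<omega>) t \<le> ennreal (x + \<theta> * x) + cum r (\<lambda>s. earnings (Z s \<omega>)) t"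
  proof eventually_elim
    case (elim \<omega>)
    then have \<omega>: "\<omega> \<in> space M" by simp
    let ?Y = "\<lambda>t. cum r (\<lambda>s. earnings (Z s \<omega>)) t"
    have cm [measurable]: "(\<lambda>s. c s \<omega>) \<in> borel_measurable halfline" and [measurable]: "(\<lambda>s. e s \<omega>) \<in> borel_measurable halfline"
      using path_measurable[OF cp \<omega>] path_measurable[OF ep \<omega>] by auto
    have fin: "cum r (\<lambda>s. c s \<omega>) s < \<infinity>" for s
    proof (cases "s \<ge> 0")
      case True
      have "cum r (\<lambda>s. c s \<omega>) s \<le> ennreal x + ?Y s" using elim(2) True by blast
      also have "\<dots> < \<infinity>" using cum_earnings_finite[OF \<omega>] by (simp add: less_top)
      finally show ?thesis .
    qed (simp add: cum_nonpos_time)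
    have ce: "cum r (\<lambda>s. e s \<omega>) t = min (cum r (\<lambda>s. c s \<omega>) t) (ennreal x)" for t
      unfolding e_def by (rule cum_stopped[OF cm fin]) (use x in simp)
    show ?case
    proof (intro allI impI)
      fix t :: real assume t: "t \<ge> 0"
      show "cum r (\<lambda>s. c s \<omega> + \<theta> * e s \<omega>) t \<le> ennreal (x + \<theta> * x) + ?Y t"
      proof (cases "\<theta> \<ge> 0")
        case True
        have "cum r (\<lambda>s. c s \<omega> + \<theta> * e s \<omega>) t = cum r (\<lambda>s. c s \<omega>) t + ennreal \<theta> * cum r (\<lambda>s. e s \<omega>) t"
          using True e_bounds(1)[OF _ \<omega>] adm_pos[OF c _ \<omega>]
          by (subst cum_add) (auto simp: cum_cmult intro: less_imp_le)
        also have "\<dots> \<le> (ennreal x + ?Y t) + ennreal \<theta> * ennreal x"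
          unfolding ce using elim(2) t by (intro add_mono mult_left_mono) auto
        also have "\<dots> = ennreal (x + \<theta> * x) + ?Y t"
          using True x by (simp add: ennreal_mult ennreal_plus add_ac)
        finally show ?thesis .
      next
        case False
        define \<kappa> where "\<kappa> = - \<theta>"
        have \<kappa>: "0 < \<kappa>" "\<kappa> \<le> 1/2" using False \<theta> by (auto simp: \<kappa>_def)
        show ?thesis
        proof (cases "cum r (\<lambda>s. c s \<omega>) t < ennreal x")
          case True
          have "cum r (\<lambda>s. c s \<omega> + \<theta> * e s \<omega>) t = cum r (\<lambda>s. (1 - \<kappa>) * c s \<omega>) t"
          proof (rule cum_cong)
            fix s assume s: "0 \<le> s" "s \<le> t"
            have "cum r (\<lambda>s. c s \<omega>) s < ennreal x" using cum_mono_time[OF s(2), of r "\<lambda>v. c v \<omega>"] True by (rule le_less_trans)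
            then show "c s \<omega> + \<theta> * e s \<omega> = (1 - \<kappa>) * c s \<omega>" by (simp add: e_def \<kappa>_def algebra_simps)
          qed
          also have "\<dots> = ennreal (1 - \<kappa>) * cum r (\<lambda>s. c s \<omega>) t" using \<kappa> by (intro cum_cmult) auto
          also have "\<dots> \<le> ennreal (1 - \<kappa>) * ennreal x" using True by (intro mult_left_mono) auto
          also have "\<dots> = ennreal (x + \<theta> * x)" using \<kappa> x by (simp add: ennreal_mult[symmetric] \<kappa>_def algebra_simps)
          finally show ?thesis by (simp add: add_increasing2)
        next
          case nf: False
          \<comment> \<open>Once x is used up, the scaling has saved exactly
            \<open>\<kappa> * x\<close>; adding it on both sides avoids subtraction in
            \<open>ennreal\<close>.\<close>
          have "cum r (\<lambda>s. c s \<omega> + \<theta> * e s \<omega>) t + ennreal (\<kappa> * x) = cum r (\<lambda>s. c s \<omega> + \<theta> * e s \<omega>) t + cum r (\<lambda>s. \<kappa> * e s \<omega>) t"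
            using nf \<kappa> x by (simp add: cum_cmult ce min_def ennreal_mult)
          also have "\<dots> = cum r (\<lambda>s. (c s \<omega> + \<theta> * e s \<omega>) + \<kappa> * e s \<omega>) t"
            using fpos[OF _ \<omega>] e_bounds(1)[OF _ \<omega>] \<kappa> by (intro cum_add[symmetric]) (auto intro: less_imp_le)
          also have "\<dots> = cum r (\<lambda>s. c s \<omega>) t" by (simp add: \<kappa>_def)
          also have "\<dots> \<le> ennreal x + ?Y t" using elim(2) t by blast
          also have "ennreal x = ennreal (x + \<theta> * x) + ennreal (\<kappa> * x)"
          proof -
            have "\<kappa> * x \<le> 1/2 * x" using \<kappa> x by (intro mult_right_mono) auto
            then have nn1: "x + \<theta> * x \<ge> 0" using x by (simp add: \<kappa>_def)
            have nn2: "\<kappa> * x \<ge> 0" using \<kappa> x by simp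
            have e: "(x + \<theta> * x) + \<kappa> * x = x" by (simp add: \<kappa>_def)
            show ?thesis using ennreal_plus[OF nn1 nn2] unfolding e .
          qed
          finally have "ennreal (\<kappa> * x) + cum r (\<lambda>s. c s \<omega> + \<theta> * e s \<omega>) t \<le> ennreal (\<kappa> * x) + (ennreal (x + \<theta> * x) + ?Y t)"
            by (simp add: add_ac)
          then show ?thesis by (simp add: ennreal_add_left_cancel_le)
        qed
      qed
    qed
  qed
  then show ?thesis using fp fpos by (simp add: adm_def e_def)
qed

text \<open>The power is a multiple of utility, or 1 if \<gamma> = 1, so its integral is controlled
  by the payoff. Near-optimality ties the payoff to \<open>V x z\<close>, which makes the bound
  common to all such controls.\<close>

lemma powr_consumption_bound:
  assumes x: "x \<ge> 0" and c: "good x z c" and J: "J z c > V x z - 1"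
  shows "integrable (Q z) (\<lambda>p. c (fst p) (snd p) powr (1 - \<gamma>))"
    and "(\<integral>p. c (fst p) (snd p) powr (1 - \<gamma>) \<partial>Q z) \<le> \<bar>1 - \<gamma>\<bar> * (\<bar>V x z\<bar> + 1) + measure (Q z) (space (Q z))"
proof -
  interpret finite_measure "Q z" by (rule finite_measure_Q[OF z])
  have adm: "adm x z c" and iu: "integrable (Q z) (\<lambda>p. crra \<gamma> (c (fst p) (snd p)))" using c by (auto simp: good_def)
  have jb: "\<bar>J z c\<bar> \<le> \<bar>V x z\<bar> + 1" using J J_le_V[OF z x c] by linarith
  have cm: "(\<lambda>p. c (fst p) (snd p) powr (1 - \<gamma>)) \<in> borel_measurable (Q z)"
    using measurable_Q[OF adm_progressive[OF adm]] by measurable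
  have "integrable (Q z) (\<lambda>p. c (fst p) (snd p) powr (1 - \<gamma>)) \<and>
     (\<integral>p. c (fst p) (snd p) powr (1 - \<gamma>) \<partial>Q z) \<le> \<bar>1 - \<gamma>\<bar> * (\<bar>V x z\<bar> + 1) + measure (Q z) (space (Q z))"
  proof (cases "\<gamma> = 1")
    case True
    have ae: "AE p in Q z. c (fst p) (snd p) powr (1 - \<gamma>) = 1"
      using AE_Q_Z[OF z]
    proof eventually_elim
      case (elim p)
      then have "c (fst p) (snd p) > 0" by (intro adm_pos[OF adm]) auto
      then show ?case using True by simp
    qed
    have "integrable (Q z) (\<lambda>p. c (fst p) (snd p) powr (1 - \<gamma>)) \<longleftrightarrow> integrable (Q z) (\<lambda>_. 1 :: real)"
      by (rule integrable_cong_AE) (use cm ae in auto)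
    moreover have "(\<integral>p. c (fst p) (snd p) powr (1 - \<gamma>) \<partial>Q z) = (\<integral>p. 1 \<partial>Q z)"
      by (rule integral_cong_AE) (use cm ae in auto)
    ultimately show ?thesis using True by simp
  next
    case False
    have eq: "c (fst p) (snd p) powr (1 - \<gamma>) = (1 - \<gamma>) * crra \<gamma> (c (fst p) (snd p))" for p
      using False by (simp add: crra_def)
    have "(\<integral>p. c (fst p) (snd p) powr (1 - \<gamma>) \<partial>Q z) = (1 - \<gamma>) * J z c"
      unfolding eq J_def by simp
    also have "\<dots> \<le> \<bar>1 - \<gamma>\<bar> * \<bar>J z c\<bar>" by (metis abs_ge_self abs_mult)
    also have "\<dots> \<le> \<bar>1 - \<gamma>\<bar> * (\<bar>V x z\<bar> + 1)" using jb by (intro mult_left_mono) auto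
    also have "\<dots> \<le> \<bar>1 - \<gamma>\<bar> * (\<bar>V x z\<bar> + 1) + measure (Q z) (space (Q z))" by simp
    finally show ?thesis unfolding eq using iu by simp
  qed
  then show "integrable (Q z) (\<lambda>p. c (fst p) (snd p) powr (1 - \<gamma>))"
    and "(\<integral>p. c (fst p) (snd p) powr (1 - \<gamma>) \<partial>Q z) \<le> \<bar>1 - \<gamma>\<bar> * (\<bar>V x z\<bar> + 1) + measure (Q z) (space (Q z))" by auto
qed

text \<open>A near-optimal control from x is scaled by \<open>1 + \<theta>\<close> and
  \<open>1 - \<theta>\<close>, with \<theta> = h / x, until it has used up x. The second difference
  of utility loses at most a multiple of \<open>\<theta>\<^sup>2 * c powr (1 - \<gamma>)\<close>,
  whose integral is bounded uniformly in the control, so the error of near-optimality can be sent to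
  0.\<close>

lemma V_second_difference:
  assumes x: "x > 0"
  obtains K where "\<And>h. 0 < h \<Longrightarrow> h \<le> x / 2 \<Longrightarrow> V (x + h) z + V (x - h) z - 2 * V x z \<ge> - K * h\<^sup>2"
proof -
  define k where "k = 2 * \<gamma> * (1 / 2) powr (- \<gamma> - 1)"
  have k: "k \<ge> 0" using \<gamma> by (simp add: k_def)
  define B where "B = \<bar>1 - \<gamma>\<bar> * (\<bar>V x z\<bar> + 1) + measure (Q z) (space (Q z))"
  have main: "V (x + \<theta> * x) z + V (x - \<theta> * x) z - 2 * V x z \<ge> - (k * \<theta>\<^sup>2 * B)" if \<theta>: "0 < \<theta>" "\<theta> \<le> 1/2" for \<theta>
  proof (rule field_le_epsilon)
    fix \<epsilon> :: real assume \<epsilon>: "\<epsilon> > 0"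
    define \<epsilon>' where "\<epsilon>' = min 1 (\<epsilon> / 2)"
    have \<epsilon>': "\<epsilon>' > 0" "\<epsilon>' \<le> 1" "2 * \<epsilon>' \<le> \<epsilon>" using \<epsilon> by (auto simp: \<epsilon>'_def)
    obtain c where c: "good x z c" "J z c > V x z - \<epsilon>'" using V_approx[OF z _ \<epsilon>'(1), of x] x by auto
    have adm: "adm x z c" and iu: "integrable (Q z) (\<lambda>p. crra \<gamma> (c (fst p) (snd p)))" using c by (auto simp: good_def)
    have J1: "J z c > V x z - 1" using c(2) \<epsilon>' by simp
    have x0: "x \<ge> 0" using x by simp
    note pw = powr_consumption_bound[OF x0 c(1) J1]
    define f where "f s t \<omega> = c t \<omega> + s * (if cum r (\<lambda>v. c v \<omega>) t < ennreal x then c t \<omega> else 0)" for s t \<omega>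
    have ap: "adm (x + \<theta> * x) z (f \<theta>)"
      unfolding f_def by (rule scaled_budget[OF adm x]) (use \<theta> in auto)
    have am: "adm (x - \<theta> * x) z (f (- \<theta>))"
      using scaled_budget[OF adm x, of "- \<theta>"] \<theta> unfolding f_def by simp
    have "\<theta> * x \<le> 1/2 * x" using \<theta> x by (intro mult_right_mono) auto
    then have xp: "x + \<theta> * x \<ge> 0" and xm: "x - \<theta> * x \<ge> 0" using x \<theta> by auto
    have cpos: "c t \<omega> > 0" if "t \<ge> 0" "\<omega> \<in> space M" for t \<omega> by (rule adm_pos[OF adm that])
    have sd: "crra \<gamma> (f \<theta> t \<omega>) + crra \<gamma> (f (- \<theta>) t \<omega>) - 2 * crra \<gamma> (c t \<omega>) \<ge> - (k * \<theta>\<^sup>2 * c t \<omega> powr (1 - \<gamma>))"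
      if t: "t \<ge> 0" "\<omega> \<in> space M" for t \<omega>
    proof (cases "cum r (\<lambda>v. c v \<omega>) t < ennreal x")
      case True
      have "f \<theta> t \<omega> = (1 + \<theta>) * c t \<omega>" "f (- \<theta>) t \<omega> = (1 - \<theta>) * c t \<omega>" using True by (auto simp: f_def algebra_simps)
      then show ?thesis using crra_second_difference[OF \<gamma> cpos[OF t], of \<theta>] \<theta> by (simp add: k_def)
    next
      case False
      have "f \<theta> t \<omega> = c t \<omega>" "f (- \<theta>) t \<omega> = c t \<omega>" using False by (auto simp: f_def)
      then show ?thesis using k by simp
    qed
    have gp: "good (x + \<theta> * x) z (f \<theta>)"
    proof (rule good_if_bounded_below[OF ap xp iu])
      show "AE p in Q z. crra \<gamma> (c (fst p) (snd p)) \<le> crra \<gamma> (f \<theta> (fst p) (snd p))"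
        using AE_Q_Z[OF z]
        by eventually_elim (use cpos \<theta> in \<open>intro crra_mono; simp add: f_def less_imp_le\<close>)
    qed
    have iup: "integrable (Q z) (\<lambda>p. crra \<gamma> (f \<theta> (fst p) (snd p)))" using gp by (simp add: good_def)
    \<comment> \<open>Utility of the scaled-down control is bounded below by the second difference
      inequality itself, whose other terms are already integrable.\<close>
    have gm: "good (x - \<theta> * x) z (f (- \<theta>))"
    proof (rule good_if_bounded_below[OF am xm])
      show "integrable (Q z) (\<lambda>p. 2 * crra \<gamma> (c (fst p) (snd p)) - crra \<gamma> (f \<theta> (fst p) (snd p)) - k * \<theta>\<^sup>2 * c (fst p) (snd p) powr (1 - \<gamma>))"
        using iu iup pw(1) by simp
      show "AE p in Q z. 2 * crra \<gamma> (c (fst p) (snd p)) - crra \<gamma> (f \<theta> (fst p) (snd p)) - k * \<theta>\<^sup>2 * c (fst p) (snd p) powr (1 - \<gamma>) \<le> crra \<gamma> (f (- \<theta>) (fst p) (snd p))"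
        using AE_Q_Z[OF z]
      proof eventually_elim
        case (elim p)
        then show ?case using sd[of "fst p" "snd p"] by simp
      qed
    qed
    have ium: "integrable (Q z) (\<lambda>p. crra \<gamma> (f (- \<theta>) (fst p) (snd p)))" using gm by (simp add: good_def)
    have "(\<integral>p. - (k * \<theta>\<^sup>2 * c (fst p) (snd p) powr (1 - \<gamma>)) \<partial>Q z) \<le>
      (\<integral>p. crra \<gamma> (f \<theta> (fst p) (snd p)) + crra \<gamma> (f (- \<theta>) (fst p) (snd p)) - 2 * crra \<gamma> (c (fst p) (snd p)) \<partial>Q z)"
    proof (rule integral_mono_AE)
      show "AE p in Q z. - (k * \<theta>\<^sup>2 * c (fst p) (snd p) powr (1 - \<gamma>)) \<le> crra \<gamma> (f \<theta> (fst p) (snd p)) + crra \<gamma> (f (- \<theta>) (fst p) (snd p)) - 2 * crra \<gamma> (c (fst p) (snd p))"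
        using AE_Q_Z[OF z] by eventually_elim (use sd in simp)
    qed (use iu iup ium pw(1) in auto)
    also have "\<dots> = J z (f \<theta>) + J z (f (- \<theta>)) - 2 * J z c"
      unfolding J_def using iu iup ium by simp
    finally have "- (k * \<theta>\<^sup>2 * (\<integral>p. c (fst p) (snd p) powr (1 - \<gamma>) \<partial>Q z)) \<le> J z (f \<theta>) + J z (f (- \<theta>)) - 2 * J z c"
      by simp
    moreover have "k * \<theta>\<^sup>2 * (\<integral>p. c (fst p) (snd p) powr (1 - \<gamma>) \<partial>Q z) \<le> k * \<theta>\<^sup>2 * B"
      using pw(2) k unfolding B_def by (intro mult_left_mono) auto
    ultimately show "- (k * \<theta>\<^sup>2 * B) \<le> V (x + \<theta> * x) z + V (x - \<theta> * x) z - 2 * V x z + \<epsilon>"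
      using J_le_V[OF z xp gp] J_le_V[OF z xm gm] c(2) \<epsilon>'(3) by linarith
  qed
  show ?thesis
  proof (rule that)
    fix h assume h: "0 < h" "h \<le> x / 2"
    have \<theta>: "0 < h / x" "h / x \<le> 1/2" using h x by (auto simp: field_simps)
    have hx: "h / x * x = h" using x by simp
    have "k * (h / x)\<^sup>2 * B = k * B / x\<^sup>2 * h\<^sup>2" by (simp add: power_divide)
    then show "V (x + h) z + V (x - h) z - 2 * V x z \<ge> - (k * B / x\<^sup>2) * h\<^sup>2"
      using main[OF \<theta>] unfolding hx by simp
  qed
qed

lemma V_differentiable:
  assumes "x \<ge> 0"
  obtains D where "((\<lambda>x. V x z) has_real_derivative D) (at x within {0..})"
proof (cases "x = 0")
  case True
  have "V h z - V 0 z \<le> earnings (Min S) powr (- \<gamma>) * h" if "h > 0" for h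
    using V_increment_at_limit[OF z that] by (simp add: mult.commute)
  from concave_has_right_derivative_at_0[OF V_concave this] show ?thesis using that True by blast
next
  case False
  then have x: "x > 0" using assms by simp
  obtain K where K: "\<And>h. 0 < h \<Longrightarrow> h \<le> x / 2 \<Longrightarrow> V (x + h) z + V (x - h) z - 2 * V x z \<ge> - K * h\<^sup>2"
    using V_second_difference[OF x] by blast
  have "x / 2 > 0" "x / 2 \<le> x" using x by auto
  from concave_has_derivative_if_second_difference[OF V_concave x this K] obtain D where "((\<lambda>x. V x z) has_real_derivative D) (at x)"
    by blast
  then show ?thesis using that has_field_derivative_at_within by blast
qed

text \<open>Extra consumption e of total cost at most \<epsilon> is added to c, and
  \<open>crra_incr_ge\<close> bounds the gain with a reference level \<beta> that may depend on
  income. The bound is affine in c, so information on integrals of c suffices to estimate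
  it.\<close>

lemma V_gain:
  assumes x: "x \<ge> 0" and \<epsilon>: "\<epsilon> \<ge> 0" and c: "good x z c"
    and e: "progressively_measurable F e" "\<And>t \<omega>. t \<ge> 0 \<Longrightarrow> \<omega> \<in> space M \<Longrightarrow> 0 \<le> e t \<omega> \<and> e t \<omega> \<le> E"
      "AE \<omega> in law z. \<forall>t\<ge>0. cum r (\<lambda>v. e v \<omega>) t \<le> ennreal \<epsilon>"
    and \<beta>: "\<And>y. y \<in> S \<Longrightarrow> \<beta> y > 0"
  shows "integrable (Q z) (\<lambda>p. (\<beta> (Z (fst p) (snd p)) powr (- \<gamma>) - \<gamma> * \<beta> (Z (fst p) (snd p)) powr (- \<gamma> - 1) *
      (c (fst p) (snd p) + e (fst p) (snd p) - \<beta> (Z (fst p) (snd p)))) * e (fst p) (snd p))"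
    and "J z c + (\<integral>p. (\<beta> (Z (fst p) (snd p)) powr (- \<gamma>) - \<gamma> * \<beta> (Z (fst p) (snd p)) powr (- \<gamma> - 1) *
      (c (fst p) (snd p) + e (fst p) (snd p) - \<beta> (Z (fst p) (snd p)))) * e (fst p) (snd p) \<partial>Q z) \<le> V (x + \<epsilon>) z"
proof -
  interpret finite_measure "Q z" by (rule finite_measure_Q[OF z])
  have adm: "adm x z c" and iu: "integrable (Q z) (\<lambda>p. crra \<gamma> (c (fst p) (snd p)))" using c by (auto simp: good_def)
  let ?W = "\<lambda>p. (\<beta> (Z (fst p) (snd p)) powr (- \<gamma>) - \<gamma> * \<beta> (Z (fst p) (snd p)) powr (- \<gamma> - 1) *
      (c (fst p) (snd p) + e (fst p) (snd p) - \<beta> (Z (fst p) (snd p)))) * e (fst p) (snd p)"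
  have em: "(\<lambda>p. e (fst p) (snd p)) \<in> borel_measurable (Q z)" by (rule measurable_Q[OF e(1)])
  have eb: "AE p in Q z. \<bar>e (fst p) (snd p)\<bar> \<le> E"
    using AE_Q_Z[OF z] by eventually_elim (use e(2) in force)
  have ie: "integrable (Q z) (\<lambda>p. e (fst p) (snd p))"
    by (rule integrable_const_bound[of _ E]) (use eb em in auto)
  obtain B where B: "\<And>y. y \<in> S \<Longrightarrow> \<bar>\<gamma> * \<beta> y powr (- \<gamma> - 1)\<bar> \<le> B"
    using finite_fun_bound[of "\<lambda>y. \<gamma> * \<beta> y powr (- \<gamma> - 1)"] by metis
  have "integrable (Q z) (\<lambda>p. c (fst p) (snd p) + e (fst p) (snd p) - \<beta> (Z (fst p) (snd p)))"
    using consumption_integrable(1)[OF z adm x] ie integrable_fun_Z[OF z, of \<beta>] by simp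
  moreover have "AE p in Q z. \<bar>\<gamma> * \<beta> (Z (fst p) (snd p)) powr (- \<gamma> - 1)\<bar> \<le> B"
    using AE_Q_Z[OF z] by eventually_elim (use B in simp)
  ultimately have "integrable (Q z) (\<lambda>p. \<gamma> * \<beta> (Z (fst p) (snd p)) powr (- \<gamma> - 1) * (c (fst p) (snd p) + e (fst p) (snd p) - \<beta> (Z (fst p) (snd p))))"
    by (intro integrable_bounded_times measurable_Q_Z[of "\<lambda>y. \<gamma> * \<beta> y powr (- \<gamma> - 1)"])
  then have "integrable (Q z) (\<lambda>p. \<beta> (Z (fst p) (snd p)) powr (- \<gamma>) - \<gamma> * \<beta> (Z (fst p) (snd p)) powr (- \<gamma> - 1) * (c (fst p) (snd p) + e (fst p) (snd p) - \<beta> (Z (fst p) (snd p))))"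
    using integrable_fun_Z[OF z, of "\<lambda>y. \<beta> y powr (- \<gamma>)"] by simp
  from integrable_bounded_times[OF this em eb]
  show W: "integrable (Q z) ?W" by (simp add: mult.commute)
  have fp: "progressively_measurable F (\<lambda>t \<omega>. c t \<omega> + e t \<omega>)"
  proof (rule progressively_measurableI)
    fix t :: real assume t: "t \<ge> 0"
    note [measurable] = progressively_measurableD[OF adm_progressive[OF adm] t] progressively_measurableD[OF e(1) t]
    show "(\<lambda>p. c (fst p) (snd p) + e (fst p) (snd p)) \<in> borel_measurable (prog_space t)" by measurable
  qed
  have "AE \<omega> in law z. \<forall>t\<ge>0. cum r (\<lambda>s. c s \<omega>) t \<le> ennreal x + cum r (\<lambda>s. earnings (Z s \<omega>)) t"
    using adm by (simp add: adm_def)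
  with AE_space e(3) have "AE \<omega> in law z. \<forall>t\<ge>0. cum r (\<lambda>s. c s \<omega> + e s \<omega>) t \<le> ennreal (x + \<epsilon>) + cum r (\<lambda>s. earnings (Z s \<omega>)) t"
  proof eventually_elim
    case (elim \<omega>)
    then have \<omega>: "\<omega> \<in> space M" by simp
    show ?case
    proof (intro allI impI)
      fix t :: real assume t: "t \<ge> 0"
      have "cum r (\<lambda>s. c s \<omega> + e s \<omega>) t = cum r (\<lambda>s. c s \<omega>) t + cum r (\<lambda>s. e s \<omega>) t"
        using path_measurable[OF adm_progressive[OF adm] \<omega>] path_measurable[OF e(1) \<omega>] e(2)[OF _ \<omega>] adm_pos[OF adm _ \<omega>]
        by (intro cum_add) (auto intro: less_imp_le)
      also have "\<dots> \<le> (ennreal x + cum r (\<lambda>s. earnings (Z s \<omega>)) t) + ennreal \<epsilon>"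
        using elim t by (intro add_mono) auto
      also have "\<dots> = ennreal (x + \<epsilon>) + cum r (\<lambda>s. earnings (Z s \<omega>)) t"
        using x \<epsilon> by (simp add: ennreal_plus add_ac)
      finally show "cum r (\<lambda>s. c s \<omega> + e s \<omega>) t \<le> ennreal (x + \<epsilon>) + cum r (\<lambda>s. earnings (Z s \<omega>)) t" .
    qed
  qed
  then have af: "adm (x + \<epsilon>) z (\<lambda>t \<omega>. c t \<omega> + e t \<omega>)"
    unfolding adm_def using fp adm_pos[OF adm] e(2) by (auto intro: add_pos_nonneg)
  have xe: "x + \<epsilon> \<ge> 0" using x \<epsilon> by simp
  have gf: "good (x + \<epsilon>) z (\<lambda>t \<omega>. c t \<omega> + e t \<omega>)"
  proof (rule good_if_bounded_below[OF af xe iu])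
    show "AE p in Q z. crra \<gamma> (c (fst p) (snd p)) \<le> crra \<gamma> (c (fst p) (snd p) + e (fst p) (snd p))"
      using AE_Q_Z[OF z] by eventually_elim (use adm_pos[OF adm] e(2) in \<open>intro crra_mono; simp\<close>)
  qed
  have "J z c + (\<integral>p. ?W p \<partial>Q z) = (\<integral>p. crra \<gamma> (c (fst p) (snd p)) + ?W p \<partial>Q z)"
    unfolding J_def using iu W by simp
  also have "\<dots> \<le> J z (\<lambda>t \<omega>. c t \<omega> + e t \<omega>)"
    unfolding J_def
  proof (rule integral_mono_AE)
    show "AE p in Q z. crra \<gamma> (c (fst p) (snd p)) + ?W p \<le> crra \<gamma> (c (fst p) (snd p) + e (fst p) (snd p))"
      using AE_Q_Z[OF z]
    proof eventually_elim
      case (elim p)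
      have "crra \<gamma> (c (fst p) (snd p) + e (fst p) (snd p)) - crra \<gamma> (c (fst p) (snd p)) \<ge> ?W p"
        using elim e(2)[of "fst p" "snd p"] adm_pos[OF adm, of "fst p" "snd p"] \<beta>[of "Z (fst p) (snd p)"]
        by (intro crra_incr_ge \<gamma>) auto
      then show ?case by linarith
    qed
  qed (use iu W gf in \<open>auto simp: good_def\<close>)
  also have "\<dots> \<le> V (x + \<epsilon>) z" by (rule J_le_V[OF z xe gf])
  finally show "J z c + (\<integral>p. ?W p \<partial>Q z) \<le> V (x + \<epsilon>) z" .
qed

end

end

section \<open>Lower bounds for the slopes of the value function\<close>

lemma abs_mult_unit_le: "0 \<le> s \<Longrightarrow> s \<le> 1 \<Longrightarrow> \<bar>a * s\<bar> \<le> \<bar>a\<bar>" for a s :: real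
  using mult_left_mono[of "\<bar>s\<bar>" 1 "\<bar>a\<bar>"] by (simp add: abs_mult)

lemma cum_unit_upper:
  assumes e: "\<And>s. 0 \<le> s \<Longrightarrow> s \<le> 1 \<Longrightarrow> e s \<le> E" "\<And>s. s > 1 \<Longrightarrow> e s = 0" and E: "E \<ge> 0" and t: "t \<ge> 0"
  shows "cum r e t \<le> ennreal (E * exp \<bar>r\<bar> * min t 1)"
proof -
  have "cum r e t \<le> (\<integral>\<^sup>+s. ennreal (E * exp \<bar>r\<bar>) * indicator {0..min t 1} s \<partial>lborel)"
    unfolding cum_def nn_integral_halfline
  proof (rule nn_integral_mono)
    fix s :: real
    show "ennreal (exp (- r * s) * e s) * indicator {..t} s * indicator {0..} s \<le> ennreal (E * exp \<bar>r\<bar>) * indicator {0..min t 1} s"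
    proof (cases "0 \<le> s \<and> s \<le> 1 \<and> s \<le> t")
      case True
      have "exp (- r * s) \<le> exp \<bar>r\<bar>" using abs_mult_unit_le[of s r] True by simp
      then have "exp (- r * s) * e s \<le> exp \<bar>r\<bar> * E"
        using e(1)[of s] True E by (intro order_trans[OF mult_left_mono mult_right_mono]) auto
      then show ?thesis using True by (simp add: mult.commute ennreal_leI)
    next
      case False
      then show ?thesis using e(2)[of s] by (cases "s > 1") (auto simp: indicator_def)
    qed
  qed
  also have "\<dots> = ennreal (E * exp \<bar>r\<bar> * min t 1)"
    using t E by (simp add: nn_integral_cmult_indicator ennreal_mult[symmetric])
  finally show ?thesis .
qed

lemma cum_unit_lower:
  assumes e: "\<And>s. 0 \<le> s \<Longrightarrow> s \<le> 1 \<Longrightarrow> l \<le> e s" and l: "l \<ge> 0" and t: "t \<ge> 0"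
  shows "ennreal (l * exp (- \<bar>r\<bar>) * min t 1) \<le> cum r e t"
proof -
  have "ennreal (l * exp (- \<bar>r\<bar>) * min t 1) = (\<integral>\<^sup>+s. ennreal (l * exp (- \<bar>r\<bar>)) * indicator {0..min t 1} s \<partial>lborel)"
    using t l by (simp add: nn_integral_cmult_indicator ennreal_mult[symmetric])
  also have "\<dots> \<le> cum r e t"
    unfolding cum_def nn_integral_halfline
  proof (rule nn_integral_mono)
    fix s :: real
    show "ennreal (l * exp (- \<bar>r\<bar>)) * indicator {0..min t 1} s \<le> ennreal (exp (- r * s) * e s) * indicator {..t} s * indicator {0..} s"
    proof (cases "0 \<le> s \<and> s \<le> 1 \<and> s \<le> t")
      case True
      have "exp (- \<bar>r\<bar>) \<le> exp (- r * s)" using abs_mult_unit_le[of s r] True by simp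
      then have "exp (- \<bar>r\<bar>) * l \<le> exp (- r * s) * e s"
        using e[of s] True l by (intro mult_mono) auto
      then show ?thesis using True by (simp add: mult.commute ennreal_leI)
    qed (auto simp: indicator_def)
  qed
  finally show ?thesis .
qed

context household
begin

text \<open>Minus the second derivative of utility at limit income, the weight of the second-order
  term in \<open>crra_incr_ge\<close> with \<open>b = earnings y\<close>.\<close>

definition phi :: "real \<Rightarrow> real" where
  "phi y = \<gamma> * earnings y powr (- \<gamma> - 1)"

text \<open>Here n is the speed of spending. Dividing by \<open>phi\<close> cancels the weight of
  the second-order term, and \<open>exp ((\<rho> - r) * t)\<close> cancels the difference between
  the discount rates of payoff and budget.\<close>

definition flow :: "real \<Rightarrow> real \<Rightarrow> 'w \<Rightarrow> real" where
  "flow n t \<omega> = (if t \<le> 1 then n * exp ((\<rho> - r) * t) / phi (Z t \<omega>) else 0)"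

definition stopped_flow :: "real \<Rightarrow> real \<Rightarrow> 'w \<Rightarrow> real" where
  "stopped_flow n t \<omega> = (if cum r (\<lambda>v. flow n v \<omega>) t < 1 then flow n t \<omega> else 0)"

definition flow_lo :: real where "flow_lo = exp (- \<bar>\<rho> - r\<bar>) / phi (Min S)"
definition flow_hi :: real where "flow_hi = exp \<bar>\<rho> - r\<bar> / phi (Max S)"

lemma phi_pos: "y \<in> S \<Longrightarrow> phi y > 0"
  using earnings_bounds(3)[of y] \<gamma> by (simp add: phi_def)

lemma phi_bounds: "y \<in> S \<Longrightarrow> phi (Max S) \<le> phi y" "y \<in> S \<Longrightarrow> phi y \<le> phi (Min S)"
proof -
  have g1: "- \<gamma> - 1 = - (\<gamma> + 1)" by simp
  show "phi (Max S) \<le> phi y" if "y \<in> S"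
    unfolding phi_def g1 using earnings_bounds[OF that] \<gamma> by (intro mult_left_mono powr_minus_antimono) auto
  show "phi y \<le> phi (Min S)" if "y \<in> S"
    unfolding phi_def g1 using earnings_bounds[OF that] earnings_Min_pos \<gamma> by (intro mult_left_mono powr_minus_antimono) auto
qed

lemma flow_lo_pos: "flow_lo > 0" and flow_hi_pos: "flow_hi > 0"
  using phi_pos[OF Min_S] phi_pos[OF Max_S] by (auto simp: flow_lo_def flow_hi_def)

lemma flow_bounds:
  assumes n: "n \<ge> 0" and t: "0 \<le> t" "t \<le> 1" and \<omega>: "\<omega> \<in> space M"
  shows "n * flow_lo \<le> flow n t \<omega>" "flow n t \<omega> \<le> n * flow_hi"
proof -
  have ZS: "Z t \<omega> \<in> S" by (rule Z_in_S[OF t(1) \<omega>])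
  have e: "exp (- \<bar>\<rho> - r\<bar>) \<le> exp ((\<rho> - r) * t)" "exp ((\<rho> - r) * t) \<le> exp \<bar>\<rho> - r\<bar>"
    using abs_mult_unit_le[OF t, of "\<rho> - r"] by auto
  have "flow_lo \<le> exp ((\<rho> - r) * t) / phi (Z t \<omega>)" "exp ((\<rho> - r) * t) / phi (Z t \<omega>) \<le> flow_hi"
    unfolding flow_lo_def flow_hi_def using e phi_bounds[OF ZS] phi_pos[OF ZS] phi_pos[OF Max_S] by (auto intro!: frac_le)
  then have "n * flow_lo \<le> n * (exp ((\<rho> - r) * t) / phi (Z t \<omega>))" "n * (exp ((\<rho> - r) * t) / phi (Z t \<omega>)) \<le> n * flow_hi"
    using n by (blast intro: mult_left_mono)+
  moreover have "flow n t \<omega> = n * (exp ((\<rho> - r) * t) / phi (Z t \<omega>))" using t by (simp add: flow_def)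
  ultimately show "n * flow_lo \<le> flow n t \<omega>" "flow n t \<omega> \<le> n * flow_hi" by presburger+
qed

lemma flow_nonneg: "n \<ge> 0 \<Longrightarrow> 0 \<le> t \<Longrightarrow> \<omega> \<in> space M \<Longrightarrow> flow n t \<omega> \<ge> 0"
  using phi_pos[OF Z_in_S[of t \<omega>]] by (auto simp: flow_def)

lemma flow_progressive: "progressively_measurable F (flow n)"
proof (rule progressively_measurableI)
  fix t :: real assume t: "t \<ge> 0"
  note [measurable] = progressively_measurableD[OF progressively_measurable_fun_Z[of phi] t]
  show "(\<lambda>p. flow n (fst p) (snd p)) \<in> borel_measurable (prog_space t)"
    unfolding flow_def by measurable
qed

lemma stopped_flow_progressive: "progressively_measurable F (stopped_flow n)"
  unfolding stopped_flow_def
  by (rule progressive_if_cum[OF flow_progressive flow_progressive]) (rule progressively_measurableI, simp)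

lemma stopped_flow_bounds:
  assumes "n \<ge> 0" "0 \<le> t" "\<omega> \<in> space M"
  shows "0 \<le> stopped_flow n t \<omega> \<and> stopped_flow n t \<omega> \<le> n * flow_hi"
proof (cases "t \<le> 1")
  case True
  then show ?thesis using assms flow_nonneg[of n t \<omega>] flow_bounds[of n t \<omega>] flow_hi_pos by (auto simp: stopped_flow_def)
next
  case False
  then show ?thesis using assms flow_hi_pos by (auto simp: stopped_flow_def flow_def)
qed

lemma cum_flow_bounds:
  assumes n: "n \<ge> 0" and t: "0 \<le> t" and \<omega>: "\<omega> \<in> space M"
  shows "ennreal (n * flow_lo * exp (- \<bar>r\<bar>) * min t 1) \<le> cum r (\<lambda>v. flow n v \<omega>) t"
    and "cum r (\<lambda>v. flow n v \<omega>) t \<le> ennreal (n * flow_hi * exp \<bar>r\<bar> * min t 1)"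
proof -
  show "ennreal (n * flow_lo * exp (- \<bar>r\<bar>) * min t 1) \<le> cum r (\<lambda>v. flow n v \<omega>) t"
    using flow_bounds[OF n _ _ \<omega>] n flow_lo_pos t by (intro cum_unit_lower) auto
  show "cum r (\<lambda>v. flow n v \<omega>) t \<le> ennreal (n * flow_hi * exp \<bar>r\<bar> * min t 1)"
    using flow_bounds[OF n _ _ \<omega>] n flow_hi_pos t by (intro cum_unit_upper) (auto simp: flow_def)
qed

lemma cum_flow_finite:
  assumes n: "n \<ge> 0" and \<omega>: "\<omega> \<in> space M" shows "cum r (\<lambda>v. flow n v \<omega>) t < \<infinity>"
proof (cases "t \<ge> 0")
  case True
  show ?thesis using cum_flow_bounds(2)[OF n True \<omega>] by (rule order.strict_trans1) simp
qed (simp add: cum_nonpos_time)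

lemma cum_stopped_flow:
  assumes n: "n \<ge> 0" and \<omega>: "\<omega> \<in> space M"
  shows "cum r (\<lambda>v. stopped_flow n v \<omega>) t = min (cum r (\<lambda>v. flow n v \<omega>) t) 1"
  unfolding stopped_flow_def
  using path_measurable[OF flow_progressive \<omega>] cum_flow_finite[OF assms] by (intro cum_stopped) auto

context
  fixes z :: real
  assumes z: "z \<in> S"
begin

lemma time_before:
  assumes a: "0 \<le> a" "a \<le> 1"
  shows "integrable (Q z) (\<lambda>p. if fst p \<le> a then 1 else 0 :: real)"
    and "a * exp (- \<rho>) \<le> (\<integral>p. (if fst p \<le> a then 1 else 0) \<partial>Q z)"
    and "(\<integral>p. (if fst p \<le> a then 1 else 0) \<partial>Q z) \<le> a * exp \<rho>"
proof -
  interpret finite_measure "Q z" by (rule finite_measure_Q[OF z])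
  interpret L: prob_space "law z" by (rule prob_space_law[OF z])
  let ?f = "\<lambda>p :: real \<times> 'w. if fst p \<le> a then 1 else 0 :: real"
  have m: "?f \<in> borel_measurable (Q z)" using fst_measurable_Q by measurable
  show i: "integrable (Q z) ?f" by (rule integrable_const_bound[of _ 1]) (use m in auto)
  have "(\<lambda>p. ennreal (?f p)) \<in> borel_measurable (halfline \<Otimes>\<^sub>M M)"
    using m unfolding measurable_cong_sets[OF sets_Q refl] by measurable
  then have "(\<integral>\<^sup>+p. ennreal (?f p) \<partial>Q z) = (\<integral>\<^sup>+t. ennreal (exp (- \<rho> * t)) * (\<integral>\<^sup>+\<omega>. ennreal (if t \<le> a then 1 else 0) \<partial>law z) \<partial>halfline)"
    by (subst nn_integral_Q(2)[OF z]) auto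
  also have "\<dots> = cum \<rho> (\<lambda>s. if s \<le> 1 then 1 else 0) a"
    unfolding cum_def using a L.emeasure_space_1 by (intro nn_integral_cong) (auto simp: indicator_def)
  finally have eq: "(\<integral>\<^sup>+p. ennreal (?f p) \<partial>Q z) = cum \<rho> (\<lambda>s. if s \<le> 1 then 1 else 0) a" .
  have e: "ennreal (\<integral>p. ?f p \<partial>Q z) = cum \<rho> (\<lambda>s. if s \<le> 1 then 1 else 0) a"
    unfolding eq[symmetric] by (rule nn_integral_eq_integral[symmetric, OF i]) simp
  have nn: "(\<integral>p. ?f p \<partial>Q z) \<ge> 0" by (rule integral_nonneg_AE) simp
  have "cum \<rho> (\<lambda>s. if s \<le> 1 then 1 else 0) a \<le> ennreal (1 * exp \<bar>\<rho>\<bar> * min a 1)"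
    by (rule cum_unit_upper) (use a in auto)
  then show "(\<integral>p. ?f p \<partial>Q z) \<le> a * exp \<rho>" using a \<rho> unfolding e[symmetric] by (simp add: mult.commute min_def)
  have "ennreal (1 * exp (- \<bar>\<rho>\<bar>) * min a 1) \<le> cum \<rho> (\<lambda>s. if s \<le> 1 then 1 else 0) a"
    by (rule cum_unit_lower) (use a in auto)
  then show "a * exp (- \<rho>) \<le> (\<integral>p. ?f p \<partial>Q z)" using a \<rho> nn unfolding e[symmetric] by (simp add: mult.commute min_def)
qed

text \<open>An extra flow k during the first unit of time costs at most 1. Its gain is at least
  \<delta> for every control, because the budget bounds expected discounted consumption
  uniformly.\<close>

lemma V_strictly_increases:
  assumes x: "x \<ge> 0" shows "V x z < V (x + 1) z"
proof -
  interpret finite_measure "Q z" by (rule finite_measure_Q[OF z])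
  define k where "k = exp (- \<bar>r\<bar>)"
  have k: "0 < k" "k \<le> 1" by (auto simp: k_def)
  define T where "T = (\<integral>p. (if fst p \<le> 1 then 1 else 0 :: real) \<partial>Q z)"
  have T: "T > 0" using time_before(2)[of 1] by (simp add: T_def less_le_trans[OF exp_gt_zero])
  define CB where "CB = x + earnings (Max S) * measure (Q z) (space (Q z))"
  define mQ where "mQ = measure (Q z) (space (Q z))"
  have CB: "CB \<ge> 0" "mQ \<ge> 0" using x earnings_bounds(3)[OF Max_S] by (auto simp: CB_def mQ_def)
  \<comment> \<open>With \<open>b * T\<close> above the bound for the integral of
    \<open>c + 1\<close>, the second-order loss is at most
    \<open>k * \<gamma> * b powr (- \<gamma>) * T\<close>, and
    \<open>k * b powr (- \<gamma>) * T\<close> of the gain remains.\<close>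
  define b where "b = (CB + mQ + 1) / T"
  have b: "b > 0" using CB T by (simp add: b_def)
  define e where "e t \<omega> = (if t \<le> 1 then k else 0)" for t :: real and \<omega> :: 'w
  have ep: "progressively_measurable F e"
    by (rule progressively_measurableI) (simp add: e_def)
  have ecum: "cum r (\<lambda>v. e v \<omega>) t \<le> ennreal 1" if "t \<ge> 0" for t \<omega>
  proof -
    have "cum r (\<lambda>v. e v \<omega>) t \<le> ennreal (k * exp \<bar>r\<bar> * min t 1)"
      by (rule cum_unit_upper) (use k that in \<open>auto simp: e_def\<close>)
    also have "\<dots> \<le> ennreal 1" by (intro ennreal_leI) (simp add: k_def exp_minus)
    finally show ?thesis .
  qed
  define \<delta> where "\<delta> = k * b powr (- \<gamma>) * T"
  have \<delta>: "\<delta> > 0" using k b T by (simp add: \<delta>_def)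
  have "J z c \<le> V (x + 1) z - \<delta>" if c: "good x z c" for c
  proof -
    have adm: "adm x z c" using c by (simp add: good_def)
    let ?W = "\<lambda>p. (b powr (- \<gamma>) - \<gamma> * b powr (- \<gamma> - 1) * (c (fst p) (snd p) + e (fst p) (snd p) - b)) * e (fst p) (snd p)"
    have gain: "integrable (Q z) ?W" "J z c + (\<integral>p. ?W p \<partial>Q z) \<le> V (x + 1) z"
      by (rule V_gain[OF z x _ c ep, where \<epsilon> = 1 and E = k and \<beta> = "\<lambda>_. b"]; use ecum k b in \<open>simp add: e_def\<close>)+
    let ?L = "\<lambda>p. k * ((1 + \<gamma>) * b powr (- \<gamma>)) * (if fst p \<le> 1 then 1 else 0) - k * (\<gamma> * b powr (- \<gamma> - 1)) * (c (fst p) (snd p) + 1)"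
    have ic: "integrable (Q z) (\<lambda>p. c (fst p) (snd p))" by (rule consumption_integrable(1)[OF z adm x])
    have bb: "b powr (- \<gamma> - 1) * b = b powr (- \<gamma>)" using b by (simp add: powr_diff)
    have "(\<integral>p. ?L p \<partial>Q z) \<le> (\<integral>p. ?W p \<partial>Q z)"
    proof (rule integral_mono_AE)
      show "integrable (Q z) ?L" using ic time_before(1)[of 1] by simp
      show "AE p in Q z. ?L p \<le> ?W p"
        using AE_Q_Z[OF z]
      proof eventually_elim
        case (elim p)
        have c0: "c (fst p) (snd p) > 0" using elim by (intro adm_pos[OF adm]) auto
        show ?case
        proof (cases "fst p \<le> 1")
          case True
          have "\<gamma> * b powr (- \<gamma> - 1) * (c (fst p) (snd p) + k) \<le> \<gamma> * b powr (- \<gamma> - 1) * (c (fst p) (snd p) + 1)"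
            using \<gamma> k by (intro mult_left_mono) auto
          then have "(1 + \<gamma>) * b powr (- \<gamma>) - \<gamma> * b powr (- \<gamma> - 1) * (c (fst p) (snd p) + 1) \<le>
            b powr (- \<gamma>) + \<gamma> * (b powr (- \<gamma> - 1) * b) - \<gamma> * b powr (- \<gamma> - 1) * (c (fst p) (snd p) + k)"
            unfolding bb by (simp add: algebra_simps)
          then have "k * ((1 + \<gamma>) * b powr (- \<gamma>) - \<gamma> * b powr (- \<gamma> - 1) * (c (fst p) (snd p) + 1)) \<le>
            k * (b powr (- \<gamma>) + \<gamma> * (b powr (- \<gamma> - 1) * b) - \<gamma> * b powr (- \<gamma> - 1) * (c (fst p) (snd p) + k))"
            using k by (intro mult_left_mono) auto
          then show ?thesis using True by (simp add: e_def algebra_simps)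
        next
          case False
          have "0 \<le> k * (\<gamma> * b powr (- \<gamma> - 1)) * (c (fst p) (snd p) + 1)"
            using k \<gamma> c0 by (intro mult_nonneg_nonneg) auto
          then show ?thesis using False by (simp add: e_def)
        qed
      qed
    qed (rule gain(1))
    moreover have "(\<integral>p. ?L p \<partial>Q z) = k * ((1 + \<gamma>) * b powr (- \<gamma>)) * T - k * (\<gamma> * b powr (- \<gamma> - 1)) * ((\<integral>p. c (fst p) (snd p) \<partial>Q z) + mQ)"
      using ic time_before(1)[of 1] by (simp add: T_def mQ_def)
    moreover have "k * (\<gamma> * b powr (- \<gamma> - 1)) * ((\<integral>p. c (fst p) (snd p) \<partial>Q z) + mQ) \<le> k * (\<gamma> * b powr (- \<gamma> - 1)) * (b * T)"
    proof (rule mult_left_mono)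
      have "(\<integral>p. c (fst p) (snd p) \<partial>Q z) \<le> CB" unfolding CB_def by (rule consumption_integrable(2)[OF z adm x])
      then show "(\<integral>p. c (fst p) (snd p) \<partial>Q z) + mQ \<le> b * T" using T by (simp add: b_def)
    qed (use k \<gamma> in simp)
    moreover have "k * (\<gamma> * b powr (- \<gamma> - 1)) * (b * T) = k * \<gamma> * b powr (- \<gamma>) * T"
      unfolding bb[symmetric] by (simp only: mult_ac)
    moreover have "k * ((1 + \<gamma>) * b powr (- \<gamma>)) * T = \<delta> + k * \<gamma> * b powr (- \<gamma>) * T"
      by (simp add: \<delta>_def algebra_simps)
    ultimately show ?thesis using gain(2) by linarith
  qed
  then have "V x z \<le> V (x + 1) z - \<delta>" by (intro V_leI[OF z x])
  then show ?thesis using \<delta> by simp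
qed

text \<open>
  Along the stopped flow the weight \<open>phi (Z t) * stopped_flow n t * exp (- (\<rho> - r) t)\<close> is the constant \<open>n\<close> on
  an initial segment of time, so the budget constraint from zero wealth controls the integral of \<open>c - earnings\<close>.
\<close>

lemma stopped_flow_budget:
  assumes n: "n \<ge> 0" and c: "good 0 z c"
  shows "(\<integral>p. (c (fst p) (snd p) - earnings (Z (fst p) (snd p))) * (phi (Z (fst p) (snd p)) * stopped_flow n (fst p) (snd p)) \<partial>Q z) \<le> 0"
proof -
  have adm: "adm 0 z c" using c by (simp add: good_def)
  let ?i = "\<lambda>p. phi (Z (fst p) (snd p)) * stopped_flow n (fst p) (snd p)"
  have im: "?i \<in> borel_measurable (Q z)"
    using measurable_Q_Z[of phi] measurable_Q[OF stopped_flow_progressive] by measurable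
  have ib: "AE p in Q z. \<bar>?i p\<bar> \<le> phi (Min S) * (n * flow_hi)"
    using AE_Q_Z[OF z]
  proof eventually_elim
    case (elim p)
    have "0 < phi (Z (fst p) (snd p))" "phi (Z (fst p) (snd p)) \<le> phi (Min S)"
      "0 \<le> stopped_flow n (fst p) (snd p)" "stopped_flow n (fst p) (snd p) \<le> n * flow_hi"
      using elim phi_pos phi_bounds(2) stopped_flow_bounds[OF n, of "fst p" "snd p"] by auto
    then show ?case by (auto simp: abs_mult intro!: mult_mono)
  qed
  have ic: "integrable (Q z) (\<lambda>p. ?i p * c (fst p) (snd p))"
    by (rule integrable_bounded_times[OF consumption_integrable(1)[OF z adm order_refl] im ib])
  have iy: "integrable (Q z) (\<lambda>p. ?i p * earnings (Z (fst p) (snd p)))"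
    by (rule integrable_bounded_times[OF integrable_fun_Z[OF z] im ib])
  have nn: "(\<integral>\<^sup>+p. ennreal (?i p * f (fst p) (snd p)) \<partial>Q z) =
      (\<integral>\<^sup>+\<omega>. ennreal n * cum r (\<lambda>s. f s \<omega>) (Sup {s\<in>{0..1}. cum r (\<lambda>v. flow n v \<omega>) s < 1}) \<partial>law z)"
    if f: "progressively_measurable F f" for f
  proof -
    have "(\<lambda>p. ennreal (?i p * f (fst p) (snd p))) \<in> borel_measurable (Q z)"
      using im measurable_Q[OF f] by measurable
    then have "(\<lambda>p. ennreal (?i p * f (fst p) (snd p))) \<in> borel_measurable (halfline \<Otimes>\<^sub>M M)"
      by (simp add: measurable_cong_sets[OF sets_Q refl])
    then have "(\<integral>\<^sup>+p. ennreal (?i p * f (fst p) (snd p)) \<partial>Q z) =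
      (\<integral>\<^sup>+\<omega>. \<integral>\<^sup>+t. ennreal (exp (- \<rho> * t)) * ennreal (phi (Z t \<omega>) * stopped_flow n t \<omega> * f t \<omega>) \<partial>halfline \<partial>law z)"
      by (subst nn_integral_Q(1)[OF z]) auto
    also have "\<dots> = (\<integral>\<^sup>+\<omega>. ennreal n * cum r (\<lambda>s. f s \<omega>) (Sup {s\<in>{0..1}. cum r (\<lambda>v. flow n v \<omega>) s < 1}) \<partial>law z)"
    proof (rule nn_integral_cong)
      fix \<omega> assume "\<omega> \<in> space (law z)"
      then have \<omega>: "\<omega> \<in> space M" by simp
      define I where "I = {s\<in>{0..1}. cum r (\<lambda>v. flow n v \<omega>) s < 1}"
      have [measurable]: "(\<lambda>s. f s \<omega>) \<in> borel_measurable halfline" by (rule path_measurable[OF f \<omega>])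
      have "(\<integral>\<^sup>+t. ennreal (exp (- \<rho> * t)) * ennreal (phi (Z t \<omega>) * stopped_flow n t \<omega> * f t \<omega>) \<partial>halfline) =
        (\<integral>\<^sup>+t. ennreal (n * (exp (- r * t) * f t \<omega>)) * indicator I t \<partial>halfline)"
      proof (rule nn_integral_cong)
        fix t assume "t \<in> space halfline"
        then have t: "t \<ge> 0" by simp
        have p: "phi (Z t \<omega>) \<noteq> 0" using phi_pos[OF Z_in_S[OF t \<omega>]] by simp
        show "ennreal (exp (- \<rho> * t)) * ennreal (phi (Z t \<omega>) * stopped_flow n t \<omega> * f t \<omega>) = ennreal (n * (exp (- r * t) * f t \<omega>)) * indicator I t"
        proof (cases "t \<in> I")
          case True
          then have "phi (Z t \<omega>) * stopped_flow n t \<omega> = n * exp ((\<rho> - r) * t)"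
            using p by (simp add: I_def stopped_flow_def flow_def)
          moreover have "exp (- \<rho> * t) * (n * exp ((\<rho> - r) * t) * f t \<omega>) = n * (exp (- r * t) * f t \<omega>)"
          proof -
            have "exp (- \<rho> * t) * exp ((\<rho> - r) * t) = exp (- r * t)" by (simp add: exp_add[symmetric] algebra_simps)
            then show ?thesis by (metis (no_types, opaque_lifting) mult.assoc mult.left_commute)
          qed
          ultimately have "ennreal (exp (- \<rho> * t)) * ennreal (phi (Z t \<omega>) * stopped_flow n t \<omega> * f t \<omega>) = ennreal (n * (exp (- r * t) * f t \<omega>))"
            by (simp only: ennreal_mult'[OF exp_ge_zero, symmetric])
          then show ?thesis using True by simp
        next
          case False
          then have "stopped_flow n t \<omega> = 0" using t by (auto simp: I_def stopped_flow_def flow_def)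
          then show ?thesis using False by simp
        qed
      qed
      also have "\<dots> = (\<integral>\<^sup>+t. ennreal (n * (exp (- r * t) * f t \<omega>)) * indicator {..Sup I} t \<partial>halfline)"
      proof (rule nn_integral_initial_segment)
        have "0 \<in> I" by (simp add: I_def cum_nonpos_time)
        then show "I \<noteq> {}" by blast
        show "I \<subseteq> {0..}" "bdd_above I" by (auto simp: I_def)
        show "v \<in> I" if "s \<in> I" "0 \<le> v" "v \<le> s" for s v
          using that cum_mono_time[OF that(3), of r "\<lambda>v. flow n v \<omega>"] by (auto simp: I_def intro: le_less_trans)
      qed
      also have "\<dots> = (\<integral>\<^sup>+t. ennreal n * (ennreal (exp (- r * t) * f t \<omega>) * indicator {..Sup I} t) \<partial>halfline)"
        using n by (intro nn_integral_cong) (simp add: ennreal_mult' mult.assoc)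
      also have "\<dots> = ennreal n * cum r (\<lambda>s. f s \<omega>) (Sup I)"
        unfolding cum_def by (rule nn_integral_cmult) measurable
      finally show "(\<integral>\<^sup>+t. ennreal (exp (- \<rho> * t)) * ennreal (phi (Z t \<omega>) * stopped_flow n t \<omega> * f t \<omega>) \<partial>halfline) =
        ennreal n * cum r (\<lambda>s. f s \<omega>) (Sup {s\<in>{0..1}. cum r (\<lambda>v. flow n v \<omega>) s < 1})" unfolding I_def .
    qed
    finally show ?thesis .
  qed
  have inn: "AE p in Q z. 0 \<le> ?i p * c (fst p) (snd p)" "AE p in Q z. 0 \<le> ?i p * earnings (Z (fst p) (snd p))"
  proof -
    have ip: "AE p in Q z. 0 \<le> ?i p \<and> 0 < c (fst p) (snd p) \<and> 0 < earnings (Z (fst p) (snd p))"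
      using AE_Q_Z[OF z]
      by eventually_elim (use phi_pos stopped_flow_bounds[OF n] adm_pos[OF adm] earnings_bounds(3) in \<open>auto simp: less_imp_le\<close>)
    show "AE p in Q z. 0 \<le> ?i p * c (fst p) (snd p)"
      using ip by eventually_elim (blast intro: mult_nonneg_nonneg less_imp_le)
    show "AE p in Q z. 0 \<le> ?i p * earnings (Z (fst p) (snd p))"
      using ip by eventually_elim (blast intro: mult_nonneg_nonneg less_imp_le)
  qed
  have "ennreal (\<integral>p. ?i p * c (fst p) (snd p) \<partial>Q z) = (\<integral>\<^sup>+p. ennreal (?i p * c (fst p) (snd p)) \<partial>Q z)"
    by (rule nn_integral_eq_integral[symmetric, OF ic inn(1)])
  also have "\<dots> \<le> (\<integral>\<^sup>+p. ennreal (?i p * earnings (Z (fst p) (snd p))) \<partial>Q z)"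
    unfolding nn[OF adm_progressive[OF adm]] nn[OF progressively_measurable_fun_Z]
  proof (rule nn_integral_mono_AE)
    have "AE \<omega> in law z. \<forall>t\<ge>0. cum r (\<lambda>s. c s \<omega>) t \<le> ennreal 0 + cum r (\<lambda>s. earnings (Z s \<omega>)) t"
      using adm by (simp add: adm_def)
    then show "AE \<omega> in law z. ennreal n * cum r (\<lambda>s. c s \<omega>) (Sup {s\<in>{0..1}. cum r (\<lambda>v. flow n v \<omega>) s < 1}) \<le>
      ennreal n * cum r (\<lambda>s. earnings (Z s \<omega>)) (Sup {s\<in>{0..1}. cum r (\<lambda>v. flow n v \<omega>) s < 1})"
    proof eventually_elim
      case (elim \<omega>)
      have "0 \<le> Sup {s\<in>{0..1}. cum r (\<lambda>v. flow n v \<omega>) s < 1}"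
        by (rule cSup_upper) (auto simp: cum_nonpos_time intro!: bdd_aboveI[of _ 1])
      then show ?case using elim by (intro mult_left_mono) auto
    qed
  qed
  also have "\<dots> = ennreal (\<integral>p. ?i p * earnings (Z (fst p) (snd p)) \<partial>Q z)"
    by (rule nn_integral_eq_integral[OF iy inn(2)])
  finally have "(\<integral>p. ?i p * c (fst p) (snd p) \<partial>Q z) \<le> (\<integral>p. ?i p * earnings (Z (fst p) (snd p)) \<partial>Q z)"
    using integral_nonneg_AE[OF inn(2)] by (simp add: ennreal_le_iff)
  moreover have "(\<integral>p. (c (fst p) (snd p) - earnings (Z (fst p) (snd p))) * ?i p \<partial>Q z) =
    (\<integral>p. ?i p * c (fst p) (snd p) - ?i p * earnings (Z (fst p) (snd p)) \<partial>Q z)"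
    by (intro Bochner_Integration.integral_cong refl) (simp add: algebra_simps)
  ultimately show ?thesis using ic iy by simp
qed

end

end

section \<open>The slope of the value function at the borrowing limit\<close>

context household
begin

definition source :: "real \<Rightarrow> real" where
  "source y = (\<rho> - r) * marginal 0 y - gen (marginal 0) y"

lemma source_eq: "y \<in> S \<Longrightarrow> source y = marginal 0 y * (\<rho> - r - excess \<gamma> (w * (1 - \<tau>)) (r * abar) y)"
  using gen_marginal_x[of 0 y] by (simp add: source_def algebra_simps)

lemma patient_iff_source: "patient \<longleftrightarrow> (\<forall>y\<in>S. source y \<ge> 0)"
  unfolding patient_def
proof (intro ball_cong refl)
  fix y assume y: "y \<in> S"
  show "(excess \<gamma> (w * (1 - \<tau>)) (r * abar) y \<le> \<rho> - r) = (source y \<ge> 0)"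
    using marginal_pos[OF _ y, of 0] by (auto simp: source_eq[OF y] zero_le_mult_iff)
qed

text \<open>The unspent budget is the weight with which \<open>source\<close> enters the slope
  estimate; it concentrates near time 0 as n grows.\<close>

definition saved :: "real \<Rightarrow> real \<times> 'w \<Rightarrow> real" where
  "saved n p = 1 - spent (stopped_flow n) p"

text \<open>
  For \<open>n \<ge> onset\<close> the stopped flow has spent its unit budget at time \<open>onset / n\<close>, and at most half of it
  at time \<open>delay / n\<close>.
\<close>

definition onset :: real where "onset = exp \<bar>r\<bar> / flow_lo"
definition delay :: real where "delay = exp (- \<bar>r\<bar>) / (2 * flow_hi)"

lemma onset_pos: "onset > 0" and delay_pos: "delay > 0"
  using flow_lo_pos flow_hi_pos by (auto simp: onset_def delay_def)

context
  fixes z :: real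
  assumes z: "z \<in> S"
begin

lemma stopped_flow_budget_one:
  assumes n: "n \<ge> 0"
  shows "AE \<omega> in law z. \<forall>t\<ge>0. cum r (\<lambda>v. stopped_flow n v \<omega>) t \<le> ennreal 1"
  by (rule AE_I2) (simp add: cum_stopped_flow[OF n])

lemma saved_bounds:
  assumes n: "n \<ge> onset"
  shows "AE p in Q z. 0 \<le> saved n p \<and> saved n p \<le> (if fst p \<le> onset / n then 1 else 0) \<and>
    (if fst p \<le> delay / n then 1/2 else 0) \<le> saved n p"
proof -
  have n0: "n > 0" using n onset_pos by linarith
  have "AE p in Q z. cum r (\<lambda>v. stopped_flow n v (snd p)) (fst p) = ennreal (spent (stopped_flow n) p) \<and> 0 \<le> spent (stopped_flow n) p \<and> spent (stopped_flow n) p \<le> 1"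
    by (rule spent_bounds[OF z stopped_flow_progressive _ _ stopped_flow_budget_one]) (use n0 stopped_flow_bounds in auto)
  then show ?thesis using AE_Q_Z[OF z]
  proof eventually_elim
    case (elim p)
    let ?s = "spent (stopped_flow n) p" and ?C = "cum r (\<lambda>v. flow n v (snd p)) (fst p)"
    have sC: "ennreal ?s = min ?C 1" using elim n0 by (simp add: cum_stopped_flow)
    have b: "ennreal (n * flow_lo * exp (- \<bar>r\<bar>) * min (fst p) 1) \<le> ?C" "?C \<le> ennreal (n * flow_hi * exp \<bar>r\<bar> * min (fst p) 1)"
      using cum_flow_bounds[of n "fst p" "snd p"] elim n0 by auto
    have "?s = 1" if "fst p > onset / n"
    proof -
      have "onset / n \<le> min (fst p) 1" using that n n0 by simp
      then have "n * flow_lo * exp (- \<bar>r\<bar>) * (onset / n) \<le> n * flow_lo * exp (- \<bar>r\<bar>) * min (fst p) 1"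
        using n0 flow_lo_pos by (intro mult_left_mono) auto
      moreover have "n * flow_lo * exp (- \<bar>r\<bar>) * (onset / n) = 1"
        using n0 flow_lo_pos by (simp add: onset_def exp_minus field_simps)
      ultimately have "1 \<le> n * flow_lo * exp (- \<bar>r\<bar>) * min (fst p) 1" by simp
      then have "1 \<le> ?C" using b(1) by (metis ennreal_1 ennreal_leI order_trans)
      then show ?thesis using sC elim by simp
    qed
    moreover have "?s \<le> 1/2" if "fst p \<le> delay / n"
    proof -
      have "min (fst p) 1 \<le> delay / n" using that by simp
      then have "n * flow_hi * exp \<bar>r\<bar> * min (fst p) 1 \<le> n * flow_hi * exp \<bar>r\<bar> * (delay / n)"
        using n0 flow_hi_pos by (intro mult_left_mono) auto
      also have "\<dots> = 1/2" using n0 flow_hi_pos by (simp add: delay_def exp_minus field_simps)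
      finally have "n * flow_hi * exp \<bar>r\<bar> * min (fst p) 1 \<le> 1/2" .
      then have "ennreal ?s \<le> ennreal (1/2)" unfolding sC by (intro min.coboundedI1 order_trans[OF b(2)] ennreal_leI)
      then show ?thesis using elim by (subst (asm) ennreal_le_iff) auto
    qed
    ultimately show ?case using elim by (simp add: saved_def)
  qed
qed

text \<open>By the resolvent identity \<open>marginal 0 z\<close> is the full integral of
  \<open>exp (r * t) * source\<close>; by the cost identity the stopped flow priced at
  \<open>marginal 0\<close> yields the \<open>spent\<close> part of it. What is missing is the
  unspent part.\<close>

lemma saved_integrable:
  assumes n: "n \<ge> 0" shows "integrable (Q z) (\<lambda>p. saved n p * (exp (r * fst p) * source (Z (fst p) (snd p))))"
    and "(\<integral>p. stopped_flow n (fst p) (snd p) * marginal 0 (Z (fst p) (snd p)) \<partial>Q z) =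
      marginal 0 z - (\<integral>p. saved n p * (exp (r * fst p) * source (Z (fst p) (snd p))) \<partial>Q z)"
    and "integrable (Q z) (\<lambda>p. stopped_flow n (fst p) (snd p) * marginal 0 (Z (fst p) (snd p)))"
proof -
  have \<alpha>: "\<rho> - r = \<rho> - r + 0" "\<rho> - r > 0" using r by auto
  note hyps = z stopped_flow_progressive conjunct1[OF stopped_flow_bounds[OF n]] zero_le_one stopped_flow_budget_one[OF n]
  let ?g = "\<lambda>p. exp (r * fst p) * source (Z (fst p) (snd p))"
  have ig: "integrable (Q z) ?g" "(\<integral>p. ?g p \<partial>Q z) = marginal 0 z"
    using resolvent_real[OF z \<alpha>, of "marginal 0"] by (simp_all add: source_def)
  have isp: "integrable (Q z) (\<lambda>p. spent (stopped_flow n) p * ?g p)" by (rule integrable_spent[OF hyps ig(1)])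
  have eq: "saved n p * ?g p = ?g p - spent (stopped_flow n) p * ?g p" for p by (simp add: saved_def algebra_simps)
  show "integrable (Q z) (\<lambda>p. saved n p * ?g p)" unfolding eq using ig(1) isp by simp
  have "(\<integral>p. stopped_flow n (fst p) (snd p) * marginal 0 (Z (fst p) (snd p)) \<partial>Q z) = (\<integral>p. spent (stopped_flow n) p * ?g p \<partial>Q z)"
    using cost_real(2)[OF hyps \<alpha>, of "marginal 0"] by (simp add: source_def)
  then show "(\<integral>p. stopped_flow n (fst p) (snd p) * marginal 0 (Z (fst p) (snd p)) \<partial>Q z) =
      marginal 0 z - (\<integral>p. saved n p * ?g p \<partial>Q z)"
    unfolding eq using ig isp by simp
  show "integrable (Q z) (\<lambda>p. stopped_flow n (fst p) (snd p) * marginal 0 (Z (fst p) (snd p)))"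
    using cost_real(1)[OF hyps \<alpha>, of "marginal 0"] by simp
qed

text \<open>The stopped flow, scaled by \<epsilon>, is added to an arbitrary control from zero
  wealth. The gain splits into \<epsilon> times the flow priced at marginal utility, a term linear
  in \<open>c - earnings\<close>, and a quadratic term. The linear term has the favourable sign by
  \<open>stopped_flow_budget\<close>: from zero wealth consumption cannot exceed earnings in that
  weighted sense.\<close>

lemma V_increment_ge:
  assumes n: "n \<ge> 0" and \<epsilon>: "\<epsilon> > 0"
  shows "V \<epsilon> z - V 0 z \<ge> \<epsilon> * (marginal 0 z - (\<integral>p. saved n p * (exp (r * fst p) * source (Z (fst p) (snd p))) \<partial>Q z))
    - \<epsilon> * \<epsilon> * (phi (Min S) * (n * flow_hi)\<^sup>2 * measure (Q z) (space (Q z)))" (is "_ \<ge> \<epsilon> * ?A - \<epsilon> * \<epsilon> * ?C")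
proof -
  interpret finite_measure "Q z" by (rule finite_measure_Q[OF z])
  have "J z c \<le> V \<epsilon> z - (\<epsilon> * ?A - \<epsilon> * \<epsilon> * ?C)" if c: "good 0 z c" for c
  proof -
    have adm: "adm 0 z c" using c by (simp add: good_def)
    let ?s = "\<lambda>p. stopped_flow n (fst p) (snd p)" and ?y = "\<lambda>p. Z (fst p) (snd p)"
    have sb: "AE p in Q z. 0 \<le> ?s p \<and> ?s p \<le> n * flow_hi \<and> ?y p \<in> S"
      using AE_Q_Z[OF z] by eventually_elim (use stopped_flow_bounds[OF n] in auto)
    have sm: "?s \<in> borel_measurable (Q z)" "(\<lambda>p. phi (?y p)) \<in> borel_measurable (Q z)"
      using measurable_Q[OF stopped_flow_progressive] measurable_Q_Z[of phi] by auto
    let ?W = "\<lambda>p. (earnings (?y p) powr (- \<gamma>) - \<gamma> * earnings (?y p) powr (- \<gamma> - 1) *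
      (c (fst p) (snd p) + \<epsilon> * ?s p - earnings (?y p))) * (\<epsilon> * ?s p)"
    have gain: "J z c + (\<integral>p. ?W p \<partial>Q z) \<le> V (0 + \<epsilon>) z"
    proof (rule V_gain(2)[OF z order_refl _ c, where E = "\<epsilon> * (n * flow_hi)"])
      show "progressively_measurable F (\<lambda>t \<omega>. \<epsilon> * stopped_flow n t \<omega>)"
      proof (rule progressively_measurableI)
        fix t :: real assume t: "t \<ge> 0"
        note [measurable] = progressively_measurableD[OF stopped_flow_progressive t, of n]
        show "(\<lambda>p. \<epsilon> * stopped_flow n (fst p) (snd p)) \<in> borel_measurable (prog_space t)" by measurable
      qed
      show "0 \<le> \<epsilon> * stopped_flow n t \<omega> \<and> \<epsilon> * stopped_flow n t \<omega> \<le> \<epsilon> * (n * flow_hi)" if "t \<ge> 0" "\<omega> \<in> space M" for t \<omega>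
        using stopped_flow_bounds[OF n that] \<epsilon> by simp
      show "AE \<omega> in law z. \<forall>t\<ge>0. cum r (\<lambda>v. \<epsilon> * stopped_flow n v \<omega>) t \<le> ennreal \<epsilon>"
      proof (rule AE_I2, intro allI impI)
        fix \<omega> t assume "\<omega> \<in> space (law z)" and t: "(t::real) \<ge> 0"
        then have \<omega>: "\<omega> \<in> space M" by simp
        have "cum r (\<lambda>v. \<epsilon> * stopped_flow n v \<omega>) t = ennreal \<epsilon> * min (cum r (\<lambda>v. flow n v \<omega>) t) 1"
          using path_measurable[OF stopped_flow_progressive \<omega>] \<epsilon> by (simp add: cum_cmult cum_stopped_flow[OF n \<omega>])
        also have "\<dots> \<le> ennreal \<epsilon> * 1" by (intro mult_left_mono) auto
        finally show "cum r (\<lambda>v. \<epsilon> * stopped_flow n v \<omega>) t \<le> ennreal \<epsilon>" by simp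
      qed
    qed (use \<epsilon> earnings_bounds(3) in auto)
    let ?b = "\<lambda>p. (c (fst p) (snd p) - earnings (?y p)) * (phi (?y p) * ?s p)" and ?q = "\<lambda>p. phi (?y p) * (?s p)\<^sup>2"
    have ib: "integrable (Q z) ?b"
    proof -
      have "AE p in Q z. \<bar>phi (?y p) * ?s p\<bar> \<le> phi (Min S) * (n * flow_hi)"
        using sb
      proof eventually_elim
        case (elim p)
        then show ?case using phi_pos[of "?y p"] phi_bounds(2)[of "?y p"] by (auto simp: abs_mult intro!: mult_mono)
      qed
      from integrable_bounded_times[OF _ _ this, of "\<lambda>p. c (fst p) (snd p) - earnings (?y p)"]
      show ?thesis using consumption_integrable(1)[OF z adm order_refl] integrable_fun_Z[OF z, of earnings] sm by (simp add: mult.commute)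
    qed
    have qb: "AE p in Q z. 0 \<le> ?q p \<and> ?q p \<le> phi (Min S) * (n * flow_hi)\<^sup>2"
      using sb
    proof eventually_elim
      case (elim p)
      then show ?case using phi_pos[of "?y p"] phi_bounds(2)[of "?y p"] by (auto intro!: mult_mono power_mono)
    qed
    have iq: "integrable (Q z) ?q"
      by (rule integrable_const_bound[of _ "phi (Min S) * (n * flow_hi)\<^sup>2"]) (use qb sm in \<open>auto elim: eventually_mono\<close>)
    have "(\<integral>p. ?q p \<partial>Q z) \<le> (\<integral>p. phi (Min S) * (n * flow_hi)\<^sup>2 \<partial>Q z)"
      by (rule integral_mono_AE[OF iq]) (use qb in \<open>auto elim: eventually_mono\<close>)
    then have q: "\<epsilon> * \<epsilon> * (\<integral>p. ?q p \<partial>Q z) \<le> \<epsilon> * \<epsilon> * ?C" using \<epsilon> by (intro mult_left_mono) (simp_all add: mult_ac)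
    have b: "\<epsilon> * (\<integral>p. ?b p \<partial>Q z) \<le> 0"
      using stopped_flow_budget[OF z n c] \<epsilon> by (simp add: mult_le_0_iff)
    have W: "?W p = \<epsilon> * (?s p * marginal 0 (?y p)) - \<epsilon> * ?b p - \<epsilon> * \<epsilon> * ?q p" for p
      by (simp add: marginal_def phi_def power2_eq_square algebra_simps)
    have "(\<integral>p. ?W p \<partial>Q z) = \<epsilon> * ?A - \<epsilon> * (\<integral>p. ?b p \<partial>Q z) - \<epsilon> * \<epsilon> * (\<integral>p. ?q p \<partial>Q z)"
      unfolding W saved_integrable(2)[OF n, symmetric] using ib iq saved_integrable(3)[OF n] by simp
    then show ?thesis using gain q b by simp
  qed
  then have "V 0 z \<le> V \<epsilon> z - (\<epsilon> * ?A - \<epsilon> * \<epsilon> * ?C)" by (intro V_leI[OF z order_refl])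
  then show ?thesis by simp
qed

lemma V_slope_at_limit_ge:
  assumes D: "((\<lambda>x. V x z) has_real_derivative D) (at 0 within {0..})" and n: "n \<ge> 0"
  shows "D \<ge> marginal 0 z - (\<integral>p. saved n p * (exp (r * fst p) * source (Z (fst p) (snd p))) \<partial>Q z)" (is "D \<ge> ?A")
proof -
  obtain C where C: "\<And>\<epsilon>. \<epsilon> > 0 \<Longrightarrow> V \<epsilon> z - V 0 z \<ge> \<epsilon> * ?A - \<epsilon> * \<epsilon> * C" using V_increment_ge[OF n] by blast
  have l: "((\<lambda>x. (V x z - V 0 z) / x) \<longlongrightarrow> D) (at 0 within {0..})"
    using D by (simp add: has_field_derivative_iff)
  have a: "((\<lambda>x. ?A - x * C) \<longlongrightarrow> ?A - 0 * C) (at 0 within {0..})" by (intro tendsto_intros)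
  have "?A - 0 * C \<le> D"
  proof (rule tendsto_le[OF _ l a])
    show "\<forall>\<^sub>F x in at 0 within {0..}. ?A - x * C \<le> (V x z - V 0 z) / x"
      unfolding eventually_at_filter
    proof (intro always_eventually allI impI)
      fix x :: real assume "x \<noteq> 0" "x \<in> {0..}"
      then have x: "x > 0" by auto
      show "?A - x * C \<le> (V x z - V 0 z) / x" using C[OF x] x by (simp add: field_simps)
    qed
    have "at_right (0::real) \<le> at 0 within {0..}" by (intro at_le) auto
    then show "at (0::real) within {0..} \<noteq> bot" by (metis bot.extremum_uniqueI trivial_limit_at_right_real)
  qed
  then show ?thesis by simp
qed

lemma exp_unit_bounds:
  "0 \<le> t \<Longrightarrow> t \<le> 1 \<Longrightarrow> exp (- \<bar>r\<bar>) \<le> exp (r * t) \<and> exp (r * t) \<le> exp \<bar>r\<bar>"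
  using abs_mult_unit_le[of t r] by auto

text \<open>Unspent budget is confined to times up to \<open>onset / n\<close>, so its contribution
  is of order 1 / n and disappears as n grows.\<close>

lemma V_slope_at_limit:
  assumes D: "((\<lambda>x. V x z) has_real_derivative D) (at 0 within {0..})"
  shows "D \<ge> marginal 0 z"
proof -
  obtain G where G: "G \<ge> 0" "\<And>y. y \<in> S \<Longrightarrow> \<bar>source y\<bar> \<le> G" using finite_fun_bound[of source] by metis
  let ?K = "exp \<bar>r\<bar> * G * (onset * exp \<rho>)"
  have low: "marginal 0 z - ?K / n \<le> D" if n: "n \<ge> onset" for n
  proof -
    have n0: "n > 0" using n onset_pos by linarith
    have a: "0 \<le> onset / n" "onset / n \<le> 1" using n n0 onset_pos by auto
    have "(\<integral>p. saved n p * (exp (r * fst p) * source (Z (fst p) (snd p))) \<partial>Q z) \<le>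
      (\<integral>p. exp \<bar>r\<bar> * G * (if fst p \<le> onset / n then 1 else 0) \<partial>Q z)"
    proof (rule integral_mono_AE)
      show "AE p in Q z. saved n p * (exp (r * fst p) * source (Z (fst p) (snd p))) \<le> exp \<bar>r\<bar> * G * (if fst p \<le> onset / n then 1 else 0)"
        using saved_bounds[OF n] AE_Q_Z[OF z]
      proof eventually_elim
        case (elim p)
        let ?h = "exp (r * fst p) * source (Z (fst p) (snd p))"
        show ?case
        proof (cases "fst p \<le> onset / n")
          case True
          then have "exp (r * fst p) \<le> exp \<bar>r\<bar>" using exp_unit_bounds[of "fst p"] elim a by auto
          moreover have "source (Z (fst p) (snd p)) \<le> G" using G(2)[of "Z (fst p) (snd p)"] elim by simp
          ultimately have "?h \<le> exp \<bar>r\<bar> * G" using G(1) by (intro order_trans[OF mult_left_mono mult_right_mono]) auto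
          then have "saved n p * ?h \<le> saved n p * (exp \<bar>r\<bar> * G)" using elim by (intro mult_left_mono) auto
          also have "\<dots> \<le> 1 * (exp \<bar>r\<bar> * G)" using elim True G(1) by (intro mult_right_mono) auto
          finally show ?thesis using True by simp
        next
          case False
          then have "saved n p = 0" using elim by auto
          then show ?thesis using False by simp
        qed
      qed
      show "integrable (Q z) (\<lambda>p. saved n p * (exp (r * fst p) * source (Z (fst p) (snd p))))"
        using saved_integrable(1) n0 by simp
      show "integrable (Q z) (\<lambda>p. exp \<bar>r\<bar> * G * (if fst p \<le> onset / n then 1 else 0))" using time_before(1)[OF z a] by simp
    qed
    also have "\<dots> = exp \<bar>r\<bar> * G * (\<integral>p. (if fst p \<le> onset / n then 1 else 0) \<partial>Q z)" by simp
    also have "\<dots> \<le> exp \<bar>r\<bar> * G * (onset / n * exp \<rho>)" using time_before(3)[OF z a] G(1) by (intro mult_left_mono) auto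
    also have "\<dots> = ?K / n" by simp
    finally show ?thesis using V_slope_at_limit_ge[OF D, of n] n0 by simp
  qed
  have "((\<lambda>n. marginal 0 z - ?K / n) \<longlongrightarrow> marginal 0 z - 0) at_top"
    by (intro tendsto_intros tendsto_divide_0[OF tendsto_const] filterlim_at_top_imp_at_infinity filterlim_ident)
  then have "marginal 0 z - 0 \<le> D"
    by (rule tendsto_upperbound) (use low in \<open>auto intro: eventually_at_top_linorderI[of onset]\<close>)
  then show ?thesis by simp
qed

lemma time_before_away:
  assumes a: "0 \<le> a" "a \<le> 1" and \<kappa>: "\<And>t. 0 \<le> t \<Longrightarrow> t \<le> a \<Longrightarrow> 1 - \<kappa> \<le> transition_prob S rate t z z"
  shows "integrable (Q z) (\<lambda>p. if fst p \<le> a \<and> Z (fst p) (snd p) \<noteq> z then 1 else 0 :: real)"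
    and "(\<integral>p. (if fst p \<le> a \<and> Z (fst p) (snd p) \<noteq> z then 1 else 0) \<partial>Q z) \<le> \<kappa> * (a * exp \<rho>)"
proof -
  interpret finite_measure "Q z" by (rule finite_measure_Q[OF z])
  interpret L: prob_space "law z" by (rule prob_space_law[OF z])
  let ?f = "\<lambda>p :: real \<times> 'w. if fst p \<le> a \<and> Z (fst p) (snd p) \<noteq> z then 1 else 0 :: real"
  let ?t = "\<lambda>p :: real \<times> 'w. if fst p \<le> a then 1 else 0 :: real"
  have k0: "\<kappa> \<ge> 0" using \<kappa>[of 0] a by (simp add: transition_prob_0)
  have "(\<lambda>p. if fst p \<le> a then (if Z (fst p) (snd p) = z then 0 else 1) else 0 :: real) \<in> borel_measurable (Q z)"
    using fst_measurable_Q measurable_Q_Z[of "\<lambda>y. if y = z then 0 else 1 :: real"] by measurable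
  moreover have "(\<lambda>p. if fst p \<le> a then (if Z (fst p) (snd p) = z then 0 else 1) else 0 :: real) = ?f" by auto
  ultimately have m: "?f \<in> borel_measurable (Q z)" by simp
  show i: "integrable (Q z) ?f" by (rule integrable_const_bound[of _ 1]) (use m in auto)
  have tm: "?t \<in> borel_measurable (Q z)" using fst_measurable_Q by measurable
  have meas: "(\<lambda>p. ennreal (?f p)) \<in> borel_measurable (halfline \<Otimes>\<^sub>M M)" "(\<lambda>p. ennreal \<kappa> * ennreal (?t p)) \<in> borel_measurable (halfline \<Otimes>\<^sub>M M)"
    using m tm unfolding measurable_cong_sets[OF sets_Q refl] by measurable
  have "ennreal (\<integral>p. ?f p \<partial>Q z) = (\<integral>\<^sup>+p. ennreal (?f p) \<partial>Q z)"
    by (rule nn_integral_eq_integral[symmetric, OF i]) simp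
  also have "\<dots> \<le> (\<integral>\<^sup>+p. ennreal \<kappa> * ennreal (?t p) \<partial>Q z)"
    unfolding nn_integral_Q(2)[OF z meas(1)] nn_integral_Q(2)[OF z meas(2)]
  proof (rule nn_integral_mono, rule mult_left_mono)
    fix t assume "t \<in> space halfline"
    then have t: "t \<ge> 0" by simp
    show "(\<integral>\<^sup>+\<omega>. ennreal (?f (t, \<omega>)) \<partial>law z) \<le> (\<integral>\<^sup>+\<omega>. ennreal \<kappa> * ennreal (?t (t, \<omega>)) \<partial>law z)"
    proof (cases "t \<le> a")
      case True
      have "(\<integral>\<^sup>+\<omega>. ennreal (?f (t, \<omega>)) \<partial>law z) = (\<integral>\<^sup>+\<omega>. indicator (space M - sat t z) \<omega> \<partial>law z)"
        by (rule nn_integral_cong_AE, use AE_law_Z[OF z] AE_space in eventually_elim) (use True in \<open>auto simp: indicator_def sat_def\<close>)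
      also have "\<dots> = emeasure (law z) (space (law z) - sat t z)" using sat_sets[OF t] by (simp add: sets.compl_sets)
      also have "\<dots> = ennreal (1 - transition_prob S rate t z z)"
        using sat_sets[OF t] law_sat[OF z z t] L.prob_compl[of "sat t z"] by (simp add: L.emeasure_eq_measure)
      also have "\<dots> \<le> ennreal \<kappa>" using \<kappa>[OF t True] by (intro ennreal_leI) simp
      finally show ?thesis using True L.emeasure_space_1 by simp
    qed simp
  qed simp
  also have "\<dots> = ennreal \<kappa> * (\<integral>\<^sup>+p. ennreal (?t p) \<partial>Q z)" by (rule nn_integral_cmult) (use tm in measurable)
  also have "\<dots> = ennreal \<kappa> * ennreal (\<integral>p. ?t p \<partial>Q z)"
    by (subst nn_integral_eq_integral[OF time_before(1)[OF z a]]) auto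
  also have "\<dots> \<le> ennreal \<kappa> * ennreal (a * exp \<rho>)" by (intro mult_left_mono ennreal_leI time_before(3)[OF z a]) simp
  finally show "(\<integral>p. ?f p \<partial>Q z) \<le> \<kappa> * (a * exp \<rho>)"
    using k0 a by (simp add: ennreal_mult[symmetric] ennreal_le_iff)
qed

text \<open>Here n stays finite. Up to time \<open>onset / n\<close> income is still z with
  probability close to 1, where the source is negative, and until \<open>delay / n\<close> at least
  half of the budget is unspent, so the unspent part contributes negatively. Both this main part and
  the error from other states are of order 1 / n, so \<kappa> only has to beat a ratio of
  constants.\<close>

lemma V_slope_at_limit_strict:
  assumes D: "((\<lambda>x. V x z) has_real_derivative D) (at 0 within {0..})" and neg: "source z < 0"
  shows "D > marginal 0 z"
proof -
  obtain G where G: "G \<ge> 0" "\<And>y. y \<in> S \<Longrightarrow> \<bar>source y\<bar> \<le> G" using finite_fun_bound[of source] by metis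
  have G0: "G > 0" using G(2)[OF z] neg by simp
  define l where "l = - source z * exp (- \<bar>r\<bar>) / 2"
  define u where "u = G * exp \<bar>r\<bar>"
  have lu: "l > 0" "u > 0" using neg G0 by (simp_all add: l_def u_def mult_neg_pos)
  \<comment> \<open>This value makes the bound for the error from other states exactly half of the
    main part.\<close>
  define \<kappa> where "\<kappa> = l * (delay * exp (- \<rho>)) / (4 * u * (onset * exp \<rho>))"
  have \<kappa>: "\<kappa> > 0" using lu onset_pos delay_pos by (simp add: \<kappa>_def)
  have "isCont (\<lambda>t. transition_prob S rate t z z) 0" using transition_prob_has_derivative[OF z z] by (rule DERIV_isCont)
  then have "\<forall>\<^sub>F t in at 0. dist (transition_prob S rate t z z) 1 < \<kappa>"
    using \<kappa> by (auto simp: isCont_def transition_prob_0 dest: tendstoD)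
  then obtain d where d: "d > 0" "\<And>t. t \<noteq> 0 \<Longrightarrow> dist t 0 < d \<Longrightarrow> dist (transition_prob S rate t z z) 1 < \<kappa>"
    unfolding eventually_at by blast
  define n where "n = onset + delay + 2 * onset / d"
  have n: "n \<ge> onset" "n \<ge> delay" "n * d > onset" "n > 0"
  proof -
    have p: "2 * onset / d > 0" using onset_pos d(1) by simp
    show "n \<ge> onset" "n \<ge> delay" "n > 0" using onset_pos delay_pos p unfolding n_def by linarith+
    have "n * d = (onset + delay) * d + 2 * onset" using d(1) by (simp add: n_def field_simps)
    moreover have "(onset + delay) * d > 0" using onset_pos delay_pos d(1) by simp
    ultimately show "n * d > onset" using onset_pos by linarith
  qed
  have a: "0 \<le> onset / n" "onset / n \<le> 1" "onset / n < d" and b: "0 \<le> delay / n" "delay / n \<le> 1"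
    using n onset_pos delay_pos by (auto simp: field_simps)
  have P: "1 - \<kappa> \<le> transition_prob S rate t z z" if "0 \<le> t" "t \<le> onset / n" for t
    using d(2)[of t] that a(3) \<kappa> by (cases "t = 0") (auto simp: transition_prob_0 dist_real_def abs_less_iff)
  let ?A = "\<lambda>p :: real \<times> 'w. if fst p \<le> delay / n then 1 else 0 :: real"
  let ?B = "\<lambda>p :: real \<times> 'w. if fst p \<le> onset / n \<and> Z (fst p) (snd p) \<noteq> z then 1 else 0 :: real"
  let ?h = "\<lambda>p. saved n p * (exp (r * fst p) * source (Z (fst p) (snd p)))"
  note iA = time_before(1)[OF z b] and iB = time_before_away(1)[OF a(1,2) P]
  have "(\<integral>p. ?h p \<partial>Q z) \<le> (\<integral>p. 2 * u * ?B p - l * ?A p \<partial>Q z)"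
  proof (rule integral_mono_AE)
    \<comment> \<open>The factor 2 serves the states other than z: there u bounds the integrand, and
      the subtracted l is at most u.\<close>
    show "AE p in Q z. ?h p \<le> 2 * u * ?B p - l * ?A p"
      using saved_bounds[OF n(1)] AE_Q_Z[OF z]
    proof eventually_elim
      case (elim p)
      let ?y = "Z (fst p) (snd p)" and ?e = "exp (r * fst p)"
      show ?case
      proof (cases "fst p \<le> onset / n")
        case True
        then have e: "exp (- \<bar>r\<bar>) \<le> ?e" "?e \<le> exp \<bar>r\<bar>" using exp_unit_bounds[of "fst p"] elim a(2) by auto
        show ?thesis
        proof (cases "?y = z")
          case True
          have "- (2 * l) \<ge> ?e * source z"
            using mult_right_mono_neg[OF e(1), of "source z"] neg by (simp add: l_def mult.commute)
          then have "saved n p * (?e * source z) \<le> saved n p * - (2 * l)" using elim by (intro mult_left_mono) auto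
          moreover have "(1/2 * ?A p) * (2 * l) \<le> saved n p * (2 * l)" using elim lu by (intro mult_right_mono) auto
          moreover have "(1/2 * ?A p) * (2 * l) = l * ?A p" "saved n p * - (2 * l) = - (saved n p * (2 * l))" by simp_all
          ultimately have "saved n p * (?e * source z) \<le> - (l * ?A p)" by linarith
          then show ?thesis using True by simp
        next
          case False
          have "source ?y \<le> G" using G(2)[of ?y] elim by simp
          then have "?e * source ?y \<le> u"
            unfolding u_def mult.commute[of G] using e(2) G(1) by (intro order_trans[OF mult_left_mono mult_right_mono]) auto
          then have "saved n p * (?e * source ?y) \<le> saved n p * u" using elim by (intro mult_left_mono) auto
          also have "\<dots> \<le> 1 * u" using elim \<open>fst p \<le> onset / n\<close> lu by (intro mult_right_mono) auto
          finally have "saved n p * (?e * source ?y) \<le> u" by simp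
          moreover have "l \<le> u"
          proof -
            have "- source z / 2 \<le> G" using G(2)[OF z] G0 by simp
            moreover have "exp (- \<bar>r\<bar>) \<le> exp \<bar>r\<bar>" by simp
            ultimately have "- source z / 2 * exp (- \<bar>r\<bar>) \<le> G * exp \<bar>r\<bar>" using G(1) by (intro mult_mono) auto
            then show ?thesis by (simp add: l_def u_def)
          qed
          ultimately show ?thesis using True False lu by (auto simp del: mult_le_cancel_left)
        qed
      next
        case False
        then have "saved n p = 0" using elim by simp
        then have "\<not> fst p \<le> delay / n" using elim by (auto split: if_splits)
        then show ?thesis using False \<open>saved n p = 0\<close> by simp
      qed
    qed
    show "integrable (Q z) ?h" using saved_integrable(1) n(4) by simp
    show "integrable (Q z) (\<lambda>p. 2 * u * ?B p - l * ?A p)" using iA iB by simp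
  qed
  also have "\<dots> = 2 * u * (\<integral>p. ?B p \<partial>Q z) - l * (\<integral>p. ?A p \<partial>Q z)" using iA iB by simp
  finally have 1: "(\<integral>p. ?h p \<partial>Q z) \<le> 2 * u * (\<integral>p. ?B p \<partial>Q z) - l * (\<integral>p. ?A p \<partial>Q z)" .
  have 2: "2 * u * (\<integral>p. ?B p \<partial>Q z) \<le> 2 * u * (\<kappa> * (onset / n * exp \<rho>))"
    using time_before_away(2)[OF a(1,2) P] lu by (intro mult_left_mono) auto
  have 3: "l * (delay / n * exp (- \<rho>)) \<le> l * (\<integral>p. ?A p \<partial>Q z)"
    using time_before(2)[OF z b] lu by (intro mult_left_mono) auto
  have 4: "2 * u * (\<kappa> * (onset / n * exp \<rho>)) = l * (delay / n * exp (- \<rho>)) / 2"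
    using lu onset_pos by (simp add: \<kappa>_def divide_simps)
  have 5: "l * (delay / n * exp (- \<rho>)) > 0" using lu delay_pos n by simp
  have "x < 0" if "x \<le> A - B" "A \<le> C" "D \<le> B" "C = D / 2" "D > 0" for x A B C D :: real
    using that by linarith
  from this[OF 1 2 3 4 5]
  show ?thesis using V_slope_at_limit_ge[OF D, of n] n by linarith
qed

end

end

section \<open>Optimal consumption and wealth\<close>

lemma has_drift_cong:
  assumes "\<And>t. t \<ge> 0 \<Longrightarrow> b t = b' t" shows "has_drift a0 b \<alpha> \<longleftrightarrow> has_drift a0 b' \<alpha>"
proof -
  have "set_integrable lborel {0..t} b \<longleftrightarrow> set_integrable lborel {0..t} b'" for t
    by (rule set_integrable_cong) (use assms in auto)
  moreover have "(LINT s:{0..t}|lborel. b s) = (LINT s:{0..t}|lborel. b' s)" for t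
    by (rule set_lebesgue_integral_cong) (use assms in auto)
  ultimately show ?thesis by (simp add: has_drift_def)
qed

lemma has_drift_shift: "has_drift a0 b \<alpha> \<longleftrightarrow> has_drift (a0 - c) b (\<lambda>t. \<alpha> t - c)"
  by (auto simp: has_drift_def algebra_simps)

context household
begin

definition slope :: "real \<Rightarrow> real \<Rightarrow> real" where
  "slope x z = vector_derivative (\<lambda>x. V x z) (at x within {0..})"

definition consumption :: "real \<Rightarrow> real \<Rightarrow> real" where
  "consumption x z = slope x z powr (- (1 / \<gamma>))"

definition drift :: "real \<Rightarrow> real \<Rightarrow> real" where
  "drift x z = earnings z + r * x - consumption x z"

abbreviation wealth :: "real \<Rightarrow> 'w \<Rightarrow> real \<Rightarrow> real" where
  "wealth \<equiv> opt_wealth M F inc \<rho> abar \<gamma> w \<tau> r"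

lemma at_within_half_line_not_bot: "(x::real) \<ge> l \<Longrightarrow> at x within {l..} \<noteq> bot"
proof -
  assume "x \<ge> l"
  then have "at_right x \<le> at x within {l..}" by (intro at_le) auto
  then show ?thesis by (metis bot.extremum_uniqueI trivial_limit_at_right_real)
qed

lemma powr_minus_inverse: "E > 0 \<Longrightarrow> (E powr (- \<gamma>)) powr (- (1 / \<gamma>)) = E"
  using \<gamma> by (simp add: powr_powr)

context
  fixes z :: real
  assumes z: "z \<in> S"
begin

lemma V_has_slope:
  assumes "x \<ge> 0" shows "((\<lambda>x. V x z) has_real_derivative slope x z) (at x within {0..})"
proof -
  obtain D where D: "((\<lambda>x. V x z) has_real_derivative D) (at x within {0..})"
    using V_differentiable[OF z assms] by blast
  then have "slope x z = D"
    unfolding slope_def has_real_derivative_iff_has_vector_derivative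
    by (intro vector_derivative_within at_within_half_line_not_bot assms)
  then show ?thesis using D by simp
qed

lemma slope_le_chord: "0 \<le> y \<Longrightarrow> y < x \<Longrightarrow> slope x z \<le> (V x z - V y z) / (x - y)"
  by (rule concave_slope_ge_derivative[OF V_concave[OF z] V_has_slope])

lemma slope_ge_chord: "0 \<le> x \<Longrightarrow> x < y \<Longrightarrow> (V y z - V x z) / (y - x) \<le> slope x z"
  by (rule concave_slope_le_derivative[OF V_concave[OF z] V_has_slope])

lemma slope_antimono: "0 \<le> x \<Longrightarrow> x \<le> y \<Longrightarrow> slope y z \<le> slope x z"
  by (rule concave_derivative_antimono[OF V_concave[OF z] V_has_slope])

lemma slope_continuous: "continuous_on {0..} (\<lambda>x. slope x z)"
  by (rule concave_derivative_continuous[OF V_concave[OF z] V_has_slope])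

lemma slope_pos: "x \<ge> 0 \<Longrightarrow> slope x z > 0"
  using slope_ge_chord[of x "x + 1"] V_strictly_increases[OF z, of x] by simp

lemma consumption_pos: "x \<ge> 0 \<Longrightarrow> consumption x z > 0"
  using slope_pos[of x] by (simp add: consumption_def)

lemma consumption_mono: "0 \<le> x \<Longrightarrow> x \<le> y \<Longrightarrow> consumption x z \<le> consumption y z"
  unfolding consumption_def using slope_pos[of y] slope_antimono[of x y] \<gamma>
  by (intro powr_minus_antimono) auto

lemma consumption_continuous: "continuous_on {0..} (\<lambda>x. consumption x z)"
  unfolding consumption_def using slope_pos
  by (intro continuous_on_powr slope_continuous continuous_on_const) (auto simp: less_imp_neq[symmetric])

lemma consumption_at_limit: "consumption 0 z \<le> earnings z"
proof -
  have e: "earnings z > 0" by (rule earnings_bounds(3)[OF z])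
  have "slope 0 z \<ge> earnings z powr (- \<gamma>)" using V_slope_at_limit[OF z V_has_slope] by (simp add: marginal_def)
  then have "consumption 0 z \<le> (earnings z powr (- \<gamma>)) powr (- (1 / \<gamma>))"
    unfolding consumption_def using e \<gamma> by (intro powr_minus_antimono) auto
  then show ?thesis using powr_minus_inverse[OF e] by simp
qed

lemma consumption_at_limit_strict:
  assumes "source z < 0" shows "consumption 0 z < earnings z"
proof -
  have e: "earnings z > 0" by (rule earnings_bounds(3)[OF z])
  have "slope 0 z > earnings z powr (- \<gamma>)" using V_slope_at_limit_strict[OF z V_has_slope assms] by (simp add: marginal_def)
  then have "consumption 0 z < (earnings z powr (- \<gamma>)) powr (- (1 / \<gamma>))"
    unfolding consumption_def using e \<gamma> by (intro powr_minus_strict_antimono) auto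
  then show ?thesis using powr_minus_inverse[OF e] by simp
qed

lemma slope_le_marginal:
  assumes p: "patient" and x: "x \<ge> 0" "r * x \<ge> 0" shows "slope x z \<le> marginal x z"
proof (rule tendsto_upperbound)
  show "((\<lambda>y. (V y z - V x z) / (y - x)) \<longlongrightarrow> slope x z) (at_right x)"
    using V_has_slope[OF x(1)] unfolding has_field_derivative_iff
    by (rule tendsto_within_subset) (use x in auto)
  show "\<forall>\<^sub>F y in at_right x. (V y z - V x z) / (y - x) \<le> marginal x z"
    unfolding eventually_at_filter
  proof (intro always_eventually allI impI)
    fix y assume "y \<in> {x<..}"
    then show "(V y z - V x z) / (y - x) \<le> marginal x z"
      using V_increment_patient[OF z p x, of "y - x"] by (simp add: divide_le_eq mult.commute)
  qed
qed simp

text \<open>For r x < 0 income at x is below limit income and its marginal utility is larger, so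
  concavity carries the bound from the limit to x.\<close>

lemma slope_le_income_marginal:
  assumes p: "patient" and x: "x \<ge> 0" and e: "earnings z + r * x > 0" shows "slope x z \<le> marginal x z"
proof (cases "r * x \<ge> 0")
  case False
  have "slope x z \<le> slope 0 z" by (rule slope_antimono) (use x in auto)
  also have "\<dots> \<le> marginal 0 z" by (rule slope_le_marginal[OF p]) auto
  also have "\<dots> \<le> marginal x z" unfolding marginal_def using e False \<gamma> by (intro powr_minus_antimono) auto
  finally show ?thesis .
qed (rule slope_le_marginal[OF p x])

lemma drift_nonpos:
  assumes p: "patient" and x: "x \<ge> 0" shows "drift x z \<le> 0"
proof (cases "earnings z + r * x > 0")
  case True
  have "(marginal x z) powr (- (1 / \<gamma>)) \<le> consumption x z"
    unfolding consumption_def using slope_le_income_marginal[OF p x True] slope_pos[OF x] \<gamma> by (intro powr_minus_antimono) auto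
  then show ?thesis using powr_minus_inverse[OF True] by (simp add: drift_def marginal_def)
next
  case False
  then show ?thesis using consumption_pos[OF x] by (simp add: drift_def)
qed

end

text \<open>By concavity the slope is at most that of any chord ending at x: a short one for r > 0,
  the chord from the limit otherwise. In the latter case income at x is at most limit income, which
  helps further.\<close>

lemma slope_Min_less:
  assumes p: "patient" and x: "x > 0" and e: "earnings (Min S) + r * x > 0" shows "slope x (Min S) < marginal x (Min S)"
proof (cases "r > 0")
  case True
  from V_slope_Min_pos_interest[OF p True x] obtain \<eta> where
    \<eta>: "0 < \<eta>" "\<eta> < x" "(V x (Min S) - V (x - \<eta>) (Min S)) / \<eta> < marginal x (Min S)" by blast
  then show ?thesis using slope_le_chord[OF Min_S, of "x - \<eta>" x] by simp
next
  case False
  then have r0: "r \<le> 0" by simp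
  have "slope x (Min S) \<le> (V x (Min S) - V 0 (Min S)) / x" using slope_le_chord[OF Min_S, of 0 x] x by simp
  also have "\<dots> < marginal 0 (Min S)" by (rule V_slope_Min_nonpos_interest[OF p r0 x])
  also have "\<dots> \<le> marginal x (Min S)"
  proof -
    have "r * x \<le> 0" using r0 x by (simp add: mult_nonpos_nonneg)
    then show ?thesis unfolding marginal_def using e \<gamma> by (intro powr_minus_antimono) auto
  qed
  finally show ?thesis .
qed

lemma drift_Min_neg:
  assumes p: "patient" and x: "x > 0" shows "drift x (Min S) < 0"
proof (cases "earnings (Min S) + r * x > 0")
  case True
  have "(marginal x (Min S)) powr (- (1 / \<gamma>)) < consumption x (Min S)"
    unfolding consumption_def using slope_Min_less[OF p x True] slope_pos[OF Min_S, of x] x \<gamma> by (intro powr_minus_strict_antimono) auto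
  then show ?thesis using powr_minus_inverse[OF True] by (simp add: drift_def marginal_def)
next
  case False
  then show ?thesis using consumption_pos[OF Min_S, of x] x by (simp add: drift_def)
qed

lemma opt_consumption_eq:
  assumes z: "z \<in> S" and a: "a \<ge> abar"
  shows "opt_consumption M F inc \<rho> abar \<gamma> w \<tau> r a z = consumption (a - abar) z"
proof -
  let ?f = "\<lambda>b. value_fun M F inc \<rho> abar \<gamma> w \<tau> r b z" and ?s = "slope (a - abar) z"
  have x: "a - abar \<ge> 0" using a by simp
  have im: "(\<lambda>b. b - abar) ` {abar..} = {0..}" by (auto intro!: image_eqI[of _ _ "_ + abar"])
  have "((\<lambda>x. V x z) \<circ> (\<lambda>b. b - abar) has_real_derivative ?s * 1) (at a within {abar..})"
    by (rule DERIV_image_chain) (auto simp: im intro!: V_has_slope[OF z x] derivative_eq_intros)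
  then have "(?f has_real_derivative ?s) (at a within {abar..})"
    unfolding mult_1_right by (rule has_field_derivative_transform_within[where d = 1]) (use a value_fun_eq[OF z] in auto)
  then have "vector_derivative ?f (at a within {abar..}) = ?s"
    unfolding has_real_derivative_iff_has_vector_derivative
    by (intro vector_derivative_within at_within_half_line_not_bot a)
  moreover have "the_inv_into {0<..} (deriv (crra \<gamma>)) ?s = consumption (a - abar) z"
  proof (rule the_inv_into_f_eq)
    show "inj_on (deriv (crra \<gamma>)) {0<..}"
      by (rule linorder_inj_onI') (use \<gamma> powr_minus_strict_antimono[of _ _ \<gamma>] in \<open>force simp: deriv_crra\<close>)
    show "deriv (crra \<gamma>) (consumption (a - abar) z) = ?s"
      using consumption_pos[OF z x] slope_pos[OF z x] \<gamma> by (simp add: deriv_crra) (simp add: consumption_def powr_powr)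
  qed (use consumption_pos[OF z x] in simp)
  ultimately show ?thesis by (simp add: opt_consumption_def)
qed

text \<open>\<open>opt_wealth\<close> is a choice, so existence is the point. The drift is
  continuous in wealth, grows at most linearly because consumption is positive, and points inward at
  the limit because consumption there is at most earnings.\<close>

lemma wealth_path:
  assumes \<omega>: "\<omega> \<in> regular" and a: "a \<ge> abar"
  shows "(\<forall>t\<ge>0. wealth a \<omega> t \<ge> abar) \<and> has_drift a (\<lambda>t. drift (wealth a \<omega> t - abar) (Z t \<omega>)) (wealth a \<omega>)"
proof -
  have \<omega>M: "\<omega> \<in> space M" and Zinc: "\<And>t. Z t \<omega> = inc t \<omega>" using \<omega> by (auto simp: regular_def Z_def)
  have ZS: "Z t \<omega> \<in> S" if "t \<ge> 0" for t using Z_in_S[OF that \<omega>M] .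
  \<comment> \<open>The existence theorem takes a right-hand side on the whole plane, so the drift
    is frozen below zero wealth and set to 0 at negative times.\<close>
  define H where "H s x = (if s \<ge> 0 then drift (max x 0) (Z s \<omega>) else 0)" for s x
  obtain C where C: "C \<ge> 0" "\<And>y. y \<in> S \<Longrightarrow> \<bar>earnings y\<bar> \<le> C" using finite_fun_bound[of earnings] by metis
  have "\<exists>\<beta>. (\<forall>t\<ge>0. \<beta> t \<ge> 0) \<and> has_drift (a - abar) (\<lambda>s. H s (\<beta> s)) \<beta>"
  proof -
    have dc: "continuous_on UNIV (\<lambda>x. drift (max x 0) y)" if "y \<in> S" for y
      unfolding drift_def
      by (intro continuous_intros continuous_on_compose2[OF consumption_continuous[OF that]]) auto
    show ?thesis
    proof (rule caratheodory_half_line[of H "C + \<bar>r\<bar> + 1" "a - abar"])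
      fix \<beta> :: "real \<Rightarrow> real" assume \<beta>: "continuous_on UNIV \<beta>"
      have [measurable]: "(\<lambda>s. drift (max (\<beta> s) 0) y) \<in> borel_measurable borel" if "y \<in> S" for y
        using continuous_on_compose2[OF dc[OF that] \<beta>] by (intro borel_measurable_continuous_onI) auto
      have "(\<lambda>s. if Z s \<omega> = y then 1 else 0 :: real) \<in> borel_measurable halfline" for y
        using path_measurable[OF progressively_measurable_fun_Z[of "\<lambda>v. if v = y then 1 else 0"] \<omega>M] .
      then have ind: "(\<lambda>s. indicator {0..} s *\<^sub>R (if Z s \<omega> = y then 1 else 0 :: real)) \<in> borel_measurable borel" for y
        by (subst borel_measurable_restrict_space_iff[symmetric]) (auto simp: measurable_cong_sets[OF sets_halfline refl])
      \<comment> \<open>Splitting over the finitely many incomes reduces measurability in time to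
        that of the indicators of \<open>Z s \<omega> = y\<close>.\<close>
      have "H s (\<beta> s) = (\<Sum>y\<in>S. (indicator {0..} s *\<^sub>R (if Z s \<omega> = y then 1 else 0)) * drift (max (\<beta> s) 0) y)" for s
      proof (cases "s \<ge> 0")
        case True
        have "(\<Sum>y\<in>S. (if Z s \<omega> = y then 1 else 0) * drift (max (\<beta> s) 0) y) = (\<Sum>y\<in>S. if y = Z s \<omega> then drift (max (\<beta> s) 0) y else 0)"
          by (intro sum.cong) auto
        then show ?thesis using True ZS[OF True] finite_S by (simp add: H_def)
      qed (simp add: H_def)
      then show "(\<lambda>s. H s (\<beta> s)) \<in> borel_measurable borel"
        using ind by simp
    next
      fix s
      show "continuous_on UNIV (H s)" using dc[OF ZS[of s]] by (cases "s \<ge> 0") (simp_all add: H_def)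
    next
      fix X :: real
      obtain B where B: "B \<ge> 0" "\<And>y. y \<in> S \<Longrightarrow> \<bar>consumption \<bar>X\<bar> y\<bar> \<le> B" using finite_fun_bound[of "consumption \<bar>X\<bar>"] by metis
      have "\<bar>H s x\<bar> \<le> C + \<bar>r\<bar> * \<bar>X\<bar> + B" if x: "\<bar>x\<bar> \<le> X" for s x
      proof (cases "s \<ge> 0")
        case True
        let ?m = "max x 0" and ?y = "Z s \<omega>"
        have m: "0 \<le> ?m" "?m \<le> \<bar>X\<bar>" using x by auto
        have "\<bar>r * ?m\<bar> \<le> \<bar>r\<bar> * \<bar>X\<bar>" using m by (auto simp: abs_mult intro!: mult_left_mono)
        moreover have "0 < consumption ?m ?y" "consumption ?m ?y \<le> B"
          using consumption_pos[OF ZS[OF True] m(1)] consumption_mono[OF ZS[OF True] m] B(2)[OF ZS[OF True]] by auto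
        moreover have "\<bar>earnings ?y\<bar> \<le> C" by (rule C(2)[OF ZS[OF True]])
        ultimately have "\<bar>drift ?m ?y\<bar> \<le> C + \<bar>r\<bar> * \<bar>X\<bar> + B" unfolding drift_def by (simp only: abs_le_iff) linarith
        then show ?thesis using True by (simp add: H_def)
      qed (use C(1) B(1) in \<open>simp add: H_def\<close>)
      then show "\<exists>M. \<forall>s x. \<bar>x\<bar> \<le> X \<longrightarrow> \<bar>H s x\<bar> \<le> M" by blast
    next
      fix s x :: real assume x: "x \<ge> 0"
      show "H s x \<le> (C + \<bar>r\<bar> + 1) * (1 + x)"
      proof (cases "s \<ge> 0")
        case True
        have "r * x \<le> \<bar>r\<bar> * x" "C * x \<ge> 0" using x C(1) by (auto intro: mult_right_mono)
        moreover have "earnings (Z s \<omega>) \<le> C" using C(2)[OF ZS[OF True]] by simp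
        ultimately have "earnings (Z s \<omega>) + r * x \<le> (C + \<bar>r\<bar> + 1) * (1 + x)" using x by (simp add: algebra_simps)
        then show ?thesis using consumption_pos[OF ZS[OF True] x] x True by (simp add: H_def drift_def)
      qed (use x C(1) in \<open>simp add: H_def\<close>)
    next
      show "H s 0 \<ge> 0" for s using consumption_at_limit[OF ZS[of s]] by (simp add: H_def drift_def)
      fix \<beta> assume "\<And>t. t \<ge> 0 \<Longrightarrow> \<beta> t \<ge> 0" "has_drift (a - abar) (\<lambda>s. H s (\<beta> s)) \<beta>"
      then show ?thesis by blast
    qed (use C(1) a in auto)
  qed
  then obtain \<beta> where \<beta>: "\<And>t. t \<ge> 0 \<Longrightarrow> \<beta> t \<ge> 0" "has_drift (a - abar) (\<lambda>s. H s (\<beta> s)) \<beta>" by blast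
  let ?b = "\<lambda>\<alpha> t. r * \<alpha> t + w * (1 - \<tau>) * inc t \<omega> - opt_consumption M F inc \<rho> abar \<gamma> w \<tau> r (\<alpha> t) (inc t \<omega>)"
  have eq: "?b \<alpha> t = drift (\<alpha> t - abar) (Z t \<omega>)" if "t \<ge> 0" "\<alpha> t \<ge> abar" for \<alpha> t
    using opt_consumption_eq[OF ZS[OF that(1)] that(2)] by (simp add: Zinc drift_def earnings_def algebra_simps)
  let ?P = "\<lambda>\<alpha>. (\<forall>t\<ge>0. \<alpha> t \<ge> abar) \<and> has_drift a (?b \<alpha>) \<alpha>"
  have "?P (\<lambda>t. \<beta> t + abar)"
  proof
    have "has_drift a (\<lambda>s. H s (\<beta> s)) (\<lambda>t. \<beta> t + abar)" using \<beta>(2) has_drift_shift[of a _ "\<lambda>t. \<beta> t + abar" abar] by simp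
    moreover have "H s (\<beta> s) = ?b (\<lambda>t. \<beta> t + abar) s" if "s \<ge> 0" for s
      using eq[OF that, of "\<lambda>t. \<beta> t + abar"] \<beta>(1)[OF that] that by (simp add: H_def)
    ultimately show "has_drift a (?b (\<lambda>t. \<beta> t + abar)) (\<lambda>t. \<beta> t + abar)" by (subst (asm) has_drift_cong) auto
  qed (use \<beta>(1) in simp)
  then have P: "?P (wealth a \<omega>)" unfolding opt_wealth_def by (rule someI[of ?P])
  then show ?thesis using has_drift_cong[of "?b (wealth a \<omega>)" "\<lambda>t. drift (wealth a \<omega> t - abar) (Z t \<omega>)"] eq by auto
qed

end

section \<open>Invariant distributions\<close>

text \<open>
  The function \<open>k\<close> will be the kernel as a function of the initial state, which may fail to be measurable;
  it is compared with a measurable minorant that has the same integral.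
\<close>

lemma AE_eq_if_nn_integral_eq:
  assumes h: "h \<in> borel_measurable N" and fin: "(\<integral>\<^sup>+x. h x \<partial>N) \<noteq> \<infinity>"
    and le: "AE x in N. k x \<le> h x" and eq: "(\<integral>\<^sup>+x. k x \<partial>N) = (\<integral>\<^sup>+x. h x \<partial>N)"
  shows "AE x in N. k x = h x"
proof -
  \<comment> \<open>The integral of k is the supremum over simple minorants even for nonmeasurable
    k. A sequence of them attains it, and its pointwise supremum m is a measurable minorant with the
    same integral.\<close>
  define I where "I = {g. simple_function N g \<and> g \<le> k}"
  have "(\<lambda>_. 0) \<in> I" by (simp add: I_def le_fun_def)
  then have "integral\<^sup>S N ` I \<noteq> {}" by (metis empty_iff image_is_empty)
  from ennreal_Sup_countable_SUP[OF this] obtain f where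
    f: "incseq f \<and> range f \<subseteq> integral\<^sup>S N ` I \<and> Sup (integral\<^sup>S N ` I) = (SUP i. f i)" by (rule exE)
  have "\<forall>i. \<exists>g. g \<in> I \<and> f i = integral\<^sup>S N g"
  proof
    fix i
    have "f i \<in> integral\<^sup>S N ` I" by (rule subsetD[OF conjunct1[OF conjunct2[OF f]] rangeI])
    then show "\<exists>g. g \<in> I \<and> f i = integral\<^sup>S N g" unfolding image_iff Bex_def .
  qed
  from choice[OF this] obtain g where gI: "\<forall>i. g i \<in> I \<and> f i = integral\<^sup>S N (g i)" by (rule exE)
  then have g: "\<And>i. simple_function N (g i)" "\<And>i. g i \<le> k" by (auto simp: I_def)
  define m where "m x = (SUP i. g i x)" for x
  have [measurable]: "g i \<in> borel_measurable N" for i using g(1) by (rule borel_measurable_simple_function)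
  have mm: "m \<in> borel_measurable N" unfolding m_def by measurable
  have mk: "m x \<le> k x" for x unfolding m_def using g(2) by (intro SUP_least) (auto simp: le_fun_def)
  have mh: "AE x in N. m x \<le> h x" using le by eventually_elim (use mk order_trans in blast)
  have "(SUP i. f i) \<le> (\<integral>\<^sup>+x. m x \<partial>N)"
  proof (rule SUP_least)
    fix i
    have "f i = (\<integral>\<^sup>+x. g i x \<partial>N)" using gI nn_integral_eq_simple_integral[OF g(1), of i] by simp
    also have "\<dots> \<le> (\<integral>\<^sup>+x. m x \<partial>N)" by (intro nn_integral_mono) (auto simp: m_def intro: SUP_upper)
    finally show "f i \<le> (\<integral>\<^sup>+x. m x \<partial>N)" .
  qed
  moreover have "(\<integral>\<^sup>+x. h x \<partial>N) = (SUP i. f i)" using eq conjunct2[OF conjunct2[OF f]] unfolding I_def nn_integral_def[of N k] by (rule trans[OF sym])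
  ultimately have hm: "(\<integral>\<^sup>+x. h x \<partial>N) \<le> (\<integral>\<^sup>+x. m x \<partial>N)" by simp
  have mfin: "(\<integral>\<^sup>+x. m x \<partial>N) \<noteq> \<infinity>" using nn_integral_mono_AE[OF mh] fin by (auto simp: top_unique)
  have "(\<integral>\<^sup>+x. h x - m x \<partial>N) = (\<integral>\<^sup>+x. h x \<partial>N) - (\<integral>\<^sup>+x. m x \<partial>N)"
    by (rule nn_integral_diff[OF h mm mfin mh])
  also have "\<dots> = 0" using hm fin by (intro diff_eq_0_ennreal) (simp_all add: less_top)
  finally have "AE x in N. h x - m x = 0" using h mm by (subst (asm) nn_integral_0_iff_AE) auto
  then show ?thesis using le mh
  proof eventually_elim
    case (elim x)
    have "h x \<le> m x" using elim(1) by (simp add: diff_eq_0_iff_ennreal)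
    then show ?case using elim(2) mk[of x] by (metis antisym order_trans)
  qed
qed

text \<open>A nonmeasurable set has \<open>emeasure\<close> 0, so mass 1 already implies
  measurability. This is how events about \<open>opt_wealth\<close> become usable.\<close>

lemma (in prob_space) emeasure_one_AE:
  assumes "emeasure M {x \<in> space M. P x} = 1" shows "AE x in M. P x"
proof -
  have "{x \<in> space M. P x} \<in> sets M" using assms emeasure_notin_sets[of "{x \<in> space M. P x}" M] by force
  then have "AE x in M. x \<in> {x \<in> space M. P x}"
    using assms by (intro AE_prob_1) (simp add: emeasure_eq_measure)
  then show ?thesis by eventually_elim simp
qed

context
  fixes a0 :: real and b \<alpha> :: "real \<Rightarrow> real"
  assumes d: "has_drift a0 b \<alpha>"
begin

lemma has_drift_increment:
  assumes "0 \<le> s" "s \<le> t" shows "\<alpha> t = \<alpha> s + (LINT v:{s<..t}|lborel. b v)"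
  using d assms set_integral_split[of 0 t b s] by (auto simp: has_drift_def)

lemma has_drift_initial: "\<alpha> 0 = a0"
  using d set_integral_singleton[of 0 b] by (auto simp: has_drift_def)

lemma has_drift_antimono:
  assumes "0 \<le> s" "s \<le> t" and b: "\<And>v. v \<ge> 0 \<Longrightarrow> b v \<le> 0" shows "\<alpha> t \<le> \<alpha> s"
proof -
  have "0 \<le> (LINT v:{s<..t}|lborel. - b v)"
    unfolding set_lebesgue_integral_def
    by (rule integral_nonneg_AE, rule AE_I2) (use assms in \<open>simp add: indicator_def\<close>)
  then have "(LINT v:{s<..t}|lborel. b v) \<le> 0" by (simp add: set_lebesgue_integral_def)
  then show ?thesis using has_drift_increment[OF assms(1,2)] by simp
qed

lemma has_drift_constant:
  assumes "0 \<le> s" "s \<le> t" and b: "\<And>v. s < v \<Longrightarrow> v \<le> t \<Longrightarrow> b v = k" shows "\<alpha> t = \<alpha> s + (t - s) * k"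
proof -
  have "(LINT v:{s<..t}|lborel. b v) = (LINT v:{s<..t}|lborel. k)"
    by (rule set_lebesgue_integral_cong) (use b in auto)
  also have "\<dots> = (t - s) * k" using assms by (subst set_integral_const) auto
  finally show ?thesis using has_drift_increment[OF assms(1,2)] by simp
qed

lemma has_drift_continuous: "continuous_on {0..T} \<alpha>"
proof (cases "T \<ge> 0")
  case True
  have i: "set_integrable lborel {0..t} b" if "t \<ge> 0" for t using d that by (simp add: has_drift_def)
  have "continuous_on {0..T} (\<lambda>t. a0 + integral {0..t} b)"
    by (intro continuous_intros indefinite_integral_continuous_1 set_borel_integral_eq_integral(1) i True)
  then show ?thesis
    by (rule continuous_on_cong[THEN iffD1, OF refl, rotated])
      (use d set_borel_integral_eq_integral(2)[OF i] in \<open>auto simp: has_drift_def\<close>)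
qed simp

end

lemma continuous_eq_on_rationals:
  fixes \<alpha> :: "real \<Rightarrow> real"
  assumes c: "continuous_on {0..1} \<alpha>" and q: "\<And>q. q \<in> \<rat> \<Longrightarrow> 0 \<le> q \<Longrightarrow> q \<le> 1 \<Longrightarrow> \<alpha> q = a" and t: "t \<in> {0..1}"
  shows "\<alpha> t = a"
proof (rule ccontr)
  assume "\<alpha> t \<noteq> a"
  then have "0 < \<bar>\<alpha> t - a\<bar>" by simp
  with c t obtain d where d: "d > 0" "\<And>s. s \<in> {0..1} \<Longrightarrow> dist s t < d \<Longrightarrow> dist (\<alpha> s) (\<alpha> t) < \<bar>\<alpha> t - a\<bar>"
    unfolding continuous_on_iff by blast
  have "max 0 (t - d) < min 1 (t + d)" using t d(1) by auto
  then obtain q where q': "q \<in> \<rat>" "max 0 (t - d) < q" "q < min 1 (t + d)" using Rats_dense_in_real by blast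
  then have "dist (\<alpha> q) (\<alpha> t) < \<bar>\<alpha> t - a\<bar>" by (intro d(2)) (auto simp: dist_real_def)
  then show False using q[of q] q' by (auto simp: dist_real_def)
qed

context household
begin

abbreviation kernel :: "real \<Rightarrow> real \<times> real \<Rightarrow> (real \<times> real) set \<Rightarrow> ennreal" where
  "kernel \<equiv> opt_kernel M F inc \<rho> abar \<gamma> w \<tau> r"

text \<open>Every income level is visited before time \<open>1\<close> with positive probability.\<close>

lemma wealth_not_constant:
  assumes x: "x \<in> S" and y: "y \<in> S" and a: "a \<ge> abar" and dr: "drift (a - abar) y \<noteq> 0"
    and const: "AE \<omega> in law x. \<forall>t\<in>{0..1}. wealth a \<omega> t = a"
  shows False
proof -
  interpret L: prob_space "law x" by (rule prob_space_law[OF x])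
  obtain t where t: "0 < t" "t < 1" "transition_prob S rate t x y > 0"
    using transition_prob_positive[OF x y, of 1] transition_prob_nonneg[OF x] by auto
  have "AE \<omega> in law x. \<omega> \<notin> sat t y"
    using const AE_law[OF x AE_regular] AE_law_Z[OF x]
  proof eventually_elim
    case (elim \<omega>)
    show ?case
    proof
      assume "\<omega> \<in> sat t y"
      then have \<omega>: "\<omega> \<in> space M" and Zt: "Z t \<omega> = y" using elim by (auto simp: sat_def)
      \<comment> \<open>Income stays at y for a while after t. With wealth constant the drift there
        is the nonzero number \<open>drift (a - abar) y\<close>, which moves wealth.\<close>
      obtain b where b: "b > t" "\<And>s. t \<le> s \<Longrightarrow> s < b \<Longrightarrow> Z s \<omega> = y"
        using Z_locally_constant[of t \<omega>] t \<omega> Zt by (metis less_imp_le)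
      obtain e where e: "t < e" "e < min b 1" using dense[of t "min b 1"] b t by auto
      have "wealth a \<omega> e = wealth a \<omega> t + (e - t) * drift (a - abar) y"
        by (rule has_drift_constant[OF conjunct2[OF wealth_path[OF elim(2) a]]]) (use t e b elim(1) in auto)
      then show False using elim(1) t e dr by simp
    qed
  qed
  then have "measure (law x) (sat t y) = 0"
    using sat_sets[of t y] t by (subst L.prob_eq_0) auto
  then show False using law_sat[OF x y, of t] t by simp
qed

lemma kernel_le_1: "x \<in> S \<Longrightarrow> kernel t (a, x) B \<le> 1"
  unfolding opt_kernel_def using prob_space.measure_le_1[OF prob_space_law] by simp

section \<open>Consequences of invariance\<close>

context
  fixes G :: "(real \<times> real) measure"
  assumes G: "invariant_prob M F S inc \<rho> abar \<gamma> w \<tau> r G"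
begin

lemma invariant_AE_state: "AE s in G. fst s \<ge> abar \<and> snd s \<in> S"
proof -
  interpret G: prob_space G using G by (simp add: invariant_prob_def)
  have "AE s in G. s \<in> {abar..} \<times> S"
    using G by (intro G.AE_prob_1) (simp add: invariant_prob_def G.emeasure_eq_measure)
  then show ?thesis by eventually_elim auto
qed

text \<open>The hypothesis says that B is not entered from outside. By invariance kernel and
  indicator have the same integral, and ordered functions with equal finite integrals agree almost
  everywhere, so B is not left either.\<close>

lemma invariant_kernel_indicator:
  assumes t: "t \<ge> 0" and B: "B \<in> sets borel"
    and le: "AE s in G. kernel t s B \<le> indicator B s"
  shows "AE s in G. kernel t s B = indicator B s"
proof -
  interpret G: prob_space G using G by (simp add: invariant_prob_def)
  have BG: "B \<in> sets G" using B G by (simp add: invariant_prob_def)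
  show ?thesis
    by (rule AE_eq_if_nn_integral_eq[OF _ _ le]) (use BG t B G in \<open>auto simp: invariant_prob_def\<close>)
qed

lemma wealth_antimono:
  assumes p: "patient" and \<omega>: "\<omega> \<in> regular" and a: "a \<ge> abar" and t: "t \<ge> 0" "t \<le> s"
  shows "wealth a \<omega> s \<le> wealth a \<omega> t" "wealth a \<omega> t \<le> a"
proof -
  have \<omega>M: "\<omega> \<in> space M" using \<omega> by (simp add: regular_def)
  have w: "\<And>t. t \<ge> 0 \<Longrightarrow> wealth a \<omega> t \<ge> abar" and d: "has_drift a (\<lambda>t. drift (wealth a \<omega> t - abar) (Z t \<omega>)) (wealth a \<omega>)"
    using wealth_path[OF \<omega> a] by auto
  have n: "drift (wealth a \<omega> v - abar) (Z v \<omega>) \<le> 0" if "v \<ge> 0" for v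
    using drift_nonpos[OF Z_in_S[OF that \<omega>M] p, of "wealth a \<omega> v - abar"] w[OF that] by simp
  show "wealth a \<omega> s \<le> wealth a \<omega> t" by (rule has_drift_antimono[OF d t n])
  show "wealth a \<omega> t \<le> a" using has_drift_antimono[OF d order_refl t(1) n] has_drift_initial[OF d] by simp
qed

text \<open>Wealth never rises, so the sets of wealth above q are not entered and hence, up to null
  sets of G, not left. Over all rational q this makes wealth constant on \<open>{0..1}\<close> from
  almost every state, against the negative drift in the lowest income state unless a = abar.\<close>

lemma invariant_at_limit_if_patient:
  assumes p: "patient" shows "emeasure G ({abar} \<times> S) = 1"
proof -
  interpret G: prob_space G using G by (simp add: invariant_prob_def)
  let ?B = "\<lambda>q. {q<..} \<times> (UNIV :: real set)"
  have "AE s in G. kernel 1 s (?B q) = indicator (?B q) s" for q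
  proof (rule invariant_kernel_indicator)
    show "?B q \<in> sets borel" by (intro borel_Times) auto
    show "AE s in G. kernel 1 s (?B q) \<le> indicator (?B q) s"
      using invariant_AE_state
    proof eventually_elim
      case (elim s)
      obtain a x where s: "s = (a, x)" by (cases s)
      have a: "a \<ge> abar" and x: "x \<in> S" using elim by (auto simp: s)
      show ?case
      proof (cases "a > q")
        case True
        then show ?thesis using kernel_le_1[OF x] by (simp add: s)
      next
        case False
        have "AE \<omega> in law x. \<not> wealth a \<omega> 1 > q"
          using AE_law[OF x AE_regular] by eventually_elim (use wealth_antimono(2)[OF p _ a zero_le_one order_refl] False in force)
        then have "emeasure (law x) {\<omega> \<in> space (law x). wealth a \<omega> 1 > q} = 0" by (rule emeasure_eq_0_AE)
        then show ?thesis by (simp add: s opt_kernel_def)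
      qed
    qed
  qed simp
  then have "AE s in G. \<forall>q\<in>\<rat>. kernel 1 s (?B q) = indicator (?B q) s"
    by (intro AE_ball_countable') (auto simp: countable_rat)
  then have "AE s in G. s \<in> {abar} \<times> S"
    using invariant_AE_state
  proof eventually_elim
    case (elim s)
    obtain a x where s: "s = (a, x)" by (cases s)
    have a: "a \<ge> abar" and x: "x \<in> S" using elim by (auto simp: s)
    interpret L: prob_space "law x" by (rule prob_space_law[OF x])
    have "a = abar"
    proof (rule ccontr)
      assume "a \<noteq> abar"
      then have a': "a > abar" using a by simp
      have "AE \<omega> in law x. \<forall>q\<in>\<rat>. q < a \<longrightarrow> wealth a \<omega> 1 > q"
      proof (rule AE_ball_countable'[OF _ countable_rat])
        fix q :: real assume q: "q \<in> \<rat>"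
        show "AE \<omega> in law x. q < a \<longrightarrow> wealth a \<omega> 1 > q"
        proof (cases "q < a")
          case True
          have "emeasure (law x) {\<omega> \<in> space (law x). wealth a \<omega> 1 > q} = 1"
            using elim(1) q True by (auto simp: s opt_kernel_def)
          then show ?thesis by (rule AE_mp[OF L.emeasure_one_AE]) simp
        qed simp
      qed
      then have "AE \<omega> in law x. \<forall>t\<in>{0..1}. wealth a \<omega> t = a"
        using AE_law[OF x AE_regular]
      proof eventually_elim
        case (elim \<omega>)
        have "\<not> wealth a \<omega> 1 < a"
        proof
          assume "wealth a \<omega> 1 < a"
          then obtain q where "q \<in> \<rat>" "wealth a \<omega> 1 < q" "q < a" using Rats_dense_in_real by blast
          then show False using elim(1) by force
        qed
        show ?case
        proof
          fix t :: real assume "t \<in> {0..1}"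
          then show "wealth a \<omega> t = a"
            using wealth_antimono[OF p elim(2) a, of t 1] \<open>\<not> wealth a \<omega> 1 < a\<close> by simp
        qed
      qed
      then show False
        using drift_Min_neg[OF p, of "a - abar"] a' by (intro wealth_not_constant[OF x Min_S a]) auto
    qed
    then show ?case using x by (simp add: s)
  qed
  moreover have "{abar} \<times> S \<in> sets G"
    using G finite_S by (auto simp: invariant_prob_def intro!: borel_Times borel_closed finite_imp_closed)
  ultimately show ?thesis using G.prob_eq_1 by (simp add: G.emeasure_eq_measure)
qed

text \<open>If G lives at the limit, almost every state there stays at the limit at all rational
  times, hence by continuity throughout \<open>{0..1}\<close>. But an income state with negative
  source has positive drift at the limit.\<close>

lemma patient_if_invariant_at_limit:
  assumes at: "emeasure G ({abar} \<times> S) = 1" shows "patient"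
proof (rule ccontr)
  assume "\<not> patient"
  then obtain y where y: "y \<in> S" "source y < 0" using patient_iff_source by force
  interpret G: prob_space G using G by (simp add: invariant_prob_def)
  let ?B = "{abar} \<times> S"
  have atAE: "AE s in G. s \<in> ?B" using at by (intro G.AE_prob_1) (simp add: G.emeasure_eq_measure)
  have "AE s in G. kernel t s ?B = indicator ?B s" if "t \<ge> 0" for t
  proof (rule invariant_kernel_indicator[OF that])
    show "?B \<in> sets borel" using finite_S by (intro borel_Times borel_closed finite_imp_closed) auto
    show "AE s in G. kernel t s ?B \<le> indicator ?B s"
      using atAE by eventually_elim (use kernel_le_1 in auto)
  qed
  then have "AE s in G. \<forall>q\<in>{q\<in>\<rat>. 0 \<le> q}. kernel q s ?B = indicator ?B s"
    by (intro AE_ball_countable') (auto intro: countable_subset[OF _ countable_rat])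
  with atAE have "AE s in G. s \<in> ?B \<and> (\<forall>q\<in>{q\<in>\<rat>. 0 \<le> q}. kernel q s ?B = 1)"
    by eventually_elim simp
  \<comment> \<open>Full measure provides a single initial state that serves all rational times at
    once.\<close>
  from eventually_happens'[OF G.ae_filter_bot this] obtain s where
    ss: "s \<in> ?B \<and> (\<forall>q\<in>{q\<in>\<rat>. 0 \<le> q}. kernel q s ?B = 1)" by (rule exE)
  then have s: "s \<in> ?B" "\<And>q. q \<in> \<rat> \<Longrightarrow> 0 \<le> q \<Longrightarrow> kernel q s ?B = 1" by simp_all
  obtain x where x: "x \<in> S" "s = (abar, x)" using s(1) by auto
  interpret L: prob_space "law x" by (rule prob_space_law[OF x(1)])
  have "AE \<omega> in law x. \<forall>q\<in>{q\<in>\<rat>. 0 \<le> q}. wealth abar \<omega> q = abar"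
  proof (rule AE_ball_countable')
    fix q :: real assume q: "q \<in> {q\<in>\<rat>. 0 \<le> q}"
    have "emeasure (law x) {\<omega> \<in> space (law x). (wealth abar \<omega> q, inc q \<omega>) \<in> ?B} = 1"
      using s(2)[of q] q by (simp add: x(2) opt_kernel_def)
    from L.emeasure_one_AE[OF this] show "AE \<omega> in law x. wealth abar \<omega> q = abar" by eventually_elim simp
  qed (auto intro: countable_subset[OF _ countable_rat])
  then have "AE \<omega> in law x. \<forall>t\<in>{0..1}. wealth abar \<omega> t = abar"
    using AE_law[OF x(1) AE_regular]
  proof eventually_elim
    case (elim \<omega>)
    show ?case
    proof
      fix t :: real assume t: "t \<in> {0..1}"
      show "wealth abar \<omega> t = abar"
        by (rule continuous_eq_on_rationals[OF has_drift_continuous[OF conjunct2[OF wealth_path[OF elim(2) order_refl]]] _ t])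
          (use elim(1) in simp)
    qed
  qed
  then show False
    using consumption_at_limit_strict[OF y] by (intro wealth_not_constant[OF x(1) y(1) order_refl]) (auto simp: drift_def)
qed

end

end

theorem corollary1p9:
  fixes M :: "'w measure" and F :: "real \<Rightarrow> 'w measure" and S :: "real set"
    and rate :: "real \<Rightarrow> real \<Rightarrow> real" and inc :: "real \<Rightarrow> 'w \<Rightarrow> real"
    and \<rho> abar \<gamma> w \<tau> :: real
  assumes "income_chain M F S rate inc"
    and "\<rho> > 0" and "abar \<le> 0" and "w > 0" and "\<tau> < 1" and "\<gamma> > 0"
  shows "(\<exists>!rbar. rbar \<in> feasible_rates S \<rho> abar w \<tau> \<and> rbar = \<rho> - Theta S rate abar \<gamma> w \<tau> rbar) \<and>
    (\<forall>rbar\<in>feasible_rates S \<rho> abar w \<tau>. rbar = \<rho> - Theta S rate abar \<gamma> w \<tau> rbar \<longrightarrow>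
      (\<forall>r\<in>feasible_rates S \<rho> abar w \<tau>. \<forall>G. invariant_prob M F S inc \<rho> abar \<gamma> w \<tau> r G \<longrightarrow>
        (emeasure G ({abar} \<times> S) = 1 \<longleftrightarrow> r \<le> rbar)))"
proof (intro conjI ballI allI impI)
  interpret income_chain M F S rate inc by fact
  show "\<exists>!rbar. rbar \<in> feasible_rates S \<rho> abar w \<tau> \<and> rbar = \<rho> - Theta S rate abar \<gamma> w \<tau> rbar"
    by (rule threshold_exists_unique) (use assms in auto)
  fix rbar r G
  assume rbar: "rbar \<in> feasible_rates S \<rho> abar w \<tau>" "rbar = \<rho> - Theta S rate abar \<gamma> w \<tau> rbar"
    and fr: "r \<in> feasible_rates S \<rho> abar w \<tau>" and G: "invariant_prob M F S inc \<rho> abar \<gamma> w \<tau> r G"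
  interpret household M F S rate inc \<rho> abar \<gamma> w \<tau> r
    by unfold_locales (use assms fr in \<open>auto simp: feasible_rates_def\<close>)
  have "r \<le> rbar \<longleftrightarrow> patient"
    unfolding patient_def by (rule threshold_iff[OF assms(2,6,4,5,3) rbar fr])
  then show "emeasure G ({abar} \<times> S) = 1 \<longleftrightarrow> r \<le> rbar"
    using invariant_at_limit_if_patient[OF G] patient_if_invariant_at_limit[OF G] by blast
qed

end
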